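(* For $0<\varepsilon<1$ let $c_\varepsilon>0$ be defined by $c_\varepsilon^2=c_\star^2+\varepsilon^2$. There exists $a_{\mathrm{per}}>0$ such that for all $0<\varepsilon<1$ and all $\alpha\in\mathbb{R}$ with $|\alpha|<a_{\mathrm{per}}$ there are a smooth $2\pi$-periodic function $\boldsymbol{\varphi}_\varepsilon^\alpha:\mathbb{R}\to\mathbb{R}^2$ and a number $\Omega_\varepsilon^\alpha\in\mathbb{R}$ such that $$\begin{pmatrix} p_1(x) \\ p_2(x) \end{pmatrix}:=\alpha\varepsilon^2\boldsymbol{\varphi}_\varepsilon^\alpha(\varepsilon\Omega_\varepsilon^\alpha x)$$ solves $$\begin{cases} c_\varepsilon^2p_1''=\mathcal{V}_1'(S^1p_2-p_1)-\mathcal{V}_2'(p_1-S^{-1}p_2) \\ c_\varepsilon^2m\,p_2''=\mathcal{V}_2'(S^1p_1-p_2)-\mathcal{V}_1'(p_2-S^{-1}p_1). \end{cases}$$ Here $\boldsymbol{\varphi}_\varepsilon^\alpha=\boldsymbol{\nu}_1^{c_\varepsilon}+\boldsymbol{\psi}_\varepsilon^\alpha$ with $\langle\boldsymbol{\psi}_\varepsilon^\alpha,\boldsymbol{\nu}_1^{c_\varepsilon}\rangle=0$, $\boldsymbol{\psi}_\varepsilon^0=0$, and $\varepsilon\Omega_\varepsilon^0=\omega_{c_\varepsilon}$. Moreover: (a) $\displaystyle\sup_{0<\varepsilon<1,\ |\alpha|<a_{\mathrm{per}}}|\varepsilon\Omega_\varepsilon^\alpha|<\infty$, and there is $C>0$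 such that $|\Omega_\varepsilon^\alpha-\Omega_\varepsilon^{\grave\alpha}|\le C\varepsilon|\alpha-\grave\alpha|$ for all $0<\varepsilon<1$ and $|\alpha|,|\grave\alpha|<a_{\mathrm{per}}$. (b) For each integer $r\ge0$, $\displaystyle\sup_{0<\varepsilon<1,\ |\alpha|<a_{\mathrm{per}}}\|\boldsymbol{\varphi}_\varepsilon^\alpha\|_{C^r_{\mathrm{per}}}<\infty$, and there is $C_r>0$ such that $\displaystyle\sup_{0<\varepsilon<1}\|\boldsymbol{\varphi}_\varepsilon^\alpha-\boldsymbol{\varphi}_\varepsilon^{\grave\alpha}\|_{C^r_{\mathrm{per}}}\le C_r|\alpha-\grave\alpha|$ for all $|\alpha|,|\grave\alpha|<a_{\mathrm{per}}$.
   Context: Material data: fix real numbers $m>0$, $\kappa>0$, $\beta$, put $w:=1/m$, and assume $w>1$ or $\kappa>1$. The spring potentials $\mathcal{V}_1,\mathcal{V}_2\in C^\infty(\mathbb{R})$ are real-valued with $\mathcal{V}_1'(r)=r+r^2+O(r^3)$ and $\mathcal{V}_2'(r)=\kappa r+\beta r^2+O(r^3)$ as $r\to0$. Notation: $(S^\theta p)(x):=p(x+\theta)$. $\langle\boldsymbol{\phi},\boldsymbol{\eta}\rangle:=\frac1{2\pi}\int_{-\pi}^{\pi}\boldsymbol{\phi}(x)\cdot\boldsymbol{\eta}(x)\,dx$. $\|\boldsymbol{\phi}\|_{C^r_{\mathrm{per}}}:=\|\boldsymbol{\phi}\|_{L^\infty}+\|\partial_x^r\boldsymbol{\phi}\|_{L^\infty}$.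 Speed of sound: $c_\star:=\sqrt{\dfrac{4\kappa w}{(1+\kappa)(1+w)}}$. Critical frequency: put $\tilde\varrho(K):=\sqrt{(1+w)^2(1-\kappa)^2+4\kappa\big((1-w)^2+4w\cos^2K\big)}$ and $\tilde\lambda_+(K):=\frac{(1+\kappa)(1+w)}{2}+\frac{\tilde\varrho(K)}{2}$. For $|c|>c_\star$ it is known that there is a unique $\omega_c>0$ such that $c^2K^2=\tilde\lambda_+(K)$ for real $K$ if and only if $K=\pm\omega_c$. Let $\boldsymbol{\mu}_c:=\begin{pmatrix} e^{i\omega_c}+\kappa e^{-i\omega_c} \\ 1+\kappa-c^2\omega_c^2 \end{pmatrix}\in\mathbb{C}^2$, $\mathcal{N}_c:=\sqrt2\,|\boldsymbol{\mu}_c|$ (Euclidean norm), and $\boldsymbol{\nu}_1^c(x):=\frac{1}{\mathcal{N}_c}\big(e^{-ix}\overline{\boldsymbol{\mu}_c}+e^{ix}\boldsymbol{\mu}_c\big)$. *)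

theory Defs
  imports "HOL-Analysis.Analysis" "HOL-Library.Landau_Symbols"
    "HOL-Probability.Essential_Supremum"
begin

definition nth_deriv :: "nat \<Rightarrow> (real \<Rightarrow> 'a::real_normed_vector) \<Rightarrow> real \<Rightarrow> 'a" where
  "nth_deriv n f = ((\<lambda>g x. vector_derivative g (at x)) ^^ n) f"

definition smooth :: "(real \<Rightarrow> 'a::real_normed_vector) \<Rightarrow> bool" where
  "smooth f \<longleftrightarrow> (\<forall>n x. nth_deriv n f differentiable (at x))"

definition shift :: "real \<Rightarrow> (real \<Rightarrow> 'a) \<Rightarrow> real \<Rightarrow> 'a" where
  "shift \<theta> p = (\<lambda>x. p (x + \<theta>))"

definition inner_per :: "(real \<Rightarrow> real^2) \<Rightarrow> (real \<Rightarrow> real^2) \<Rightarrow> real" where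
  "inner_per \<phi> \<eta> = 1 / (2 * pi) * integral {-pi..pi} (\<lambda>x. \<phi> x \<bullet> \<eta> x)"

text \<open>The norms are extended-real valued, so that their finiteness is part of every bound
  stated with them.\<close>

definition Linf_norm :: "(real \<Rightarrow> real^2) \<Rightarrow> ereal" where
  "Linf_norm \<phi> = esssup lborel (\<lambda>x. ereal (norm (\<phi> x)))"

definition Cper_norm :: "nat \<Rightarrow> (real \<Rightarrow> real^2) \<Rightarrow> ereal" where
  "Cper_norm r \<phi> = Linf_norm \<phi> + Linf_norm (nth_deriv r \<phi>)"

definition c_star :: "real \<Rightarrow> real \<Rightarrow> real" where
  "c_star \<kappa> w = sqrt (4 * \<kappa> * w / ((1 + \<kappa>) * (1 + w)))"

definition c_eps :: "real \<Rightarrow> real \<Rightarrow> real \<Rightarrow> real" where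
  "c_eps \<kappa> w \<epsilon> = sqrt ((c_star \<kappa> w)^2 + \<epsilon>^2)"

definition rho :: "real \<Rightarrow> real \<Rightarrow> real \<Rightarrow> real" where
  "rho \<kappa> w K = sqrt ((1 + w)^2 * (1 - \<kappa>)^2 + 4 * \<kappa> * ((1 - w)^2 + 4 * w * (cos K)^2))"

definition lambda_plus :: "real \<Rightarrow> real \<Rightarrow> real \<Rightarrow> real" where
  "lambda_plus \<kappa> w K = (1 + \<kappa>) * (1 + w) / 2 + rho \<kappa> w K / 2"

text \<open>Meaningful for \<open>\<bar>c\<bar> > c_star \<kappa> w\<close>, where existence and uniqueness hold.\<close>

definition crit_freq :: "real \<Rightarrow> real \<Rightarrow> real \<Rightarrow> real" where
  "crit_freq \<kappa> w c =
     (THE \<omega>. \<omega> > 0 \<and> (\<forall>K. c^2 * K^2 = lambda_plus \<kappa> w K \<longleftrightarrow> K = \<omega> \<or> K = - \<omega>))"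

definition mu :: "real \<Rightarrow> real \<Rightarrow> real \<Rightarrow> complex^2" where
  "mu \<kappa> w c = (let \<omega> = crit_freq \<kappa> w c in
     vector [exp (\<i> * of_real \<omega>) + of_real \<kappa> * exp (- \<i> * of_real \<omega>),
             of_real (1 + \<kappa> - c^2 * \<omega>^2)])"

definition N_norm :: "real \<Rightarrow> real \<Rightarrow> real \<Rightarrow> real" where
  "N_norm \<kappa> w c = sqrt 2 * norm (mu \<kappa> w c)"

definition nu1_complex :: "real \<Rightarrow> real \<Rightarrow> real \<Rightarrow> real \<Rightarrow> complex^2" where
  "nu1_complex \<kappa> w c x = (1 / N_norm \<kappa> w c) *\<^sub>R
     (exp (- \<i> * of_real x) *s (\<chi> j. cnj (mu \<kappa> w c $ j)) + exp (\<i> * of_real x) *s mu \<kappa> w c)"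

text \<open>The two summands are conjugate, so \<open>nu1_complex\<close> has real entries; \<open>nu1\<close> is
  the same function with values in \<open>real^2\<close>.\<close>

definition nu1 :: "real \<Rightarrow> real \<Rightarrow> real \<Rightarrow> real \<Rightarrow> real^2" where
  "nu1 \<kappa> w c x = (\<chi> j. Re (nu1_complex \<kappa> w c x $ j))"

lemma of_real_nu1: "of_real (nu1 \<kappa> w c x $ j) = nu1_complex \<kappa> w c x $ j"
  by (simp add: nu1_def nu1_complex_def complex_eq_iff Re_exp Im_exp)

definition travelling_wave ::
  "real \<Rightarrow> (real \<Rightarrow> real) \<Rightarrow> (real \<Rightarrow> real) \<Rightarrow> real \<Rightarrow> (real \<Rightarrow> real) \<Rightarrow> (real \<Rightarrow> real) \<Rightarrow> bool" where
  "travelling_wave m V1 V2 c p1 p2 \<longleftrightarrow> (\<forall>x.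
     c^2 * deriv (deriv p1) x
       = deriv V1 (shift 1 p2 x - p1 x) - deriv V2 (p1 x - shift (-1) p2 x) \<and>
     c^2 * m * deriv (deriv p2) x
       = deriv V2 (shift 1 p1 x - p2 x) - deriv V1 (p2 x - shift (-1) p1 x))"

end

theory Submission
  imports Defs
begin

text \<open>Two devices pay for the derivative lost to the shifts. The inverse commutes with shifts
  and turns bounded functions into Lipschitz ones, so a shift can be applied after inverting; and
  distances are measured in the supremum norm alone, in which functions with Lipschitz constant 1
  form a closed set. The derivative of the resulting map is almost triangular: its frequency
  component is small in all variables, while the functions react to the frequency by an amount that
  is merely bounded. The condition w > 1 or \<kappa> > 1 keeps the second entry of \<mu> away from 0
  and the two branches of the dispersion relation apart. The amplitude \<alpha> \<epsilon>^2 also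
  explains the factor \<epsilon> in (a): a frequency that is Lipschitz in s changes by at most a
  multiple of \<epsilon>^2 |\<alpha> - \<alpha>'|, and \<Omega> is that frequency divided by
  \<epsilon>. Density of trigonometric polynomials takes the place of convergence of Fourier series:
  a linear identity is checked on single cosines and carried over by uniform bounds.\<close>

text \<open>Put \<open>s = \<alpha> \<epsilon>\<^sup>2\<close>. Dividing by \<open>s\<close> and rescaling \<open>x\<close> by the frequency \<open>\<omega>\<close> turns the lattice equation at
  speed \<open>c\<close> into \<open>c\<^sup>2 \<omega>\<^sup>2 \<phi>'' = A(\<omega>) \<phi> + s N(s, \<omega>, \<phi>)\<close> on \<open>2 \<pi>\<close>-periodic functions. At \<open>s = 0\<close> and
  \<open>\<omega> = \<omega>\<^sub>c\<close> the kernel is spanned by \<open>\<nu>\<^sub>1\<close>, its derivative and the constants, and a Fourier multiplier with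
  symbol of order \<open>k\<^sup>-\<^sup>2\<close>, hence bounded in the supremum norm, inverts the operator off the kernel. Solving the
  equation modulo \<open>\<nu>\<^sub>1'\<close> and the constants is a fixed point problem for \<open>(\<omega>, \<psi>)\<close> that contracts on functions
  with a fixed Lipschitz constant (the shifts by \<open>\<omega>\<close> cost one derivative), uniformly in \<open>c\<close>, since the derivative
  of the bifurcation equation in \<open>\<omega>\<close> is bounded below by the gap \<open>K - \<bar>sin K\<bar>\<close>, which survives as
  \<open>c\<close> tends to the speed of sound. The neglected components vanish because the problem is a translation
  invariant gradient system: the forces do no work along \<open>\<phi>'\<close> and along constants. All higher derivatives
  follow by bootstrapping.\<close>

section \<open>Continuous periodic functions and their means\<close>

definition cper :: "(real \<Rightarrow> real) \<Rightarrow> bool" where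
  "cper f \<longleftrightarrow> continuous_on UNIV f \<and> (\<forall>x. f (x + 2 * pi) = f x)"

text \<open>A supremum norm bound with its constant in view: every estimate has to be uniform in the
  wave speed, so constants are tracked by name.\<close>

definition bdd :: "real \<Rightarrow> (real \<Rightarrow> real) \<Rightarrow> bool" where
  "bdd d f \<longleftrightarrow> (\<forall>x. \<bar>f x\<bar> \<le> d)"

definition mean :: "(real \<Rightarrow> real) \<Rightarrow> real" where
  "mean f = integral {-pi..pi} f / (2 * pi)"

lemma cperD: "cper f \<Longrightarrow> f (x + 2 * pi) = f x"
  by (simp add: cper_def)

lemma cper_cont: "cper f \<Longrightarrow> continuous_on A f"
  unfolding cper_def using continuous_on_subset by blast

lemma cper_isCont: "cper f \<Longrightarrow> isCont f x"
  unfolding cper_def by (simp add: continuous_on_eq_continuous_at)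

lemma cperD2: "cper f \<Longrightarrow> f (x - 2 * pi) = f x"
  using cperD[of f "x - 2 * pi"] by simp

lemma cper_const [intro, simp]: "cper (\<lambda>x. c)"
  by (simp add: cper_def)

lemma cper_add [intro]: "cper f \<Longrightarrow> cper g \<Longrightarrow> cper (\<lambda>x. f x + g x)"
  by (auto simp: cper_def intro!: continuous_intros)

lemma cper_diff [intro]: "cper f \<Longrightarrow> cper g \<Longrightarrow> cper (\<lambda>x. f x - g x)"
  by (auto simp: cper_def intro!: continuous_intros)

lemma cper_minus [intro]: "cper f \<Longrightarrow> cper (\<lambda>x. - f x)"
  by (auto simp: cper_def intro!: continuous_intros)

lemma cper_mult [intro]: "cper f \<Longrightarrow> cper g \<Longrightarrow> cper (\<lambda>x. f x * g x)"
  by (auto simp: cper_def intro!: continuous_intros)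

lemma cper_divide [intro]: "cper f \<Longrightarrow> cper (\<lambda>x. f x / c)"
  using cper_mult[of f "\<lambda>x. inverse c"] by (simp add: divide_inverse)

lemma cper_compose:
  assumes "continuous_on UNIV F" "cper f"
  shows "cper (\<lambda>x. F (f x))"
  using assms unfolding cper_def
  by (auto intro: continuous_on_compose2[of UNIV F UNIV f])

lemma cper_shift:
  assumes "cper f" shows "cper (\<lambda>x. f (x + h))"
proof -
  have "f (x + 2 * pi + h) = f (x + h)" for x
    using cperD[OF assms, of "x + h"] by (simp add: algebra_simps)
  then show ?thesis
    using assms by (auto simp: cper_def intro!: continuous_on_compose2[of UNIV f] continuous_intros)
qed

lemma cper_shift': "cper f \<Longrightarrow> cper (\<lambda>x. f (x - h))"
  using cper_shift[of f "- h"] by simp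

lemma cos_add_int_2pi: "cos (x + of_int k * (2 * pi)) = cos x"
  by (auto simp: cos_eq intro!: exI[of _ k])

lemma sin_add_int_2pi: "sin (x + of_int k * (2 * pi)) = sin x"
  using cos_add_int_2pi[of "x - pi / 2" k] by (simp add: cos_diff cos_add sin_add algebra_simps)

lemma cper_cos_int [intro, simp]: "cper (\<lambda>x. cos (of_int k * x + \<theta>))"
proof -
  have "cos (of_int k * (x + 2 * pi) + \<theta>) = cos (of_int k * x + \<theta>)" for x
    using cos_add_int_2pi[of "of_int k * x + \<theta>" k] by (simp add: algebra_simps)
  then show ?thesis
    by (auto simp: cper_def intro!: continuous_intros)
qed

lemma cper_cos [intro, simp]: "cper (\<lambda>x. cos (real k * x + \<theta>))"
  using cper_cos_int[of "int k" \<theta>] by simp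

lemma bdd_mono: "bdd d f \<Longrightarrow> d \<le> e \<Longrightarrow> bdd e f"
  by (meson bdd_def order_trans)

lemma bdd_nonneg: "bdd d f \<Longrightarrow> 0 \<le> d"
  by (meson abs_ge_zero bdd_def order_trans)

lemma bdd_cos [simp]: "bdd 1 (\<lambda>x. cos (f x))"
  by (simp add: bdd_def)

lemma bdd_add: "bdd d f \<Longrightarrow> bdd e g \<Longrightarrow> bdd (d + e) (\<lambda>x. f x + g x)"
  unfolding bdd_def by (meson abs_triangle_ineq add_mono order_trans)

lemma bdd_diff: "bdd d f \<Longrightarrow> bdd e g \<Longrightarrow> bdd (d + e) (\<lambda>x. f x - g x)"
  unfolding bdd_def by (meson abs_triangle_ineq4 add_mono order_trans)

lemma bdd_mult: "bdd d f \<Longrightarrow> bdd e g \<Longrightarrow> bdd (d * e) (\<lambda>x. f x * g x)"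
  unfolding bdd_def abs_mult by (meson abs_ge_zero mult_mono order_trans)

lemma bdd_cmult: "bdd d f \<Longrightarrow> bdd (\<bar>c\<bar> * d) (\<lambda>x. c * f x)"
  unfolding bdd_def abs_mult by (simp add: mult_left_mono)

lemma bdd_shift: "bdd d f \<Longrightarrow> bdd d (\<lambda>x. f (h x))"
  by (simp add: bdd_def)

lemma cper_minus_int:
  assumes "cper f" shows "f (x - of_int k * (2 * pi)) = f x"
proof (induction k rule: int_induct[where k=0])
  case (step1 i)
  have "x - of_int (i + 1) * (2 * pi) = (x - of_int i * (2 * pi)) - 2 * pi"
    by (simp add: algebra_simps)
  then show ?case using step1 cperD2[OF assms] by metis
next
  case (step2 i)
  have "x - of_int (i - 1) * (2 * pi) = (x - of_int i * (2 * pi)) + 2 * pi"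
    by (simp add: algebra_simps)
  then show ?case using step2 cperD[OF assms] by metis
qed simp

lemma reduce_mod_2pi:
  obtains k :: int where "x - of_int k * (2 * pi) \<in> {-pi<..pi}"
proof
  define k where "k = \<lceil>(x - pi) / (2 * pi)\<rceil>"
  have "(x - pi) / (2 * pi) \<le> k" "k < (x - pi) / (2 * pi) + 1"
    unfolding k_def by linarith+
  then show "x - of_int k * (2 * pi) \<in> {-pi<..pi}"
    by (auto simp: field_simps)
qed

lemma cper_bounded:
  assumes "cper f"
  obtains d where "bdd d f"
proof -
  have "compact (f ` {-pi..pi})"
    by (intro compact_continuous_image cper_cont assms) auto
  then obtain d where d: "\<And>y. y \<in> f ` {-pi..pi} \<Longrightarrow> norm y \<le> d"
    using compact_imp_bounded bounded_iff by metis
  have "\<bar>f x\<bar> \<le> d" for x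
  proof -
    obtain k where "x - of_int k * (2 * pi) \<in> {-pi<..pi}" using reduce_mod_2pi .
    then have "f (x - of_int k * (2 * pi)) \<in> f ` {-pi..pi}" by (intro imageI) auto
    then show ?thesis using d[of "f x"] by (simp add: cper_minus_int[OF assms])
  qed
  then show ?thesis using that bdd_def by blast
qed

section \<open>Means over one period\<close>

lemma cper_antiderivative:
  assumes "cper f"
  obtains g where "\<And>x. (g has_real_derivative f x) (at x)"
proof -
  have "\<exists>F. \<forall>x. - \<infinity> < ereal x \<longrightarrow> ereal x < \<infinity> \<longrightarrow> (F has_vector_derivative f x) (at x)"
    by (rule einterval_antiderivative) (auto intro: cper_isCont assms)
  then show ?thesis
    using that by (auto simp: has_real_derivative_iff_has_vector_derivative)
qed

lemma cper_integrable [intro]: "cper f \<Longrightarrow> f integrable_on {a..b}"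
  by (intro integrable_continuous_interval cper_cont)

lemma mean_ftc:
  assumes "\<And>x. (g has_real_derivative f x) (at x)"
  shows "mean f = (g pi - g (- pi)) / (2 * pi)"
proof -
  have "(f has_integral (g pi - g (- pi))) {-pi..pi}"
    by (rule fundamental_theorem_of_calculus)
      (auto intro!: DERIV_subset[OF assms] simp flip: has_real_derivative_iff_has_vector_derivative)
  then show ?thesis by (simp add: mean_def integral_unique)
qed

lemma mean_deriv:
  assumes "\<And>x. (g has_real_derivative f x) (at x)" "\<And>x. g (x + 2 * pi) = g x"
  shows "mean f = 0"
  using mean_ftc[OF assms(1)] assms(2)[of "- pi"] by simp

text \<open>An antiderivative \<open>g\<close> need not be periodic, but its increment over 2 pi has
  derivative 0 and is therefore constant, so all windows of length 2 pi carry the same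
  integral.\<close>

lemma mean_shift:
  assumes "cper f"
  shows "mean (\<lambda>x. f (x + h)) = mean f"
proof -
  obtain g where g: "\<And>x. (g has_real_derivative f x) (at x)"
    using cper_antiderivative[OF assms] by blast
  have "((\<lambda>x. g (x + h)) has_real_derivative f (x + h)) (at x)" for x h
    using DERIV_shift[of g "f (x + h)" x h] g by simp
  note g' = this
  have "((\<lambda>x. g (x + 2 * pi) - g x) has_real_derivative 0) (at x)" for x
    using DERIV_diff[OF g'[where h="2 * pi"] g] by (simp add: cperD[OF assms])
  then have "g (pi + h + 2 * pi) - g (pi + h) = g (- pi + 2 * pi) - g (- pi)" for h
    by (rule DERIV_isconst_all[rule_format])
  from this[of "h - 2 * pi"] show ?thesis
    by (simp add: mean_ftc[OF g'] mean_ftc[OF g] add.commute)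
qed

lemma mean_shift': "cper f \<Longrightarrow> mean (\<lambda>x. f (x - h)) = mean f"
  using mean_shift[of f "- h"] by simp

lemma mean_add: "cper f \<Longrightarrow> cper g \<Longrightarrow> mean (\<lambda>x. f x + g x) = mean f + mean g"
  unfolding mean_def by (subst integral_add) (auto simp: add_divide_distrib)

lemma mean_diff: "cper f \<Longrightarrow> cper g \<Longrightarrow> mean (\<lambda>x. f x - g x) = mean f - mean g"
  unfolding mean_def by (subst integral_diff) (auto simp: diff_divide_distrib)

lemma mean_cmult [simp]: "mean (\<lambda>x. c * f x) = c * mean f"
  unfolding mean_def by simp

lemma mean_const [simp]: "mean (\<lambda>x. c) = c"
  unfolding mean_def by simp

lemma mean_bdd:
  assumes "cper f" "bdd d f" shows "\<bar>mean f\<bar> \<le> d"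
proof -
  have "norm (integral {-pi..pi} f) \<le> d * (pi - (- pi))"
    using assms(2) by (intro integral_bound cper_cont assms(1)) (auto simp: bdd_def)
  then show ?thesis by (simp add: mean_def field_simps)
qed

lemma mean_cos:
  assumes "k \<noteq> 0" shows "mean (\<lambda>x. cos (of_int k * x + \<theta>)) = 0"
proof (rule mean_deriv)
  show "((\<lambda>x. sin (of_int k * x + \<theta>) / of_int k) has_real_derivative cos (of_int k * x + \<theta>)) (at x)"
    for x using assms by (auto intro!: derivative_eq_intros)
  show "sin (of_int k * (x + 2 * pi) + \<theta>) / of_int k = sin (of_int k * x + \<theta>) / of_int k" for x
    using sin_add_int_2pi[of "of_int k * x + \<theta>" k] by (simp add: algebra_simps)
qed

lemma mean_cos_nat: "k \<noteq> 0 \<Longrightarrow> mean (\<lambda>x. cos (real k * x + \<theta>)) = 0"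
  using mean_cos[of "int k"] by simp

section \<open>Density of trigonometric polynomials\<close>

text \<open>Sines are absorbed into the phase. The frequency is an integer, so that the product
  formula, which produces the difference k - l, stays inside the class.\<close>

inductive trig_poly :: "(real \<Rightarrow> real) \<Rightarrow> bool" where
  monom: "trig_poly (\<lambda>x. a * cos (of_int k * x + \<theta>))"
| add: "trig_poly f \<Longrightarrow> trig_poly g \<Longrightarrow> trig_poly (\<lambda>x. f x + g x)"

lemma trig_poly_mult:
  assumes "trig_poly f" "trig_poly g"
  shows "trig_poly (\<lambda>x. f x * g x)"
  using assms(1)
proof induction
  case (monom a k \<theta>)
  show ?case using assms(2)
  proof induction
    case (monom b l \<eta>)
    have eq: "a * cos (of_int k * x + \<theta>) * (b * cos (of_int l * x + \<eta>)) =
        (a * b / 2) * cos (of_int (k - l) * x + (\<theta> - \<eta>)) +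
        (a * b / 2) * cos (of_int (k + l) * x + (\<theta> + \<eta>))" for x
    proof -
      have "of_int (k - l) * x + (\<theta> - \<eta>) = (of_int k * x + \<theta>) - (of_int l * x + \<eta>)"
        "of_int (k + l) * x + (\<theta> + \<eta>) = (of_int k * x + \<theta>) + (of_int l * x + \<eta>)"
        by (simp_all add: algebra_simps)
      then show ?thesis
        by (simp only: cos_add cos_diff) (simp add: algebra_simps)
    qed
    show ?case unfolding eq by (intro trig_poly.intros)
  next
    case (add f g)
    then show ?case by (simp add: distrib_left trig_poly.add)
  qed
next
  case (add f g)
  then show ?case by (simp add: distrib_right trig_poly.add)
qed

text \<open>Stone-Weierstrass yields polynomials on the complex numbers as a real plane; their
  linear generators restrict to first harmonics on the circle.\<close>

lemma trig_poly_of_real_polynomial: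
  fixes g :: "complex \<Rightarrow> real"
  assumes "real_polynomial_function g"
  shows "trig_poly (\<lambda>x. g (cis x))"
  using assms
proof induction
  case (linear f)
  then interpret bounded_linear f .
  have "f (cis x) = f 1 * cos (of_int 1 * x + 0) + f \<i> * cos (of_int 1 * x + (- (pi / 2)))" for x
  proof -
    have "cis x = cos x *\<^sub>R 1 + sin x *\<^sub>R \<i>"
      by (simp add: complex_eq_iff)
    then have "f (cis x) = cos x * f 1 + sin x * f \<i>"
      by (simp only: add scale) simp
    then show ?thesis by (simp add: cos_diff)
  qed
  then show ?case by (simp only:) (intro trig_poly.intros)
next
  case (const c)
  show ?case using trig_poly.monom[of c 0 0] by simp
qed (auto intro: trig_poly.add trig_poly_mult)

lemma cper_Arg:
  assumes "cper f" shows "f (Arg (cis x)) = f x"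
proof -
  obtain k where k: "x - of_int k * (2 * pi) \<in> {-pi<..pi}" using reduce_mod_2pi .
  have "cis (x - of_int k * (2 * pi)) = cis x"
    using cos_add_int_2pi[of x "- k"] sin_add_int_2pi[of x "- k"] by (simp add: complex_eq_iff)
  then have "f (Arg (cis x)) = f (x - of_int k * (2 * pi))"
    using Arg_cis[OF k] by simp
  then show ?thesis by (simp add: cper_minus_int[OF assms])
qed

text \<open>Stone-Weierstrass on the unit circle, to which \<open>f\<close> descends by periodicity.
  The only difficulty is that \<open>Arg\<close> jumps on the negative real axis.\<close>

lemma trig_poly_dense:
  assumes f: "cper f" and e: "e > 0"
  obtains g where "trig_poly g" "\<And>x. \<bar>f x - g x\<bar> < e"
proof -
  \<comment> \<open>Across the branch cut \<open>Arg z\<close> is traded for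
    \<open>Arg (- z) + pi\<close>, which is continuous there; the two differ by 0 or 2 pi.\<close>
  have eq: "f (Arg z) = f (Arg (- z) + pi)" if "z \<noteq> 0" for z
    using Arg_minus[OF that] cperD[OF f, of "Arg z"] cperD2[OF f, of "Arg z"] 
    by (auto simp: algebra_simps)
  have "continuous (at z) (\<lambda>z. f (Arg z))" if "z \<in> sphere 0 1" for z
  proof (cases "z \<in> \<real>\<^sub>\<le>\<^sub>0")
    case False
    then show ?thesis
      by (intro continuous_at_compose[of z Arg f, unfolded o_def] continuous_at_Arg cper_isCont f)
  next
    case True
    with that have z: "- z \<notin> \<real>\<^sub>\<le>\<^sub>0"
      by (auto simp: complex_nonpos_Reals_iff cmod_def)
    then have "isCont (\<lambda>z. Arg (- z) + pi) z"
      by (intro continuous_intros isCont_o2[OF _ continuous_at_Arg])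
    then have c: "isCont (\<lambda>z. f (Arg (- z) + pi)) z"
      by (rule isCont_o2[OF _ cper_isCont[OF f]])
    have "\<forall>\<^sub>F y in nhds z. y \<noteq> 0" 
      using that by (intro t1_space_nhds) auto
    then have ev: "\<forall>\<^sub>F y in nhds z. f (Arg (- y) + pi) = f (Arg y)"
      by eventually_elim (rule eq[symmetric])
    show ?thesis using isCont_cong[OF ev] c by simp
  qed
  then have "continuous_on (sphere 0 1) (\<lambda>z. f (Arg z))"
    by (simp add: continuous_at_imp_continuous_on)
  then obtain g where g: "real_polynomial_function g"
      "\<And>z. z \<in> sphere 0 1 \<Longrightarrow> \<bar>f (Arg z) - g z\<bar> < e"
    using Stone_Weierstrass_real_polynomial_function[of "sphere (0::complex) 1" "\<lambda>z. f (Arg z)"] e by auto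
  show ?thesis
  proof (rule that[OF trig_poly_of_real_polynomial[OF g(1)]])
    show "\<bar>f x - g (cis x)\<bar> < e" for x
      using g(2)[of "cis x"] cper_Arg[OF f, of x] by simp
  qed
qed

lemma trig_poly_cper: "trig_poly f \<Longrightarrow> cper f"
  by (induction rule: trig_poly.induct) auto

text \<open>Density as an induction rule: a claim about all continuous periodic functions is reduced
  to single cosines. The explicit rate in the limit case can be pushed through any bounded linear
  operator. Negative frequencies are folded by evenness of the cosine.\<close>

lemma cper_dense_induct [consumes 1, case_names monom add lim]:
  assumes f: "cper f"
    and monom: "\<And>a k \<theta>. Q (\<lambda>x. a * cos (real k * x + \<theta>))"
    and add: "\<And>f g. cper f \<Longrightarrow> cper g \<Longrightarrow> Q f \<Longrightarrow> Q g \<Longrightarrow> Q (\<lambda>x. f x + g x)"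
    and lim: "\<And>F f. cper f \<Longrightarrow> (\<And>n. cper (F n)) \<Longrightarrow> (\<And>n. Q (F n)) \<Longrightarrow>
      (\<And>n. bdd (1 / real (Suc n)) (\<lambda>x. F n x - f x)) \<Longrightarrow> Q f"
  shows "Q f"
proof -
  have Q: "Q g" if "trig_poly g" for g
    using that
  proof induction
    case (monom a k \<theta>)
    show ?case
    proof (cases "k \<ge> 0")
      case True
      then show ?thesis using assms(2)[of a "nat k" \<theta>] by simp
    next
      case False
      have "cos (of_int k * x + \<theta>) = cos (real (nat (- k)) * x + (- \<theta>))" for x
        using False cos_minus[of "of_int k * x + \<theta>"] by simp
      then show ?thesis using assms(2)[of a "nat (- k)" "- \<theta>"] by simp
    qed
  next
    case (add f g)
    then show ?case using assms(3) trig_poly_cper by blast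
  qed
  have "\<exists>g. trig_poly g \<and> bdd (1 / real (Suc n)) (\<lambda>x. g x - f x)" for n
  proof -
    obtain g where "trig_poly g" "\<And>x. \<bar>f x - g x\<bar> < 1 / real (Suc n)"
      using trig_poly_dense[OF f, of "1 / real (Suc n)"] by auto
    then show ?thesis by (auto simp: bdd_def abs_minus_commute intro!: exI[of _ g] less_imp_le)
  qed
  then obtain F where F: "\<And>n. trig_poly (F n)" "\<And>n. bdd (1 / real (Suc n)) (\<lambda>x. F n x - f x)"
    by metis
  show ?thesis
    by (rule lim[OF f _ _ F(2)]) (use F trig_poly_cper Q in auto)
qed

section \<open>Fourier multipliers\<close>

text \<open>The k-th harmonic a_k cos(k x) + b_k sin(k x), written as a convolution; the factor 2
  for positive k makes it a projection.\<close>

definition mode :: "nat \<Rightarrow> (real \<Rightarrow> real) \<Rightarrow> real \<Rightarrow> real" where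
  "mode k f x = (if k = 0 then 1 else 2) * mean (\<lambda>y. cos (real k * (x - y)) * f y)"

text \<open>Symbols are real and carry no phase; the phases of the lattice operator are expressed by
  explicit shifts.\<close>

definition multiplier :: "(nat \<Rightarrow> real) \<Rightarrow> (real \<Rightarrow> real) \<Rightarrow> real \<Rightarrow> real" where
  "multiplier \<sigma> f x = (\<Sum>k. \<sigma> k * mode k f x)"

lemma cper_cos_diff [intro, simp]: "cper (\<lambda>y. cos (real k * (x - y)))"
  using cper_cos_int[of "- int k" "real k * x"] by (simp add: algebra_simps)

lemma mode_bdd:
  assumes "cper f" "bdd d f" shows "\<bar>mode k f x\<bar> \<le> 2 * d"
proof -
  have "bdd (1 * d) (\<lambda>y. cos (real k * (x - y)) * f y)"
    by (intro bdd_mult assms) simp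
  then have "\<bar>mean (\<lambda>y. cos (real k * (x - y)) * f y)\<bar> \<le> d"
    using mean_bdd[of _ d] assms by auto
  then show ?thesis using bdd_nonneg[OF assms(2)] by (auto simp: mode_def abs_mult)
qed

lemma mode_add: "cper f \<Longrightarrow> cper g \<Longrightarrow> mode k (\<lambda>x. f x + g x) x = mode k f x + mode k g x"
  using mean_add[of "\<lambda>y. cos (real k * (x - y)) * f y" "\<lambda>y. cos (real k * (x - y)) * g y"]
  by (simp add: mode_def distrib_left cper_mult)

lemma mode_cmult: "mode k (\<lambda>x. c * f x) x = c * mode k f x"
  unfolding mode_def using mean_cmult[of c] by (simp add: mult.left_commute)

lemma mode_shift:
  assumes "cper f" shows "mode k (\<lambda>x. f (x + h)) x = mode k f (x + h)"
proof -
  have "mean (\<lambda>y. cos (real k * (x - y)) * f (y + h)) = mean (\<lambda>y. cos (real k * (x + h - y)) * f y)"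
    using mean_shift[of "\<lambda>y. cos (real k * (x + h - y)) * f y" h] assms by (auto simp: cper_mult)
  then show ?thesis by (simp add: mode_def)
qed

text \<open>Orthogonality by the product formula: the frequencies j - k and j + k have mean zero
  unless they vanish. Both vanish only for j = k = 0, which is why the normalising factor differs
  there.\<close>

lemma mode_cos: "mode k (\<lambda>x. cos (real j * x + \<theta>)) x = (if k = j then cos (real j * x + \<theta>) else 0)"
proof -
  let ?i = "int j - int k" and ?l = "int j + int k"
  have eq: "cos (real k * (x - y)) * cos (real j * y + \<theta>) =
      1/2 * cos (of_int ?i * y + (\<theta> + real k * x)) + 1/2 * cos (of_int ?l * y + (\<theta> - real k * x))" for y
  proof -
    have "of_int ?i * y + (\<theta> + real k * x) = (real j * y + \<theta>) + real k * (x - y)"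
      "of_int ?l * y + (\<theta> - real k * x) = (real j * y + \<theta>) - real k * (x - y)"
      by (simp_all add: algebra_simps)
    then show ?thesis
      by (simp only: cos_add[of "real j * y + \<theta>"] cos_diff[of "real j * y + \<theta>"])
        (simp add: field_simps)
  qed
  have "mean (\<lambda>y. cos (real k * (x - y)) * cos (real j * y + \<theta>)) =
      1/2 * mean (\<lambda>y. cos (of_int ?i * y + (\<theta> + real k * x)))
      + 1/2 * mean (\<lambda>y. cos (of_int ?l * y + (\<theta> - real k * x)))"
    unfolding eq by (simp only: mean_add[OF cper_mult[OF cper_const cper_cos_int] cper_mult[OF cper_const cper_cos_int]] mean_cmult)
  also have "\<dots> = (if k = j then (if k = 0 then 1 else 1/2) * cos (real j * x + \<theta>) else 0)"
  proof (cases "k = j")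
    case False
    then have "?i \<noteq> 0" "?l \<noteq> 0" by auto
    then show ?thesis using mean_cos[of ?i] mean_cos[of ?l] False by (simp del: of_int_diff of_int_add)
  next
    case True
    show ?thesis
    proof (cases "k = 0")
      case False
      with True have "?l \<noteq> 0" by auto
      then show ?thesis using True mean_cos[of ?l] False by (simp del: of_int_add add: add.commute)
    qed (use True in simp)
  qed
  finally show ?thesis by (auto simp: mode_def)
qed

text \<open>Order -2 is the decay obtained by inverting two derivatives. It makes the series of
  harmonics converge absolutely, so the multiplier is bounded in the supremum norm without
  smoothness of its argument. The shift by 1 covers k = 0.\<close>

definition decay :: "real \<Rightarrow> (nat \<Rightarrow> real) \<Rightarrow> bool" where
  "decay C \<sigma> \<longleftrightarrow> (\<forall>k. \<bar>\<sigma> k\<bar> \<le> C / (real k + 1)\<^sup>2)"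

definition zeta2 :: real where
  "zeta2 = (\<Sum>k. 1 / (real k + 1)\<^sup>2)"

lemma summable_zeta2: "summable (\<lambda>k. 1 / (real k + 1)\<^sup>2)"
proof -
  have "summable (\<lambda>k. inverse (real (Suc k) ^ 2))"
    using inverse_power_summable[of 2, where 'a=real] summable_Suc_iff[of "\<lambda>k. inverse (real k ^ 2)"] by simp
  then show ?thesis by (simp add: field_simps)
qed

lemma zeta2_nonneg: "0 \<le> zeta2"
  unfolding zeta2_def by (intro suminf_nonneg summable_zeta2) auto

lemma multiplier_term_bound:
  assumes "decay C \<sigma>" "cper f" "bdd d f"
  shows "norm (\<sigma> k * mode k f x) \<le> 2 * C * d * (1 / (real k + 1)\<^sup>2)"
proof -
  have "\<bar>\<sigma> k\<bar> * \<bar>mode k f x\<bar> \<le> (C / (real k + 1)\<^sup>2) * (2 * d)"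
    using assms(1) mode_bdd[OF assms(2,3), of k x] by (intro mult_mono) (auto simp: decay_def intro: order_trans[of 0 "\<bar>\<sigma> k\<bar>"])
  then show ?thesis by (simp add: abs_mult algebra_simps)
qed

lemma multiplier_summable:
  assumes "decay C \<sigma>" "cper f"
  shows "summable (\<lambda>k. \<sigma> k * mode k f x)"
proof -
  obtain d where d: "bdd d f" using cper_bounded[OF assms(2)] .
  show ?thesis
    by (rule summable_comparison_test'[OF summable_mult[OF summable_zeta2, of "2 * C * d"], of 0])
      (rule multiplier_term_bound[OF assms d])
qed

lemma multiplier_bdd:
  assumes "decay C \<sigma>" "cper f" "bdd d f"
  shows "bdd (2 * zeta2 * C * d) (multiplier \<sigma> f)"
  unfolding bdd_def
proof
  fix x
  have s: "summable (\<lambda>k. norm (\<sigma> k * mode k f x))"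
    by (rule summable_comparison_test'[OF summable_mult[OF summable_zeta2, of "2 * C * d"], of 0])
      (use multiplier_term_bound[OF assms] in simp)
  have "\<bar>multiplier \<sigma> f x\<bar> \<le> (\<Sum>k. norm (\<sigma> k * mode k f x))"
    unfolding multiplier_def using summable_norm[OF s] by simp
  also have "\<dots> \<le> (\<Sum>k. 2 * C * d * (1 / (real k + 1)\<^sup>2))"
    by (intro suminf_le s summable_mult summable_zeta2 multiplier_term_bound assms)
  also have "\<dots> = 2 * zeta2 * C * d"
    unfolding zeta2_def by (subst suminf_mult[OF summable_zeta2]) simp
  finally show "\<bar>multiplier \<sigma> f x\<bar> \<le> 2 * zeta2 * C * d" .
qed

lemma multiplier_add:
  assumes "decay C \<sigma>" "cper f" "cper g"
  shows "multiplier \<sigma> (\<lambda>x. f x + g x) x = multiplier \<sigma> f x + multiplier \<sigma> g x"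
  unfolding multiplier_def
  by (subst suminf_add[OF multiplier_summable[OF assms(1,2)] multiplier_summable[OF assms(1,3)]])
    (simp add: mode_add assms algebra_simps)

lemma multiplier_cmult:
  assumes "decay C \<sigma>" "cper f"
  shows "multiplier \<sigma> (\<lambda>x. c * f x) x = c * multiplier \<sigma> f x"
  unfolding multiplier_def
  by (subst suminf_mult[OF multiplier_summable[OF assms], symmetric])
    (simp add: mode_cmult algebra_simps)

lemma multiplier_shift:
  assumes "cper f"
  shows "multiplier \<sigma> (\<lambda>x. f (x + h)) x = multiplier \<sigma> f (x + h)"
  unfolding multiplier_def by (simp add: mode_shift assms)

lemma multiplier_cos:
  "multiplier \<sigma> (\<lambda>x. cos (real j * x + \<theta>)) x = \<sigma> j * cos (real j * x + \<theta>)"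
proof -
  have "(\<lambda>k. \<sigma> k * mode k (\<lambda>x. cos (real j * x + \<theta>)) x) sums (\<sigma> j * cos (real j * x + \<theta>))"
    using sums_single[of j "\<lambda>k. \<sigma> k * cos (real j * x + \<theta>)"]
    by (rule sums_cong[THEN iffD1, rotated]) (auto simp: mode_cos)
  then show ?thesis unfolding multiplier_def by (simp add: sums_iff)
qed

text \<open>For a cosine the series has a single term, and \<open>multiplier_bdd\<close> turns
  uniform approximation of the argument into uniform approximation of the values, which preserves
  continuity.\<close>

lemma multiplier_cper:
  assumes "decay C \<sigma>" "cper f"
  shows "cper (multiplier \<sigma> f)"
  using assms(2)
proof (induction rule: cper_dense_induct)
  case (monom a k \<theta>)
  have "multiplier \<sigma> (\<lambda>x. a * cos (real k * x + \<theta>)) = (\<lambda>x. a * (\<sigma> k * cos (real k * x + \<theta>)))"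
    by (rule ext) (simp add: multiplier_cmult[OF assms(1)] multiplier_cos)
  then show ?case by (auto intro!: cper_mult)
next
  case (add f g)
  have "multiplier \<sigma> (\<lambda>x. f x + g x) = (\<lambda>x. multiplier \<sigma> f x + multiplier \<sigma> g x)"
    by (rule ext) (rule multiplier_add[OF assms(1) add(1,2)])
  then show ?case using add by auto
next
  case (lim F f)
  have eq: "multiplier \<sigma> (F n) x - multiplier \<sigma> f x = multiplier \<sigma> (\<lambda>x. F n x - f x) x" for n x
    using multiplier_add[OF assms(1), of "\<lambda>x. F n x - f x" f x] lim by (simp add: cper_diff)
  have b: "\<bar>multiplier \<sigma> (F n) x - multiplier \<sigma> f x\<bar> \<le> 2 * zeta2 * C * (1 / real (Suc n))" for n x
    unfolding eq using multiplier_bdd[OF assms(1) _ lim(3)] lim by (simp add: bdd_def cper_diff)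
  have l: "(\<lambda>n. 2 * zeta2 * C * (1 / real (Suc n))) \<longlonglongrightarrow> 2 * zeta2 * C * 0"
    by (intro tendsto_mult tendsto_const) (use LIMSEQ_inverse_real_of_nat in \<open>simp add: inverse_eq_divide\<close>)
  have "uniform_limit UNIV (\<lambda>n. multiplier \<sigma> (F n)) (multiplier \<sigma> f) sequentially"
  proof (rule uniform_limitI)
    fix e :: real assume "e > 0"
    then have "\<forall>\<^sub>F n in sequentially. 2 * zeta2 * C * (1 / real (Suc n)) < e"
      using order_tendstoD(2)[OF l] by simp
    then show "\<forall>\<^sub>F n in sequentially. \<forall>x\<in>UNIV. dist (multiplier \<sigma> (F n) x) (multiplier \<sigma> f x) < e"
      by eventually_elim (use b in \<open>auto simp: dist_real_def intro: le_less_trans\<close>)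
  qed
  then have "continuous_on UNIV (multiplier \<sigma> f)"
    by (rule uniform_limit_theorem[rotated]) (use lim(4) in \<open>auto simp: cper_def\<close>)
  moreover have "multiplier \<sigma> f (x + 2 * pi) = multiplier \<sigma> f x" for x
    using multiplier_shift[OF lim(1), of \<sigma> "2 * pi" x] cperD[OF lim(1)] by simp
  ultimately show ?case by (simp add: cper_def)
qed

section \<open>Second derivatives of periodic functions\<close>

definition deriv2 :: "(real \<Rightarrow> real) \<Rightarrow> (real \<Rightarrow> real) \<Rightarrow> (real \<Rightarrow> real) \<Rightarrow> bool" where
  "deriv2 u u' v \<longleftrightarrow> (\<forall>x. (u has_real_derivative u' x) (at x)) \<and> (\<forall>x. (u' has_real_derivative v x) (at x))"

lemma deriv2_add:
  "deriv2 u u' v \<Longrightarrow> deriv2 f f' g \<Longrightarrow> deriv2 (\<lambda>x. u x + f x) (\<lambda>x. u' x + f' x) (\<lambda>x. v x + g x)"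
  by (auto simp: deriv2_def intro!: DERIV_add)

lemma deriv2_diff:
  "deriv2 u u' v \<Longrightarrow> deriv2 f f' g \<Longrightarrow> deriv2 (\<lambda>x. u x - f x) (\<lambda>x. u' x - f' x) (\<lambda>x. v x - g x)"
  by (auto simp: deriv2_def intro!: DERIV_diff)

lemma deriv2_cmult:
  "deriv2 u u' v \<Longrightarrow> deriv2 (\<lambda>x. c * u x) (\<lambda>x. c * u' x) (\<lambda>x. c * v x)"
  by (auto simp: deriv2_def intro!: DERIV_cmult)

lemma deriv2_cos:
  "deriv2 (\<lambda>x. cos (k * x + \<theta>)) (\<lambda>x. - k * sin (k * x + \<theta>)) (\<lambda>x. - k\<^sup>2 * cos (k * x + \<theta>))"
  by (auto simp: deriv2_def power2_eq_square intro!: derivative_eq_intros)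

lemma deriv2_cong: "deriv2 u u' v \<Longrightarrow> (\<And>x. u x = f x) \<Longrightarrow> (\<And>x. v x = g x) \<Longrightarrow> deriv2 f u' g"
  by (metis ext)

lemma deriv_periodic:
  assumes "\<And>x. (u has_real_derivative u' x) (at x)" "\<And>x. u (x + 2 * pi) = u x"
  shows "u' (x + 2 * pi) = u' x"
proof -
  have "((\<lambda>x. u (x + 2 * pi)) has_real_derivative u' (x + 2 * pi)) (at x)"
    using DERIV_shift[of u "u' (x + 2 * pi)" x "2 * pi"] assms(1) by simp
  then have "(u has_real_derivative u' (x + 2 * pi)) (at x)"
    by (simp only: assms(2))
  then show ?thesis using assms(1) by (rule DERIV_unique)
qed

lemma deriv2_cper:
  assumes "deriv2 u u' v" "cper u"
  shows "cper u'"
  unfolding cper_def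
proof safe
  show "continuous_on UNIV u'"
    using assms(1) DERIV_isCont unfolding deriv2_def by (blast intro: continuous_at_imp_continuous_on)
  show "u' (x + 2 * pi) = u' x" for x
    using deriv_periodic[of u u'] assms unfolding deriv2_def cper_def by blast
qed

lemma lipschitz_of_deriv:
  assumes "\<And>x. (u has_real_derivative u' x) (at x)" "bdd L u'"
  shows "\<bar>u x - u y\<bar> \<le> L * \<bar>x - y\<bar>"
  using field_differentiable_bound[of UNIV u u' L x y] assms by (simp add: bdd_def)

text \<open>Rolle on one period: \<open>u'\<close> vanishes somewhere in each window of length 2 pi
  and changes from there at rate at most \<open>d\<close>.\<close>

lemma deriv_bdd:
  assumes "deriv2 u u' v" "cper u" "bdd d v"
  shows "bdd (2 * pi * d) u'"
  unfolding bdd_def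
proof
  fix x
  have "\<exists>z>x - 2 * pi. z < x \<and> u x - u (x - 2 * pi) = (x - (x - 2 * pi)) * u' z"
    using assms(1) by (intro MVT2) (auto simp: deriv2_def)
  then obtain z where z: "z > x - 2 * pi" "z < x" "u' z = 0"
    using cperD2[OF assms(2)] by auto
  have "\<bar>u' x - u' z\<bar> \<le> d * \<bar>x - z\<bar>"
    using assms by (intro lipschitz_of_deriv[of _ v]) (auto simp: deriv2_def)
  also have "\<dots> \<le> d * (2 * pi)"
    using z bdd_nonneg[OF assms(3)] by (intro mult_left_mono) auto
  finally show "\<bar>u' x\<bar> \<le> 2 * pi * d" using z by (simp add: algebra_simps)
qed

lemma inverse_Suc_eventually:
  "0 < e \<Longrightarrow> \<forall>\<^sub>F n in sequentially. A / real (Suc n) < (e :: real)"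
proof -
  have "(\<lambda>n. A * inverse (real (Suc n))) \<longlonglongrightarrow> A * 0"
    by (intro tendsto_mult tendsto_const LIMSEQ_inverse_real_of_nat)
  then show "0 < e \<Longrightarrow> ?thesis"
    using order_tendstoD(2)[of "\<lambda>n. A * inverse (real (Suc n))" 0 sequentially e] by (simp add: divide_inverse)
qed

lemma tendsto_of_bdd:
  assumes "\<And>n. bdd (A / real (Suc n)) (\<lambda>x. U n x - u x)"
  shows "(\<lambda>n. U n x) \<longlonglongrightarrow> u x"
proof (rule tendstoI)
  fix e :: real assume "e > 0"
  from inverse_Suc_eventually[OF this, of A]
  show "\<forall>\<^sub>F n in sequentially. dist (U n x) (u x) < e"
    by eventually_elim (use assms in \<open>auto simp: dist_real_def bdd_def intro: le_less_trans\<close>)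
qed

lemma deriv_lim:
  assumes der: "\<And>n x. (U n has_real_derivative W n x) (at x)"
    and W: "\<And>n. bdd (A / real (Suc n)) (\<lambda>x. W n x - w x)"
    and U: "\<And>x. (\<lambda>n. U n x) \<longlonglongrightarrow> u x"
  shows "(u has_real_derivative w x) (at x)"
proof -
  have "\<exists>g. \<forall>x\<in>UNIV. (\<lambda>n. U n x) \<longlonglongrightarrow> g x \<and> (g has_derivative (*) (w x)) (at x within UNIV)"
  proof (rule has_derivative_sequence[OF _ _ _ _ U])
    show "(U n has_derivative (*) (W n x)) (at x within UNIV)" for n x
      using der by (simp add: has_field_derivative_def)
    show "\<forall>\<^sub>F n in sequentially. \<forall>x\<in>UNIV. \<forall>h. norm (W n x * h - w x * h) \<le> e * norm h" if "e > 0" for e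
      using inverse_Suc_eventually[OF that, of A]
    proof eventually_elim
      case (elim n)
      have "\<bar>W n x - w x\<bar> \<le> e" for x using W[of n] elim by (auto simp: bdd_def intro: order_trans less_imp_le)
      then show ?case by (auto simp: abs_mult mult_right_mono simp flip: left_diff_distrib)
    qed
  qed auto
  then obtain g where g: "\<And>x. (\<lambda>n. U n x) \<longlonglongrightarrow> g x" "\<And>x. (g has_real_derivative w x) (at x)"
    by (auto simp: has_field_derivative_def)
  then have "g = u" using U LIMSEQ_unique by blast
  then show ?thesis using g by simp
qed

text \<open>The second derivative is a closed operation: \<open>deriv_bdd\<close>, applied to
  differences of members of the sequence, makes the first derivatives uniformly Cauchy, and then
  derivatives and limits can be exchanged twice.\<close>

lemma deriv2_lim:
  assumes cper: "\<And>n. cper (U n)"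
    and der: "\<And>n. deriv2 (U n) (U' n) (V n)"
    and U: "\<And>n. bdd (A / real (Suc n)) (\<lambda>x. U n x - u x)"
    and V: "\<And>n. bdd (A / real (Suc n)) (\<lambda>x. V n x - v x)"
  shows "\<exists>u'. deriv2 u u' v"
proof -
  have "bdd (A / real (Suc n) + A / real (Suc k)) (\<lambda>x. V n x - V k x)" for n k
    using bdd_diff[OF V[of n] V[of k]] by simp
  then have U': "bdd (2 * pi * (A / real (Suc n) + A / real (Suc k))) (\<lambda>x. U' n x - U' k x)" for n k
    using deriv_bdd[OF deriv2_diff[OF der der] cper_diff[OF cper cper]] by simp
  have A: "A \<ge> 0" using bdd_nonneg[OF U[of 0]] by simp
  have "Cauchy (\<lambda>n. U' n x)" for x
  proof (rule metric_CauchyI)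
    fix e :: real assume "e > 0"
    then have "\<forall>\<^sub>F n in sequentially. 4 * pi * A / real (Suc n) < e"
      by (rule inverse_Suc_eventually)
    then obtain N where N: "\<And>n. n \<ge> N \<Longrightarrow> 4 * pi * A / real (Suc n) < e"
      by (auto simp: eventually_sequentially)
    show "\<exists>M. \<forall>m\<ge>M. \<forall>n\<ge>M. dist (U' m x) (U' n x) < e"
    proof (intro exI allI impI)
      fix k n assume kn: "k \<ge> N" "n \<ge> N"
      have "\<bar>U' k x - U' n x\<bar> \<le> 2 * pi * (A / real (Suc k) + A / real (Suc n))"
        using U'[of k n] by (simp add: bdd_def)
      moreover have "4 * pi * (A / real (Suc k)) < e" "4 * pi * (A / real (Suc n)) < e"
        using N[OF kn(1)] N[OF kn(2)] by simp_all
      ultimately have "\<bar>U' k x - U' n x\<bar> < e"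
        unfolding distrib_left by linarith
      then show "dist (U' k x) (U' n x) < e" by (simp add: dist_real_def)
    qed
  qed
  then have "\<exists>l. (\<lambda>n. U' n x) \<longlonglongrightarrow> l" for x
    using Cauchy_convergent convergent_def by metis
  then obtain u' where u': "\<And>x. (\<lambda>n. U' n x) \<longlonglongrightarrow> u' x" by metis
  have bu': "bdd ((2 * pi * A) / real (Suc n)) (\<lambda>x. U' n x - u' x)" for n
    unfolding bdd_def
  proof
    fix x
    have 1: "(\<lambda>k. \<bar>U' n x - U' k x\<bar>) \<longlonglongrightarrow> \<bar>U' n x - u' x\<bar>"
      by (intro tendsto_intros u')
    have 2: "(\<lambda>k. 2 * pi * (A / real (Suc n) + A * inverse (real (Suc k)))) \<longlonglongrightarrow> 2 * pi * (A / real (Suc n) + A * 0)"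
      by (intro tendsto_intros LIMSEQ_inverse_real_of_nat)
    show "\<bar>U' n x - u' x\<bar> \<le> (2 * pi * A) / real (Suc n)"
      using LIMSEQ_le[OF 1 2] U' by (force simp: bdd_def divide_inverse)
  qed
  have "deriv2 u u' v"
    unfolding deriv2_def
  proof safe
    show "(u has_real_derivative u' x) (at x)" for x
      by (rule deriv_lim[of U U', OF _ bu' tendsto_of_bdd[OF U]]) (use der in \<open>simp add: deriv2_def\<close>)
    show "(u' has_real_derivative v x) (at x)" for x
      by (rule deriv_lim[of U' V, OF _ V u']) (use der in \<open>simp add: deriv2_def\<close>)
  qed
  then show ?thesis by blast
qed

section \<open>The linearised operator\<close>

definition ip :: "(real \<Rightarrow> real) \<Rightarrow> (real \<Rightarrow> real) \<Rightarrow> (real \<Rightarrow> real) \<Rightarrow> (real \<Rightarrow> real) \<Rightarrow> real" where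
  "ip f1 f2 g1 g2 = mean (\<lambda>x. f1 x * g1 x + f2 x * g2 x)"

lemma ip_add:
  assumes "cper f1" "cper f2" "cper h1" "cper h2" "cper g1" "cper g2"
  shows "ip (\<lambda>x. f1 x + h1 x) (\<lambda>x. f2 x + h2 x) g1 g2 = ip f1 f2 g1 g2 + ip h1 h2 g1 g2"
  unfolding ip_def by (subst mean_add[symmetric]) (auto simp: algebra_simps intro!: cper_mult cper_add assms)

lemma ip_cmult: "ip (\<lambda>x. c * f1 x) (\<lambda>x. c * f2 x) g1 g2 = c * ip f1 f2 g1 g2"
  unfolding ip_def mean_cmult[symmetric] by (simp add: algebra_simps)

lemma ip_diff:
  assumes "cper f1" "cper f2" "cper h1" "cper h2" "cper g1" "cper g2"
  shows "ip (\<lambda>x. f1 x - h1 x) (\<lambda>x. f2 x - h2 x) g1 g2 = ip f1 f2 g1 g2 - ip h1 h2 g1 g2"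
  unfolding ip_def by (subst mean_diff[symmetric]) (auto simp: algebra_simps intro!: cper_mult cper_add assms)

lemma ip_bdd:
  assumes "cper f1" "cper f2" "cper g1" "cper g2" "bdd d f1" "bdd d f2" "bdd e g1" "bdd e g2"
  shows "\<bar>ip f1 f2 g1 g2\<bar> \<le> 2 * d * e"
proof -
  have "bdd (d * e + d * e) (\<lambda>x. f1 x * g1 x + f2 x * g2 x)"
    by (intro bdd_add bdd_mult assms)
  then show ?thesis
    unfolding ip_def
    using mean_bdd[OF cper_add[OF cper_mult cper_mult, OF assms(1,3,2,4)], of "d * e + d * e"]
    by (simp add: algebra_simps)
qed

text \<open>The mean is half of a first harmonic evaluated at -\<eta>, so orthogonality is inherited
  from \<open>mode_cos\<close>.\<close>

lemma mean_cos_cos: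
  "mean (\<lambda>y. cos (y + \<eta>) * cos (real j * y + \<theta>)) = (if j = 1 then cos (\<theta> - \<eta>) / 2 else 0)"
proof -
  have c: "cos (real 1 * (- \<eta> - y)) = cos (y + \<eta>)" for y
    using cos_minus[of "y + \<eta>"] by (simp add: algebra_simps)
  have "2 * mean (\<lambda>y. cos (y + \<eta>) * cos (real j * y + \<theta>)) = mode 1 (\<lambda>x. cos (real j * x + \<theta>)) (- \<eta>)"
    unfolding mode_def c by simp
  also have "\<dots> = (if j = 1 then cos (\<theta> - \<eta>) else 0)"
    unfolding mode_cos by auto
  finally show ?thesis by (auto split: if_splits)
qed

lemma multiplier_zero [simp]: "multiplier \<sigma> (\<lambda>x. 0) x = 0"
  by (simp add: multiplier_def mode_def)

lemma multiplier_monom: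
  "decay C \<sigma> \<Longrightarrow> multiplier \<sigma> (\<lambda>x. a * cos (real k * x + \<theta>)) x = a * (\<sigma> k * cos (real k * x + \<theta>))"
  by (simp add: multiplier_cmult multiplier_cos)

text \<open>\<open>\<xi>\<close> is the critical frequency, \<open>\<Lambda> = c\<^sup>2 \<xi>\<^sup>2\<close> the eigenvalue at it, and \<open>n0\<close> a lower bound for
  minus the second entry of \<open>\<mu>\<close> that does not depend on \<open>c\<close>.\<close>

locale dimer =
  fixes m \<kappa> \<xi> \<Lambda> n0 :: real
  assumes m_pos: "m > 0" and kap_pos: "\<kappa> > 0" and xi_pos: "\<xi> > 0" and n0_pos: "n0 > 0"
    and n_ge: "\<Lambda> - (1 + \<kappa>) \<ge> n0"
    and eig: "(\<Lambda> - (1 + \<kappa>)) * (m * \<Lambda> - (1 + \<kappa>)) = 1 + \<kappa>\<^sup>2 + 2 * \<kappa> * cos (2 * \<xi>)"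
    and lam_ge: "(1 + \<kappa>) * (1 + m) \<le> 2 * m * \<Lambda>"
    and lam_le: "m * \<Lambda> \<le> (1 + \<kappa>) * (1 + m)"
begin

text \<open>\<open>n\<close> is minus the second entry of \<mu> and \<open>zz\<close> the squared
  modulus of the first, so |\<mu>|^2 = \<open>zz + n\<^sup>2\<close>.\<close>

definition "n = \<Lambda> - (1 + \<kappa>)"
definition "zz = 1 + \<kappa>\<^sup>2 + 2 * \<kappa> * cos (2 * \<xi>)"
text \<open>On the k-th harmonic the linearised operator, divided by \<Lambda>, is the Hermitian
  matrix with diagonal entries a - k^2 and a - m k^2 and off-diagonal entries -(e^{i k \<xi>} +
  \<kappa> e^{-i k \<xi>}) / \<Lambda> and its conjugate. \<open>symdet\<close> is its determinant
  and \<open>t\<close> its trace at k = 1.\<close>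

definition "a = (1 + \<kappa>) / \<Lambda>"
definition "t = 2 * a - 1 - m"
definition "symdet k = (a - (real k)\<^sup>2) * (a - m * (real k)\<^sup>2)
  - (1 + \<kappa>\<^sup>2 + 2 * \<kappa> * cos (2 * (real k * \<xi>))) / \<Lambda>\<^sup>2"
text \<open>For k >= 2 these are entries of the adjugate over the determinant. For k = 0 and k = 1
  the matrix has rank one, so that matrix / trace is the orthogonal projection off its kernel; the
  scalar 1 / trace therefore inverts it there, with no off-diagonal entry.\<close>

definition "\<sigma>1 k = (if k = 0 then 1 / (2 * a) else if k = 1 then 1 / t else (a - m * (real k)\<^sup>2) / symdet k)"
definition "\<sigma>2 k = (if k = 0 then 1 / (2 * a) else if k = 1 then 1 / t else (a - (real k)\<^sup>2) / symdet k)"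
definition "\<sigma>0 k = (if k < 2 then 0 else 1 / symdet k)"
text \<open>One summand for each of the cases k = 0, k = 1 and k >= 2. None involves \<xi> or
  \<Lambda>, that is, the speed.\<close>

definition "C0 = (1 + 1 / m) + 4 * ((1 + \<kappa>) * (1 + m) / m / n0) + 5 * (1 + m) / m"
definition "Z f x = f (x + \<xi>) + \<kappa> * f (x - \<xi>)"
definition "Zad f x = \<kappa> * f (x + \<xi>) + f (x - \<xi>)"
text \<open>The components of the inverse; the off-diagonal phases appear as the shifts in
  \<open>Z\<close> and its adjoint \<open>Zad\<close>.\<close>

definition "K1 f1 f2 x = multiplier \<sigma>1 f1 x + Z (multiplier \<sigma>0 f2) x / \<Lambda>"
definition "K2 f1 f2 x = Zad (multiplier \<sigma>0 f1) x / \<Lambda> + multiplier \<sigma>2 f2 x"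
text \<open>This is 2 / N_c with the normalising constant N_c of \<nu>.\<close>

definition "g = 2 / sqrt (2 * (zz + n\<^sup>2))"
definition "\<nu>1 x = g * (cos (x + \<xi>) + \<kappa> * cos (x - \<xi>))"
definition "\<nu>2 x = - g * n * cos x"
text \<open>Orthogonal projection onto the span of \<nu>, \<nu>' and the constant pair (1, 1). On
  the first harmonic a quarter period shift is differentiation, and (1, 1) has squared norm
  2.\<close>

definition "Pi1 f1 f2 x = ip f1 f2 \<nu>1 \<nu>2 * \<nu>1 x
  + ip f1 f2 (\<lambda>x. \<nu>1 (x + pi / 2)) (\<lambda>x. \<nu>2 (x + pi / 2)) * \<nu>1 (x + pi / 2) + (mean f1 + mean f2) / 2"
definition "Pi2 f1 f2 x = ip f1 f2 \<nu>1 \<nu>2 * \<nu>2 x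
  + ip f1 f2 (\<lambda>x. \<nu>1 (x + pi / 2)) (\<lambda>x. \<nu>2 (x + pi / 2)) * \<nu>2 (x + pi / 2) + (mean f1 + mean f2) / 2"
text \<open>What the second derivatives (times the masses) of \<open>K1 f1 f2\<close> and
  \<open>K2 f1 f2\<close> must be if these invert the operator up to the projection.\<close>

definition "rhs1 f1 f2 x = (Z (K2 f1 f2) x - (1 + \<kappa>) * K1 f1 f2 x) / \<Lambda> + f1 x - Pi1 f1 f2 x"
definition "rhs2 f1 f2 x = (Zad (K1 f1 f2) x - (1 + \<kappa>) * K2 f1 f2 x) / \<Lambda> + f2 x - Pi2 f1 f2 x"

lemma n_pos: "n > 0" and lam_pos: "\<Lambda> > 0"
  using n_ge n0_pos kap_pos by (auto simp: n_def)

lemma a_pos: "a > 0" and a_less: "a < 1"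
  using n_pos lam_pos kap_pos by (auto simp: a_def n_def)

lemma zz_n: "zz = n * (m * \<Lambda> - (1 + \<kappa>))"
  using eig by (simp add: zz_def n_def)

lemma zz_nonneg: "zz \<ge> 0"
proof -
  have "zz = (cos \<xi> + \<kappa> * cos \<xi>)\<^sup>2 + (sin \<xi> - \<kappa> * sin \<xi>)\<^sup>2"
    using sin_cos_squared_add[of \<xi>] unfolding zz_def cos_double by algebra
  then show ?thesis by simp
qed

text \<open>The trace of a rank one matrix is its nonzero eigenvalue; in this form its sign and its
  distance from 0 can be read off.\<close>

lemma t_eq: "t = - (zz + n\<^sup>2) / (n * \<Lambda>)"
proof -
  have "n * \<Lambda> * t = - (zz + n\<^sup>2)"
    using lam_pos unfolding t_def a_def zz_n
    by (simp add: field_simps) (simp add: n_def power2_eq_square algebra_simps)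
  then show ?thesis using n_pos lam_pos by (simp add: field_simps)
qed

lemma zzn_pos: "zz + n\<^sup>2 > 0"
  using zz_nonneg n_pos by (simp add: add_nonneg_pos)

lemma g2: "g\<^sup>2 = 2 / (zz + n\<^sup>2)"
proof -
  have "g\<^sup>2 = 4 / (2 * (zz + n\<^sup>2))"
    using zzn_pos unfolding g_def power_divide by (subst real_sqrt_pow2) auto
  also have "\<dots> = (2 * 2) / (2 * (zz + n\<^sup>2))" by simp
  finally show ?thesis by (simp only: mult_divide_mult_cancel_left) 
qed

text \<open>No higher harmonic is resonant. \<Lambda> lies on the upper branch, so X = \<Lambda> k^2
  with k >= 2 is so large that in X (m X - (1 + \<kappa>) (1 + m)) half of the leading term
  survives, whatever the phase of the off-diagonal entry.\<close>

lemma symdet_ge: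
  assumes "k \<ge> 2" shows "symdet k \<ge> m * (real k)^4 / 2"
proof -
  define X where "X = \<Lambda> * (real k)\<^sup>2"
  have k2: "(real k)\<^sup>2 \<ge> 4" using assms power_mono[of 2 "real k" 2] by simp
  have X: "m * X \<ge> 2 * ((1 + \<kappa>) * (1 + m))"
  proof -
    have "m * \<Lambda> * 4 \<le> m * \<Lambda> * (real k)\<^sup>2"
      using k2 m_pos lam_pos by (intro mult_left_mono) auto
    then show ?thesis using lam_ge by (simp add: X_def)
  qed
  have Xpos: "X > 0" using lam_pos k2 unfolding X_def by (intro mult_pos_pos) linarith+
  have zk: "1 + \<kappa>\<^sup>2 + 2 * \<kappa> * cos (2 * (real k * \<xi>)) \<le> (1 + \<kappa>)\<^sup>2"
    using mult_left_mono[OF cos_le_one[of "2 * (real k * \<xi>)"], of "2 * \<kappa>"] kap_pos by (simp add: power2_sum)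
  have "\<Lambda>\<^sup>2 * symdet k = (1 + \<kappa> - X) * (1 + \<kappa> - m * X) - (1 + \<kappa>\<^sup>2 + 2 * \<kappa> * cos (2 * (real k * \<xi>)))"
    using lam_pos by (simp add: symdet_def X_def a_def field_simps power2_eq_square)
  also have "\<dots> \<ge> X * (m * X - (1 + \<kappa>) * (1 + m))"
    using zk by (simp add: algebra_simps power2_eq_square)
  also have "X * (m * X - (1 + \<kappa>) * (1 + m)) \<ge> X * (m * X / 2)"
    using X Xpos by (intro mult_left_mono) linarith+
  finally have "\<Lambda>\<^sup>2 * symdet k \<ge> \<Lambda>\<^sup>2 * (m * (real k)^4 / 2)"
    by (simp add: X_def power_mult_distrib eval_nat_numeral algebra_simps)
  then show ?thesis using lam_pos by simp
qed

lemma symdet_pos: "k \<ge> 2 \<Longrightarrow> symdet k > 0"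
  using symdet_ge[of k] m_pos by (smt (verit) divide_pos_pos mult_pos_pos of_nat_0_less_iff not_numeral_le_zero zero_less_power gr0I)

lemma C0_parts: "C0 \<ge> 1 + 1 / m" "C0 \<ge> 4 * ((1 + \<kappa>) * (1 + m) / m / n0)" "C0 \<ge> 5 * (1 + m) / m" "C0 > 0"
  using m_pos kap_pos n0_pos unfolding C0_def by (auto intro!: add_pos_pos)

text \<open>The factor 1/4 compensates (k + 1)^2 = 4 at k = 1 in \<open>decay\<close>.\<close>

lemma low_bounds: "1 / (2 * a) \<le> C0" "\<bar>1 / t\<bar> \<le> C0 / 4"
proof -
  have "\<Lambda> \<le> (1 + \<kappa>) * (1 + 1 / m)"
    using lam_le m_pos by (simp add: field_simps)
  then have "1 / a \<le> 1 + 1 / m"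
    using kap_pos by (simp add: a_def field_simps)
  moreover have "1 / a > 0" using a_pos by simp
  moreover have "1 / (2 * a) = 1 / a / 2" by simp
  ultimately show "1 / (2 * a) \<le> C0" using C0_parts(1) by linarith
  have "\<bar>1 / t\<bar> = (n * \<Lambda>) / (zz + n\<^sup>2)"
    using n_pos lam_pos zzn_pos by (simp add: t_eq)
  also have "\<dots> \<le> (n * \<Lambda>) / n\<^sup>2"
    using zz_nonneg n_pos lam_pos by (intro divide_left_mono) (auto intro!: add_nonneg_pos mult_pos_pos)
  also have "\<dots> = \<Lambda> / n" using n_pos by (simp add: power2_eq_square)
  also have "\<dots> \<le> ((1 + \<kappa>) * (1 + m) / m) / n0"
    using lam_le n_ge n0_pos m_pos kap_pos by (intro frac_le) (auto simp: n_def field_simps)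
  finally show "\<bar>1 / t\<bar> \<le> C0 / 4" using C0_parts(2) by simp
qed

text \<open>For k >= 2 one has (k + 1)^2 <= 9/4 k^2; with the factor 2 from \<open>symdet_ge\<close>
  this gives 9/2, which \<open>C0\<close> rounds up to 5.\<close>

lemma high_bounds:
  assumes "k \<ge> 2" and "\<bar>y\<bar> \<le> (1 + m) * (real k)\<^sup>2"
  shows "\<bar>y / symdet k\<bar> \<le> C0 / (real k + 1)\<^sup>2"
proof -
  have k: "real k \<ge> 2" using assms by simp
  have "\<bar>y / symdet k\<bar> \<le> (1 + m) * (real k)\<^sup>2 / (m * (real k)^4 / 2)"
    unfolding abs_divide using symdet_ge[OF assms(1)] symdet_pos[OF assms(1)] assms m_pos k
    by (intro frac_le) auto
  also have "\<dots> = 2 * (1 + m) / m / (real k)\<^sup>2"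
    using m_pos k by (simp add: field_simps eval_nat_numeral)
  also have "\<dots> \<le> 2 * (1 + m) / m * (9 / 4 / (real k + 1)\<^sup>2)"
  proof -
    have "(real k + 1)\<^sup>2 \<le> (3 / 2 * real k)\<^sup>2"
      using k by (intro power_mono) auto
    then have "1 / (real k)\<^sup>2 \<le> 9 / 4 / (real k + 1)\<^sup>2"
      using k by (simp add: field_simps)
    from mult_left_mono[OF this, of "2 * (1 + m) / m"] show ?thesis using m_pos by simp
  qed
  also have "\<dots> = (9 / 10) * (5 * (1 + m) / m) / (real k + 1)\<^sup>2"
    using m_pos by (simp add: divide_simps)
  also have "\<dots> \<le> C0 / (real k + 1)\<^sup>2"
  proof (intro divide_right_mono)
    have "5 * (1 + m) / m > 0" using m_pos by simp
    then show "(9 / 10) * (5 * (1 + m) / m) \<le> C0" using C0_parts(3) by linarith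
  qed simp
  finally show ?thesis .
qed

lemma decay1: "decay C0 \<sigma>1" and decay2: "decay C0 \<sigma>2" and decay0: "decay C0 \<sigma>0"
proof -
  have k2: "k \<noteq> 0 \<Longrightarrow> k \<noteq> Suc 0 \<Longrightarrow> 2 \<le> k" for k :: nat by simp
  have low: "\<bar>1 / (2 * a)\<bar> \<le> C0 / (real 0 + 1)\<^sup>2" "\<bar>1 / t\<bar> \<le> C0 / (real 1 + 1)\<^sup>2"
    using low_bounds a_pos by auto
  have ks: "(real k)\<^sup>2 \<ge> 1" if "k \<ge> 2" for k using that power_mono[of 1 "real k" 2] by simp
  have "\<bar>a - m * (real k)\<^sup>2\<bar> \<le> (1 + m) * (real k)\<^sup>2" "\<bar>a - (real k)\<^sup>2\<bar> \<le> (1 + m) * (real k)\<^sup>2"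
    "\<bar>1\<bar> \<le> (1 + m) * (real k)\<^sup>2" if "k \<ge> 2" for k
  proof -
    define X where "X = (real k)\<^sup>2"
    have X: "m * X \<ge> 0" "X \<ge> 1" using m_pos ks[OF that] by (simp_all add: X_def)
    show "\<bar>a - m * (real k)\<^sup>2\<bar> \<le> (1 + m) * (real k)\<^sup>2" "\<bar>a - (real k)\<^sup>2\<bar> \<le> (1 + m) * (real k)\<^sup>2"
      "\<bar>1\<bar> \<le> (1 + m) * (real k)\<^sup>2"
      unfolding X_def[symmetric] distrib_right using X a_pos a_less by linarith+
  qed
  note high = this[THEN high_bounds[rotated]]
  show "decay C0 \<sigma>1" unfolding decay_def \<sigma>1_def using low high k2 by auto
  show "decay C0 \<sigma>2" unfolding decay_def \<sigma>2_def using low high k2 by auto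
  show "decay C0 \<sigma>0" unfolding decay_def \<sigma>0_def using high C0_parts(4) by (auto simp: not_less)
qed

section \<open>Bounds for the inverse and for the projection onto the kernel\<close>

lemmas decays = decay0 decay1 decay2

lemma cper_Z [intro]: "cper f \<Longrightarrow> cper (Z f)" and cper_Zad [intro]: "cper f \<Longrightarrow> cper (Zad f)"
  unfolding Z_def[abs_def] Zad_def[abs_def] by (intro cper_add cper_mult cper_const cper_shift cper_shift'; assumption)+

lemma cper_K [intro]: "cper f1 \<Longrightarrow> cper f2 \<Longrightarrow> cper (K1 f1 f2)" "cper f1 \<Longrightarrow> cper f2 \<Longrightarrow> cper (K2 f1 f2)"
  unfolding K1_def[abs_def] K2_def[abs_def]
  by (auto intro!: cper_add cper_divide cper_Z cper_Zad intro: multiplier_cper[OF decay0]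
      multiplier_cper[OF decay1] multiplier_cper[OF decay2])

lemma K_add:
  assumes "cper f1" "cper f2" "cper h1" "cper h2"
  shows "K1 (\<lambda>x. f1 x + h1 x) (\<lambda>x. f2 x + h2 x) x = K1 f1 f2 x + K1 h1 h2 x"
    "K2 (\<lambda>x. f1 x + h1 x) (\<lambda>x. f2 x + h2 x) x = K2 f1 f2 x + K2 h1 h2 x"
  unfolding K1_def K2_def Z_def Zad_def using assms
  by (auto simp: multiplier_add[OF decay0] multiplier_add[OF decay1] multiplier_add[OF decay2]
      distrib_left add_divide_distrib)

lemma K_cmult:
  assumes "cper f1" "cper f2"
  shows "K1 (\<lambda>x. c * f1 x) (\<lambda>x. c * f2 x) x = c * K1 f1 f2 x"
    "K2 (\<lambda>x. c * f1 x) (\<lambda>x. c * f2 x) x = c * K2 f1 f2 x"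
  unfolding K1_def K2_def Z_def Zad_def using assms
  by (auto simp: multiplier_cmult[OF decay0] multiplier_cmult[OF decay1] multiplier_cmult[OF decay2] field_simps)

text \<open>Translation invariance is what later lets a frequency dependent shift be moved outside
  the inverse.\<close>

lemma K_shift:
  assumes "cper f1" "cper f2"
  shows "K1 (\<lambda>x. f1 (x + h)) (\<lambda>x. f2 (x + h)) x = K1 f1 f2 (x + h)"
    "K2 (\<lambda>x. f1 (x + h)) (\<lambda>x. f2 (x + h)) x = K2 f1 f2 (x + h)"
  unfolding K1_def K2_def Z_def Zad_def using assms
  by (auto simp: multiplier_shift algebra_simps)

lemma bdd_Z: "bdd d f \<Longrightarrow> bdd ((1 + \<kappa>) * d) (Z f)" and bdd_Zad: "bdd d f \<Longrightarrow> bdd ((1 + \<kappa>) * d) (Zad f)"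
  using bdd_add[OF bdd_shift[of d f "\<lambda>x. x + \<xi>"] bdd_cmult[OF bdd_shift[of d f "\<lambda>x. x - \<xi>"], of \<kappa>]]
    bdd_add[OF bdd_cmult[OF bdd_shift[of d f "\<lambda>x. x + \<xi>"], of \<kappa>] bdd_shift[of d f "\<lambda>x. x - \<xi>"]] kap_pos
  by (auto simp: Z_def[abs_def] Zad_def[abs_def] algebra_simps)

text \<open>Each component of the inverse adds two multipliers of norm 2 \<open>zeta2\<close>
  \<open>C0\<close>, and \<open>Z / \<Lambda>\<close> does not increase the supremum norm.\<close>

definition "KC = 4 * zeta2 * C0"

lemma bdd_Z_div:
  assumes "bdd d f" shows "bdd d (\<lambda>x. Z f x / \<Lambda>)" "bdd d (\<lambda>x. Zad f x / \<Lambda>)"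
proof -
  have "a * d \<le> d" using a_pos a_less bdd_nonneg[OF assms] by (simp add: mult_left_le_one_le)
  then show "bdd d (\<lambda>x. Z f x / \<Lambda>)" "bdd d (\<lambda>x. Zad f x / \<Lambda>)"
    using bdd_cmult[OF bdd_Z[OF assms], of "1 / \<Lambda>"] bdd_cmult[OF bdd_Zad[OF assms], of "1 / \<Lambda>"] lam_pos
    by (auto simp: a_def intro: bdd_mono)
qed

lemma K_bdd:
  assumes "cper f1" "cper f2" "bdd d f1" "bdd d f2"
  shows "bdd (KC * d) (K1 f1 f2)" "bdd (KC * d) (K2 f1 f2)"
proof -
  let ?e = "2 * zeta2 * C0 * d"
  have "bdd (?e + ?e) (K1 f1 f2)" "bdd (?e + ?e) (K2 f1 f2)"
    unfolding K1_def[abs_def] K2_def[abs_def]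
    by (intro bdd_add bdd_Z_div multiplier_bdd decays assms)+
  then show "bdd (KC * d) (K1 f1 f2)" "bdd (KC * d) (K2 f1 f2)"
    by (simp_all add: KC_def mult_ac)
qed

lemma cper_nu [intro, simp]: "cper \<nu>1" "cper \<nu>2"
proof -
  have c: "cper (\<lambda>x. cos (x + h))" for h using cper_cos[of 1 h] by simp
  show "cper \<nu>1" "cper \<nu>2"
    unfolding \<nu>1_def[abs_def] \<nu>2_def[abs_def] using c[of \<xi>] c[of "- \<xi>"] c[of 0]
    by (auto intro!: cper_mult cper_add)
qed

lemma Zcos_squares: "(cos (x + \<xi>) + \<kappa> * cos (x - \<xi>))\<^sup>2 + (sin (x + \<xi>) + \<kappa> * sin (x - \<xi>))\<^sup>2 = zz"
proof -
  have "(cos (x + \<xi>) + \<kappa> * cos (x - \<xi>))\<^sup>2 + (sin (x + \<xi>) + \<kappa> * sin (x - \<xi>))\<^sup>2 =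
    ((sin (x + \<xi>))\<^sup>2 + (cos (x + \<xi>))\<^sup>2) + \<kappa>\<^sup>2 * ((sin (x - \<xi>))\<^sup>2 + (cos (x - \<xi>))\<^sup>2)
    + 2 * \<kappa> * (cos (x + \<xi>) * cos (x - \<xi>) + sin (x + \<xi>) * sin (x - \<xi>))"
    by algebra
  also have "cos (x + \<xi>) * cos (x - \<xi>) + sin (x + \<xi>) * sin (x - \<xi>) = cos (2 * \<xi>)"
    by (simp flip: cos_diff)
  finally show ?thesis by (simp only: sin_cos_squared_add) (simp add: zz_def)
qed

text \<open>The normalisation gives sqrt 2; the bound 2 keeps the later constants integral.\<close>

lemma bdd_nu: "bdd 2 \<nu>1" "bdd 2 \<nu>2"
proof -
  have "(\<nu>1 x)\<^sup>2 \<le> 2\<^sup>2" for x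
  proof -
    have "(\<nu>1 x)\<^sup>2 \<le> g\<^sup>2 * zz"
      unfolding \<nu>1_def power_mult_distrib
      by (intro mult_left_mono) (simp_all add: Zcos_squares[of x, symmetric])
    also have "\<dots> \<le> 2" using zzn_pos zz_nonneg by (simp add: g2 pos_divide_le_eq)
    finally show ?thesis by simp
  qed
  then show "bdd 2 \<nu>1" unfolding bdd_def using abs_le_square_iff[of _ "2::real"] by force
  have "(\<nu>2 x)\<^sup>2 \<le> 2\<^sup>2" for x
  proof -
    have "(cos x)\<^sup>2 \<le> 1" by (simp add: abs_square_le_1)
    then have "(\<nu>2 x)\<^sup>2 \<le> g\<^sup>2 * n\<^sup>2 * 1"
      unfolding \<nu>2_def power_mult_distrib by (intro mult_mono) auto
    also have "\<dots> \<le> 2" using zzn_pos zz_nonneg by (simp add: g2 pos_divide_le_eq)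
    finally show ?thesis by simp
  qed
  then show "bdd 2 \<nu>2" unfolding bdd_def using abs_le_square_iff[of _ "2::real"] by force
qed

lemma Pi_add:
  assumes "cper f1" "cper f2" "cper h1" "cper h2"
  shows "Pi1 (\<lambda>x. f1 x + h1 x) (\<lambda>x. f2 x + h2 x) x = Pi1 f1 f2 x + Pi1 h1 h2 x"
    "Pi2 (\<lambda>x. f1 x + h1 x) (\<lambda>x. f2 x + h2 x) x = Pi2 f1 f2 x + Pi2 h1 h2 x"
  unfolding Pi1_def Pi2_def using assms
  by (auto simp: ip_add mean_add cper_shift distrib_right add_divide_distrib)

text \<open>17 = 8 + 8 + 1: two coefficients of size 4 d against functions bounded by 2, and the
  mean.\<close>

lemma Pi_bdd:
  assumes "cper f1" "cper f2" "bdd d f1" "bdd d f2"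
  shows "bdd (17 * d) (Pi1 f1 f2)" "bdd (17 * d) (Pi2 f1 f2)"
proof -
  have i: "\<bar>ip f1 f2 \<nu>1 \<nu>2\<bar> \<le> 4 * d" 
    "\<bar>ip f1 f2 (\<lambda>x. \<nu>1 (x + pi / 2)) (\<lambda>x. \<nu>2 (x + pi / 2))\<bar> \<le> 4 * d"
    using ip_bdd[of f1 f2 \<nu>1 \<nu>2 d 2] ip_bdd[of f1 f2 "\<lambda>x. \<nu>1 (x + pi / 2)" "\<lambda>x. \<nu>2 (x + pi / 2)" d 2] assms bdd_nu
    by (auto simp: bdd_shift[where h="\<lambda>x. x + pi / 2"] cper_shift)
  have e: "\<bar>(mean f1 + mean f2) / 2\<bar> \<le> d"
    proof -
    have "\<bar>mean f1 + mean f2\<bar> \<le> 2 * d"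
      using mean_bdd[OF assms(1,3)] mean_bdd[OF assms(2,4)] by linarith
    then show ?thesis by simp
  qed
  have p: "\<bar>x * y\<bar> \<le> 8 * d" if "\<bar>x\<bar> \<le> 4 * d" "\<bar>y\<bar> \<le> 2" for x y
    using mult_mono[OF that] bdd_nonneg[OF assms(3)] by (simp add: abs_mult)
  show "bdd (17 * d) (Pi1 f1 f2)" "bdd (17 * d) (Pi2 f1 f2)"
    unfolding bdd_def
  proof safe
    fix x
    have "\<bar>\<nu>1 x\<bar> \<le> 2" "\<bar>\<nu>1 (x + pi / 2)\<bar> \<le> 2" "\<bar>\<nu>2 x\<bar> \<le> 2" "\<bar>\<nu>2 (x + pi / 2)\<bar> \<le> 2"
      using bdd_nu by (auto simp: bdd_def)
    note q = p[OF i(1) this(1)] p[OF i(2) this(2)] p[OF i(1) this(3)] p[OF i(2) this(4)]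
    show "\<bar>Pi1 f1 f2 x\<bar> \<le> 17 * d" unfolding Pi1_def using q(1,2) e by linarith
    show "\<bar>Pi2 f1 f2 x\<bar> \<le> 17 * d" unfolding Pi2_def using q(3,4) e by linarith
  qed
qed

lemma rhs_add:
  assumes "cper f1" "cper f2" "cper h1" "cper h2"
  shows "rhs1 (\<lambda>x. f1 x + h1 x) (\<lambda>x. f2 x + h2 x) x = rhs1 f1 f2 x + rhs1 h1 h2 x"
    "rhs2 (\<lambda>x. f1 x + h1 x) (\<lambda>x. f2 x + h2 x) x = rhs2 f1 f2 x + rhs2 h1 h2 x"
  unfolding rhs1_def rhs2_def Z_def Zad_def
  by (simp_all add: Pi_add K_add assms distrib_left add_divide_distrib diff_divide_distrib)

definition "RC = 2 * KC + 18"

lemma rhs_bdd: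
  assumes "cper f1" "cper f2" "bdd d f1" "bdd d f2"
  shows "bdd (RC * d) (rhs1 f1 f2)" "bdd (RC * d) (rhs2 f1 f2)"
proof -
  note K = K_bdd[OF assms] and P = Pi_bdd[OF assms]
  have aK: "bdd (KC * d) (\<lambda>x. a * K1 f1 f2 x)" "bdd (KC * d) (\<lambda>x. a * K2 f1 f2 x)"
  proof -
    have "a * (KC * d) \<le> KC * d" 
      using a_pos a_less bdd_nonneg[OF K(1)] by (simp add: mult_left_le_one_le)
    then show "bdd (KC * d) (\<lambda>x. a * K1 f1 f2 x)" "bdd (KC * d) (\<lambda>x. a * K2 f1 f2 x)"
      using bdd_cmult[OF K(1), of a] bdd_cmult[OF K(2), of a] a_pos by (auto intro: bdd_mono)
  qed
  have "bdd (KC * d + KC * d + d + 17 * d) (\<lambda>x. Z (K2 f1 f2) x / \<Lambda> - a * K1 f1 f2 x + f1 x - Pi1 f1 f2 x)"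
       "bdd (KC * d + KC * d + d + 17 * d) (\<lambda>x. Zad (K1 f1 f2) x / \<Lambda> - a * K2 f1 f2 x + f2 x - Pi2 f1 f2 x)"
    by (intro bdd_add bdd_diff bdd_Z_div aK K P assms)+
  then show "bdd (RC * d) (rhs1 f1 f2)" "bdd (RC * d) (rhs2 f1 f2)"
    by (simp_all add: rhs1_def[abs_def] rhs2_def[abs_def] RC_def algebra_simps diff_divide_distrib a_def)
qed

text \<open>The inversion property for given data, in a form that can be proved by density: on
  cosines from the symbol, then for sums and uniform limits.\<close>

definition "sol f1 f2 \<longleftrightarrow> (\<exists>d. deriv2 (K1 f1 f2) d (rhs1 f1 f2)) \<and> (\<exists>d. deriv2 (K2 f1 f2) d (\<lambda>x. rhs2 f1 f2 x / m))"

lemma sol_add: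
  assumes "cper f1" "cper f2" "cper h1" "cper h2" "sol f1 f2" "sol h1 h2"
  shows "sol (\<lambda>x. f1 x + h1 x) (\<lambda>x. f2 x + h2 x)"
  unfolding sol_def
proof
  show "\<exists>d. deriv2 (K1 (\<lambda>x. f1 x + h1 x) (\<lambda>x. f2 x + h2 x)) d (rhs1 (\<lambda>x. f1 x + h1 x) (\<lambda>x. f2 x + h2 x))"
    using assms(5,6) deriv2_add[of "K1 f1 f2" _ "rhs1 f1 f2" "K1 h1 h2" _ "rhs1 h1 h2"] 
    unfolding sol_def K_add[OF assms(1-4), abs_def] rhs_add[OF assms(1-4), abs_def] by blast
  show "\<exists>d. deriv2 (K2 (\<lambda>x. f1 x + h1 x) (\<lambda>x. f2 x + h2 x)) d (\<lambda>x. rhs2 (\<lambda>x. f1 x + h1 x) (\<lambda>x. f2 x + h2 x) x / m)"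
    using assms(5,6) deriv2_add[of "K2 f1 f2" _ "\<lambda>x. rhs2 f1 f2 x / m" "K2 h1 h2" _ "\<lambda>x. rhs2 h1 h2 x / m"] 
    unfolding sol_def K_add[OF assms(1-4), abs_def] rhs_add[OF assms(1-4), abs_def] add_divide_distrib by blast
qed

text \<open>Both the inverse and \<open>rhs1\<close>, \<open>rhs2\<close> are bounded in the
  supremum norm, so uniform convergence of the data passes to the solutions and to their second
  derivatives, and \<open>deriv2_lim\<close> applies.\<close>

lemma sol_lim:
  assumes "cper f1" "cper f2" "\<And>i. cper (F1 i)" "\<And>i. cper (F2 i)"
    and "\<And>i. sol (F1 i) (F2 i)"
    and "\<And>i. bdd (1 / real (Suc i)) (\<lambda>x. F1 i x - f1 x)" "\<And>i. bdd (1 / real (Suc i)) (\<lambda>x. F2 i x - f2 x)"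
  shows "sol f1 f2"
proof -
  let ?D1 = "\<lambda>i x. F1 i x - f1 x" and ?D2 = "\<lambda>i x. F2 i x - f2 x"
  have c: "cper (?D1 i)" "cper (?D2 i)" for i using assms by auto
  have "(\<lambda>x. K1 (F1 i) (F2 i) x - K1 f1 f2 x) = K1 (?D1 i) (?D2 i)"
    "(\<lambda>x. K2 (F1 i) (F2 i) x - K2 f1 f2 x) = K2 (?D1 i) (?D2 i)"
    "(\<lambda>x. rhs1 (F1 i) (F2 i) x - rhs1 f1 f2 x) = rhs1 (?D1 i) (?D2 i)"
    "(\<lambda>x. rhs2 (F1 i) (F2 i) x - rhs2 f1 f2 x) = rhs2 (?D1 i) (?D2 i)" for i
    using K_add[OF c[of i] assms(1,2)] rhs_add[OF c[of i] assms(1,2)] by (auto simp: fun_eq_iff)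
  then have b: "bdd (KC * (1 / real (Suc i))) (\<lambda>x. K1 (F1 i) (F2 i) x - K1 f1 f2 x)"
    "bdd (KC * (1 / real (Suc i))) (\<lambda>x. K2 (F1 i) (F2 i) x - K2 f1 f2 x)"
    "bdd (RC * (1 / real (Suc i))) (\<lambda>x. rhs1 (F1 i) (F2 i) x - rhs1 f1 f2 x)"
    "bdd (RC * (1 / real (Suc i))) (\<lambda>x. rhs2 (F1 i) (F2 i) x - rhs2 f1 f2 x)" for i
    using K_bdd[OF c[of i] assms(6,7)] rhs_bdd[OF c[of i] assms(6,7)] by simp_all
  obtain E1 E2 where E: "\<And>i. deriv2 (K1 (F1 i) (F2 i)) (E1 i) (rhs1 (F1 i) (F2 i))"
    "\<And>i. deriv2 (K2 (F1 i) (F2 i)) (E2 i) (\<lambda>x. rhs2 (F1 i) (F2 i) x / m)"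
    using assms(5) unfolding sol_def by metis
  define A where "A = KC + RC + RC / m"
  have pos: "KC \<ge> 0" "RC \<ge> 0"
    using C0_parts zeta2_nonneg by (auto simp: RC_def KC_def)
  have A: "KC * (1 / real (Suc i)) \<le> A / real (Suc i)" "RC * (1 / real (Suc i)) \<le> A / real (Suc i)" 
    "\<bar>1 / m\<bar> * (RC * (1 / real (Suc i))) \<le> A / real (Suc i)" for i
  proof -
    have "KC \<le> A" "RC \<le> A" "RC / m \<le> A" using pos m_pos by (auto simp: A_def)
    note this[THEN divide_right_mono, where c="real (Suc i)"]
    then show "KC * (1 / real (Suc i)) \<le> A / real (Suc i)" "RC * (1 / real (Suc i)) \<le> A / real (Suc i)" 
      "\<bar>1 / m\<bar> * (RC * (1 / real (Suc i))) \<le> A / real (Suc i)" using m_pos by simp_all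
  qed
  have "\<exists>d. deriv2 (K1 f1 f2) d (rhs1 f1 f2)"
    by (rule deriv2_lim[OF _ E(1), where A=A]) (use bdd_mono[OF b(1) A(1)] bdd_mono[OF b(3) A(2)] assms in auto)
  moreover have "bdd (A / real (Suc i)) (\<lambda>x. rhs2 (F1 i) (F2 i) x / m - rhs2 f1 f2 x / m)" for i
    using bdd_mono[OF bdd_cmult[OF b(4), of "1 / m"] A(3)] by (simp add: diff_divide_distrib)
  then have "\<exists>d. deriv2 (K2 f1 f2) d (\<lambda>x. rhs2 f1 f2 x / m)"
    by (rule deriv2_lim[OF _ E(2), where A=A, rotated 2]) (use bdd_mono[OF b(2) A(1)] assms in auto)
  ultimately show ?thesis by (simp add: sol_def)
qed

lemma ip_monom_left:
  "ip (\<lambda>x. A * cos (real k * x + \<theta>)) (\<lambda>x. 0) (\<lambda>x. \<nu>1 (x + h)) (\<lambda>x. \<nu>2 (x + h)) =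
    (if k = 1 then A * g / 2 * (cos (\<theta> - h - \<xi>) + \<kappa> * cos (\<theta> - h + \<xi>)) else 0)"
proof -
  have c: "cper (\<lambda>x. cos (x + h))" for h using cper_cos[of 1 h] by simp
  have eq: "A * cos (real k * x + \<theta>) * \<nu>1 (x + h) + 0 * \<nu>2 (x + h) =
    A * g * (cos (x + (h + \<xi>)) * cos (real k * x + \<theta>) + \<kappa> * (cos (x + (h - \<xi>)) * cos (real k * x + \<theta>)))" for x
    by (simp add: \<nu>1_def algebra_simps)
  show ?thesis
    unfolding ip_def eq mean_cmult
    by (subst mean_add[OF cper_mult[OF c cper_cos] cper_mult[OF cper_const cper_mult[OF c cper_cos]]])
      (simp only: mean_cmult mean_cos_cos, simp add: algebra_simps)
qed

lemma ip_monom_right: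
  "ip (\<lambda>x. 0) (\<lambda>x. A * cos (real k * x + \<theta>)) (\<lambda>x. \<nu>1 (x + h)) (\<lambda>x. \<nu>2 (x + h)) =
    (if k = 1 then - A * g * n / 2 * cos (\<theta> - h) else 0)"
proof -
  have eq: "0 * \<nu>1 (x + h) + A * cos (real k * x + \<theta>) * \<nu>2 (x + h) =
    - A * g * n * (cos (x + h) * cos (real k * x + \<theta>))" for x
    by (simp add: \<nu>2_def algebra_simps)
  show ?thesis
    unfolding ip_def eq mean_cmult by (simp add: mean_cos_cos)
qed

lemma nu_half_pi:
  "\<nu>1 (x + pi / 2) = - g * (sin (x + \<xi>) + \<kappa> * sin (x - \<xi>))" "\<nu>2 (x + pi / 2) = g * n * sin x"
proof -
  have "x + pi / 2 + \<xi> = (x + \<xi>) + pi / 2" "x + pi / 2 - \<xi> = (x - \<xi>) + pi / 2" by simp_all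
  then show "\<nu>1 (x + pi / 2) = - g * (sin (x + \<xi>) + \<kappa> * sin (x - \<xi>))" 
    unfolding \<nu>1_def by (simp only: cos_add[of _ "pi / 2"]) (simp add: algebra_simps)
  show "\<nu>2 (x + pi / 2) = g * n * sin x"
    unfolding \<nu>2_def by (simp add: cos_add)
qed

lemma g2_half: "g\<^sup>2 / 2 = 1 / (zz + n\<^sup>2)"
proof -
  have "2 / s / 2 = 1 / s" for s :: real by simp
  then show ?thesis unfolding g2 .
qed

lemma mean_monom: "mean (\<lambda>x. A * cos (real k * x + \<theta>)) = (if k = 0 then A * cos \<theta> else 0)"
  by (auto simp: mean_cos_nat)

lemmas ip_monom_left_0 = ip_monom_left[where h=0, simplified]
lemmas ip_monom_right_0 = ip_monom_right[where h=0, simplified]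

lemma cos_sub_half_pi: "cos (y - pi / 2 - z) = sin (y - z)" "cos (y - pi / 2 + z) = sin (y + z)" "cos (y - pi / 2) = sin y"
proof -
  have "y - pi / 2 - z = (y - z) - pi / 2" "y - pi / 2 + z = (y + z) - pi / 2" by simp_all
  then show "cos (y - pi / 2 - z) = sin (y - z)" "cos (y - pi / 2 + z) = sin (y + z)" "cos (y - pi / 2) = sin y"
    by (simp_all only: cos_diff[of _ "pi / 2"]) simp_all
qed

text \<open>The kernel \<nu>(x) \<nu>(y)^T + \<nu>'(x) \<nu>'(y)^T depends on x - y only, so on the
  first harmonic the projection acts as the matrix \<mu> \<mu>^* / |\<mu>|^2.\<close>

lemma Pi_monom_left:
  defines "f \<equiv> \<lambda>A \<theta> (k::nat) x. A * cos (real k * x + \<theta>)"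
  shows "Pi1 (f A \<theta> k) (\<lambda>x. 0) x = (if k = 0 then A * cos \<theta> / 2 else if k = 1 then
      zz / (zz + n\<^sup>2) * f A \<theta> k x else 0)" (is ?th1)
    and "Pi2 (f A \<theta> k) (\<lambda>x. 0) x = (if k = 0 then A * cos \<theta> / 2 else if k = 1 then
      - n / (zz + n\<^sup>2) * Zad (f A \<theta> k) x else 0)" (is ?th2)
proof -
  have 1: "(cos (\<theta> - \<xi>) + \<kappa> * cos (\<theta> + \<xi>)) * (cos (x + \<xi>) + \<kappa> * cos (x - \<xi>))
    - (sin (\<theta> - \<xi>) + \<kappa> * sin (\<theta> + \<xi>)) * (sin (x + \<xi>) + \<kappa> * sin (x - \<xi>)) = zz * cos (x + \<theta>)"
  proof -
    have "(cos (\<theta> - \<xi>) + \<kappa> * cos (\<theta> + \<xi>)) * (cos (x + \<xi>) + \<kappa> * cos (x - \<xi>))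
      - (sin (\<theta> - \<xi>) + \<kappa> * sin (\<theta> + \<xi>)) * (sin (x + \<xi>) + \<kappa> * sin (x - \<xi>)) =
      cos ((\<theta> - \<xi>) + (x + \<xi>)) + \<kappa> * cos ((\<theta> - \<xi>) + (x - \<xi>)) +
      \<kappa> * cos ((\<theta> + \<xi>) + (x + \<xi>)) + \<kappa>\<^sup>2 * cos ((\<theta> + \<xi>) + (x - \<xi>))"
      by (simp only: cos_add[of "\<theta> - \<xi>"] cos_add[of "\<theta> + \<xi>"]) (simp add: algebra_simps power2_eq_square)
    also have "\<dots> = cos (x + \<theta>) + \<kappa> * cos ((x + \<theta>) - 2 * \<xi>) + \<kappa> * cos ((x + \<theta>) + 2 * \<xi>) + \<kappa>\<^sup>2 * cos (x + \<theta>)"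
      by (simp add: algebra_simps)
    also have "\<dots> = zz * cos (x + \<theta>)"
      by (simp only: cos_add[of "x + \<theta>"] cos_diff[of "x + \<theta>"] zz_def) (simp add: algebra_simps)
    finally show ?thesis .
  qed
  have 2: "(cos (\<theta> - \<xi>) + \<kappa> * cos (\<theta> + \<xi>)) * cos x
    - (sin (\<theta> - \<xi>) + \<kappa> * sin (\<theta> + \<xi>)) * sin x = cos (x - \<xi> + \<theta>) + \<kappa> * cos (x + \<xi> + \<theta>)"
  proof -
    have "x - \<xi> + \<theta> = (\<theta> - \<xi>) + x" "x + \<xi> + \<theta> = (\<theta> + \<xi>) + x" by simp_all
    then show ?thesis
      by (simp only: cos_add[of "\<theta> - \<xi>"] cos_add[of "\<theta> + \<xi>"]) (simp add: algebra_simps)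
  qed
  have "Pi1 (f A \<theta> 1) (\<lambda>x. 0) x = A * (g\<^sup>2 / 2) *
     ((cos (\<theta> - \<xi>) + \<kappa> * cos (\<theta> + \<xi>)) * (cos (x + \<xi>) + \<kappa> * cos (x - \<xi>))
    - (sin (\<theta> - \<xi>) + \<kappa> * sin (\<theta> + \<xi>)) * (sin (x + \<xi>) + \<kappa> * sin (x - \<xi>)))"
    unfolding Pi1_def f_def ip_monom_left ip_monom_left_0 mean_monom unfolding nu_half_pi cos_sub_half_pi unfolding \<nu>1_def
    by (simp add: field_simps power2_eq_square)
  then have a1: "Pi1 (f A \<theta> 1) (\<lambda>x. 0) x = zz / (zz + n\<^sup>2) * f A \<theta> 1 x"
    unfolding 1 g2_half by (simp add: f_def)
  have "Pi2 (f A \<theta> 1) (\<lambda>x. 0) x = - n * A * (g\<^sup>2 / 2) *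
     ((cos (\<theta> - \<xi>) + \<kappa> * cos (\<theta> + \<xi>)) * cos x - (sin (\<theta> - \<xi>) + \<kappa> * sin (\<theta> + \<xi>)) * sin x)"
    unfolding Pi2_def f_def ip_monom_left ip_monom_left_0 mean_monom unfolding nu_half_pi cos_sub_half_pi unfolding \<nu>2_def
    by (simp add: field_simps power2_eq_square)
  then have a2: "Pi2 (f A \<theta> 1) (\<lambda>x. 0) x = - n / (zz + n\<^sup>2) * Zad (f A \<theta> 1) x"
    unfolding 2 g2_half by (simp add: f_def Zad_def algebra_simps add_divide_distrib)
  have b: "k \<noteq> 1 \<Longrightarrow> Pi1 (f A \<theta> k) (\<lambda>x. 0) x = (if k = 0 then A * cos \<theta> / 2 else 0)"
    "k \<noteq> 1 \<Longrightarrow> Pi2 (f A \<theta> k) (\<lambda>x. 0) x = (if k = 0 then A * cos \<theta> / 2 else 0)"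
    unfolding Pi1_def Pi2_def f_def ip_monom_left ip_monom_left_0 mean_monom by auto
  show ?th1 ?th2 using a1 a2 b by (cases "k = 1"; simp)+
qed

lemma Pi_monom_right:
  defines "f \<equiv> \<lambda>A \<theta> (k::nat) x. A * cos (real k * x + \<theta>)"
  shows "Pi1 (\<lambda>x. 0) (f A \<theta> k) x = (if k = 0 then A * cos \<theta> / 2 else if k = 1 then
      - n / (zz + n\<^sup>2) * Z (f A \<theta> k) x else 0)" (is ?th1)
    and "Pi2 (\<lambda>x. 0) (f A \<theta> k) x = (if k = 0 then A * cos \<theta> / 2 else if k = 1 then
      n\<^sup>2 / (zz + n\<^sup>2) * f A \<theta> k x else 0)" (is ?th2)
proof -
  have 1: "cos \<theta> * (cos (x + \<xi>) + \<kappa> * cos (x - \<xi>))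
    - sin \<theta> * (sin (x + \<xi>) + \<kappa> * sin (x - \<xi>)) = cos (x + \<xi> + \<theta>) + \<kappa> * cos (x - \<xi> + \<theta>)"
    by (simp only: cos_add[of _ \<theta>]) (simp add: algebra_simps)
  have "Pi1 (\<lambda>x. 0) (f A \<theta> 1) x = - n * A * (g\<^sup>2 / 2) *
     (cos \<theta> * (cos (x + \<xi>) + \<kappa> * cos (x - \<xi>)) - sin \<theta> * (sin (x + \<xi>) + \<kappa> * sin (x - \<xi>)))"
    unfolding Pi1_def f_def ip_monom_right ip_monom_right_0 mean_monom unfolding nu_half_pi cos_sub_half_pi unfolding \<nu>1_def
    by (simp add: field_simps power2_eq_square)
  then have a1: "Pi1 (\<lambda>x. 0) (f A \<theta> 1) x = - n / (zz + n\<^sup>2) * Z (f A \<theta> 1) x"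
    unfolding 1 g2_half by (simp add: f_def Z_def algebra_simps add_divide_distrib)
  have "Pi2 (\<lambda>x. 0) (f A \<theta> 1) x = n\<^sup>2 * A * (g\<^sup>2 / 2) * cos (x + \<theta>)"
    unfolding Pi2_def f_def ip_monom_right ip_monom_right_0 mean_monom unfolding nu_half_pi cos_sub_half_pi unfolding \<nu>2_def
    by (simp add: field_simps power2_eq_square cos_add)
  then have a2: "Pi2 (\<lambda>x. 0) (f A \<theta> 1) x = n\<^sup>2 / (zz + n\<^sup>2) * f A \<theta> 1 x"
    unfolding g2_half by (simp add: f_def)
  have b: "k \<noteq> 1 \<Longrightarrow> Pi1 (\<lambda>x. 0) (f A \<theta> k) x = (if k = 0 then A * cos \<theta> / 2 else 0)"
    "k \<noteq> 1 \<Longrightarrow> Pi2 (\<lambda>x. 0) (f A \<theta> k) x = (if k = 0 then A * cos \<theta> / 2 else 0)"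
    unfolding Pi1_def Pi2_def f_def ip_monom_right ip_monom_right_0 mean_monom by auto
  show ?th1 ?th2 using a1 a2 b by (cases "k = 1"; simp)+
qed

text \<open>The entries of matrix / trace at k = 1, seen as entries of the identity minus the
  projection onto \<mu>.\<close>

lemma a_t:
  "(a - 1) / t = n\<^sup>2 / (zz + n\<^sup>2)" "(a - m) / t = zz / (zz + n\<^sup>2)" "1 / (\<Lambda> * t) = - n / (zz + n\<^sup>2)"
proof -
  have a: "a - 1 = - n / \<Lambda>" "a - m = - zz / (n * \<Lambda>)"
    using n_pos lam_pos unfolding a_def zz_n by (simp_all add: divide_simps) (simp_all add: n_def)
  define s where "s = zz + n\<^sup>2"
  have nz: "s \<noteq> 0" "n \<noteq> 0" "\<Lambda> \<noteq> 0" using zzn_pos n_pos lam_pos by (auto simp: s_def)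
  show "(a - 1) / t = n\<^sup>2 / (zz + n\<^sup>2)" "(a - m) / t = zz / (zz + n\<^sup>2)" "1 / (\<Lambda> * t) = - n / (zz + n\<^sup>2)"
    unfolding a t_eq s_def[symmetric] using nz by (simp_all add: power2_eq_square)
qed

lemma zzn_frac: "n\<^sup>2 / (zz + n\<^sup>2) = 1 - zz / (zz + n\<^sup>2)"
  using zzn_pos by (simp add: diff_divide_eq_iff)

text \<open>The multiplier is |e^{i k \<xi>} + \<kappa> e^{-i k \<xi>}|^2, the product of the
  off-diagonal entries up to the factor \<Lambda>^2.\<close>

lemma Z_Zad_cos:
  fixes k :: nat and \<theta> :: real
  defines "f \<equiv> \<lambda>x. cos (real k * x + \<theta>)"
  shows "Z (Zad f) x = (1 + \<kappa>\<^sup>2 + 2 * \<kappa> * cos (2 * (real k * \<xi>))) * f x"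
    "Zad (Z f) x = (1 + \<kappa>\<^sup>2 + 2 * \<kappa> * cos (2 * (real k * \<xi>))) * f x"
proof -
  have "f (x + \<xi> + \<xi>) + f (x - \<xi> - \<xi>) = 2 * cos (2 * (real k * \<xi>)) * f x"
  proof -
    have "f (x + \<xi> + \<xi>) = cos ((real k * x + \<theta>) + 2 * (real k * \<xi>))"
      "f (x - \<xi> - \<xi>) = cos ((real k * x + \<theta>) - 2 * (real k * \<xi>))"
      by (simp_all add: f_def algebra_simps)
    then show ?thesis
      by (simp only: cos_add[of "real k * x + \<theta>"] cos_diff[of "real k * x + \<theta>"]) (simp add: f_def)
  qed
  then have s: "f (x + \<xi> + \<xi>) = 2 * cos (2 * (real k * \<xi>)) * f x - f (x - \<xi> - \<xi>)" by simp
  show "Z (Zad f) x = (1 + \<kappa>\<^sup>2 + 2 * \<kappa> * cos (2 * (real k * \<xi>))) * f x"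
    "Zad (Z f) x = (1 + \<kappa>\<^sup>2 + 2 * \<kappa> * cos (2 * (real k * \<xi>))) * f x"
    unfolding Z_def Zad_def s by (simp_all add: algebra_simps power2_eq_square)
qed

text \<open>Entry by entry, these say that matrix times approximate inverse is the identity minus
  the projection, separately for k = 0, k = 1 and k >= 2.\<close>

lemma symbol_identities:
  defines "z \<equiv> \<lambda>k. 1 + \<kappa>\<^sup>2 + 2 * \<kappa> * cos (2 * (real k * \<xi>))"
  shows "(a - (real k)\<^sup>2) * \<sigma>1 k - \<sigma>0 k * z k / \<Lambda>\<^sup>2 = (if k = 0 then 1 / 2 else if k = 1 then n\<^sup>2 / (zz + n\<^sup>2) else 1)"
    and "(a - m * (real k)\<^sup>2) * \<sigma>2 k - \<sigma>0 k * z k / \<Lambda>\<^sup>2 = (if k = 0 then 1 / 2 else if k = 1 then zz / (zz + n\<^sup>2) else 1)"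
    and "(\<sigma>1 k - (a - m * (real k)\<^sup>2) * \<sigma>0 k) / \<Lambda> = (if k = 0 then 1 / (2 * (1 + \<kappa>)) else if k = 1 then - n / (zz + n\<^sup>2) else 0)"
    and "(\<sigma>2 k - (a - (real k)\<^sup>2) * \<sigma>0 k) / \<Lambda> = (if k = 0 then 1 / (2 * (1 + \<kappa>)) else if k = 1 then - n / (zz + n\<^sup>2) else 0)"
proof -
  have d: "k \<ge> 2 \<Longrightarrow> symdet k \<noteq> 0" using symdet_pos[of k] by simp
  have d': "symdet k = (a - (real k)\<^sup>2) * (a - m * (real k)\<^sup>2) - z k / \<Lambda>\<^sup>2"
    by (simp add: symdet_def z_def)
  have k: "k = 0 \<or> k = 1 \<or> k \<ge> 2" by linarith
  have 0: "1 / (2 * a * \<Lambda>) = 1 / (2 * (1 + \<kappa>))" using lam_pos by (simp add: a_def)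
  have q: "x / symdet k - y / symdet k / \<Lambda>\<^sup>2 = 1" if "k \<ge> 2" "x - y / \<Lambda>\<^sup>2 = symdet k" for x y
  proof -
    have "x / symdet k - y / symdet k / \<Lambda>\<^sup>2 = (x - y / \<Lambda>\<^sup>2) / symdet k" by (simp add: diff_divide_distrib)
    then show ?thesis using that d by simp
  qed
  show "(a - (real k)\<^sup>2) * \<sigma>1 k - \<sigma>0 k * z k / \<Lambda>\<^sup>2 = (if k = 0 then 1 / 2 else if k = 1 then n\<^sup>2 / (zz + n\<^sup>2) else 1)"
    using k q[OF _ d'[symmetric]] a_pos a_t by (auto simp: \<sigma>1_def \<sigma>0_def)
  show "(a - m * (real k)\<^sup>2) * \<sigma>2 k - \<sigma>0 k * z k / \<Lambda>\<^sup>2 = (if k = 0 then 1 / 2 else if k = 1 then zz / (zz + n\<^sup>2) else 1)"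
    using k q[OF _ d'[symmetric]] a_pos a_t by (auto simp: \<sigma>2_def \<sigma>0_def mult.commute)
  show "(\<sigma>1 k - (a - m * (real k)\<^sup>2) * \<sigma>0 k) / \<Lambda> = (if k = 0 then 1 / (2 * (1 + \<kappa>)) else if k = 1 then - n / (zz + n\<^sup>2) else 0)"
    "(\<sigma>2 k - (a - (real k)\<^sup>2) * \<sigma>0 k) / \<Lambda> = (if k = 0 then 1 / (2 * (1 + \<kappa>)) else if k = 1 then - n / (zz + n\<^sup>2) else 0)"
    using k d 0 a_t(3) by (auto simp: \<sigma>1_def \<sigma>2_def \<sigma>0_def mult.commute)
qed

lemma deriv2_Z_cos: 
  "\<exists>d. deriv2 (\<lambda>x. c * Z (\<lambda>x. cos (real k * x + \<theta>)) x) d (\<lambda>x. - (real k)\<^sup>2 * (c * Z (\<lambda>x. cos (real k * x + \<theta>)) x))"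
  "\<exists>d. deriv2 (\<lambda>x. c * Zad (\<lambda>x. cos (real k * x + \<theta>)) x) d (\<lambda>x. - (real k)\<^sup>2 * (c * Zad (\<lambda>x. cos (real k * x + \<theta>)) x))"
  unfolding Z_def Zad_def
  by (rule exI, rule deriv2_cong[OF deriv2_cmult[OF deriv2_add[OF deriv2_cos[of "real k" "real k * \<xi> + \<theta>"]
        deriv2_cmult[OF deriv2_cos[of "real k" "- real k * \<xi> + \<theta>"], of \<kappa>]], of c]];
      simp add: algebra_simps)
    (rule exI, rule deriv2_cong[OF deriv2_cmult[OF deriv2_add[OF deriv2_cmult[OF deriv2_cos[of "real k" "real k * \<xi> + \<theta>"], of \<kappa>]
        deriv2_cos[of "real k" "- real k * \<xi> + \<theta>"]], of c]];
      simp add: algebra_simps)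

lemma Z_cmult: "Z (\<lambda>x. c * f x) x = c * Z f x" and Zad_cmult: "Zad (\<lambda>x. c * f x) x = c * Zad f x"
  by (simp_all add: Z_def Zad_def algebra_simps)

text \<open>On a cosine the difference between \<open>rhs1\<close>, \<open>rhs2\<close> and the
  second derivatives is a combination from \<open>symbol_identities\<close> minus the projection,
  and these cancel.\<close>

lemma sol_monom_left: "sol (\<lambda>x. A * cos (real k * x + \<theta>)) (\<lambda>x. 0)"
proof -
  define C where "C = (\<lambda>x. cos (real k * x + \<theta>))"
  define zk where "zk = 1 + \<kappa>\<^sup>2 + 2 * \<kappa> * cos (2 * (real k * \<xi>))"
  have K1: "K1 (\<lambda>x. A * C x) (\<lambda>x. 0) = (\<lambda>x. (A * \<sigma>1 k) * C x)"
    by (simp add: K1_def[abs_def] C_def multiplier_monom[OF decay1] Z_def mult.assoc fun_eq_iff)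
  have K2: "K2 (\<lambda>x. A * C x) (\<lambda>x. 0) = (\<lambda>x. (A * \<sigma>0 k / \<Lambda>) * Zad C x)"
    by (simp add: K2_def[abs_def] C_def multiplier_monom[OF decay0] Zad_def add_divide_distrib fun_eq_iff)
      (simp add: algebra_simps add_divide_distrib)
  have Cx: "cos (real k * x + \<theta>) = C x" for x by (simp add: C_def)
  note ZZ = Z_Zad_cos[where k=k and \<theta>=\<theta>, folded C_def zk_def, unfolded Cx]
  note symb = symbol_identities[of k, folded zk_def]
  note P = Pi_monom_left[where A=A and \<theta>=\<theta> and k=k, unfolded Cx]
  have C0: "k = 0 \<Longrightarrow> C x = cos \<theta>" for x by (simp add: C_def)
  have Zad0: "k = 0 \<Longrightarrow> Zad C x = (1 + \<kappa>) * cos \<theta>" for x by (simp add: Zad_def C0 algebra_simps)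
  have r1: "rhs1 (\<lambda>x. A * C x) (\<lambda>x. 0) x = (A * \<sigma>1 k) * (- (real k)\<^sup>2 * C x)" for x
  proof -
    have "rhs1 (\<lambda>x. A * C x) (\<lambda>x. 0) x = (A * \<sigma>1 k) * (- (real k)\<^sup>2 * C x) +
       (A * C x * (1 - ((a - (real k)\<^sup>2) * \<sigma>1 k - \<sigma>0 k * zk / \<Lambda>\<^sup>2)) - Pi1 (\<lambda>x. A * C x) (\<lambda>x. 0) x)"
      unfolding rhs1_def K1 K2 Z_cmult ZZ
      using lam_pos by (simp add: a_def field_simps power2_eq_square)
    also have "A * C x * (1 - ((a - (real k)\<^sup>2) * \<sigma>1 k - \<sigma>0 k * zk / \<Lambda>\<^sup>2)) - Pi1 (\<lambda>x. A * C x) (\<lambda>x. 0) x = 0"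
      unfolding symb(1) P(1) zzn_frac using C0[of x] by (auto simp: algebra_simps)
    finally show ?thesis by simp
  qed
  have r2: "rhs2 (\<lambda>x. A * C x) (\<lambda>x. 0) x = - m * (real k)\<^sup>2 * ((A * \<sigma>0 k / \<Lambda>) * Zad C x)" for x
  proof -
    have "rhs2 (\<lambda>x. A * C x) (\<lambda>x. 0) x = - m * (real k)\<^sup>2 * ((A * \<sigma>0 k / \<Lambda>) * Zad C x) +
       (A * Zad C x * ((\<sigma>1 k - (a - m * (real k)\<^sup>2) * \<sigma>0 k) / \<Lambda>) - Pi2 (\<lambda>x. A * C x) (\<lambda>x. 0) x)"
      unfolding rhs2_def K1 K2 Zad_cmult
      using lam_pos by (simp add: a_def field_simps power2_eq_square)
    also have "A * Zad C x * ((\<sigma>1 k - (a - m * (real k)\<^sup>2) * \<sigma>0 k) / \<Lambda>) - Pi2 (\<lambda>x. A * C x) (\<lambda>x. 0) x = 0"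
      unfolding symb(3) P(2) using Zad0[of x] kap_pos by (auto simp: Zad_cmult field_simps)
    finally show ?thesis by simp
  qed
  have r2': "(\<lambda>x. rhs2 (\<lambda>x. A * C x) (\<lambda>x. 0) x / m) = (\<lambda>x. - (real k)\<^sup>2 * ((A * \<sigma>0 k / \<Lambda>) * Zad C x))"
    unfolding r2 using m_pos by auto
  have "\<exists>d. deriv2 (K1 (\<lambda>x. A * C x) (\<lambda>x. 0)) d (rhs1 (\<lambda>x. A * C x) (\<lambda>x. 0))"
    unfolding K1 r1[abs_def] unfolding C_def by (rule exI, rule deriv2_cmult, rule deriv2_cos)
  moreover have "\<exists>d. deriv2 (K2 (\<lambda>x. A * C x) (\<lambda>x. 0)) d (\<lambda>x. rhs2 (\<lambda>x. A * C x) (\<lambda>x. 0) x / m)"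
    unfolding K2 r2' unfolding C_def by (rule deriv2_Z_cos(2))
  ultimately show ?thesis by (simp add: sol_def C_def)
qed

lemma sol_monom_right: "sol (\<lambda>x. 0) (\<lambda>x. A * cos (real k * x + \<theta>))"
proof -
  define C where "C = (\<lambda>x. cos (real k * x + \<theta>))"
  define zk where "zk = 1 + \<kappa>\<^sup>2 + 2 * \<kappa> * cos (2 * (real k * \<xi>))"
  have K1: "K1 (\<lambda>x. 0) (\<lambda>x. A * C x) = (\<lambda>x. (A * \<sigma>0 k / \<Lambda>) * Z C x)"
    by (simp add: K1_def[abs_def] C_def multiplier_monom[OF decay0] Z_def add_divide_distrib fun_eq_iff)
      (simp add: algebra_simps add_divide_distrib)
  have K2: "K2 (\<lambda>x. 0) (\<lambda>x. A * C x) = (\<lambda>x. (A * \<sigma>2 k) * C x)"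
    by (simp add: K2_def[abs_def] C_def multiplier_monom[OF decay2] Zad_def mult.assoc fun_eq_iff)
  have Cx: "cos (real k * x + \<theta>) = C x" for x by (simp add: C_def)
  note ZZ = Z_Zad_cos[where k=k and \<theta>=\<theta>, folded C_def zk_def, unfolded Cx]
  note symb = symbol_identities[of k, folded zk_def]
  note P = Pi_monom_right[where A=A and \<theta>=\<theta> and k=k, unfolded Cx]
  have C0: "k = 0 \<Longrightarrow> C x = cos \<theta>" for x by (simp add: C_def)
  have Z0: "k = 0 \<Longrightarrow> Z C x = (1 + \<kappa>) * cos \<theta>" for x by (simp add: Z_def C0 algebra_simps)
  have r2: "rhs2 (\<lambda>x. 0) (\<lambda>x. A * C x) x = - m * (real k)\<^sup>2 * ((A * \<sigma>2 k) * C x)" for x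
  proof -
    have "rhs2 (\<lambda>x. 0) (\<lambda>x. A * C x) x = - m * (real k)\<^sup>2 * ((A * \<sigma>2 k) * C x) +
       (A * C x * (1 - ((a - m * (real k)\<^sup>2) * \<sigma>2 k - \<sigma>0 k * zk / \<Lambda>\<^sup>2)) - Pi2 (\<lambda>x. 0) (\<lambda>x. A * C x) x)"
      unfolding rhs2_def K1 K2 Zad_cmult ZZ
      using lam_pos by (simp add: a_def field_simps power2_eq_square)
    also have "A * C x * (1 - ((a - m * (real k)\<^sup>2) * \<sigma>2 k - \<sigma>0 k * zk / \<Lambda>\<^sup>2)) - Pi2 (\<lambda>x. 0) (\<lambda>x. A * C x) x = 0"
      unfolding symb(2) P(2) zzn_frac using C0[of x] by (auto simp: algebra_simps)
    finally show ?thesis by simp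
  qed
  have r1: "rhs1 (\<lambda>x. 0) (\<lambda>x. A * C x) x = - (real k)\<^sup>2 * ((A * \<sigma>0 k / \<Lambda>) * Z C x)" for x
  proof -
    have "rhs1 (\<lambda>x. 0) (\<lambda>x. A * C x) x = - (real k)\<^sup>2 * ((A * \<sigma>0 k / \<Lambda>) * Z C x) +
       (A * Z C x * ((\<sigma>2 k - (a - (real k)\<^sup>2) * \<sigma>0 k) / \<Lambda>) - Pi1 (\<lambda>x. 0) (\<lambda>x. A * C x) x)"
      unfolding rhs1_def K1 K2 Z_cmult
      using lam_pos by (simp add: a_def field_simps power2_eq_square)
    also have "A * Z C x * ((\<sigma>2 k - (a - (real k)\<^sup>2) * \<sigma>0 k) / \<Lambda>) - Pi1 (\<lambda>x. 0) (\<lambda>x. A * C x) x = 0"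
      unfolding symb(4) P(1) using Z0[of x] kap_pos by (auto simp: Z_cmult field_simps)
    finally show ?thesis by simp
  qed
  have "(\<lambda>x. rhs2 (\<lambda>x. 0) (\<lambda>x. A * C x) x / m) = (\<lambda>x. (A * \<sigma>2 k) * (- (real k)\<^sup>2 * C x))"
    unfolding r2 using m_pos by auto
  then have "\<exists>d. deriv2 (K2 (\<lambda>x. 0) (\<lambda>x. A * C x)) d (\<lambda>x. rhs2 (\<lambda>x. 0) (\<lambda>x. A * C x) x / m)"
    unfolding K2 unfolding C_def using deriv2_cmult[OF deriv2_cos] by auto
  moreover have "\<exists>d. deriv2 (K1 (\<lambda>x. 0) (\<lambda>x. A * C x)) d (rhs1 (\<lambda>x. 0) (\<lambda>x. A * C x))"
    unfolding K1 r1[abs_def] unfolding C_def by (rule deriv2_Z_cos(1))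
  ultimately show ?thesis by (simp add: sol_def C_def)
qed

text \<open>Splitting the data as (f1, 0) + (0, f2) reduces density to one scalar function at a
  time.\<close>

lemma sol_cper:
  assumes "cper f1" "cper f2" shows "sol f1 f2"
proof -
  have "sol f1 (\<lambda>x. 0)"
    using assms(1)
  proof (induction rule: cper_dense_induct)
    case (add f g)
    then show ?case using sol_add[of f "\<lambda>x. 0" g "\<lambda>x. 0"] by simp
  next
    case (lim F f)
    show ?case by (rule sol_lim[OF lim(1) _ lim(2) _ lim(4) lim(3)]) (auto simp: bdd_def)
  qed (rule sol_monom_left)
  moreover have "sol (\<lambda>x. 0) f2"
    using assms(2)
  proof (induction rule: cper_dense_induct)
    case (add f g)
    then show ?case using sol_add[of "\<lambda>x. 0" f "\<lambda>x. 0" g] by simp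
  next
    case (lim F f)
    show ?case by (rule sol_lim[OF _ lim(1) _ lim(2) lim(4) _ lim(3)]) (auto simp: bdd_def)
  qed (rule sol_monom_right)
  ultimately show ?thesis
    using sol_add[of f1 "\<lambda>x. 0" "\<lambda>x. 0" f2] assms by simp
qed

end

section \<open>A uniform fixed point principle\<close>

text \<open>Banach's principle for the supremum distance over a family of real coordinates, a
  distance that may be infinite. Completeness is asked for coordinatewise limits only; the uniform
  rate along the iterates comes from the contraction itself.\<close>

lemma coordinate_contraction:
  fixes coord :: "'j \<Rightarrow> 'a \<Rightarrow> real" and T :: "'a \<Rightarrow> 'a"
  defines "near \<equiv> \<lambda>d u v. \<forall>j. \<bar>coord j u - coord j v\<bar> \<le> d"
  assumes complete: "\<And>U. (\<And>n. P (U n)) \<Longrightarrow> (\<And>j. convergent (\<lambda>n. coord j (U n))) \<Longrightarrow>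
      \<exists>u. P u \<and> (\<forall>j. (\<lambda>n. coord j (U n)) \<longlonglongrightarrow> coord j u)"
    and separated: "\<And>u v. (\<And>j. coord j u = coord j v) \<Longrightarrow> u = v"
    and P0: "P u0" and T: "\<And>u. P u \<Longrightarrow> P (T u)"
    and contr: "\<And>d u v. P u \<Longrightarrow> P v \<Longrightarrow> near d u v \<Longrightarrow> near (d / 2) (T u) (T v)"
    and start: "near D u0 (T u0)"
  shows "\<exists>u. P u \<and> T u = u"
proof -
  define U where "U n = (T ^^ n) u0" for n
  have U_Suc: "U (Suc n) = T (U n)" for n by (simp add: U_def)
  have PU: "P (U n)" for n by (induction n) (auto simp: U_def P0 T)
  have step: "near (D / 2 ^ n) (U n) (U (Suc n))" for n
  proof (induction n)
    case (Suc n)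
    then show ?case using contr[OF PU PU Suc] by (simp add: U_Suc field_simps)
  qed (use start in \<open>simp add: U_def\<close>)
  have D: "D \<ge> 0" using start abs_ge_zero order_trans unfolding near_def by blast
  \<comment> \<open>The closed form of D (1 / 2^n + ... + 1 / 2^(n + k - 1)).\<close>
  have tele: "near (2 * D / 2 ^ n - 2 * D / 2 ^ (n + k)) (U n) (U (n + k))" for n k
  proof (induction k)
    case (Suc k)
    show ?case unfolding near_def
    proof
      fix j
      have "\<bar>coord j (U n) - coord j (U (n + k))\<bar> \<le> 2 * D / 2 ^ n - 2 * D / 2 ^ (n + k)"
        "\<bar>coord j (U (n + k)) - coord j (U (n + Suc k))\<bar> \<le> D / 2 ^ (n + k)"
        using Suc step[of "n + k"] by (simp_all add: near_def)
      moreover have "2 * D / 2 ^ (n + Suc k) = D / 2 ^ (n + k)" by simp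
      moreover have "2 * D / 2 ^ (n + k) = 2 * (D / 2 ^ (n + k))" by simp
      ultimately show "\<bar>coord j (U n) - coord j (U (n + Suc k))\<bar> \<le> 2 * D / 2 ^ n - 2 * D / 2 ^ (n + Suc k)"
        by linarith
    qed
  qed (simp add: near_def)
  have close: "\<bar>coord j (U n) - coord j (U (n + k))\<bar> \<le> 2 * D / 2 ^ n" for j n k
  proof -
    have "2 * D / 2 ^ (n + k) \<ge> 0" using D by simp
    moreover have "\<bar>coord j (U n) - coord j (U (n + k))\<bar> \<le> 2 * D / 2 ^ n - 2 * D / 2 ^ (n + k)"
      using tele[of n k] unfolding near_def by blast
    ultimately show ?thesis by linarith
  qed
  have lim0: "(\<lambda>n. c / 2 ^ n) \<longlonglongrightarrow> 0" for c :: real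
    using tendsto_mult[OF tendsto_const[of c] LIMSEQ_realpow_zero[of "1 / 2"]]
    by (simp add: power_divide)
  have "Cauchy (\<lambda>n. coord j (U n))" for j
  proof (rule metric_CauchyI)
    fix e :: real assume "e > 0"
    then have "\<forall>\<^sub>F n in sequentially. 4 * D / 2 ^ n < e" using order_tendstoD(2)[OF lim0] by blast
    then obtain N where N: "4 * D / 2 ^ N < e" by (auto simp: eventually_sequentially)
    show "\<exists>M. \<forall>m\<ge>M. \<forall>n\<ge>M. dist (coord j (U m)) (coord j (U n)) < e"
    proof (intro exI allI impI)
      fix m n assume "m \<ge> N" "n \<ge> N"
      then have "\<bar>coord j (U N) - coord j (U m)\<bar> \<le> 2 * D / 2 ^ N" "\<bar>coord j (U N) - coord j (U n)\<bar> \<le> 2 * D / 2 ^ N"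
        using close[of j N "m - N"] close[of j N "n - N"] by auto
      moreover have "4 * D / 2 ^ N = 2 * D / 2 ^ N + 2 * D / 2 ^ N" by simp
      ultimately show "dist (coord j (U m)) (coord j (U n)) < e"
        using N unfolding dist_real_def by linarith
    qed
  qed
  then have "convergent (\<lambda>n. coord j (U n))" for j by (rule Cauchy_convergent)
  from complete[OF PU this] obtain u where u: "P u" and lim: "\<And>j. (\<lambda>n. coord j (U n)) \<longlonglongrightarrow> coord j u"
    by blast
  have near_u: "near (2 * D / 2 ^ n) (U n) u" for n
    unfolding near_def
  proof
    fix j
    have "(\<lambda>k. \<bar>coord j (U n) - coord j (U (n + k))\<bar>) \<longlonglongrightarrow> \<bar>coord j (U n) - coord j u\<bar>"
      using LIMSEQ_ignore_initial_segment[OF lim[of j], of n] by (intro tendsto_intros) (simp add: add.commute)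
    then show "\<bar>coord j (U n) - coord j u\<bar> \<le> 2 * D / 2 ^ n"
      by (rule LIMSEQ_le_const2) (use close in auto)
  qed
  have "T u = u"
  proof (rule separated)
    fix j
    have "(\<lambda>n. coord j (U (Suc n)) - coord j (T u)) \<longlonglongrightarrow> 0"
    proof (rule Lim_null_comparison[OF _ lim0[of D]])
      have "\<bar>coord j (U (Suc n)) - coord j (T u)\<bar> \<le> D / 2 ^ n" for n
        using contr[OF PU u near_u[of n]] by (simp add: near_def U_Suc)
      then show "\<forall>\<^sub>F n in sequentially. norm (coord j (U (Suc n)) - coord j (T u)) \<le> D / 2 ^ n"
        by simp
    qed
    then have "(\<lambda>n. coord j (U (Suc n))) \<longlonglongrightarrow> coord j (T u)"
      by (simp add: LIM_zero_iff)
    then show "coord j (T u) = coord j u"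
      using LIMSEQ_unique LIMSEQ_Suc[OF lim[of j]] by blast
  qed
  then show ?thesis using u by blast
qed

definition lip :: "real \<Rightarrow> (real \<Rightarrow> real) \<Rightarrow> bool" where
  "lip l f \<longleftrightarrow> (\<forall>x y. \<bar>f x - f y\<bar> \<le> l * \<bar>x - y\<bar>)"

text \<open>\<open>diff0\<close> and \<open>diff1\<close> record the shape of the derivative of the
  map: all entries are of size Q (r + |s|), except that \<open>T1\<close> and \<open>T2\<close>
  depend on the frequency with the merely bounded constant \<open>Q\<close>. The radii
  \<open>r\<close> and \<open>a\<close> are functions of \<open>Q\<close> alone, so a
  \<open>Q\<close> common to all wave speeds gives a common interval of amplitudes.\<close>

locale newton_family =
  fixes Q \<xi> :: real
    and T0 :: "real \<Rightarrow> real \<Rightarrow> (real \<Rightarrow> real) \<Rightarrow> (real \<Rightarrow> real) \<Rightarrow> real"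
    and T1 T2 :: "real \<Rightarrow> real \<Rightarrow> (real \<Rightarrow> real) \<Rightarrow> (real \<Rightarrow> real) \<Rightarrow> real \<Rightarrow> real"
    and r a :: real and dom :: "real \<Rightarrow> (real \<Rightarrow> real) \<Rightarrow> (real \<Rightarrow> real) \<Rightarrow> bool"
  assumes r_eq: "r = 1 / (32 * Q\<^sup>2)" and a_eq: "a = 1 / (256 * Q ^ 4)"
    and dom_eq: "dom \<omega> p q \<longleftrightarrow> \<bar>\<omega> - \<xi>\<bar> \<le> r \<and> cper p \<and> cper q \<and> bdd r p \<and> bdd r q \<and> lip 1 p \<and> lip 1 q"
    and Q: "Q \<ge> 1"
    and reg: "\<And>s \<omega> p q. \<bar>s\<bar> \<le> a \<Longrightarrow> dom \<omega> p q \<Longrightarrow>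
      cper (T1 s \<omega> p q) \<and> cper (T2 s \<omega> p q) \<and> lip 1 (T1 s \<omega> p q) \<and> lip 1 (T2 s \<omega> p q)"
    and diff0: "\<And>s \<omega> p q \<omega>' p' q' d. \<bar>s\<bar> \<le> a \<Longrightarrow> dom \<omega> p q \<Longrightarrow> dom \<omega>' p' q' \<Longrightarrow>
      bdd d (\<lambda>x. p x - p' x) \<Longrightarrow> bdd d (\<lambda>x. q x - q' x) \<Longrightarrow>
      \<bar>T0 s \<omega> p q - T0 s \<omega>' p' q'\<bar> \<le> Q * (r + \<bar>s\<bar>) * (\<bar>\<omega> - \<omega>'\<bar> + d)"
    and diff1: "\<And>s \<omega> p q \<omega>' p' q' d. \<bar>s\<bar> \<le> a \<Longrightarrow> dom \<omega> p q \<Longrightarrow> dom \<omega>' p' q' \<Longrightarrow>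
      bdd d (\<lambda>x. p x - p' x) \<Longrightarrow> bdd d (\<lambda>x. q x - q' x) \<Longrightarrow>
      bdd (Q * \<bar>\<omega> - \<omega>'\<bar> + Q * (r + \<bar>s\<bar>) * (\<bar>\<omega> - \<omega>'\<bar> + d)) (\<lambda>x. T1 s \<omega> p q x - T1 s \<omega>' p' q' x) \<and>
      bdd (Q * \<bar>\<omega> - \<omega>'\<bar> + Q * (r + \<bar>s\<bar>) * (\<bar>\<omega> - \<omega>'\<bar> + d)) (\<lambda>x. T2 s \<omega> p q x - T2 s \<omega>' p' q' x)"
    and sdiff: "\<And>s s' \<omega> p q. \<bar>s\<bar> \<le> a \<Longrightarrow> \<bar>s'\<bar> \<le> a \<Longrightarrow> dom \<omega> p q \<Longrightarrow>
      \<bar>T0 s \<omega> p q - T0 s' \<omega> p q\<bar> \<le> Q * \<bar>s - s'\<bar> \<and>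
      bdd (Q * \<bar>s - s'\<bar>) (\<lambda>x. T1 s \<omega> p q x - T1 s' \<omega> p q x) \<and>
      bdd (Q * \<bar>s - s'\<bar>) (\<lambda>x. T2 s \<omega> p q x - T2 s' \<omega> p q x)"
    and base: "T0 0 \<xi> (\<lambda>x. 0) (\<lambda>x. 0) = \<xi>" "T1 0 \<xi> (\<lambda>x. 0) (\<lambda>x. 0) x = 0" "T2 0 \<xi> (\<lambda>x. 0) (\<lambda>x. 0) x = 0"
begin

text \<open>The weight \<open>4 * Q\<close> on the frequency absorbs the only entry of the derivative that is not small.\<close>

definition near where
  "near d \<omega> p q \<omega>' p' q' \<longleftrightarrow> 4 * Q * \<bar>\<omega> - \<omega>'\<bar> \<le> d \<and> bdd d (\<lambda>x. p x - p' x) \<and> bdd d (\<lambda>x. q x - q' x)"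

text \<open>The invariant set, a ball in the weighted distance; it lies inside \<open>dom\<close>,
  on which the estimates are available.\<close>

definition D where "D \<omega> p q \<longleftrightarrow> near r \<omega> p q \<xi> (\<lambda>x. 0) (\<lambda>x. 0) \<and> cper p \<and> cper q \<and> lip 1 p \<and> lip 1 q"

text \<open>The choice of \<open>r\<close> makes 8 Q^2 r = 1/4, which leaves room for
  \<open>a\<close> in the contraction condition; \<open>a = r / (8 * Q\<^sup>2)\<close> is then such
  that switching on \<open>s\<close> moves the centre by at most r / 2.\<close>

lemma const_bounds: "r > 0" "a > 0" "a \<le> r / 8" "4 * Q * (Q * a) \<le> r / 2" "Q * (r + a) * (8 * Q) \<le> 1 / 2"
proof -
  have Q2: "Q\<^sup>2 \<ge> 1" using Q by simp
  have "a = r / (8 * Q\<^sup>2)" using Q by (simp add: a_eq r_eq field_simps eval_nat_numeral)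
  moreover show "r > 0" "a > 0" using Q by (auto simp: r_eq a_eq)
  moreover have "r / (8 * Q\<^sup>2) \<le> r / 8"
    using Q2 \<open>r > 0\<close> by (intro divide_left_mono) auto
  ultimately show "a \<le> r / 8" by simp
  show "4 * Q * (Q * a) \<le> r / 2"
    using Q by (simp add: \<open>a = r / (8 * Q\<^sup>2)\<close> power2_eq_square)
  have "Q * (r + a) * (8 * Q) \<le> Q * (r + r / 8) * (8 * Q)"
    using Q \<open>a \<le> r / 8\<close> by (intro mult_right_mono mult_left_mono) auto
  also have "\<dots> = 9 / 32" using Q by (simp add: r_eq field_simps power2_eq_square)
  finally show "Q * (r + a) * (8 * Q) \<le> 1 / 2" by simp
qed

lemma D_dom: "D \<omega> p q \<Longrightarrow> dom \<omega> p q"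
proof -
  assume *: "D \<omega> p q"
  have "\<bar>\<omega> - \<xi>\<bar> \<le> 4 * Q * \<bar>\<omega> - \<xi>\<bar>" using Q mult_right_mono[of 1 "4 * Q" "\<bar>\<omega> - \<xi>\<bar>"] by simp
  then show ?thesis using * by (auto simp: D_def dom_eq near_def)
qed

lemma D_base: "D \<xi> (\<lambda>x. 0) (\<lambda>x. 0)"
  using const_bounds(1) by (auto simp: D_def near_def bdd_def lip_def)

lemma near_mono: "near d \<omega> p q \<omega>' p' q' \<Longrightarrow> d \<le> e \<Longrightarrow> near e \<omega> p q \<omega>' p' q'"
  unfolding near_def by (meson bdd_mono order_trans)

lemma near_trans:
  assumes "near d \<omega> p q \<omega>' p' q'" "near e \<omega>' p' q' \<omega>'' p'' q''"
  shows "near (d + e) \<omega> p q \<omega>'' p'' q''"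
proof -
  have "\<bar>\<omega> - \<omega>''\<bar> \<le> \<bar>\<omega> - \<omega>'\<bar> + \<bar>\<omega>' - \<omega>''\<bar>" by linarith
  then have "4 * Q * \<bar>\<omega> - \<omega>''\<bar> \<le> 4 * Q * (\<bar>\<omega> - \<omega>'\<bar> + \<bar>\<omega>' - \<omega>''\<bar>)"
    using Q by (intro mult_left_mono) auto
  then show ?thesis
    using assms bdd_add[of d "\<lambda>x. p x - p' x" e "\<lambda>x. p' x - p'' x"]
      bdd_add[of d "\<lambda>x. q x - q' x" e "\<lambda>x. q' x - q'' x"]
    by (auto simp: near_def algebra_simps)
qed

text \<open>The frequency component carries the small factor throughout, even after multiplication
  by the weight. For the functions the bounded term Q |\<omega> - \<omega>'| is at most d / 4 by the
  weight, and the small terms fit into the rest.\<close>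

lemma contraction:
  assumes s: "\<bar>s\<bar> \<le> a" and u: "dom \<omega> p q" "dom \<omega>' p' q'" and n: "near d \<omega> p q \<omega>' p' q'"
  shows "near (d / 2) (T0 s \<omega> p q) (T1 s \<omega> p q) (T2 s \<omega> p q) (T0 s \<omega>' p' q') (T1 s \<omega>' p' q') (T2 s \<omega>' p' q')"
proof -
  have b: "bdd d (\<lambda>x. p x - p' x)" "bdd d (\<lambda>x. q x - q' x)" and w: "4 * Q * \<bar>\<omega> - \<omega>'\<bar> \<le> d"
    using n by (auto simp: near_def)
  have d: "d \<ge> 0" using bdd_nonneg[OF b(1)] .
  have wd: "\<bar>\<omega> - \<omega>'\<bar> \<le> d" 
    using w Q mult_right_mono[of 1 "4 * Q" "\<bar>\<omega> - \<omega>'\<bar>"] by simp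
  let ?X = "Q * (r + \<bar>s\<bar>) * (\<bar>\<omega> - \<omega>'\<bar> + d)"
  have X: "4 * Q * ?X \<le> d / 2"
  proof -
    have "?X \<le> Q * (r + a) * (2 * d)"
      using s wd d Q const_bounds by (intro mult_mono) auto
    then have "4 * Q * ?X \<le> 4 * Q * (Q * (r + a) * (2 * d))"
      using Q by (intro mult_left_mono) auto
    also have "\<dots> = (Q * (r + a) * (8 * Q)) * d" by simp
    also have "\<dots> \<le> 1 / 2 * d" using const_bounds(5) d by (rule mult_right_mono)
    finally show ?thesis by simp
  qed
  have X0: "?X \<ge> 0" using Q const_bounds d by (intro mult_nonneg_nonneg) auto
  then have XQ: "?X \<le> Q * ?X" using Q mult_right_mono[of 1 Q ?X] by simp
  have "Q * \<bar>\<omega> - \<omega>'\<bar> + y \<le> d / 2" if "y \<le> Q * y" "4 * Q * y \<le> d / 2" for y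
  proof -
    have "4 * (Q * y) \<le> d / 2" "4 * (Q * \<bar>\<omega> - \<omega>'\<bar>) \<le> d" using that w by (simp_all only: mult.assoc)
    then show ?thesis using that d by linarith
  qed
  from this[OF XQ X] have Xb: "Q * \<bar>\<omega> - \<omega>'\<bar> + ?X \<le> d / 2" .
  have "4 * Q * \<bar>T0 s \<omega> p q - T0 s \<omega>' p' q'\<bar> \<le> 4 * Q * ?X"
    using Q diff0[OF s u b] by (intro mult_left_mono) auto
  with X have "4 * Q * \<bar>T0 s \<omega> p q - T0 s \<omega>' p' q'\<bar> \<le> d / 2" by linarith
  then show ?thesis
    unfolding near_def using diff1[OF s u b] Xb bdd_mono by blast
qed

lemma sdiff_near:
  assumes "\<bar>s\<bar> \<le> a" "\<bar>s'\<bar> \<le> a" "dom \<omega> p q"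
  shows "near (4 * Q * (Q * \<bar>s - s'\<bar>)) (T0 s \<omega> p q) (T1 s \<omega> p q) (T2 s \<omega> p q) (T0 s' \<omega> p q) (T1 s' \<omega> p q) (T2 s' \<omega> p q)"
proof -
  note * = sdiff[OF assms]
  have "4 * Q * \<bar>T0 s \<omega> p q - T0 s' \<omega> p q\<bar> \<le> 4 * Q * (Q * \<bar>s - s'\<bar>)"
    using * Q by (intro mult_left_mono) auto
  moreover have "Q * \<bar>s - s'\<bar> \<le> 4 * Q * (Q * \<bar>s - s'\<bar>)"
    using Q mult_right_mono[of 1 "4 * Q" "Q * \<bar>s - s'\<bar>"] by simp
  ultimately show ?thesis unfolding near_def using * bdd_mono by blast
qed

text \<open>Half of the radius pays for the distance to the image of the centre, the other half for
  the displacement of the centre at parameter \<open>s\<close>.\<close>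

lemma D_invariant:
  assumes s: "\<bar>s\<bar> \<le> a" and D: "D \<omega> p q"
  shows "D (T0 s \<omega> p q) (T1 s \<omega> p q) (T2 s \<omega> p q)"
proof -
  let ?z = "\<lambda>x :: real. 0 :: real"
  have "near r \<omega> p q \<xi> ?z ?z" using D by (simp add: D_def)
  from contraction[OF s D_dom[OF D] D_dom[OF D_base] this]
  have 1: "near (r / 2) (T0 s \<omega> p q) (T1 s \<omega> p q) (T2 s \<omega> p q) (T0 s \<xi> ?z ?z) (T1 s \<xi> ?z ?z) (T2 s \<xi> ?z ?z)" .
  have "near (4 * Q * (Q * \<bar>s - 0\<bar>)) (T0 s \<xi> ?z ?z) (T1 s \<xi> ?z ?z) (T2 s \<xi> ?z ?z) (T0 0 \<xi> ?z ?z) (T1 0 \<xi> ?z ?z) (T2 0 \<xi> ?z ?z)"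
    using const_bounds s by (intro sdiff_near D_dom D_base) auto
  moreover have "4 * Q * (Q * \<bar>s - 0\<bar>) \<le> r / 2"
  proof -
    have "4 * Q * (Q * \<bar>s - 0\<bar>) \<le> 4 * Q * (Q * a)" using Q s by (intro mult_left_mono) auto
    then show ?thesis using const_bounds(4) by linarith
  qed
  ultimately have 2: "near (r / 2) (T0 s \<xi> ?z ?z) (T1 s \<xi> ?z ?z) (T2 s \<xi> ?z ?z) \<xi> ?z ?z"
    using near_mono base by (simp add: fun_eq_iff[symmetric] base[abs_def])
  show ?thesis
    using near_trans[OF 1 2] reg[OF s D_dom[OF D]] by (simp add: D_def)
qed

lemma fixed_point:
  assumes s: "\<bar>s\<bar> \<le> a"
  shows "\<exists>\<omega> p q. D \<omega> p q \<and> T0 s \<omega> p q = \<omega> \<and> T1 s \<omega> p q = p \<and> T2 s \<omega> p q = q"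
proof -
  \<comment> \<open>Index 0 reads the weighted frequency, indices 1 and 2 read values of
    \<open>p\<close> and \<open>q\<close>; higher indices repeat \<open>q\<close>, so that every
    pair is a legitimate coordinate.\<close>
  define coord :: "nat \<times> real \<Rightarrow> real \<times> (real \<Rightarrow> real) \<times> (real \<Rightarrow> real) \<Rightarrow> real" where
    "coord = (\<lambda>(i, x) (\<omega>, p, q). if i = 0 then 4 * Q * \<omega> else if i = 1 then p x else q x)"
  have coord: "coord (0, x) (\<omega>, p, q) = 4 * Q * \<omega>" "coord (1, x) (\<omega>, p, q) = p x" "coord (2, x) (\<omega>, p, q) = q x"
    for x \<omega> p q by (simp_all add: coord_def)
  have coord_cases: "(\<forall>j. R j) \<longleftrightarrow> (\<forall>x. R (0, x)) \<and> (\<forall>x. R (1, x)) \<and> (\<forall>x. R (2, x))"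
    if "\<And>(i::nat) x. i > 2 \<Longrightarrow> R (i, x) \<longleftrightarrow> R (2, x)" for R :: "nat \<times> real \<Rightarrow> bool"
  proof safe
    fix i :: nat and x assume R: "\<forall>x. R (0, x)" "\<forall>x. R (1, x)" "\<forall>x. R (2, x)"
    have "i = 0 \<or> i = 1 \<or> i = 2 \<or> i > 2" by linarith
    then show "R (i, x)" using R that by auto
  qed auto
  have coord_high: "coord (i, x) u = coord (2, x) u" if "i > 2" for i x u
    using that by (cases u) (simp add: coord_def)
  have near_coord: "(\<forall>j. \<bar>coord j (\<omega>, p, q) - coord j (\<omega>', p', q')\<bar> \<le> d) \<longleftrightarrow> near d \<omega> p q \<omega>' p' q'" 
    for d \<omega> p q \<omega>' p' q'
  proof -
    have "\<bar>4 * Q * \<omega> - 4 * Q * \<omega>'\<bar> = 4 * Q * \<bar>\<omega> - \<omega>'\<bar>"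
      using Q by (simp add: abs_mult flip: right_diff_distrib)
    then show ?thesis
      by (subst coord_cases) (auto simp: coord_high coord[simplified] near_def bdd_def)
  qed
  have "\<exists>u. (\<lambda>(\<omega>, p, q). D \<omega> p q) u \<and> (\<lambda>(\<omega>, p, q). (T0 s \<omega> p q, T1 s \<omega> p q, T2 s \<omega> p q)) u = u"
  proof (rule coordinate_contraction[of _ coord])
    fix U :: "nat \<Rightarrow> real \<times> (real \<Rightarrow> real) \<times> (real \<Rightarrow> real)"
    assume PU: "\<And>n. (\<lambda>(\<omega>, p, q). D \<omega> p q) (U n)" and conv: "\<And>j. convergent (\<lambda>n. coord j (U n))"
    define w p q where "w n = fst (U n)" and "p n = fst (snd (U n))" and "q n = snd (snd (U n))" for n
    have U: "U n = (w n, p n, q n)" for n by (simp add: w_def p_def q_def)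
    have DU: "D (w n) (p n) (q n)" for n using PU[of n] by (simp add: U)
    obtain l where l: "\<And>j. (\<lambda>n. coord j (U n)) \<longlonglongrightarrow> l j"
      using conv unfolding convergent_def by metis
    define w' p' q' where "w' = l (0, 0) / (4 * Q)" and "p' x = l (1, x)" and "q' x = l (2, x)" for x
    have lim: "w \<longlonglongrightarrow> w'" "(\<lambda>n. p n x) \<longlonglongrightarrow> p' x" "(\<lambda>n. q n x) \<longlonglongrightarrow> q' x" for x
    proof -
      show "w \<longlonglongrightarrow> w'" using tendsto_divide[OF l[of "(0, 0)"] tendsto_const[of "4 * Q"]] Q
        by (simp add: U coord w'_def)
      show "(\<lambda>n. p n x) \<longlonglongrightarrow> p' x" "(\<lambda>n. q n x) \<longlonglongrightarrow> q' x"
        using l[of "(1, x)"] l[of "(2, x)"] by (simp_all add: U coord[simplified] p'_def q'_def)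
    qed
    have bdd_lim: "bdd r f" if "\<And>x. (\<lambda>n. F n x) \<longlonglongrightarrow> f x" "\<And>n. bdd r (F n)" for F :: "nat \<Rightarrow> real \<Rightarrow> real" and f
      unfolding bdd_def
    proof
      fix x show "\<bar>f x\<bar> \<le> r"
        by (rule LIMSEQ_le_const2[OF tendsto_rabs[OF that(1)]]) (use that(2) in \<open>auto simp: bdd_def\<close>)
    qed
    have lip_lim: "lip 1 f" if "\<And>x. (\<lambda>n. F n x) \<longlonglongrightarrow> f x" "\<And>n. lip 1 (F n)" for F :: "nat \<Rightarrow> real \<Rightarrow> real" and f
      unfolding lip_def
    proof safe
      fix x y show "\<bar>f x - f y\<bar> \<le> 1 * \<bar>x - y\<bar>"
        by (rule LIMSEQ_le_const2[OF tendsto_rabs[OF tendsto_diff[OF that(1) that(1)]]])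
          (use that(2) in \<open>auto simp: lip_def\<close>)
    qed
    \<comment> \<open>Continuity of the limit comes from its Lipschitz bound, so convergence at each
      point is enough.\<close>
    have cper_lim: "cper f" if "\<And>x. (\<lambda>n. F n x) \<longlonglongrightarrow> f x" "\<And>n. cper (F n)" "lip 1 f" for F :: "nat \<Rightarrow> real \<Rightarrow> real" and f
      unfolding cper_def
    proof safe
      have "1-lipschitz_on UNIV f" using that(3) by (auto simp: lipschitz_on_def lip_def dist_real_def)
      then show "continuous_on UNIV f" by (rule lipschitz_on_continuous_on)
      show "f (x + 2 * pi) = f x" for x
        using that(1)[of "x + 2 * pi"] that(1)[of x] LIMSEQ_unique by (simp add: cperD[OF that(2)])
    qed
    note DU' = DU[unfolded D_def near_def, simplified]
    have lips: "lip 1 p'" "lip 1 q'" using lip_lim[OF lim(2)] lip_lim[OF lim(3)] DU' by auto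
    have "(\<lambda>n. 4 * Q * \<bar>w n - \<xi>\<bar>) \<longlonglongrightarrow> 4 * Q * \<bar>w' - \<xi>\<bar>"
      by (intro tendsto_intros lim)
    then have "4 * Q * \<bar>w' - \<xi>\<bar> \<le> r" by (rule LIMSEQ_le_const2) (use DU' in auto)
    then have "D w' p' q'"
      using lips bdd_lim[OF lim(2)] bdd_lim[OF lim(3)] cper_lim[OF lim(2)] cper_lim[OF lim(3)] DU'
      by (simp add: D_def near_def)
    moreover have "\<forall>j. (\<lambda>n. coord j (U n)) \<longlonglongrightarrow> coord j (w', p', q')"
      using lim Q by (subst coord_cases) (auto simp: coord_high U coord[simplified] intro!: tendsto_intros)
    ultimately show "\<exists>u. (\<lambda>(\<omega>, p, q). D \<omega> p q) u \<and> (\<forall>j. (\<lambda>n. coord j (U n)) \<longlonglongrightarrow> coord j u)" by blast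
  next
    fix u v assume *: "\<And>j. coord j u = coord j v"
    obtain w p q w' p' q' where u: "u = (w, p, q)" "v = (w', p', q')" by (metis prod_cases3)
    show "u = v"
      using *[of "(0, _)"] *[of "(1, _)"] *[of "(2, _)"] Q
      unfolding u coord by (auto simp: coord[simplified])
  next
    show "(\<lambda>(\<omega>, p, q). D \<omega> p q) (\<xi>, \<lambda>x. 0, \<lambda>x. 0)" using D_base by simp
  next
    fix u assume "(\<lambda>(\<omega>, p, q). D \<omega> p q) u"
    then show "(\<lambda>(\<omega>, p, q). D \<omega> p q) ((\<lambda>(\<omega>, p, q). (T0 s \<omega> p q, T1 s \<omega> p q, T2 s \<omega> p q)) u)"
      using D_invariant[OF s] by auto
  next
    fix d u v assume *: "(\<lambda>(\<omega>, p, q). D \<omega> p q) u" "(\<lambda>(\<omega>, p, q). D \<omega> p q) v" "\<forall>j. \<bar>coord j u - coord j v\<bar> \<le> d"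
    obtain w p q w' p' q' where u: "u = (w, p, q)" "v = (w', p', q')" by (metis prod_cases3)
    show "\<forall>j. \<bar>coord j ((\<lambda>(\<omega>, p, q). (T0 s \<omega> p q, T1 s \<omega> p q, T2 s \<omega> p q)) u)
      - coord j ((\<lambda>(\<omega>, p, q). (T0 s \<omega> p q, T1 s \<omega> p q, T2 s \<omega> p q)) v)\<bar> \<le> d / 2"
      using contraction[OF s, of w p q w' p' q' d] * D_dom unfolding u prod.case near_coord by blast
  next
    let ?z = "\<lambda>x :: real. 0 :: real"
    have "near r (T0 s \<xi> ?z ?z) (T1 s \<xi> ?z ?z) (T2 s \<xi> ?z ?z) \<xi> ?z ?z"
      using D_invariant[OF s D_base] by (simp add: D_def)
    then show "\<forall>j. \<bar>coord j (\<xi>, ?z, ?z) - coord j ((\<lambda>(\<omega>, p, q). (T0 s \<omega> p q, T1 s \<omega> p q, T2 s \<omega> p q)) (\<xi>, ?z, ?z))\<bar> \<le> r"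
      unfolding prod.case near_coord by (simp add: near_def bdd_def abs_minus_commute)
  qed
  then show ?thesis by auto
qed

text \<open>Applying the map once turns a distance d between the two fixed points into d / 2 + e
  with e = 4 Q^2 |s - s'|. Starting from the crude bound 2 r and iterating, the distance is at most
  2 e.\<close>

lemma fixed_point_lipschitz:
  assumes s: "\<bar>s\<bar> \<le> a" "\<bar>s'\<bar> \<le> a" and D: "D \<omega> p q" "D \<omega>' p' q'"
    and f: "T0 s \<omega> p q = \<omega>" "T1 s \<omega> p q = p" "T2 s \<omega> p q = q"
    and f': "T0 s' \<omega>' p' q' = \<omega>'" "T1 s' \<omega>' p' q' = p'" "T2 s' \<omega>' p' q' = q'"
  shows "near (8 * Q\<^sup>2 * \<bar>s - s'\<bar>) \<omega> p q \<omega>' p' q'"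
proof -
  let ?e = "4 * Q * (Q * \<bar>s - s'\<bar>)"
  have e: "?e \<ge> 0" using Q by simp
  have it: "near (d / 2 + ?e) \<omega> p q \<omega>' p' q'" if "near d \<omega> p q \<omega>' p' q'" for d
    using near_trans[OF contraction[OF s(1) D_dom[OF D(1)] D_dom[OF D(2)] that] sdiff_near[OF s D_dom[OF D(2)]]]
    unfolding f f' .
  have "near (2 * r) \<omega> p q \<omega>' p' q'"
  proof -
    have "near r \<xi> (\<lambda>x. 0) (\<lambda>x. 0) \<omega>' p' q'"
      using D(2) by (simp add: D_def near_def bdd_def abs_minus_commute)
    then show ?thesis using near_trans[of r \<omega> p q \<xi> "\<lambda>x. 0" "\<lambda>x. 0" r \<omega>' p' q'] D(1) by (simp add: D_def)
  qed
  then have n: "near (2 * r / 2 ^ n + 2 * ?e) \<omega> p q \<omega>' p' q'" for n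
  proof (induction n)
    case 0
    then show ?case using near_mono e by fastforce
  next
    case (Suc n)
    have "(2 * r / 2 ^ n + 2 * ?e) / 2 + ?e = 2 * r / 2 ^ Suc n + 2 * ?e" by simp
    with it[OF Suc(1)[OF Suc(2)]] show ?case by (simp only:)
  qed
  have lim: "(\<lambda>n. 2 * r / 2 ^ n + 2 * ?e) \<longlonglongrightarrow> 0 + 2 * ?e"
  proof (intro tendsto_add tendsto_const)
    show "(\<lambda>n. 2 * r / 2 ^ n) \<longlonglongrightarrow> 0"
      using tendsto_mult[OF tendsto_const[of "2 * r"] LIMSEQ_realpow_zero[of "1 / 2"]]
      by (simp add: power_divide)
  qed
  have "near (0 + 2 * ?e) \<omega> p q \<omega>' p' q'"
    unfolding near_def bdd_def
    by (intro conjI allI LIMSEQ_le_const[OF lim]) (use n in \<open>auto simp: near_def bdd_def\<close>)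
  then show ?thesis by (simp add: power2_eq_square mult.assoc)
qed

lemma fixed_point_family:
  obtains om p q where
    "\<And>s. \<bar>s\<bar> \<le> a \<Longrightarrow> D (om s) (p s) (q s)"
    "\<And>s. \<bar>s\<bar> \<le> a \<Longrightarrow> T0 s (om s) (p s) (q s) = om s"
    "\<And>s. \<bar>s\<bar> \<le> a \<Longrightarrow> T1 s (om s) (p s) (q s) = p s"
    "\<And>s. \<bar>s\<bar> \<le> a \<Longrightarrow> T2 s (om s) (p s) (q s) = q s"
    "\<And>s s'. \<bar>s\<bar> \<le> a \<Longrightarrow> \<bar>s'\<bar> \<le> a \<Longrightarrow> near (8 * Q\<^sup>2 * \<bar>s - s'\<bar>) (om s) (p s) (q s) (om s') (p s') (q s')"
    "om 0 = \<xi>" "p 0 = (\<lambda>x. 0)" "q 0 = (\<lambda>x. 0)"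
proof -
  obtain om p q where *: "\<And>s. \<bar>s\<bar> \<le> a \<Longrightarrow> D (om s) (p s) (q s) \<and> T0 s (om s) (p s) (q s) = om s \<and>
    T1 s (om s) (p s) (q s) = p s \<and> T2 s (om s) (p s) (q s) = q s"
    using fixed_point by metis
  note 1 = *[THEN conjunct1] and 2 = *[THEN conjunct2, THEN conjunct1]
    and 3 = *[THEN conjunct2, THEN conjunct2, THEN conjunct1]
    and 4 = *[THEN conjunct2, THEN conjunct2, THEN conjunct2]
  have a0: "\<bar>0\<bar> \<le> a" using const_bounds by simp
  \<comment> \<open>With s = s' = 0 the Lipschitz estimate is a uniqueness statement, and the base
    point is a fixed point at s = 0.\<close>
  have "near (8 * Q\<^sup>2 * \<bar>0 - 0\<bar>) (om 0) (p 0) (q 0) \<xi> (\<lambda>x. 0) (\<lambda>x. 0)"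
    by (rule fixed_point_lipschitz[OF a0 a0 1[OF a0] D_base 2[OF a0] 3[OF a0] 4[OF a0]])
      (use base in auto)
  then have "om 0 = \<xi>" "p 0 = (\<lambda>x. 0)" "q 0 = (\<lambda>x. 0)"
    using Q by (auto simp: near_def bdd_def mult_le_0_iff)
  then show ?thesis
    using that[of om p q] 1 2 3 4 fixed_point_lipschitz[OF _ _ 1 1 2 3 4 2 3 4] by blast
qed

end

lemma lip_add: "lip k f \<Longrightarrow> lip l g \<Longrightarrow> lip (k + l) (\<lambda>x. f x + g x)"
  unfolding lip_def distrib_right by (smt (verit, ccfv_SIG))

lemma lip_cmult: "lip l f \<Longrightarrow> lip (\<bar>c\<bar> * l) (\<lambda>x. c * f x)"
  unfolding lip_def by (metis abs_ge_zero abs_mult mult.assoc mult_left_mono right_diff_distrib)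

lemma lip_mono: "lip k f \<Longrightarrow> k \<le> l \<Longrightarrow> lip l f"
  unfolding lip_def by (meson abs_ge_zero mult_right_mono order_trans)

lemma abs_mult_diff_le:
  fixes a b c d :: real
  assumes "\<bar>a - b\<bar> \<le> A" "\<bar>c\<bar> \<le> C" "\<bar>b\<bar> \<le> B" "\<bar>c - d\<bar> \<le> D"
  shows "\<bar>a * c - b * d\<bar> \<le> A * C + B * D"
proof -
  have "\<bar>(a - b) * c\<bar> \<le> A * C" "\<bar>b * (c - d)\<bar> \<le> B * D"
    unfolding abs_mult using assms by (intro mult_mono; force)+
  moreover have "a * c - b * d = (a - b) * c + b * (c - d)" by (simp add: algebra_simps)
  ultimately show ?thesis by linarith
qed

section \<open>The operator at a varying frequency\<close>

context dimer
begin

definition "LK = 2 * pi * RC * (1 + 1 / m)"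

lemma KC_nonneg: "KC \<ge> 0" and RC_nonneg: "RC \<ge> 0" and LK_nonneg: "LK \<ge> 0"
  using C0_parts zeta2_nonneg m_pos by (auto simp: LK_def RC_def KC_def)

text \<open>The gain that pays for shifts: bounded data have solutions with bounded second
  derivative, hence by \<open>deriv_bdd\<close> with bounded first derivative.\<close>

lemma K_lip:
  assumes "cper f1" "cper f2" "bdd d f1" "bdd d f2"
  shows "lip (LK * d) (K1 f1 f2)" "lip (LK * d) (K2 f1 f2)"
proof -
  note r = rhs_bdd[OF assms]
  have d: "d \<ge> 0" using bdd_nonneg[OF assms(3)] .
  obtain d1 d2 where D: "deriv2 (K1 f1 f2) d1 (rhs1 f1 f2)" "deriv2 (K2 f1 f2) d2 (\<lambda>x. rhs2 f1 f2 x / m)"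
    using sol_cper[OF assms(1,2)] by (auto simp: sol_def)
  have "RC * d \<le> RC * d * (1 + 1 / m)" "1 / m * (RC * d) \<le> RC * d * (1 + 1 / m)"
    using RC_nonneg d m_pos by (simp_all add: algebra_simps)
  then have b: "bdd (RC * d * (1 + 1 / m)) (rhs1 f1 f2)" "bdd (RC * d * (1 + 1 / m)) (\<lambda>x. rhs2 f1 f2 x / m)"
    using r(1) bdd_cmult[OF r(2), of "1 / m"] m_pos by (auto intro: bdd_mono)
  have "bdd (LK * d) d1" "bdd (LK * d) d2"
  proof -
    have "2 * pi * (RC * d * (1 + 1 / m)) = LK * d" by (simp only: LK_def mult_ac)
    then show "bdd (LK * d) d1" "bdd (LK * d) d2"
      using deriv_bdd[OF D(1) cper_K(1)[OF assms(1,2)] b(1)] deriv_bdd[OF D(2) cper_K(2)[OF assms(1,2)] b(2)]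
      by (simp_all only:)
  qed
  then show "lip (LK * d) (K1 f1 f2)" "lip (LK * d) (K2 f1 f2)"
    using D lipschitz_of_deriv unfolding lip_def deriv2_def by blast+
qed

lemma nu_deriv2:
  "deriv2 \<nu>1 (\<lambda>x. \<nu>1 (x + pi / 2)) (\<lambda>x. - \<nu>1 x)" "deriv2 \<nu>2 (\<lambda>x. \<nu>2 (x + pi / 2)) (\<lambda>x. - \<nu>2 x)"
  unfolding deriv2_def nu_half_pi unfolding \<nu>1_def[abs_def] \<nu>2_def[abs_def]
  by (auto intro!: derivative_eq_intros simp: algebra_simps)

text \<open>Since \<nu>'' = -\<nu>, this makes \<nu> a null vector of the linearised operator, with
  masses 1 and m in the two components.\<close>

lemma nu_eig: "Z \<nu>2 x - (1 + \<kappa>) * \<nu>1 x = - \<Lambda> * \<nu>1 x" "Zad \<nu>1 x - (1 + \<kappa>) * \<nu>2 x = - m * \<Lambda> * \<nu>2 x"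
proof -
  have "Z \<nu>2 x = - n * \<nu>1 x" by (simp add: Z_def \<nu>1_def \<nu>2_def algebra_simps)
  then show "Z \<nu>2 x - (1 + \<kappa>) * \<nu>1 x = - \<Lambda> * \<nu>1 x" by (simp add: n_def algebra_simps)
  have "Zad \<nu>1 x = g * (Zad (Z (\<lambda>x. cos (real 1 * x + 0))) x)"
    by (simp add: Z_def Zad_def \<nu>1_def algebra_simps)
  also have "\<dots> = g * zz * cos x" unfolding Z_Zad_cos(2) by (simp add: zz_def)
  finally show "Zad \<nu>1 x - (1 + \<kappa>) * \<nu>2 x = - m * \<Lambda> * \<nu>2 x" 
    unfolding zz_n by (simp add: \<nu>2_def algebra_simps)
qed

text \<open>Means of products of first harmonics without integration: adding the quarter period
  shift replaces squares of sine or cosine by their constant sum.\<close>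

lemma mean_half_pi:
  assumes "cper f" "\<And>x. f x + f (x + pi / 2) = c"
  shows "mean f = c / 2"
proof -
  have "mean f + mean (\<lambda>x. f (x + pi / 2)) = c"
    by (subst mean_add[symmetric]) (simp_all add: assms cper_shift)
  then show ?thesis using mean_shift[OF assms(1)] by simp
qed

lemma g2_mult: "g\<^sup>2 * (zz + n\<^sup>2) = 2"
  using zzn_pos g2 by (metis less_irrefl nonzero_eq_divide_eq)

lemma ip_nu: "ip \<nu>1 \<nu>2 \<nu>1 \<nu>2 = 1"
proof -
  have "mean (\<lambda>x. \<nu>1 x * \<nu>1 x + \<nu>2 x * \<nu>2 x) = (g\<^sup>2 * (zz + n\<^sup>2)) / 2"
  proof (rule mean_half_pi)
    fix x
    have "\<nu>1 x * \<nu>1 x + \<nu>2 x * \<nu>2 x + (\<nu>1 (x + pi / 2) * \<nu>1 (x + pi / 2) + \<nu>2 (x + pi / 2) * \<nu>2 (x + pi / 2)) =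
      g\<^sup>2 * ((cos (x + \<xi>) + \<kappa> * cos (x - \<xi>))\<^sup>2 + (sin (x + \<xi>) + \<kappa> * sin (x - \<xi>))\<^sup>2) + g\<^sup>2 * n\<^sup>2 * ((sin x)\<^sup>2 + (cos x)\<^sup>2)"
      unfolding nu_half_pi unfolding \<nu>1_def \<nu>2_def by algebra
    then show "\<nu>1 x * \<nu>1 x + \<nu>2 x * \<nu>2 x + (\<nu>1 (x + pi / 2) * \<nu>1 (x + pi / 2) + \<nu>2 (x + pi / 2) * \<nu>2 (x + pi / 2)) =
      g\<^sup>2 * (zz + n\<^sup>2)" unfolding Zcos_squares sin_cos_squared_add by (simp add: algebra_simps)
  qed (auto intro!: cper_add cper_mult)
  then show ?thesis unfolding g2_mult by (simp add: ip_def)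
qed

definition "Zw \<omega> f x = f (x + \<omega>) + \<kappa> * f (x - \<omega>)"
definition "Zwad \<omega> f x = \<kappa> * f (x + \<omega>) + f (x - \<omega>)"
definition "A1 \<omega> p q x = Zw \<omega> q x - (1 + \<kappa>) * p x"
definition "A2 \<omega> p q x = Zwad \<omega> p x - (1 + \<kappa>) * q x"
text \<open>Equal to 1 / (c^2 \<omega>^2) when \<Lambda> = c^2 \<xi>^2; in this form it refers only
  to the parameters of the locale.\<close>

definition "bb \<omega> = \<xi>\<^sup>2 / (\<Lambda> * \<omega>\<^sup>2)"
definition "B1 \<omega> p q x = bb \<omega> * A1 \<omega> p q x"
definition "B2 \<omega> p q x = bb \<omega> * A2 \<omega> p q x"

lemma bb_xi: "bb \<xi> = 1 / \<Lambda>"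
  using xi_pos by (simp add: bb_def)

lemma A_xi: "A1 \<xi> p q x = Z q x - (1 + \<kappa>) * p x" "A2 \<xi> p q x = Zad p x - (1 + \<kappa>) * q x"
  by (simp_all add: A1_def A2_def Zw_def Zwad_def Z_def Zad_def)

lemma cper_AB [intro]:
  assumes "cper p" "cper q"
  shows "cper (A1 \<omega> p q)" "cper (A2 \<omega> p q)" "cper (B1 \<omega> p q)" "cper (B2 \<omega> p q)"
  unfolding A1_def[abs_def] A2_def[abs_def] B1_def[abs_def] B2_def[abs_def] Zw_def Zwad_def
  by (intro cper_mult cper_diff cper_add cper_const cper_shift cper_shift' assms)+

lemma A_diff:
  "A1 \<omega> (\<lambda>x. p x - p' x) (\<lambda>x. q x - q' x) x = A1 \<omega> p q x - A1 \<omega> p' q' x"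
  "A2 \<omega> (\<lambda>x. p x - p' x) (\<lambda>x. q x - q' x) x = A2 \<omega> p q x - A2 \<omega> p' q' x"
  by (simp_all add: A1_def A2_def Zw_def Zwad_def algebra_simps)

lemma A_add:
  "A1 \<omega> (\<lambda>x. p x + p' x) (\<lambda>x. q x + q' x) x = A1 \<omega> p q x + A1 \<omega> p' q' x"
  "A2 \<omega> (\<lambda>x. p x + p' x) (\<lambda>x. q x + q' x) x = A2 \<omega> p q x + A2 \<omega> p' q' x"
  by (simp_all add: A1_def A2_def Zw_def Zwad_def algebra_simps)

text \<open>The shifts by \<omega> and -\<omega> are adjoint with respect to the mean, and
  \<open>Zw\<close>, \<open>Zwad\<close> are built from them with exchanged weights.\<close>

lemma A_symmetric:
  assumes "cper f1" "cper f2" "cper g1" "cper g2"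
  shows "ip (A1 \<omega> f1 f2) (A2 \<omega> f1 f2) g1 g2 = ip f1 f2 (A1 \<omega> g1 g2) (A2 \<omega> g1 g2)"
proof -
  have s: "mean (\<lambda>x. f (x + h) * k x) = mean (\<lambda>x. f x * k (x - h))" if "cper f" "cper k" for f k h
    using mean_shift[of "\<lambda>x. f x * k (x - h)" h] that by (simp add: cper_mult cper_shift')
  have s': "mean (\<lambda>x. f (x - h) * k x) = mean (\<lambda>x. f x * k (x + h))" if "cper f" "cper k" for f k h
    using s[OF that, of "- h"] by simp
  note c = cper_mult[OF cper_shift[where h=\<omega>]] cper_mult[OF cper_shift'[where h=\<omega>]]
    cper_mult[OF _ cper_shift[where h=\<omega>]] cper_mult[OF _ cper_shift'[where h=\<omega>]] cper_mult
  have "ip (A1 \<omega> f1 f2) (A2 \<omega> f1 f2) g1 g2 =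
     mean (\<lambda>x. f2 (x + \<omega>) * g1 x + \<kappa> * (f2 (x - \<omega>) * g1 x) + \<kappa> * (f1 (x + \<omega>) * g2 x) + f1 (x - \<omega>) * g2 x
       + (- (1 + \<kappa>)) * (f1 x * g1 x) + (- (1 + \<kappa>)) * (f2 x * g2 x))"
    unfolding ip_def A1_def A2_def Zw_def Zwad_def by (rule arg_cong[of _ _ mean]) (auto simp: algebra_simps)
  also have "\<dots> = mean (\<lambda>x. f2 (x + \<omega>) * g1 x) + \<kappa> * mean (\<lambda>x. f2 (x - \<omega>) * g1 x) + \<kappa> * mean (\<lambda>x. f1 (x + \<omega>) * g2 x)
      + mean (\<lambda>x. f1 (x - \<omega>) * g2 x) + (- (1 + \<kappa>)) * mean (\<lambda>x. f1 x * g1 x) + (- (1 + \<kappa>)) * mean (\<lambda>x. f2 x * g2 x)"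
    by (simp only: mean_cmult[symmetric] mean_add[symmetric] c cper_add cper_const assms)
  also have "\<dots> = mean (\<lambda>x. f2 x * g1 (x - \<omega>)) + \<kappa> * mean (\<lambda>x. f2 x * g1 (x + \<omega>)) + \<kappa> * mean (\<lambda>x. f1 x * g2 (x - \<omega>))
      + mean (\<lambda>x. f1 x * g2 (x + \<omega>)) + (- (1 + \<kappa>)) * mean (\<lambda>x. f1 x * g1 x) + (- (1 + \<kappa>)) * mean (\<lambda>x. f2 x * g2 x)"
    by (simp only: s s' assms)
  also have "\<dots> = mean (\<lambda>x. f2 x * g1 (x - \<omega>) + \<kappa> * (f2 x * g1 (x + \<omega>)) + \<kappa> * (f1 x * g2 (x - \<omega>)) + f1 x * g2 (x + \<omega>)
       + (- (1 + \<kappa>)) * (f1 x * g1 x) + (- (1 + \<kappa>)) * (f2 x * g2 x))"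
    by (simp only: mean_cmult[symmetric] mean_add[symmetric] c cper_add cper_const assms)
  also have "\<dots> = ip f1 f2 (A1 \<omega> g1 g2) (A2 \<omega> g1 g2)"
    unfolding ip_def A1_def A2_def Zw_def Zwad_def by (rule arg_cong[of _ _ mean]) (auto simp: algebra_simps)
  finally show ?thesis .
qed

lemma abs_comb_le:
  fixes y z :: real
  assumes "\<bar>y\<bar> \<le> d" "\<bar>z\<bar> \<le> d" shows "\<bar>y + \<kappa> * z\<bar> \<le> (1 + \<kappa>) * d" "\<bar>\<kappa> * y + z\<bar> \<le> (1 + \<kappa>) * d"
proof -
  have "\<bar>\<kappa> * z\<bar> \<le> \<kappa> * d" "\<bar>\<kappa> * y\<bar> \<le> \<kappa> * d" using assms kap_pos by (simp_all add: abs_mult)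
  then show "\<bar>y + \<kappa> * z\<bar> \<le> (1 + \<kappa>) * d" "\<bar>\<kappa> * y + z\<bar> \<le> (1 + \<kappa>) * d"
    using assms unfolding distrib_right by linarith+
qed

lemma A_bdd:
  assumes "bdd d p" "bdd d q"
  shows "\<bar>A1 \<omega> p q x\<bar> \<le> 2 * (1 + \<kappa>) * d" "\<bar>A2 \<omega> p q x\<bar> \<le> 2 * (1 + \<kappa>) * d"
proof -
  have b: "\<bar>p y\<bar> \<le> d" "\<bar>q y\<bar> \<le> d" for y using assms by (auto simp: bdd_def)
  have "\<bar>(1 + \<kappa>) * p x\<bar> \<le> (1 + \<kappa>) * d" "\<bar>(1 + \<kappa>) * q x\<bar> \<le> (1 + \<kappa>) * d"
    using b kap_pos by (simp_all add: abs_mult)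
  then show "\<bar>A1 \<omega> p q x\<bar> \<le> 2 * (1 + \<kappa>) * d" "\<bar>A2 \<omega> p q x\<bar> \<le> 2 * (1 + \<kappa>) * d"
    unfolding A1_def A2_def Zw_def Zwad_def
    using abs_comb_le(1)[OF b(2)[of "x + \<omega>"] b(2)[of "x - \<omega>"]] abs_comb_le(2)[OF b(1)[of "x + \<omega>"] b(1)[of "x - \<omega>"]] by linarith+
qed

lemma A_omega_lip:
  assumes "lip l p" "lip l q"
  shows "\<bar>A1 \<omega> p q x - A1 \<omega>' p q x\<bar> \<le> (1 + \<kappa>) * (l * \<bar>\<omega> - \<omega>'\<bar>)"
    "\<bar>A2 \<omega> p q x - A2 \<omega>' p q x\<bar> \<le> (1 + \<kappa>) * (l * \<bar>\<omega> - \<omega>'\<bar>)"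
proof -
  have b: "\<bar>f (x + \<omega>) - f (x + \<omega>')\<bar> \<le> l * \<bar>\<omega> - \<omega>'\<bar>" "\<bar>f (x - \<omega>) - f (x - \<omega>')\<bar> \<le> l * \<bar>\<omega> - \<omega>'\<bar>" if "lip l f" for f
  proof -
    have "\<bar>(x - \<omega>) - (x - \<omega>')\<bar> = \<bar>\<omega> - \<omega>'\<bar>" "\<bar>(x + \<omega>) - (x + \<omega>')\<bar> = \<bar>\<omega> - \<omega>'\<bar>" by linarith+
    then show "\<bar>f (x + \<omega>) - f (x + \<omega>')\<bar> \<le> l * \<bar>\<omega> - \<omega>'\<bar>" "\<bar>f (x - \<omega>) - f (x - \<omega>')\<bar> \<le> l * \<bar>\<omega> - \<omega>'\<bar>"
      using that unfolding lip_def by metis+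
  qed
  show "\<bar>A1 \<omega> p q x - A1 \<omega>' p q x\<bar> \<le> (1 + \<kappa>) * (l * \<bar>\<omega> - \<omega>'\<bar>)"
    using abs_comb_le(1)[OF b[OF assms(2)]] by (simp add: A1_def Zw_def algebra_simps)
  show "\<bar>A2 \<omega> p q x - A2 \<omega>' p q x\<bar> \<le> (1 + \<kappa>) * (l * \<bar>\<omega> - \<omega>'\<bar>)"
    using abs_comb_le(2)[OF b[OF assms(1)]] by (simp add: A2_def Zwad_def algebra_simps)
qed

text \<open>Translation invariance moves the shifts by \<omega> from the argument of the inverse to
  its values. The frequency then acts on functions that the inverse has made Lipschitz.\<close>

lemma K_B:
  assumes "cper g1" "cper g2"
  shows "K1 (B1 \<omega> g1 g2) (B2 \<omega> g1 g2) x = bb \<omega> *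
      (K1 g2 (\<lambda>x. \<kappa> * g1 x) (x + \<omega>) + K1 (\<lambda>x. \<kappa> * g2 x) g1 (x - \<omega>) - (1 + \<kappa>) * K1 g1 g2 x)"
    "K2 (B1 \<omega> g1 g2) (B2 \<omega> g1 g2) x = bb \<omega> *
      (K2 g2 (\<lambda>x. \<kappa> * g1 x) (x + \<omega>) + K2 (\<lambda>x. \<kappa> * g2 x) g1 (x - \<omega>) - (1 + \<kappa>) * K2 g1 g2 x)"
proof -
  have B: "B1 \<omega> g1 g2 = (\<lambda>x. bb \<omega> * ((g2 (x + \<omega>) + \<kappa> * g2 (x + (- \<omega>))) + (- (1 + \<kappa>)) * g1 x))"
    "B2 \<omega> g1 g2 = (\<lambda>x. bb \<omega> * ((\<kappa> * g1 (x + \<omega>) + g1 (x + (- \<omega>))) + (- (1 + \<kappa>)) * g2 x))"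
    by (auto simp: B1_def B2_def A1_def A2_def Zw_def Zwad_def fun_eq_iff algebra_simps)
  have c: "cper (\<lambda>x. g1 (x + h))" "cper (\<lambda>x. g2 (x + h))" "cper (\<lambda>x. \<kappa> * g1 (x + h))" "cper (\<lambda>x. \<kappa> * g2 (x + h))"
     "cper (\<lambda>x. (- (1 + \<kappa>)) * g1 x)" "cper (\<lambda>x. (- (1 + \<kappa>)) * g2 x)"
     "cper (\<lambda>x. \<kappa> * g1 x)" "cper (\<lambda>x. \<kappa> * g2 x)" for h
    by (intro cper_mult cper_const cper_shift assms)+
  note d = cper_add[OF c(2)[of \<omega>] c(4)[of "- \<omega>"]] cper_add[OF c(3)[of \<omega>] c(1)[of "- \<omega>"]]
  note e = cper_add[OF d(1) c(5)] cper_add[OF d(2) c(6)]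
  have sh: "K1 (\<lambda>x. g2 (x + h)) (\<lambda>x. \<kappa> * g1 (x + h)) x = K1 g2 (\<lambda>x. \<kappa> * g1 x) (x + h)"
     "K2 (\<lambda>x. g2 (x + h)) (\<lambda>x. \<kappa> * g1 (x + h)) x = K2 g2 (\<lambda>x. \<kappa> * g1 x) (x + h)"
     "K1 (\<lambda>x. \<kappa> * g2 (x + h)) (\<lambda>x. g1 (x + h)) x = K1 (\<lambda>x. \<kappa> * g2 x) g1 (x + h)"
     "K2 (\<lambda>x. \<kappa> * g2 (x + h)) (\<lambda>x. g1 (x + h)) x = K2 (\<lambda>x. \<kappa> * g2 x) g1 (x + h)" for h
    using K_shift[OF assms(2) c(7), of h x] K_shift[OF c(8) assms(1), of h x] by simp_all
  show "K1 (B1 \<omega> g1 g2) (B2 \<omega> g1 g2) x = bb \<omega> *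
      (K1 g2 (\<lambda>x. \<kappa> * g1 x) (x + \<omega>) + K1 (\<lambda>x. \<kappa> * g2 x) g1 (x - \<omega>) - (1 + \<kappa>) * K1 g1 g2 x)"
    "K2 (B1 \<omega> g1 g2) (B2 \<omega> g1 g2) x = bb \<omega> *
      (K2 g2 (\<lambda>x. \<kappa> * g1 x) (x + \<omega>) + K2 (\<lambda>x. \<kappa> * g2 x) g1 (x - \<omega>) - (1 + \<kappa>) * K2 g1 g2 x)"
    unfolding B
    by (simp_all only: K_cmult[OF e] K_add[OF d c(5,6)] K_cmult[OF assms]
        K_add[OF c(2)[of \<omega>] c(3)[of \<omega>] c(4)[of "- \<omega>"] c(1)[of "- \<omega>"]] sh) (simp_all add: algebra_simps)
qed

text \<open>The assumptions give \<omega> >= \<xi> / 2 and \<Lambda> >= 1, and the constants refer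
  to \<xi> only through its lower bound \<open>x0\<close>.\<close>

lemma bb_bounds:
  assumes "\<bar>\<omega> - \<xi>\<bar> \<le> x0 / 2" "\<bar>\<omega>' - \<xi>\<bar> \<le> x0 / 2" "0 < x0" "x0 \<le> \<xi>"
  shows "0 < bb \<omega>" "bb \<omega> \<le> 4" "\<bar>bb \<omega> - bb \<omega>'\<bar> \<le> 16 / x0 * \<bar>\<omega> - \<omega>'\<bar>"
proof -
  have w: "\<omega> \<ge> \<xi> / 2" "\<omega>' \<ge> \<xi> / 2" "\<omega> > 0" "\<omega>' > 0" using assms by linarith+
  have L: "\<Lambda> \<ge> 1" using n_pos kap_pos by (simp add: n_def)
  show "0 < bb \<omega>" using w xi_pos lam_pos by (simp add: bb_def)
  have "(\<xi> / 2)\<^sup>2 \<le> \<omega>\<^sup>2" using w xi_pos by (intro power_mono) auto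
  then have "\<xi>\<^sup>2 \<le> 4 * \<omega>\<^sup>2 * 1" by (simp add: power_divide)
  also have "\<dots> \<le> 4 * \<omega>\<^sup>2 * \<Lambda>" using L by (intro mult_left_mono) auto
  finally show "bb \<omega> \<le> 4" using w lam_pos by (simp add: bb_def pos_divide_le_eq algebra_simps)
  have inv: "1 / \<omega> \<le> 2 / \<xi>" "1 / \<omega>' \<le> 2 / \<xi>" using w xi_pos by (simp_all add: field_simps)
  have pos: "1 / \<omega> > 0" "1 / \<omega>' > 0" "2 / \<xi> > 0" using w xi_pos by auto
  have "bb \<omega> - bb \<omega>' = (\<xi>\<^sup>2 / \<Lambda>) * ((\<omega>' - \<omega>) * ((1 / \<omega>) * (1 / \<omega>') * (1 / \<omega> + 1 / \<omega>')))"
    using w lam_pos by (simp add: bb_def field_simps power2_eq_square)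
  then have "\<bar>bb \<omega> - bb \<omega>'\<bar> = (\<xi>\<^sup>2 / \<Lambda>) * (\<bar>\<omega> - \<omega>'\<bar> * ((1 / \<omega>) * (1 / \<omega>') * (1 / \<omega> + 1 / \<omega>')))"
    using w lam_pos by (simp add: abs_mult abs_minus_commute)
  also have "\<dots> \<le> (\<xi>\<^sup>2 / 1) * (\<bar>\<omega> - \<omega>'\<bar> * ((2 / \<xi>) * (2 / \<xi>) * (2 / \<xi> + 2 / \<xi>)))"
    using inv pos L lam_pos by (intro mult_mono add_mono divide_left_mono) auto
  also have "\<dots> = 16 / \<xi> * \<bar>\<omega> - \<omega>'\<bar>" using xi_pos by (simp add: field_simps power2_eq_square)
  also have "\<dots> \<le> 16 / x0 * \<bar>\<omega> - \<omega>'\<bar>"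
    using assms by (intro mult_right_mono divide_left_mono) auto
  finally show "\<bar>bb \<omega> - bb \<omega>'\<bar> \<le> 16 / x0 * \<bar>\<omega> - \<omega>'\<bar>" .
qed

lemma B_omega_lip:
  assumes "\<bar>\<omega> - \<xi>\<bar> \<le> x0 / 2" "\<bar>\<omega>' - \<xi>\<bar> \<le> x0 / 2" "0 < x0" "x0 \<le> \<xi>" 
    and "bdd d p" "bdd d q" "lip l p" "lip l q"
  defines "C \<equiv> (1 + \<kappa>) * (2 * (16 / x0) * d + 4 * l) * \<bar>\<omega> - \<omega>'\<bar>"
  shows "bdd C (\<lambda>x. B1 \<omega> p q x - B1 \<omega>' p q x)" "bdd C (\<lambda>x. B2 \<omega> p q x - B2 \<omega>' p q x)"
proof -
  note b = bb_bounds[OF assms(1-4)] bb_bounds(1,2)[OF assms(2,1,3,4)]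
  have b4: "\<bar>bb \<omega>'\<bar> \<le> 4" using b by simp
  have eq: "16 / x0 * \<bar>\<omega> - \<omega>'\<bar> * (2 * (1 + \<kappa>) * d) + 4 * ((1 + \<kappa>) * (l * \<bar>\<omega> - \<omega>'\<bar>)) = C"
    by (simp add: C_def algebra_simps)
  show "bdd C (\<lambda>x. B1 \<omega> p q x - B1 \<omega>' p q x)" "bdd C (\<lambda>x. B2 \<omega> p q x - B2 \<omega>' p q x)"
    unfolding bdd_def B1_def B2_def eq[symmetric]
    using abs_mult_diff_le[OF b(3) A_bdd(1)[OF assms(5,6)] b4 A_omega_lip(1)[OF assms(7,8)]]
      abs_mult_diff_le[OF b(3) A_bdd(2)[OF assms(5,6)] b4 A_omega_lip(2)[OF assms(7,8)]]
    by blast+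
qed

definition "KB x0 = (1 + \<kappa>) * (3 * (16 / x0) * KC * (1 + \<kappa>) + 8 * LK * (1 + \<kappa>))"

text \<open>In contrast to \<open>B_omega_lip\<close>, the profile enters through its supremum norm
  alone. That matters for the difference of two candidate profiles, which is small in this norm
  only.\<close>

lemma K_B_omega_lip:
  assumes "\<bar>\<omega> - \<xi>\<bar> \<le> x0 / 2" "\<bar>\<omega>' - \<xi>\<bar> \<le> x0 / 2" "0 < x0" "x0 \<le> \<xi>" 
    and c: "cper p" "cper q" and d: "bdd d p" "bdd d q"
  shows "bdd (KB x0 * d * \<bar>\<omega> - \<omega>'\<bar>) (\<lambda>x. K1 (B1 \<omega> p q) (B2 \<omega> p q) x - K1 (B1 \<omega>' p q) (B2 \<omega>' p q) x)"
    "bdd (KB x0 * d * \<bar>\<omega> - \<omega>'\<bar>) (\<lambda>x. K2 (B1 \<omega> p q) (B2 \<omega> p q) x - K2 (B1 \<omega>' p q) (B2 \<omega>' p q) x)"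
proof -
  note b = bb_bounds[OF assms(1-4)] bb_bounds(1,2)[OF assms(2,1,3,4)]
  have b4: "\<bar>bb \<omega>'\<bar> \<le> 4" using b by simp
  define e where "e = (1 + \<kappa>) * d"
  have d0: "d \<ge> 0" using bdd_nonneg[OF d(1)] .
  have e: "d \<le> e" "\<kappa> * d \<le> e" using d0 kap_pos by (simp_all add: e_def algebra_simps)
  have cc: "cper (\<lambda>x. \<kappa> * p x)" "cper (\<lambda>x. \<kappa> * q x)" using c by auto
  have de: "bdd e p" "bdd e q" "bdd e (\<lambda>x. \<kappa> * p x)" "bdd e (\<lambda>x. \<kappa> * q x)"
    using bdd_mono[OF d(1) e(1)] bdd_mono[OF d(2) e(1)] bdd_mono[OF bdd_cmult[OF d(1), of \<kappa>]] bdd_mono[OF bdd_cmult[OF d(2), of \<kappa>]] kap_pos e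
    by auto
  have core: "bdd (KB x0 * d * \<bar>\<omega> - \<omega>'\<bar>) (\<lambda>x. bb \<omega> * (U (x + \<omega>) + V (x - \<omega>) - (1 + \<kappa>) * W x)
      - bb \<omega>' * (U (x + \<omega>') + V (x - \<omega>') - (1 + \<kappa>) * W x))"
    if "bdd (KC * e) U" "bdd (KC * e) V" "bdd (KC * d) W" "lip (LK * e) U" "lip (LK * e) V" for U V W
    unfolding bdd_def
  proof
    fix x
    have u: "\<bar>U (x + \<omega>)\<bar> \<le> KC * e" "\<bar>V (x - \<omega>)\<bar> \<le> KC * e" "\<bar>(1 + \<kappa>) * W x\<bar> \<le> KC * e"
    proof -
      have "(1 + \<kappa>) * \<bar>W x\<bar> \<le> (1 + \<kappa>) * (KC * d)"
        using that(3) kap_pos by (intro mult_left_mono) (auto simp: bdd_def)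
      then show "\<bar>(1 + \<kappa>) * W x\<bar> \<le> KC * e"
        using kap_pos by (simp add: abs_mult e_def mult_ac)
    qed (use that(1,2) in \<open>auto simp: bdd_def\<close>)
    have uv: "\<bar>U (x + \<omega>) - U (x + \<omega>')\<bar> \<le> LK * e * \<bar>\<omega> - \<omega>'\<bar>" "\<bar>V (x - \<omega>) - V (x - \<omega>')\<bar> \<le> LK * e * \<bar>\<omega> - \<omega>'\<bar>"
    proof -
      have "\<bar>(x - \<omega>) - (x - \<omega>')\<bar> = \<bar>\<omega> - \<omega>'\<bar>" "\<bar>(x + \<omega>) - (x + \<omega>')\<bar> = \<bar>\<omega> - \<omega>'\<bar>" by linarith+
      then show "\<bar>U (x + \<omega>) - U (x + \<omega>')\<bar> \<le> LK * e * \<bar>\<omega> - \<omega>'\<bar>" "\<bar>V (x - \<omega>) - V (x - \<omega>')\<bar> \<le> LK * e * \<bar>\<omega> - \<omega>'\<bar>"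
        using that(4,5) unfolding lip_def by metis+
    qed
    have 1: "\<bar>U (x + \<omega>) + V (x - \<omega>) - (1 + \<kappa>) * W x\<bar> \<le> 3 * (KC * e)" using u by linarith
    have 2: "\<bar>U (x + \<omega>) + V (x - \<omega>) - (1 + \<kappa>) * W x - (U (x + \<omega>') + V (x - \<omega>') - (1 + \<kappa>) * W x)\<bar>
      \<le> 2 * (LK * e * \<bar>\<omega> - \<omega>'\<bar>)" using uv by linarith
    have "16 / x0 * \<bar>\<omega> - \<omega>'\<bar> * (3 * (KC * e)) + 4 * (2 * (LK * e * \<bar>\<omega> - \<omega>'\<bar>)) =
        (3 * (16 / x0) * KC * (1 + \<kappa>) + 8 * LK * (1 + \<kappa>)) * d * \<bar>\<omega> - \<omega>'\<bar>"
      by (simp add: e_def algebra_simps add_divide_distrib)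
    also have "\<dots> \<le> KB x0 * d * \<bar>\<omega> - \<omega>'\<bar>"
      unfolding KB_def using d0 kap_pos KC_nonneg LK_nonneg assms(3)
      by (intro mult_right_mono) (auto simp: mult_le_cancel_right1 not_less intro!: add_nonneg_nonneg)
    finally show "\<bar>bb \<omega> * (U (x + \<omega>) + V (x - \<omega>) - (1 + \<kappa>) * W x)
      - bb \<omega>' * (U (x + \<omega>') + V (x - \<omega>') - (1 + \<kappa>) * W x)\<bar> \<le> KB x0 * d * \<bar>\<omega> - \<omega>'\<bar>"
      using abs_mult_diff_le[OF b(3) 1 b4 2] by linarith
  qed
  show "bdd (KB x0 * d * \<bar>\<omega> - \<omega>'\<bar>) (\<lambda>x. K1 (B1 \<omega> p q) (B2 \<omega> p q) x - K1 (B1 \<omega>' p q) (B2 \<omega>' p q) x)"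
    unfolding K_B[OF c] using c d cc de by (intro core K_bdd K_lip) auto
  show "bdd (KB x0 * d * \<bar>\<omega> - \<omega>'\<bar>) (\<lambda>x. K2 (B1 \<omega> p q) (B2 \<omega> p q) x - K2 (B1 \<omega>' p q) (B2 \<omega>' p q) x)"
    unfolding K_B[OF c] using c d cc de by (intro core K_bdd K_lip) auto
qed

section \<open>Transversality\<close>

text \<open>\<open>G \<omega>\<close> is the quadratic form of the lattice operator at \<nu>; \<tau>
  is the derivative of \<open>bb * G\<close> at \<xi>, hence the slope of the bifurcation equation
  in the frequency.\<close>

definition "G \<omega> = - (1 + \<kappa>) - g\<^sup>2 * n * ((1 + \<kappa>\<^sup>2) * cos (\<omega> - \<xi>) + 2 * \<kappa> * cos (\<omega> + \<xi>))"
definition "\<tau> = g\<^sup>2 * ((zz + m * n\<^sup>2) / \<xi> + 2 * \<kappa> * n * sin (2 * \<xi>) / \<Lambda>)"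

lemma ip_A_nu: "ip (A1 \<omega> \<nu>1 \<nu>2) (A2 \<omega> \<nu>1 \<nu>2) \<nu>1 \<nu>2 = G \<omega>"
proof -
  let ?r = "(1 + \<kappa>\<^sup>2) * cos (\<omega> - \<xi>) + 2 * \<kappa> * cos (\<omega> + \<xi>)"
  have c: "cper (Zw \<omega> \<nu>2)" "cper (Zwad \<omega> \<nu>1)"
    unfolding Zw_def[abs_def] Zwad_def[abs_def] by (intro cper_add cper_mult cper_const cper_shift cper_shift' cper_nu)+
  have 1: "mean (\<lambda>x. Zw \<omega> \<nu>2 x * \<nu>1 x) = - (g\<^sup>2 * n * ?r) / 2"
  proof (rule mean_half_pi)
    fix x
    have sh: "x + pi / 2 + \<omega> = (x + \<omega>) + pi / 2" "x + pi / 2 - \<omega> = (x - \<omega>) + pi / 2" by simp_all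
    have "Zw \<omega> \<nu>2 x * \<nu>1 x + Zw \<omega> \<nu>2 (x + pi / 2) * \<nu>1 (x + pi / 2) =
      - g\<^sup>2 * n * ((cos (x + \<omega>) * cos (x + \<xi>) + sin (x + \<omega>) * sin (x + \<xi>))
        + \<kappa> * (cos (x + \<omega>) * cos (x - \<xi>) + sin (x + \<omega>) * sin (x - \<xi>))
        + \<kappa> * (cos (x - \<omega>) * cos (x + \<xi>) + sin (x - \<omega>) * sin (x + \<xi>))
        + \<kappa>\<^sup>2 * (cos (x - \<omega>) * cos (x - \<xi>) + sin (x - \<omega>) * sin (x - \<xi>)))"
      unfolding Zw_def sh nu_half_pi unfolding \<nu>1_def \<nu>2_def by algebra
    also have "\<dots> = - g\<^sup>2 * n * (cos (\<omega> - \<xi>) + \<kappa> * cos (\<omega> + \<xi>) + \<kappa> * cos (- (\<omega> + \<xi>)) + \<kappa>\<^sup>2 * cos (- (\<omega> - \<xi>)))"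
      unfolding cos_diff[symmetric] by (simp add: algebra_simps)
    also have "\<dots> = - (g\<^sup>2 * n * ?r)" unfolding cos_minus by (simp add: algebra_simps)
    finally show "Zw \<omega> \<nu>2 x * \<nu>1 x + Zw \<omega> \<nu>2 (x + pi / 2) * \<nu>1 (x + pi / 2) = - (g\<^sup>2 * n * ?r)" .
  qed (intro cper_mult c cper_nu)
  have 2: "mean (\<lambda>x. Zwad \<omega> \<nu>1 x * \<nu>2 x) = mean (\<lambda>x. Zw \<omega> \<nu>2 x * \<nu>1 x)"
    using A_symmetric[of \<nu>1 "\<lambda>x. 0" "\<lambda>x. 0" \<nu>2 \<omega>]
    by (simp add: ip_def A1_def A2_def Zw_def Zwad_def mult.commute)
  have "ip (A1 \<omega> \<nu>1 \<nu>2) (A2 \<omega> \<nu>1 \<nu>2) \<nu>1 \<nu>2 =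
     mean (\<lambda>x. Zw \<omega> \<nu>2 x * \<nu>1 x + Zwad \<omega> \<nu>1 x * \<nu>2 x + (- (1 + \<kappa>)) * (\<nu>1 x * \<nu>1 x + \<nu>2 x * \<nu>2 x))"
    unfolding ip_def A1_def A2_def by (rule arg_cong[of _ _ mean]) (auto simp: algebra_simps)
  also have "\<dots> = mean (\<lambda>x. Zw \<omega> \<nu>2 x * \<nu>1 x) + mean (\<lambda>x. Zwad \<omega> \<nu>1 x * \<nu>2 x) + (- (1 + \<kappa>)) * ip \<nu>1 \<nu>2 \<nu>1 \<nu>2"
    unfolding ip_def by (simp only: mean_cmult[symmetric] mean_add[symmetric] cper_mult cper_add cper_const c cper_nu)
  finally show ?thesis unfolding 1 2 ip_nu G_def by simp
qed

lemma ip_B_nu: "ip (B1 \<omega> \<nu>1 \<nu>2) (B2 \<omega> \<nu>1 \<nu>2) \<nu>1 \<nu>2 = bb \<omega> * G \<omega>"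
  unfolding B1_def[abs_def] B2_def[abs_def] ip_cmult ip_A_nu ..

definition "G0 = (1 + \<kappa>) + 2 / n0 * (1 + \<kappa>)\<^sup>2"
definition "Cq x0 = G0 * (96 / x0\<^sup>2 + 32 / x0 + 4)"

text \<open>The product rule for \<open>bb * G\<close> at \<xi>, with -2 / \<xi> stemming from
  \<open>bb\<close>; the eigenvalue equation \<open>zz_n\<close> collects the first term into zz + m
  n^2.\<close>

lemma G_xi: "- 2 * G \<xi> / \<xi> + g\<^sup>2 * n * 2 * \<kappa> * sin (2 * \<xi>) = \<Lambda> * \<tau>"
proof -
  have k: "1 + \<kappa> = (1 + \<kappa>) * (g\<^sup>2 * (zz + n\<^sup>2)) / 2" unfolding g2_mult by simp
  have "- 2 * G \<xi> = 2 * (1 + \<kappa>) + 2 * (g\<^sup>2 * n * zz)" by (simp add: G_def zz_def)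
  also have "\<dots> = g\<^sup>2 * ((1 + \<kappa>) * (zz + n\<^sup>2) + 2 * n * zz)"
    by (subst k) (simp add: algebra_simps)
  also have "(1 + \<kappa>) * (zz + n\<^sup>2) + 2 * n * zz = \<Lambda> * (zz + m * n\<^sup>2)"
    unfolding zz_n by (simp add: n_def algebra_simps power2_eq_square)
  finally show ?thesis using xi_pos lam_pos by (simp add: \<tau>_def field_simps)
qed

text \<open>On the interval of radius \<open>r\<close> the second derivative of
  \<open>bb * G\<close> is at most \<open>Cq x0\<close>, so its slope stays within
  \<open>Cq x0 * r\<close> of the value \<tau> at \<xi>.\<close>

lemma q_estimate:
  assumes r: "0 \<le> r" "r \<le> x0 / 2" "0 < x0" "x0 \<le> \<xi>" and w: "\<bar>\<omega> - \<xi>\<bar> \<le> r" "\<bar>\<omega>' - \<xi>\<bar> \<le> r"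
  shows "\<bar>(bb \<omega> * G \<omega> - bb \<omega>' * G \<omega>') - \<tau> * (\<omega> - \<omega>')\<bar> \<le> Cq x0 * r * \<bar>\<omega> - \<omega>'\<bar>"
proof -
  define S where "S = {\<xi> - r..\<xi> + r}"
  define c s where "c \<omega> = (1 + \<kappa>\<^sup>2) * cos (\<omega> - \<xi>) + 2 * \<kappa> * cos (\<omega> + \<xi>)"
    and "s \<omega> = (1 + \<kappa>\<^sup>2) * sin (\<omega> - \<xi>) + 2 * \<kappa> * sin (\<omega> + \<xi>)" for \<omega>
  have S: "z \<ge> x0 / 2" "z > 0" "\<bar>z - \<xi>\<bar> \<le> x0 / 2" if "z \<in> S" for z
    using that r unfolding S_def atLeastAtMost_iff abs_le_iff by linarith+
  have dG: "(G has_real_derivative g\<^sup>2 * n * s z) (at z within A)" for z A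
    unfolding G_def[abs_def] s_def by (auto intro!: derivative_eq_intros simp: algebra_simps)
  have dG': "((\<lambda>z. g\<^sup>2 * n * s z) has_real_derivative g\<^sup>2 * n * c z) (at z within A)" for z A
    unfolding s_def c_def by (auto intro!: derivative_eq_intros simp: algebra_simps)
  have db: "(bb has_real_derivative - 2 * bb z / z) (at z within A)" if "z > 0" for z A
    unfolding bb_def[abs_def] using that lam_pos
    by (auto intro!: derivative_eq_intros simp: field_simps power2_eq_square)
  define q1 where "q1 z = - 2 * bb z / z * G z + bb z * (g\<^sup>2 * n * s z)" for z
  define q2 where "q2 z = 6 * bb z / z\<^sup>2 * G z - 4 * bb z / z * (g\<^sup>2 * n * s z) + bb z * (g\<^sup>2 * n * c z)" for z
  have d1: "((\<lambda>z. bb z * G z) has_real_derivative q1 z) (at z within S)" if "z \<in> S" for z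
    unfolding q1_def using DERIV_mult[OF db[OF S(2)[OF that]] dG[of z]] by (simp add: algebra_simps)
  have d2: "(q1 has_real_derivative q2 z) (at z within S)" if "z \<in> S" for z
  proof -
    note z = S(2)[OF that]
    have "((\<lambda>z. - 2 * bb z / z) has_real_derivative 6 * bb z / z\<^sup>2) (at z within S)"
      using z by (auto intro!: derivative_eq_intros db simp: field_simps power2_eq_square)
    from DERIV_add[OF DERIV_mult[OF this dG[of z]] DERIV_mult[OF db[OF z] dG'[of z]]]
    show ?thesis unfolding q1_def[abs_def] q2_def by (simp add: algebra_simps)
  qed
  have gn: "0 \<le> g\<^sup>2 * n" "g\<^sup>2 * n \<le> 2 / n0"
  proof -
    show "0 \<le> g\<^sup>2 * n" using n_pos by simp
    have "g\<^sup>2 * n \<le> 2 / n\<^sup>2 * n" unfolding g2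
      using n_pos zz_nonneg by (intro mult_right_mono divide_left_mono) (auto intro!: mult_pos_pos add_nonneg_pos)
    also have "\<dots> = 2 / n" using n_pos by (simp add: power2_eq_square)
    also have "\<dots> \<le> 2 / n0" using n_ge n0_pos by (intro divide_left_mono) (auto simp: n_def)
    finally show "g\<^sup>2 * n \<le> 2 / n0" .
  qed
  have comb: "\<bar>(1 + \<kappa>\<^sup>2) * y + 2 * \<kappa> * z\<bar> \<le> (1 + \<kappa>)\<^sup>2" if "\<bar>y\<bar> \<le> 1" "\<bar>z\<bar> \<le> 1" for y z
  proof -
    have "\<bar>(1 + \<kappa>\<^sup>2) * y\<bar> \<le> (1 + \<kappa>\<^sup>2) * 1" "\<bar>2 * \<kappa> * z\<bar> \<le> 2 * \<kappa> * 1"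
      unfolding abs_mult using that kap_pos by (intro mult_mono; auto)+
    then show ?thesis by (simp add: power2_sum)
  qed
  have sc: "\<bar>s z\<bar> \<le> (1 + \<kappa>)\<^sup>2" "\<bar>c z\<bar> \<le> (1 + \<kappa>)\<^sup>2" for z
    unfolding s_def c_def by (intro comb; simp)+
  have gs: "\<bar>g\<^sup>2 * n * y\<bar> \<le> 2 / n0 * (1 + \<kappa>)\<^sup>2" if "\<bar>y\<bar> \<le> (1 + \<kappa>)\<^sup>2" for y
    unfolding abs_mult[of "g\<^sup>2 * n"] using gn that by (intro mult_mono) linarith+
  have G0: "\<bar>g\<^sup>2 * n * s z\<bar> \<le> G0" "\<bar>g\<^sup>2 * n * c z\<bar> \<le> G0" "\<bar>G z\<bar> \<le> G0" for z
    using gs[OF sc(1)[of z]] gs[OF sc(2)[of z]] kap_pos n0_pos unfolding G0_def G_def c_def[symmetric] by linarith+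
  have G0n: "G0 \<ge> 0" using abs_ge_zero G0 order_trans by blast
  have q2: "\<bar>q2 z\<bar> \<le> Cq x0" if "z \<in> S" for z
  proof -
    note z = S[OF that]
    have b: "0 < bb z" "bb z \<le> 4" using bb_bounds[OF z(3,3) r(3,4)] by auto
    have i: "1 / z \<le> 2 / x0" "0 < 1 / z" using z r by (auto simp: field_simps)
    have i2: "1 / z\<^sup>2 \<le> 4 / x0\<^sup>2" using power_mono[OF i(1), of 2] i(2) by (simp add: power_divide)
    have "\<bar>6 * bb z / z\<^sup>2 * G z\<bar> \<le> (6 * 4 * (4 / x0\<^sup>2)) * G0"
    proof -
      have "\<bar>6 * bb z / z\<^sup>2\<bar> = 6 * bb z * (1 / z\<^sup>2)" using b by simp
      also have "\<dots> \<le> 6 * 4 * (4 / x0\<^sup>2)" using b i2 by (intro mult_mono) auto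
      finally show ?thesis unfolding abs_mult[of _ "G z"] using G0 by (intro mult_mono) auto
    qed
    moreover have "\<bar>4 * bb z / z * (g\<^sup>2 * n * s z)\<bar> \<le> (4 * 4 * (2 / x0)) * G0"
    proof -
      have "\<bar>4 * bb z / z\<bar> = 4 * bb z * (1 / z)" using b z by simp
      also have "\<dots> \<le> 4 * 4 * (2 / x0)" using b i by (intro mult_mono) auto
      finally show ?thesis unfolding abs_mult[of _ "g\<^sup>2 * n * s z"] using G0 r by (intro mult_mono) auto
    qed
    moreover have "\<bar>bb z * (g\<^sup>2 * n * c z)\<bar> \<le> 4 * G0"
      unfolding abs_mult[of "bb z"] using G0 b by (intro mult_mono) auto
    moreover have "(6 * 4 * (4 / x0\<^sup>2)) * G0 + (4 * 4 * (2 / x0)) * G0 + 4 * G0 = Cq x0"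
      by (simp add: Cq_def algebra_simps)
    ultimately show ?thesis unfolding q2_def by linarith
  qed
  have conv: "convex S" by (simp add: S_def)
  have xiS: "\<xi> \<in> S" using r by (simp add: S_def)
  have q1xi: "q1 \<xi> = \<tau>"
  proof -
    have "q1 \<xi> = (- 2 * G \<xi> / \<xi> + g\<^sup>2 * n * 2 * \<kappa> * sin (2 * \<xi>)) / \<Lambda>"
      using lam_pos xi_pos by (simp add: q1_def bb_xi s_def field_simps)
    then show ?thesis unfolding G_xi using lam_pos by simp
  qed
  have q1: "\<bar>q1 z - \<tau>\<bar> \<le> Cq x0 * r" if "z \<in> S" for z
  proof -
    have "\<bar>q1 z - q1 \<xi>\<bar> \<le> Cq x0 * \<bar>z - \<xi>\<bar>"
      using field_differentiable_bound[OF conv d2, of "Cq x0" z \<xi>] q2 that xiS by simp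
    also have "\<dots> \<le> Cq x0 * r"
      using that G0n r by (intro mult_left_mono) (auto simp: S_def Cq_def abs_le_iff intro!: mult_nonneg_nonneg)
    finally show ?thesis by (simp add: q1xi)
  qed
  have "\<bar>(bb \<omega> * G \<omega> - \<tau> * \<omega>) - (bb \<omega>' * G \<omega>' - \<tau> * \<omega>')\<bar> \<le> Cq x0 * r * \<bar>\<omega> - \<omega>'\<bar>"
  proof -
    have "((\<lambda>z. bb z * G z - \<tau> * z) has_real_derivative q1 z - \<tau>) (at z within S)" if "z \<in> S" for z
      using DERIV_diff[OF d1[OF that] DERIV_cmult[OF DERIV_ident, of \<tau>]] by simp
    from field_differentiable_bound[OF conv this, of "Cq x0 * r" \<omega> \<omega>'] q1 w show ?thesis
      by (auto simp: S_def abs_le_iff)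
  qed
  then show ?thesis by (simp add: algebra_simps)
qed

end

section \<open>Momentum and work of the spring forces\<close>

lemma continuous_antiderivative:
  fixes f :: "real \<Rightarrow> real"
  assumes "continuous_on UNIV f"
  obtains g where "\<And>x. (g has_real_derivative f x) (at x)"
proof -
  have "\<exists>F. \<forall>x. - \<infinity> < ereal x \<longrightarrow> ereal x < \<infinity> \<longrightarrow> (F has_vector_derivative f x) (at x)"
    using assms by (intro einterval_antiderivative) (auto simp: continuous_on_eq_continuous_at)
  then show ?thesis
    using that by (auto simp: has_real_derivative_iff_has_vector_derivative)
qed

definition force1 where "force1 g1 g2 \<omega> p q x = g1 (q (x + \<omega>) - p x) - g2 (p x - q (x - \<omega>))" for x :: real
definition force2 where "force2 g1 g2 \<omega> p q x = g2 (p (x + \<omega>) - q x) - g1 (q x - p (x - \<omega>))" for x :: real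

text \<open>Both forces are differences of the two spring tensions \<open>a1\<close>,
  \<open>a2\<close> and their shifts. In the sum the shifts cancel under the mean; in the work they
  are moved onto \<open>p'\<close> and \<open>q'\<close>, and what results is the derivative of a
  periodic potential energy.\<close>

lemma force_invariants:
  fixes g1 g2 p q p' q' :: "real \<Rightarrow> real"
  assumes g: "continuous_on UNIV g1" "continuous_on UNIV g2" and c: "cper p" "cper q" "cper p'" "cper q'"
    and d: "\<And>x. (p has_real_derivative p' x) (at x)" "\<And>x. (q has_real_derivative q' x) (at x)"
  shows "mean (\<lambda>x. force1 g1 g2 \<omega> p q x + force2 g1 g2 \<omega> p q x) = 0"
    "ip (force1 g1 g2 \<omega> p q) (force2 g1 g2 \<omega> p q) p' q' = 0"
proof -
  obtain W1 W2 where W: "\<And>x. (W1 has_real_derivative g1 x) (at x)" "\<And>x. (W2 has_real_derivative g2 x) (at x)"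
    using continuous_antiderivative g by metis
  define a1 a2 where "a1 x = g1 (q (x + \<omega>) - p x)" and "a2 x = g2 (p (x + \<omega>) - q x)" for x
  have ca: "cper a1" "cper a2" unfolding a1_def[abs_def] a2_def[abs_def]
    by (intro cper_compose[OF g(1)] cper_compose[OF g(2)] cper_diff cper_shift c)+
  have f: "force1 g1 g2 \<omega> p q x = a1 x - a2 (x - \<omega>)" "force2 g1 g2 \<omega> p q x = a2 x - a1 (x - \<omega>)" for x
    by (simp_all add: force1_def force2_def a1_def a2_def)
  note cs = cper_shift'[OF ca(1)] cper_shift'[OF ca(2)]
  show "mean (\<lambda>x. force1 g1 g2 \<omega> p q x + force2 g1 g2 \<omega> p q x) = 0"
    unfolding f by (simp add: mean_add mean_diff mean_shift' ca cs cper_diff)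
  have sh: "mean (\<lambda>x. a (x - \<omega>) * k x) = mean (\<lambda>x. a x * k (x + \<omega>))" if "cper a" "cper k" for a k
    using mean_shift'[of "\<lambda>x. a x * k (x + \<omega>)" \<omega>] that by (simp add: cper_mult cper_shift)
  have dsh: "((\<lambda>x. f (x + \<omega>)) has_real_derivative f' (x + \<omega>)) (at x)"
    if "\<And>x. (f has_real_derivative f' x) (at x)" for f f' :: "real \<Rightarrow> real" and x
    using DERIV_shift[of f "f' (x + \<omega>)" x \<omega>] that by simp
  have z1: "mean (\<lambda>x. a1 x * (q' (x + \<omega>) - p' x)) = 0"
  proof (rule mean_deriv)
    show "((\<lambda>x. W1 (q (x + \<omega>) - p x)) has_real_derivative a1 x * (q' (x + \<omega>) - p' x)) (at x)" for x
      unfolding a1_def by (rule DERIV_chain2[OF W(1)]) (intro DERIV_diff dsh d)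
    show "W1 (q (x + 2 * pi + \<omega>) - p (x + 2 * pi)) = W1 (q (x + \<omega>) - p x)" for x
      using cperD[OF cper_shift[OF c(2)], of x \<omega>] cperD[OF c(1), of x] by simp
  qed
  have z2: "mean (\<lambda>x. a2 x * (p' (x + \<omega>) - q' x)) = 0"
  proof (rule mean_deriv)
    show "((\<lambda>x. W2 (p (x + \<omega>) - q x)) has_real_derivative a2 x * (p' (x + \<omega>) - q' x)) (at x)" for x
      unfolding a2_def by (rule DERIV_chain2[OF W(2)]) (intro DERIV_diff dsh d)
    show "W2 (p (x + 2 * pi + \<omega>) - q (x + 2 * pi)) = W2 (p (x + \<omega>) - q x)" for x
      using cperD[OF cper_shift[OF c(1)], of x \<omega>] cperD[OF c(2), of x] by simp
  qed
  note cm = cper_mult[OF ca(1)] cper_mult[OF ca(2)] cper_mult[OF cs(1)] cper_mult[OF cs(2)]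
  note cq = cper_shift[OF c(3)] cper_shift[OF c(4)]
  have "ip (force1 g1 g2 \<omega> p q) (force2 g1 g2 \<omega> p q) p' q' =
    mean (\<lambda>x. (a1 x * p' x - a2 (x - \<omega>) * p' x) + (a2 x * q' x - a1 (x - \<omega>) * q' x))"
    unfolding ip_def f by (simp add: algebra_simps)
  also have "\<dots> = (mean (\<lambda>x. a1 x * p' x) - mean (\<lambda>x. a2 (x - \<omega>) * p' x)) + (mean (\<lambda>x. a2 x * q' x) - mean (\<lambda>x. a1 (x - \<omega>) * q' x))"
    by (simp only: mean_add mean_diff cm c cper_diff)
  also have "\<dots> = - (mean (\<lambda>x. a1 x * q' (x + \<omega>)) - mean (\<lambda>x. a1 x * p' x)) - (mean (\<lambda>x. a2 x * p' (x + \<omega>)) - mean (\<lambda>x. a2 x * q' x))"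
    by (simp only: sh ca c)
  also have "\<dots> = - mean (\<lambda>x. a1 x * (q' (x + \<omega>) - p' x)) - mean (\<lambda>x. a2 x * (p' (x + \<omega>) - q' x))"
    by (simp only: mean_diff[symmetric] cm c cq) (simp add: right_diff_distrib)
  finally show "ip (force1 g1 g2 \<omega> p q) (force2 g1 g2 \<omega> p q) p' q' = 0" using z1 z2 by simp
qed

lemma abs_diff_le2: "\<bar>y\<bar> \<le> A \<Longrightarrow> \<bar>z\<bar> \<le> A \<Longrightarrow> \<bar>y - z\<bar> \<le> 2 * A" for y z A :: real
  by linarith

lemma abs_diff_diff_le2: "\<bar>y - y'\<bar> \<le> A \<Longrightarrow> \<bar>z - z'\<bar> \<le> A \<Longrightarrow> \<bar>(y - z) - (y' - z')\<bar> \<le> 2 * A"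
  for y z y' z' A :: real
  by linarith

lemma bdd_diff6:
  assumes "bdd 3 p" "bdd 3 q" shows "\<bar>q y - p z\<bar> \<le> 6" "\<bar>p y - q z\<bar> \<le> 6"
  using abs_diff_le2[of "q y" 3 "p z"] abs_diff_le2[of "p y" 3 "q z"] assms by (simp_all add: bdd_def)

section \<open>The nonlinear problem at fixed wave speed\<close>

text \<open>After scaling by the amplitude the spring forces are y + s h1(s, y) and \<kappa> y + s
  h2(s, y). Bounds are asked for |y| <= 6, because profiles are kept within 3 and the forces see
  their differences. \<open>\<tau>0\<close> and \<open>x0\<close> are lower bounds that will be
  chosen independent of the speed.\<close>

locale dimer_nonlinear = dimer +
  fixes h1 h2 :: "real \<Rightarrow> real \<Rightarrow> real" and M \<tau>0 x0 :: real
  assumes x0: "0 < x0" "x0 \<le> \<xi>" and M: "0 \<le> M" and tau: "0 < \<tau>0" "\<tau>0 \<le> \<tau>"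
    and h_cont: "continuous_on UNIV (h1 s)" "continuous_on UNIV (h2 s)"
    and h_bdd: "\<bar>s\<bar> \<le> 1 \<Longrightarrow> \<bar>y\<bar> \<le> 6 \<Longrightarrow> \<bar>h1 s y\<bar> \<le> M \<and> \<bar>h2 s y\<bar> \<le> M"
    and h_lip: "\<bar>s\<bar> \<le> 1 \<Longrightarrow> \<bar>y\<bar> \<le> 6 \<Longrightarrow> \<bar>y'\<bar> \<le> 6 \<Longrightarrow>
      \<bar>h1 s y - h1 s y'\<bar> \<le> M * \<bar>y - y'\<bar> \<and> \<bar>h2 s y - h2 s y'\<bar> \<le> M * \<bar>y - y'\<bar>"
    and h_slip: "\<bar>s\<bar> \<le> 1 \<Longrightarrow> \<bar>s'\<bar> \<le> 1 \<Longrightarrow> \<bar>y\<bar> \<le> 6 \<Longrightarrow>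
      \<bar>h1 s y - h1 s' y\<bar> \<le> M * \<bar>s - s'\<bar> \<and> \<bar>h2 s y - h2 s' y\<bar> \<le> M * \<bar>s - s'\<bar>"
begin

definition "N1 s \<omega> p q x = bb \<omega> * force1 (h1 s) (h2 s) \<omega> p q x"
definition "N2 s \<omega> p q x = bb \<omega> * force2 (h1 s) (h2 s) \<omega> p q x"
definition "P1 p x = \<nu>1 x + p x"
definition "P2 q x = \<nu>2 x + q x"
text \<open>All of the equation but its linear part at \<xi>; the inverse is applied to this
  remainder.\<close>

definition "R1 s \<omega> p q x = B1 \<omega> (P1 p) (P2 q) x - B1 \<xi> (P1 p) (P2 q) x + s * N1 s \<omega> (P1 p) (P2 q) x"
definition "R2 s \<omega> p q x = B2 \<omega> (P1 p) (P2 q) x - B2 \<xi> (P1 p) (P2 q) x + s * N2 s \<omega> (P1 p) (P2 q) x"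
definition "KR1 s \<omega> p q = K1 (R1 s \<omega> p q) (R2 s \<omega> p q)"
definition "KR2 s \<omega> p q = K2 (R1 s \<omega> p q) (R2 s \<omega> p q)"
text \<open>A Newton step with frozen slope \<tau> for the component of the remainder along \<nu>,
  which vanishes at a fixed point. \<open>T1\<close> and \<open>T2\<close> invert and then remove
  the component along \<nu>, since the amplitude is already prescribed.\<close>

definition "T0 s \<omega> p q = \<omega> - ip (R1 s \<omega> p q) (R2 s \<omega> p q) \<nu>1 \<nu>2 / \<tau>"
definition "T1 s \<omega> p q x = KR1 s \<omega> p q x - ip (KR1 s \<omega> p q) (KR2 s \<omega> p q) \<nu>1 \<nu>2 * \<nu>1 x"
definition "T2 s \<omega> p q x = KR2 s \<omega> p q x - ip (KR1 s \<omega> p q) (KR2 s \<omega> p q) \<nu>1 \<nu>2 * \<nu>2 x"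

definition "CH = M * (2 * (16 / x0) + 24)"
definition "CB = (1 + \<kappa>) * (2 * (16 / x0) * 2 + 4 * 2)"
definition "CR = (1 + \<kappa>) * (2 * (16 / x0) * 3 + 4 * 3) + 8 * M"
text \<open>One summand per estimate to be dominated: r <= x0 / 2, the variation of
  \<open>T1\<close>, \<open>T2\<close>, their Lipschitz constants, the variation of
  \<open>T0\<close>, and the dependence of \<open>T0\<close> and of \<open>T1\<close>,
  \<open>T2\<close> on \<open>s\<close>. None involves \<xi> or \<Lambda>, whence the uniformity in
  the speed.\<close>

definition "Q = 1 + 1 / x0 + (27 * KB x0 + 9 * KC * CH) + (LK + 8 * KC) * CR
  + (Cq x0 + 2 * CB + 4 * CH) / \<tau>0 + 64 * M / \<tau>0 + 144 * KC * M"

lemma constants_nonneg: "0 \<le> CH" "0 \<le> CB" "0 \<le> CR" "0 \<le> KB x0" "0 \<le> Cq x0"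
  using x0 M kap_pos KC_nonneg LK_nonneg n0_pos unfolding CH_def CB_def CR_def KB_def Cq_def G0_def
  by (auto intro!: mult_nonneg_nonneg add_nonneg_nonneg divide_nonneg_nonneg)

lemma Q_parts: "Q \<ge> 1" "1 / x0 \<le> Q" "27 * KB x0 + 9 * KC * CH \<le> Q" "(LK + 8 * KC) * CR \<le> Q"
   "(Cq x0 + 2 * CB + 4 * CH) / \<tau>0 \<le> Q" "64 * M / \<tau>0 \<le> Q" "144 * KC * M \<le> Q"
proof -
  have "0 \<le> 1 / x0" "0 \<le> 27 * KB x0 + 9 * KC * CH" "0 \<le> (LK + 8 * KC) * CR"
   "0 \<le> (Cq x0 + 2 * CB + 4 * CH) / \<tau>0" "0 \<le> 64 * M / \<tau>0" "0 \<le> 144 * KC * M"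
    using constants_nonneg x0 M KC_nonneg LK_nonneg tau by auto
  then show "Q \<ge> 1" "1 / x0 \<le> Q" "27 * KB x0 + 9 * KC * CH \<le> Q" "(LK + 8 * KC) * CR \<le> Q"
   "(Cq x0 + 2 * CB + 4 * CH) / \<tau>0 \<le> Q" "64 * M / \<tau>0 \<le> Q" "144 * KC * M \<le> Q"
    unfolding Q_def by linarith+
qed

definition "r = 1 / (32 * Q\<^sup>2)"
definition "a0 = 1 / (256 * Q ^ 4)"

lemma r_bounds: "0 < r" "r \<le> 1" "r \<le> x0 / 2" "0 < a0" "a0 \<le> 1" "Q * (r + a0) \<le> 1"
proof -
  have Q2: "Q \<le> Q\<^sup>2" using Q_parts(1) by (simp add: power2_eq_square)
  have Q4: "Q \<le> Q ^ 4" using Q_parts(1) power_increasing[of 1 4 Q] by simp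
  show "0 < r" "0 < a0" using Q_parts(1) by (auto simp: r_def a0_def)
  have r: "r \<le> 1 / (32 * Q)" unfolding r_def using Q2 Q_parts(1) by (intro divide_left_mono) auto
  have a: "a0 \<le> 1 / (256 * Q)" unfolding a0_def using Q4 Q_parts(1) by (intro divide_left_mono) auto
  have "1 / (32 * Q) \<le> 1" "1 / (256 * Q) \<le> 1" using Q_parts(1) by (auto simp: field_simps)
  then show "r \<le> 1" "a0 \<le> 1" using r a by auto
  have "1 / Q \<le> x0" using Q_parts(1,2) x0 by (simp add: field_simps)
  moreover have "1 / (32 * Q) = 1 / Q / 32" by simp
  ultimately show "r \<le> x0 / 2" using r x0 by linarith
  have "Q * (r + a0) \<le> Q * (1 / (32 * Q) + 1 / (256 * Q))" using r a Q_parts(1) by (intro mult_left_mono) auto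
  also have "\<dots> = 9 / 256" using Q_parts(1) by (simp add: field_simps)
  finally show "Q * (r + a0) \<le> 1" by simp
qed

definition "adm \<omega> p q \<longleftrightarrow> \<bar>\<omega> - \<xi>\<bar> \<le> r \<and> cper p \<and> cper q \<and> bdd r p \<and> bdd r q \<and> lip 1 p \<and> lip 1 q"

lemma lip_nu: "lip 2 \<nu>1" "lip 2 \<nu>2"
  using lipschitz_of_deriv[of \<nu>1 "\<lambda>x. \<nu>1 (x + pi / 2)" 2] lipschitz_of_deriv[of \<nu>2 "\<lambda>x. \<nu>2 (x + pi / 2)" 2]
    nu_deriv2 bdd_shift[OF bdd_nu(1)] bdd_shift[OF bdd_nu(2)]
  by (auto simp: lip_def deriv2_def)

lemma adm_P:
  assumes "adm \<omega> p q"
  shows "cper (P1 p)" "cper (P2 q)" "bdd 3 (P1 p)" "bdd 3 (P2 q)" "lip 3 (P1 p)" "lip 3 (P2 q)" "\<bar>\<omega> - \<xi>\<bar> \<le> x0 / 2"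
proof -
  have *: "cper p" "cper q" "bdd r p" "bdd r q" "lip 1 p" "lip 1 q" "\<bar>\<omega> - \<xi>\<bar> \<le> r" using assms by (auto simp: adm_def)
  show "cper (P1 p)" "cper (P2 q)" unfolding P1_def[abs_def] P2_def[abs_def] using * by auto
  show "bdd 3 (P1 p)" "bdd 3 (P2 q)" unfolding P1_def[abs_def] P2_def[abs_def]
    using bdd_mono[OF bdd_add[OF bdd_nu(1) *(3)]] bdd_mono[OF bdd_add[OF bdd_nu(2) *(4)]] r_bounds by auto
  show "lip 3 (P1 p)" "lip 3 (P2 q)" unfolding P1_def[abs_def] P2_def[abs_def]
    using lip_add[OF lip_nu(1) *(5)] lip_add[OF lip_nu(2) *(6)] by auto
  show "\<bar>\<omega> - \<xi>\<bar> \<le> x0 / 2" using * r_bounds by linarith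
qed

lemma cper_N:
  assumes "cper p" "cper q" shows "cper (N1 s \<omega> p q)" "cper (N2 s \<omega> p q)"
  unfolding N1_def[abs_def] N2_def[abs_def] force1_def[abs_def] force2_def[abs_def]
  by (intro cper_mult cper_const cper_diff cper_shift cper_shift' assms
      cper_compose[OF h_cont(1)] cper_compose[OF h_cont(2)])+

lemma N_bdd:
  assumes "bdd 3 p" "bdd 3 q" "\<bar>s\<bar> \<le> 1" "\<bar>\<omega> - \<xi>\<bar> \<le> x0 / 2"
  shows "bdd (8 * M) (N1 s \<omega> p q)" "bdd (8 * M) (N2 s \<omega> p q)"
proof -
  note d = bdd_diff6[OF assms(1,2)]
  note h = h_bdd[OF assms(3) d(1)] h_bdd[OF assms(3) d(2)]
  note h' = h[THEN conjunct1] h[THEN conjunct2]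
  have f: "\<bar>force1 (h1 s) (h2 s) \<omega> p q x\<bar> \<le> 2 * M" "\<bar>force2 (h1 s) (h2 s) \<omega> p q x\<bar> \<le> 2 * M" for x
    unfolding force1_def force2_def
    by (intro abs_diff_le2 h')+
  note b = bb_bounds(1,2)[OF assms(4,4) x0]
  have "\<bar>bb \<omega> * y\<bar> \<le> 8 * M" if "\<bar>y\<bar> \<le> 2 * M" for y
  proof -
    have "\<bar>bb \<omega> * y\<bar> \<le> 4 * (2 * M)" unfolding abs_mult using b that by (intro mult_mono) auto
    then show ?thesis by simp
  qed
  with f show "bdd (8 * M) (N1 s \<omega> p q)" "bdd (8 * M) (N2 s \<omega> p q)" by (simp_all add: bdd_def N1_def N2_def)
qed

lemma N_diff:
  assumes p: "bdd 3 p" "bdd 3 q" "bdd 3 p'" "bdd 3 q'" "lip 3 p" "lip 3 q"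
    and d: "bdd d (\<lambda>x. p x - p' x)" "bdd d (\<lambda>x. q x - q' x)"
    and s: "\<bar>s\<bar> \<le> 1" and w: "\<bar>\<omega> - \<xi>\<bar> \<le> x0 / 2" "\<bar>\<omega>' - \<xi>\<bar> \<le> x0 / 2"
  shows "bdd (CH * (\<bar>\<omega> - \<omega>'\<bar> + d)) (\<lambda>x. N1 s \<omega> p q x - N1 s \<omega>' p' q' x)"
    "bdd (CH * (\<bar>\<omega> - \<omega>'\<bar> + d)) (\<lambda>x. N2 s \<omega> p q x - N2 s \<omega>' p' q' x)"
proof -
  have d0: "d \<ge> 0" using bdd_nonneg[OF d(1)] .
  note b6 = bdd_diff6[OF p(1,2)] bdd_diff6[OF p(3,4)]
  define e where "e = 3 * \<bar>\<omega> - \<omega>'\<bar> + 2 * d"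
  have ee: "\<bar>(q y - p z) - (q' y' - p' z')\<bar> \<le> e" "\<bar>(p y - q z) - (p' y' - q' z')\<bar> \<le> e"
    if "\<bar>y - y'\<bar> + \<bar>z - z'\<bar> \<le> \<bar>\<omega> - \<omega>'\<bar>" for y y' z z'
  proof -
    have "\<bar>f y - f y'\<bar> \<le> 3 * \<bar>y - y'\<bar>" "\<bar>f z - f z'\<bar> \<le> 3 * \<bar>z - z'\<bar>" if "lip 3 f" for f
      using that by (auto simp: lip_def)
    note l = this[OF p(5)] this[OF p(6)]
    have dd: "\<bar>p y' - p' y'\<bar> \<le> d" "\<bar>p z' - p' z'\<bar> \<le> d" "\<bar>q y' - q' y'\<bar> \<le> d" "\<bar>q z' - q' z'\<bar> \<le> d"
      using d by (auto simp: bdd_def)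
    have tri: "\<bar>(a - b) - (a'' - b'')\<bar> \<le> A + B + d + d"
      if "\<bar>a - a'\<bar> \<le> A" "\<bar>b - b'\<bar> \<le> B" "\<bar>a' - a''\<bar> \<le> d" "\<bar>b' - b''\<bar> \<le> d" for a b a' b' a'' b'' A B :: real
      using that by linarith
    have le: "3 * \<bar>y - y'\<bar> + 3 * \<bar>z - z'\<bar> + d + d \<le> e" using mult_left_mono[OF that, of 3] unfolding e_def by (simp add: distrib_left)
    show "\<bar>(q y - p z) - (q' y' - p' z')\<bar> \<le> e" "\<bar>(p y - q z) - (p' y' - q' z')\<bar> \<le> e"
      by (rule order_trans[OF tri[OF l(3) l(2) dd(3) dd(2)] le] order_trans[OF tri[OF l(1) l(4) dd(1) dd(4)] le])+
  qed
  have hd: "\<bar>h1 s y - h1 s z\<bar> \<le> M * e \<and> \<bar>h2 s y - h2 s z\<bar> \<le> M * e" if "\<bar>y\<bar> \<le> 6" "\<bar>z\<bar> \<le> 6" "\<bar>y - z\<bar> \<le> e" for y z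
    using h_lip[OF s that(1,2)] mult_left_mono[OF that(3) M] by linarith
  have w': "\<bar>x + \<omega> - (x + \<omega>')\<bar> + \<bar>x - x\<bar> \<le> \<bar>\<omega> - \<omega>'\<bar>" "\<bar>x - x\<bar> + \<bar>x - \<omega> - (x - \<omega>')\<bar> \<le> \<bar>\<omega> - \<omega>'\<bar>" for x :: real
    by linarith+
  have f: "\<bar>force1 (h1 s) (h2 s) \<omega> p q x - force1 (h1 s) (h2 s) \<omega>' p' q' x\<bar> \<le> 2 * (M * e)"
    "\<bar>force2 (h1 s) (h2 s) \<omega> p q x - force2 (h1 s) (h2 s) \<omega>' p' q' x\<bar> \<le> 2 * (M * e)" for x
    unfolding force1_def force2_def
    by (intro abs_diff_diff_le2 hd[THEN conjunct1] hd[THEN conjunct2] b6 ee w')+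
  note b = bb_bounds[OF w x0] bb_bounds(1,2)[OF w(2,1) x0]
  have b4: "\<bar>bb \<omega>'\<bar> \<le> 4" using b by simp
  have fb: "\<bar>force1 (h1 s) (h2 s) \<omega> p q x\<bar> \<le> 2 * M" "\<bar>force2 (h1 s) (h2 s) \<omega> p q x\<bar> \<le> 2 * M" for x
    unfolding force1_def force2_def
    by (intro abs_diff_le2 h_bdd[OF s, THEN conjunct1] h_bdd[OF s, THEN conjunct2] b6)+
  \<comment> \<open>The coefficient of |\<omega> - \<omega>'| is exactly \<open>CH\<close>; that of
    d is 16 M, and the displayed difference is what is left over.\<close>
  have le: "16 / x0 * \<bar>\<omega> - \<omega>'\<bar> * (2 * M) + 4 * (2 * (M * e)) \<le> CH * (\<bar>\<omega> - \<omega>'\<bar> + d)"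
  proof -
    have "CH * (\<bar>\<omega> - \<omega>'\<bar> + d) - (16 / x0 * \<bar>\<omega> - \<omega>'\<bar> * (2 * M) + 4 * (2 * (M * e))) = M * d * (2 * (16 / x0) + 8)"
      unfolding CH_def e_def by (simp add: algebra_simps add_divide_distrib)
    moreover have "\<dots> \<ge> 0" using M d0 x0 by (intro mult_nonneg_nonneg add_nonneg_nonneg) auto
    ultimately show ?thesis by linarith
  qed
  show "bdd (CH * (\<bar>\<omega> - \<omega>'\<bar> + d)) (\<lambda>x. N1 s \<omega> p q x - N1 s \<omega>' p' q' x)"
    "bdd (CH * (\<bar>\<omega> - \<omega>'\<bar> + d)) (\<lambda>x. N2 s \<omega> p q x - N2 s \<omega>' p' q' x)"
    unfolding bdd_def N1_def N2_def
    using order_trans[OF abs_mult_diff_le[OF b(3) fb(1) b4 f(1)] le] order_trans[OF abs_mult_diff_le[OF b(3) fb(2) b4 f(2)] le]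
    by blast+
qed

lemma sN_diff:
  assumes p: "bdd 3 p" "bdd 3 q" and s: "\<bar>s\<bar> \<le> 1" "\<bar>s'\<bar> \<le> 1" and w: "\<bar>\<omega> - \<xi>\<bar> \<le> x0 / 2"
  shows "bdd (16 * M * \<bar>s - s'\<bar>) (\<lambda>x. s * N1 s \<omega> p q x - s' * N1 s' \<omega> p q x)"
    "bdd (16 * M * \<bar>s - s'\<bar>) (\<lambda>x. s * N2 s \<omega> p q x - s' * N2 s' \<omega> p q x)"
proof -
  note b6 = bdd_diff6[OF p]
  have f: "\<bar>force1 (h1 s) (h2 s) \<omega> p q x - force1 (h1 s') (h2 s') \<omega> p q x\<bar> \<le> 2 * (M * \<bar>s - s'\<bar>)"
    "\<bar>force2 (h1 s) (h2 s) \<omega> p q x - force2 (h1 s') (h2 s') \<omega> p q x\<bar> \<le> 2 * (M * \<bar>s - s'\<bar>)" for x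
    unfolding force1_def force2_def
    by (intro abs_diff_diff_le2 h_slip[OF s, THEN conjunct1] h_slip[OF s, THEN conjunct2] b6)+
  note b = bb_bounds(1,2)[OF w w x0]
  have "\<bar>bb \<omega> * y - bb \<omega> * z\<bar> \<le> 8 * M * \<bar>s - s'\<bar>" if "\<bar>y - z\<bar> \<le> 2 * (M * \<bar>s - s'\<bar>)" for y z
  proof -
    have "\<bar>bb \<omega> * (y - z)\<bar> \<le> 4 * (2 * (M * \<bar>s - s'\<bar>))" unfolding abs_mult[of "bb \<omega>"] using b that by (intro mult_mono) auto
    then show ?thesis by (simp add: algebra_simps)
  qed
  from this[OF f(1)] this[OF f(2)]
  have n: "\<bar>N1 s \<omega> p q x - N1 s' \<omega> p q x\<bar> \<le> 8 * M * \<bar>s - s'\<bar>" "\<bar>N2 s \<omega> p q x - N2 s' \<omega> p q x\<bar> \<le> 8 * M * \<bar>s - s'\<bar>" for x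
    by (simp_all add: N1_def N2_def)
  have nb: "\<bar>N1 s \<omega> p q x\<bar> \<le> 8 * M" "\<bar>N2 s \<omega> p q x\<bar> \<le> 8 * M" for x
    using N_bdd[OF p s(1) w] by (auto simp: bdd_def)
  have eq: "\<bar>s - s'\<bar> * (8 * M) + 1 * (8 * M * \<bar>s - s'\<bar>) = 16 * M * \<bar>s - s'\<bar>" by simp
  show "bdd (16 * M * \<bar>s - s'\<bar>) (\<lambda>x. s * N1 s \<omega> p q x - s' * N1 s' \<omega> p q x)"
    "bdd (16 * M * \<bar>s - s'\<bar>) (\<lambda>x. s * N2 s \<omega> p q x - s' * N2 s' \<omega> p q x)"
    unfolding bdd_def eq[symmetric]
    using abs_mult_diff_le[OF order_refl nb(1) s(2) n(1)] abs_mult_diff_le[OF order_refl nb(2) s(2) n(2)] by blast+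
qed

lemma cper_R:
  assumes "adm \<omega> p q" shows "cper (R1 s \<omega> p q)" "cper (R2 s \<omega> p q)"
  unfolding R1_def[abs_def] R2_def[abs_def]
  by (intro cper_add cper_diff cper_mult cper_const cper_AB cper_N adm_P[OF assms])+

lemma cper_KR:
  assumes "adm \<omega> p q" shows "cper (KR1 s \<omega> p q)" "cper (KR2 s \<omega> p q)"
  unfolding KR1_def KR2_def by (intro cper_K cper_R assms)+

text \<open>The remainder vanishes at \<omega> = \<xi>, s = 0, and each of its two parts is of the
  order of one of these deviations.\<close>

lemma R_bdd:
  assumes D: "adm \<omega> p q" and s: "\<bar>s\<bar> \<le> 1"
  shows "bdd (CR * (r + \<bar>s\<bar>)) (R1 s \<omega> p q)" "bdd (CR * (r + \<bar>s\<bar>)) (R2 s \<omega> p q)"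
proof -
  note P = adm_P[OF D]
  have xi: "\<bar>\<xi> - \<xi>\<bar> \<le> x0 / 2" using x0 by simp
  define c where "c = (1 + \<kappa>) * (2 * (16 / x0) * 3 + 4 * 3)"
  have c: "c \<ge> 0" using x0 kap_pos by (simp add: c_def)
  have b: "bdd (c * \<bar>\<omega> - \<xi>\<bar>) (\<lambda>x. B1 \<omega> (P1 p) (P2 q) x - B1 \<xi> (P1 p) (P2 q) x)"
    "bdd (c * \<bar>\<omega> - \<xi>\<bar>) (\<lambda>x. B2 \<omega> (P1 p) (P2 q) x - B2 \<xi> (P1 p) (P2 q) x)"
    unfolding c_def by (intro B_omega_lip[OF P(7) xi x0] P)+
  have "c * \<bar>\<omega> - \<xi>\<bar> \<le> c * r" using c D by (intro mult_left_mono) (auto simp: adm_def)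
  moreover have "0 \<le> c * \<bar>s\<bar>" "0 \<le> 8 * M * r" using c M r_bounds by auto
  ultimately have le: "c * \<bar>\<omega> - \<xi>\<bar> + \<bar>s\<bar> * (8 * M) \<le> CR * (r + \<bar>s\<bar>)"
    unfolding CR_def c_def[symmetric] by (simp add: algebra_simps)
  note n = N_bdd[OF P(3,4) s P(7)]
  show "bdd (CR * (r + \<bar>s\<bar>)) (R1 s \<omega> p q)" "bdd (CR * (r + \<bar>s\<bar>)) (R2 s \<omega> p q)"
    unfolding R1_def[abs_def] R2_def[abs_def]
    by (rule bdd_mono[OF bdd_add[OF b(1) bdd_cmult[OF n(1)]] le] bdd_mono[OF bdd_add[OF b(2) bdd_cmult[OF n(2)]] le])+
qed

lemma K_diff:
  assumes "cper f1" "cper f2" "cper k1" "cper k2"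
  shows "K1 (\<lambda>x. f1 x - k1 x) (\<lambda>x. f2 x - k2 x) x = K1 f1 f2 x - K1 k1 k2 x"
    "K2 (\<lambda>x. f1 x - k1 x) (\<lambda>x. f2 x - k2 x) x = K2 f1 f2 x - K2 k1 k2 x"
  using K_add[OF cper_diff[OF assms(1,3)] cper_diff[OF assms(2,4)] assms(3,4)] by simp_all

text \<open>9 = 1 + 4 * 2: the coefficient is at most 4 e, and \<nu> is bounded by 2.\<close>

lemma projected_bdd:
  assumes "cper u" "cper v" "bdd e u" "bdd e v"
  shows "bdd (9 * e) (\<lambda>x. u x - ip u v \<nu>1 \<nu>2 * \<nu>1 x)" "bdd (9 * e) (\<lambda>x. v x - ip u v \<nu>1 \<nu>2 * \<nu>2 x)"
proof -
  have i: "\<bar>ip u v \<nu>1 \<nu>2\<bar> \<le> 4 * e"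
    using ip_bdd[OF assms(1,2) cper_nu assms(3,4) bdd_nu] by simp
  have "\<bar>ip u v \<nu>1 \<nu>2 * y\<bar> \<le> 8 * e" if "\<bar>y\<bar> \<le> 2" for y
  proof -
    have "\<bar>ip u v \<nu>1 \<nu>2 * y\<bar> \<le> (4 * e) * 2"
      unfolding abs_mult using i that bdd_nonneg[OF assms(3)] by (intro mult_mono) auto
    then show ?thesis by simp
  qed
  then have "bdd (8 * e) (\<lambda>x. ip u v \<nu>1 \<nu>2 * \<nu>1 x)" "bdd (8 * e) (\<lambda>x. ip u v \<nu>1 \<nu>2 * \<nu>2 x)"
    using bdd_nu by (auto simp: bdd_def)
  then show "bdd (9 * e) (\<lambda>x. u x - ip u v \<nu>1 \<nu>2 * \<nu>1 x)" "bdd (9 * e) (\<lambda>x. v x - ip u v \<nu>1 \<nu>2 * \<nu>2 x)"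
    using bdd_diff[OF assms(3), of "8 * e"] bdd_diff[OF assms(4), of "8 * e"] by auto
qed

lemma T_diff_of_KR:
  assumes D: "adm \<omega> p q" "adm \<omega>' p' q'"
    and b: "bdd e (\<lambda>x. KR1 s \<omega> p q x - KR1 s' \<omega>' p' q' x)" "bdd e (\<lambda>x. KR2 s \<omega> p q x - KR2 s' \<omega>' p' q' x)"
  shows "bdd (9 * e) (\<lambda>x. T1 s \<omega> p q x - T1 s' \<omega>' p' q' x)" "bdd (9 * e) (\<lambda>x. T2 s \<omega> p q x - T2 s' \<omega>' p' q' x)"
proof -
  note c = cper_KR[OF D(1), of s] cper_KR[OF D(2), of s']
  note i = ip_diff[OF c cper_nu]
  show "bdd (9 * e) (\<lambda>x. T1 s \<omega> p q x - T1 s' \<omega>' p' q' x)" "bdd (9 * e) (\<lambda>x. T2 s \<omega> p q x - T2 s' \<omega>' p' q' x)"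
    using projected_bdd[OF cper_diff[OF c(1,3)] cper_diff[OF c(2,4)] b] unfolding i T1_def T2_def by (simp_all add: algebra_simps)
qed

text \<open>This closes the Lipschitz class: the remainder has size r + |s| in the supremum norm,
  and inverting turns that into a Lipschitz constant, which the choice of \<open>Q\<close> brings
  below 1.\<close>

lemma T_regular:
  assumes s: "\<bar>s\<bar> \<le> a0" and D: "adm \<omega> p q"
  shows "cper (T1 s \<omega> p q) \<and> cper (T2 s \<omega> p q) \<and> lip 1 (T1 s \<omega> p q) \<and> lip 1 (T2 s \<omega> p q)"
proof -
  have s1: "\<bar>s\<bar> \<le> 1" using s r_bounds by linarith
  define e where "e = CR * (r + \<bar>s\<bar>)"
  note R = R_bdd[OF D s1, folded e_def]
  have e0: "e \<ge> 0" using bdd_nonneg[OF R(1)] .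
  note K = K_bdd[OF cper_R[OF D, of s] R, folded KR1_def KR2_def]
  note L = K_lip[OF cper_R[OF D, of s] R, folded KR1_def KR2_def]
  have i: "\<bar>ip (KR1 s \<omega> p q) (KR2 s \<omega> p q) \<nu>1 \<nu>2\<bar> \<le> 4 * (KC * e)"
    using ip_bdd[OF cper_KR[OF D, of s] cper_nu K bdd_nu] by simp
  have "LK * e + \<bar>- ip (KR1 s \<omega> p q) (KR2 s \<omega> p q) \<nu>1 \<nu>2\<bar> * 2 \<le> (LK + 8 * KC) * e"
    using i by (simp add: algebra_simps)
  also have "\<dots> = (LK + 8 * KC) * CR * (r + \<bar>s\<bar>)" by (simp add: e_def)
  also have "\<dots> \<le> Q * (r + a0)"
    using Q_parts s r_bounds by (intro mult_mono) auto
  also have "\<dots> \<le> 1" by (rule r_bounds)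
  finally have le: "LK * e + \<bar>- ip (KR1 s \<omega> p q) (KR2 s \<omega> p q) \<nu>1 \<nu>2\<bar> * 2 \<le> 1" .
  have "lip 1 (T1 s \<omega> p q)" "lip 1 (T2 s \<omega> p q)"
    using lip_mono[OF lip_add[OF L(1) lip_cmult[OF lip_nu(1)]] le] lip_mono[OF lip_add[OF L(2) lip_cmult[OF lip_nu(2)]] le]
    by (simp_all add: T1_def[abs_def] T2_def[abs_def])
  moreover have "cper (T1 s \<omega> p q)" "cper (T2 s \<omega> p q)"
    unfolding T1_def[abs_def] T2_def[abs_def] by (intro cper_diff cper_KR[OF D] cper_mult cper_const cper_nu)+
  ultimately show ?thesis by blast
qed

text \<open>Three sources of change: the frequency acting on the full profile, which is not small;
  the change of profile under the difference of the operators at \<omega>' and \<xi>, small with r;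
  and the nonlinear force, small with s.\<close>

lemma R_decompose:
  "R1 s \<omega> p q x = (B1 \<omega> (P1 p) (P2 q) x - B1 \<omega>' (P1 p) (P2 q) x)
    + (B1 \<omega>' (\<lambda>x. p x - p' x) (\<lambda>x. q x - q' x) x - B1 \<xi> (\<lambda>x. p x - p' x) (\<lambda>x. q x - q' x) x)
    + s * (N1 s \<omega> (P1 p) (P2 q) x - N1 s \<omega>' (P1 p') (P2 q') x) + R1 s \<omega>' p' q' x"
  "R2 s \<omega> p q x = (B2 \<omega> (P1 p) (P2 q) x - B2 \<omega>' (P1 p) (P2 q) x)
    + (B2 \<omega>' (\<lambda>x. p x - p' x) (\<lambda>x. q x - q' x) x - B2 \<xi> (\<lambda>x. p x - p' x) (\<lambda>x. q x - q' x) x)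
    + s * (N2 s \<omega> (P1 p) (P2 q) x - N2 s \<omega>' (P1 p') (P2 q') x) + R2 s \<omega>' p' q' x"
proof -
  have d: "B1 w (\<lambda>x. p x - p' x) (\<lambda>x. q x - q' x) x = B1 w (P1 p) (P2 q) x - B1 w (P1 p') (P2 q') x"
    "B2 w (\<lambda>x. p x - p' x) (\<lambda>x. q x - q' x) x = B2 w (P1 p) (P2 q) x - B2 w (P1 p') (P2 q') x" for w
    unfolding B1_def B2_def right_diff_distrib[symmetric] A_diff[symmetric] P1_def P2_def by simp_all
  show "R1 s \<omega> p q x = (B1 \<omega> (P1 p) (P2 q) x - B1 \<omega>' (P1 p) (P2 q) x)
    + (B1 \<omega>' (\<lambda>x. p x - p' x) (\<lambda>x. q x - q' x) x - B1 \<xi> (\<lambda>x. p x - p' x) (\<lambda>x. q x - q' x) x)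
    + s * (N1 s \<omega> (P1 p) (P2 q) x - N1 s \<omega>' (P1 p') (P2 q') x) + R1 s \<omega>' p' q' x"
  "R2 s \<omega> p q x = (B2 \<omega> (P1 p) (P2 q) x - B2 \<omega>' (P1 p) (P2 q) x)
    + (B2 \<omega>' (\<lambda>x. p x - p' x) (\<lambda>x. q x - q' x) x - B2 \<xi> (\<lambda>x. p x - p' x) (\<lambda>x. q x - q' x) x)
    + s * (N2 s \<omega> (P1 p) (P2 q) x - N2 s \<omega>' (P1 p') (P2 q') x) + R2 s \<omega>' p' q' x"
    unfolding R1_def R2_def d by (simp_all add: algebra_simps)
qed

context
  fixes s \<omega> \<omega>' d :: real and p q p' q' :: "real \<Rightarrow> real"
  assumes s: "\<bar>s\<bar> \<le> 1" and D: "adm \<omega> p q" "adm \<omega>' p' q'"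
    and d: "bdd d (\<lambda>x. p x - p' x)" "bdd d (\<lambda>x. q x - q' x)"
begin

definition "X1 x = B1 \<omega> (P1 p) (P2 q) x - B1 \<omega>' (P1 p) (P2 q) x"
definition "X2 x = B2 \<omega> (P1 p) (P2 q) x - B2 \<omega>' (P1 p) (P2 q) x"
definition "Y1 x = B1 \<omega>' (\<lambda>x. p x - p' x) (\<lambda>x. q x - q' x) x - B1 \<xi> (\<lambda>x. p x - p' x) (\<lambda>x. q x - q' x) x"
definition "Y2 x = B2 \<omega>' (\<lambda>x. p x - p' x) (\<lambda>x. q x - q' x) x - B2 \<xi> (\<lambda>x. p x - p' x) (\<lambda>x. q x - q' x) x"
definition "V1 x = s * (N1 s \<omega> (P1 p) (P2 q) x - N1 s \<omega>' (P1 p') (P2 q') x)"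
definition "V2 x = s * (N2 s \<omega> (P1 p) (P2 q) x - N2 s \<omega>' (P1 p') (P2 q') x)"

lemma R_XYV: "R1 s \<omega> p q = (\<lambda>x. X1 x + Y1 x + V1 x + R1 s \<omega>' p' q' x)"
  "R2 s \<omega> p q = (\<lambda>x. X2 x + Y2 x + V2 x + R2 s \<omega>' p' q' x)"
  unfolding X1_def X2_def Y1_def Y2_def V1_def V2_def by (rule ext, rule R_decompose)+

lemma cper_diffs: "cper p" "cper q" "cper p'" "cper q'" "cper (\<lambda>x. p x - p' x)" "cper (\<lambda>x. q x - q' x)"
  using D by (auto simp: adm_def)

lemma cper_XYV: "cper X1" "cper X2" "cper Y1" "cper Y2" "cper V1" "cper V2"
  unfolding X1_def[abs_def] X2_def[abs_def] Y1_def[abs_def] Y2_def[abs_def] V1_def[abs_def] V2_def[abs_def]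
  by (intro cper_mult cper_const cper_diff cper_AB cper_N adm_P[OF D(1)] adm_P[OF D(2)] cper_diffs)+

lemma near_xi: "\<bar>\<xi> - \<xi>\<bar> \<le> x0 / 2" "\<bar>\<omega>' - \<xi>\<bar> \<le> r"
  using x0 D by (auto simp: adm_def)

lemma bdd_V: "bdd (\<bar>s\<bar> * (CH * (\<bar>\<omega> - \<omega>'\<bar> + d))) V1" "bdd (\<bar>s\<bar> * (CH * (\<bar>\<omega> - \<omega>'\<bar> + d))) V2"
proof -
  have e: "(\<lambda>x. P1 p x - P1 p' x) = (\<lambda>x. p x - p' x)" "(\<lambda>x. P2 q x - P2 q' x) = (\<lambda>x. q x - q' x)"
    by (auto simp: P1_def P2_def)
  note n = N_diff[OF adm_P(3,4)[OF D(1)] adm_P(3,4)[OF D(2)] adm_P(5,6)[OF D(1)] d[folded e] s adm_P(7)[OF D(1)] adm_P(7)[OF D(2)]]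
  show "bdd (\<bar>s\<bar> * (CH * (\<bar>\<omega> - \<omega>'\<bar> + d))) V1" "bdd (\<bar>s\<bar> * (CH * (\<bar>\<omega> - \<omega>'\<bar> + d))) V2"
    unfolding V1_def[abs_def] V2_def[abs_def] by (intro bdd_cmult n)+
qed

text \<open>X and Y both go through \<open>K_B_omega_lip\<close>: X with a profile of norm 3 and
  frequencies \<omega>, \<omega>', Y with a profile of norm d and frequencies \<omega>', \<xi> at
  distance at most r.\<close>

lemma KR_diff:
  defines "E \<equiv> 3 * KB x0 * \<bar>\<omega> - \<omega>'\<bar> + KB x0 * r * d + KC * (\<bar>s\<bar> * (CH * (\<bar>\<omega> - \<omega>'\<bar> + d)))"
  shows "bdd E (\<lambda>x. KR1 s \<omega> p q x - KR1 s \<omega>' p' q' x)" "bdd E (\<lambda>x. KR2 s \<omega> p q x - KR2 s \<omega>' p' q' x)"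
proof -
  note c = cper_XYV and cR = cper_R[OF D(2), of s]
  note P = adm_P[OF D(1)] and P' = adm_P[OF D(2)]
  have eq: "KR1 s \<omega> p q x - KR1 s \<omega>' p' q' x = K1 X1 X2 x + K1 Y1 Y2 x + K1 V1 V2 x"
    "KR2 s \<omega> p q x - KR2 s \<omega>' p' q' x = K2 X1 X2 x + K2 Y1 Y2 x + K2 V1 V2 x" for x
    unfolding KR1_def KR2_def R_XYV
    by (simp_all add: K_add[OF cper_add[OF cper_add[OF c(1,3)] c(5)] cper_add[OF cper_add[OF c(2,4)] c(6)] cR]
        K_add[OF cper_add[OF c(1,3)] cper_add[OF c(2,4)] c(5,6)] K_add[OF c(1,2) c(3,4)])
  have X: "bdd (3 * KB x0 * \<bar>\<omega> - \<omega>'\<bar>) (K1 X1 X2)" "bdd (3 * KB x0 * \<bar>\<omega> - \<omega>'\<bar>) (K2 X1 X2)"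
  proof -
    have "K1 X1 X2 x = K1 (B1 \<omega> (P1 p) (P2 q)) (B2 \<omega> (P1 p) (P2 q)) x - K1 (B1 \<omega>' (P1 p) (P2 q)) (B2 \<omega>' (P1 p) (P2 q)) x"
      "K2 X1 X2 x = K2 (B1 \<omega> (P1 p) (P2 q)) (B2 \<omega> (P1 p) (P2 q)) x - K2 (B1 \<omega>' (P1 p) (P2 q)) (B2 \<omega>' (P1 p) (P2 q)) x" for x
      unfolding X1_def[abs_def] X2_def[abs_def] by (intro K_diff cper_AB P)+
    then show "bdd (3 * KB x0 * \<bar>\<omega> - \<omega>'\<bar>) (K1 X1 X2)" "bdd (3 * KB x0 * \<bar>\<omega> - \<omega>'\<bar>) (K2 X1 X2)"
      using K_B_omega_lip[OF P(7) P'(7) x0 P(1-4)] by (simp_all add: bdd_def mult.commute[of _ 3])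
  qed
  have Y: "bdd (KB x0 * r * d) (K1 Y1 Y2)" "bdd (KB x0 * r * d) (K2 Y1 Y2)"
  proof -
    let ?p = "\<lambda>x. p x - p' x" and ?q = "\<lambda>x. q x - q' x"
    have "K1 Y1 Y2 x = K1 (B1 \<omega>' ?p ?q) (B2 \<omega>' ?p ?q) x - K1 (B1 \<xi> ?p ?q) (B2 \<xi> ?p ?q) x"
      "K2 Y1 Y2 x = K2 (B1 \<omega>' ?p ?q) (B2 \<omega>' ?p ?q) x - K2 (B1 \<xi> ?p ?q) (B2 \<xi> ?p ?q) x" for x
      unfolding Y1_def[abs_def] Y2_def[abs_def] by (intro K_diff cper_AB cper_diffs)+
    then have b: "bdd (KB x0 * d * \<bar>\<omega>' - \<xi>\<bar>) (K1 Y1 Y2)" "bdd (KB x0 * d * \<bar>\<omega>' - \<xi>\<bar>) (K2 Y1 Y2)"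
      using K_B_omega_lip[OF P'(7) near_xi(1) x0 cper_diffs(5,6) d] by (simp_all add: bdd_def)
    have "KB x0 * d * \<bar>\<omega>' - \<xi>\<bar> \<le> KB x0 * d * r"
      using constants_nonneg bdd_nonneg[OF d(1)] near_xi by (intro mult_left_mono) auto
    also have "\<dots> = KB x0 * r * d" by simp
    finally show "bdd (KB x0 * r * d) (K1 Y1 Y2)" "bdd (KB x0 * r * d) (K2 Y1 Y2)"
      using b bdd_mono by blast+
  qed
  note V = K_bdd[OF c(5,6) bdd_V]
  show "bdd E (\<lambda>x. KR1 s \<omega> p q x - KR1 s \<omega>' p' q' x)" "bdd E (\<lambda>x. KR2 s \<omega> p q x - KR2 s \<omega>' p' q' x)"
    unfolding eq E_def by (intro bdd_add X Y V)+
qed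

lemma T_diff:
  defines "E \<equiv> Q * \<bar>\<omega> - \<omega>'\<bar> + Q * (r + \<bar>s\<bar>) * (\<bar>\<omega> - \<omega>'\<bar> + d)"
  shows "bdd E (\<lambda>x. T1 s \<omega> p q x - T1 s \<omega>' p' q' x)" "bdd E (\<lambda>x. T2 s \<omega> p q x - T2 s \<omega>' p' q' x)"
proof -
  define w where "w = \<bar>\<omega> - \<omega>'\<bar>"
  have pos: "0 \<le> w" "0 \<le> d" "0 \<le> \<bar>s\<bar>" "0 \<le> r" using bdd_nonneg[OF d(1)] r_bounds by (auto simp: w_def)
  have "9 * (3 * KB x0 * w + KB x0 * r * d + KC * (\<bar>s\<bar> * (CH * (w + d)))) \<le> Q * w + Q * (r + \<bar>s\<bar>) * (w + d)"
  proof -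
    have c: "0 \<le> KB x0" "0 \<le> KC * CH" using constants_nonneg KC_nonneg by auto
    have "27 * KB x0 * w \<le> Q * w" using Q_parts(3) c pos by (intro mult_right_mono) auto
    moreover have "9 * KB x0 * (r * d) + 9 * (KC * CH) * (\<bar>s\<bar> * (w + d)) \<le> (9 * KB x0 + 9 * (KC * CH)) * ((r + \<bar>s\<bar>) * (w + d))"
    proof -
      have "r * d \<le> (r + \<bar>s\<bar>) * (w + d)" "\<bar>s\<bar> * (w + d) \<le> (r + \<bar>s\<bar>) * (w + d)" using pos by (auto intro!: mult_mono)
      then show ?thesis unfolding distrib_right[of "9 * KB x0"] using c by (intro add_mono mult_left_mono) auto
    qed
    moreover have "(9 * KB x0 + 9 * (KC * CH)) * ((r + \<bar>s\<bar>) * (w + d)) \<le> Q * ((r + \<bar>s\<bar>) * (w + d))"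
      using Q_parts(3) c pos by (intro mult_right_mono) auto
    moreover have "9 * (3 * KB x0 * w + KB x0 * r * d + KC * (\<bar>s\<bar> * (CH * (w + d)))) =
        27 * KB x0 * w + (9 * KB x0 * (r * d) + 9 * (KC * CH) * (\<bar>s\<bar> * (w + d)))"
      by (simp add: algebra_simps)
    moreover have "Q * (r + \<bar>s\<bar>) * (w + d) = Q * ((r + \<bar>s\<bar>) * (w + d))" by (rule mult.assoc)
    ultimately show ?thesis by linarith
  qed
  then have "9 * (3 * KB x0 * \<bar>\<omega> - \<omega>'\<bar> + KB x0 * r * d + KC * (\<bar>s\<bar> * (CH * (\<bar>\<omega> - \<omega>'\<bar> + d)))) \<le> E"
    unfolding E_def w_def .
  with T_diff_of_KR[OF D KR_diff] bdd_mono
  show "bdd E (\<lambda>x. T1 s \<omega> p q x - T1 s \<omega>' p' q' x)" "bdd E (\<lambda>x. T2 s \<omega> p q x - T2 s \<omega>' p' q' x)"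
    by blast+
qed

text \<open>By symmetry the difference of the operators is moved onto \<nu>, whose Lipschitz
  constant is known, so that \<open>f1\<close> and \<open>f2\<close> enter through their supremum
  norm.\<close>

lemma ip_B_diff_nu:
  assumes f: "cper f1" "cper f2" "bdd e f1" "bdd e f2" and w: "\<bar>w - \<xi>\<bar> \<le> x0 / 2" "\<bar>w' - \<xi>\<bar> \<le> x0 / 2"
  shows "\<bar>ip (\<lambda>x. B1 w f1 f2 x - B1 w' f1 f2 x) (\<lambda>x. B2 w f1 f2 x - B2 w' f1 f2 x) \<nu>1 \<nu>2\<bar> \<le> 2 * e * (CB * \<bar>w - w'\<bar>)"
proof -
  have B: "ip (B1 w f1 f2) (B2 w f1 f2) \<nu>1 \<nu>2 = ip f1 f2 (B1 w \<nu>1 \<nu>2) (B2 w \<nu>1 \<nu>2)" for w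
  proof -
    have "ip (B1 w f1 f2) (B2 w f1 f2) \<nu>1 \<nu>2 = bb w * ip f1 f2 (A1 w \<nu>1 \<nu>2) (A2 w \<nu>1 \<nu>2)"
      unfolding B1_def[abs_def] B2_def[abs_def] ip_cmult A_symmetric[OF f(1,2) cper_nu] ..
    also have "\<dots> = ip f1 f2 (B1 w \<nu>1 \<nu>2) (B2 w \<nu>1 \<nu>2)"
      unfolding B1_def B2_def ip_def mean_cmult[symmetric] by (simp add: algebra_simps)
    finally show ?thesis .
  qed
  have c: "cper (B1 w f1 f2)" "cper (B2 w f1 f2)" "cper (B1 w \<nu>1 \<nu>2)" "cper (B2 w \<nu>1 \<nu>2)" for w
    by (intro cper_AB f cper_nu)+
  have flip: "ip g1 g2 k1 k2 = ip k1 k2 g1 g2" for g1 g2 k1 k2 by (simp add: ip_def mult.commute)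
  have "ip (\<lambda>x. B1 w f1 f2 x - B1 w' f1 f2 x) (\<lambda>x. B2 w f1 f2 x - B2 w' f1 f2 x) \<nu>1 \<nu>2 =
    ip (B1 w \<nu>1 \<nu>2) (B2 w \<nu>1 \<nu>2) f1 f2 - ip (B1 w' \<nu>1 \<nu>2) (B2 w' \<nu>1 \<nu>2) f1 f2"
    unfolding ip_diff[OF c(1,2)[of w] c(1,2)[of w'] cper_nu] B by (simp only: flip)
  also have "\<dots> = ip f1 f2 (\<lambda>x. B1 w \<nu>1 \<nu>2 x - B1 w' \<nu>1 \<nu>2 x) (\<lambda>x. B2 w \<nu>1 \<nu>2 x - B2 w' \<nu>1 \<nu>2 x)"
    unfolding ip_diff[OF c(3,4)[of w] c(3,4)[of w'] f(1,2), symmetric] by (rule flip)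
  also have "\<bar>\<dots>\<bar> \<le> 2 * e * (CB * \<bar>w - w'\<bar>)"
    unfolding CB_def by (intro ip_bdd f cper_diff c B_omega_lip[OF w x0 bdd_nu lip_nu])
  finally show ?thesis .
qed

text \<open>Dividing by \<tau> cancels the only term that is of first order in |\<omega> -
  \<omega>'|; by \<open>q_estimate\<close> and the bounds for the other parts, all that remains
  carries a factor r or |s|.\<close>

lemma T0_diff: "\<bar>T0 s \<omega> p q - T0 s \<omega>' p' q'\<bar> \<le> Q * (r + \<bar>s\<bar>) * (\<bar>\<omega> - \<omega>'\<bar> + d)"
proof -
  note c = cper_XYV and cR = cper_R[OF D(2), of s]
  note P = adm_P[OF D(1)] and P' = adm_P[OF D(2)]
  have D1: "\<bar>\<omega> - \<xi>\<bar> \<le> r" "bdd r p" "bdd r q" using D by (auto simp: adm_def)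
  define w where "w = \<bar>\<omega> - \<omega>'\<bar>"
  have pos: "0 \<le> w" "0 \<le> d" "0 \<le> \<bar>s\<bar>" "0 \<le> r" using bdd_nonneg[OF d(1)] r_bounds by (auto simp: w_def)
  have R: "ip (R1 s \<omega> p q) (R2 s \<omega> p q) \<nu>1 \<nu>2 - ip (R1 s \<omega>' p' q') (R2 s \<omega>' p' q') \<nu>1 \<nu>2 =
    ip X1 X2 \<nu>1 \<nu>2 + ip Y1 Y2 \<nu>1 \<nu>2 + ip V1 V2 \<nu>1 \<nu>2"
    unfolding R_XYV
    by (simp add: ip_add[OF cper_add[OF cper_add[OF c(1,3)] c(5)] cper_add[OF cper_add[OF c(2,4)] c(6)] cR cper_nu]
        ip_add[OF cper_add[OF c(1,3)] cper_add[OF c(2,4)] c(5,6) cper_nu] ip_add[OF c(1,2) c(3,4) cper_nu])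
  define X' where "X' = ip (\<lambda>x. B1 \<omega> p q x - B1 \<omega>' p q x) (\<lambda>x. B2 \<omega> p q x - B2 \<omega>' p q x) \<nu>1 \<nu>2"
  have X: "ip X1 X2 \<nu>1 \<nu>2 = (bb \<omega> * G \<omega> - bb \<omega>' * G \<omega>') + X'"
  proof -
    have BP: "B1 v (P1 p) (P2 q) = (\<lambda>x. B1 v \<nu>1 \<nu>2 x + B1 v p q x)" "B2 v (P1 p) (P2 q) = (\<lambda>x. B2 v \<nu>1 \<nu>2 x + B2 v p q x)" for v
      unfolding B1_def[abs_def] B2_def[abs_def] P1_def[abs_def] P2_def[abs_def] A_add distrib_left by simp_all
    have eq: "X1 = (\<lambda>x. (B1 \<omega> \<nu>1 \<nu>2 x - B1 \<omega>' \<nu>1 \<nu>2 x) + (B1 \<omega> p q x - B1 \<omega>' p q x))"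
      "X2 = (\<lambda>x. (B2 \<omega> \<nu>1 \<nu>2 x - B2 \<omega>' \<nu>1 \<nu>2 x) + (B2 \<omega> p q x - B2 \<omega>' p q x))"
      unfolding X1_def[abs_def] X2_def[abs_def] BP by auto
    have c1: "cper (B1 v p q)" "cper (B2 v p q)" "cper (B1 v \<nu>1 \<nu>2)" "cper (B2 v \<nu>1 \<nu>2)" for v
      by (intro cper_AB cper_diffs cper_nu)+
    show ?thesis unfolding eq X'_def
      by (subst ip_add) (simp_all add: cper_diff c1 ip_diff ip_B_nu)
  qed
  have X': "\<bar>X'\<bar> \<le> 2 * r * (CB * w)"
    unfolding X'_def w_def by (intro ip_B_diff_nu cper_diffs D1 P P')
  have Y: "\<bar>ip Y1 Y2 \<nu>1 \<nu>2\<bar> \<le> 2 * d * (CB * r)"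
  proof -
    have "\<bar>ip Y1 Y2 \<nu>1 \<nu>2\<bar> \<le> 2 * d * (CB * \<bar>\<omega>' - \<xi>\<bar>)"
      unfolding Y1_def[abs_def] Y2_def[abs_def] by (intro ip_B_diff_nu cper_diffs d P' near_xi)
    also have "\<dots> \<le> 2 * d * (CB * r)"
      using constants_nonneg pos near_xi by (intro mult_left_mono) auto
    finally show ?thesis .
  qed
  have V: "\<bar>ip V1 V2 \<nu>1 \<nu>2\<bar> \<le> 2 * (\<bar>s\<bar> * (CH * (w + d))) * 2"
    unfolding w_def by (intro ip_bdd c cper_nu bdd_V bdd_nu)
  have q: "\<bar>(bb \<omega> * G \<omega> - bb \<omega>' * G \<omega>') - \<tau> * (\<omega> - \<omega>')\<bar> \<le> Cq x0 * r * w"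
    unfolding w_def using r_bounds x0 D1 near_xi by (intro q_estimate) auto
  let ?S = "(r + \<bar>s\<bar>) * (w + d)"
  have sum: "Cq x0 * r * w + 2 * r * (CB * w) + 2 * d * (CB * r) + 2 * (\<bar>s\<bar> * (CH * (w + d))) * 2 \<le> (Cq x0 + 2 * CB + 4 * CH) * ?S"
  proof -
    have "r * w \<le> ?S" "\<bar>s\<bar> * (w + d) \<le> ?S" "r * (w + d) \<le> ?S" using pos by (auto intro!: mult_mono)
    then have "Cq x0 * (r * w) \<le> Cq x0 * ?S" "2 * CB * (r * (w + d)) \<le> 2 * CB * ?S" "4 * CH * (\<bar>s\<bar> * (w + d)) \<le> 4 * CH * ?S"
      using constants_nonneg by (auto intro!: mult_left_mono)
    then show ?thesis by (simp add: algebra_simps)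
  qed
  have tpos: "\<tau> > 0" using tau by linarith
  have "T0 s \<omega> p q - T0 s \<omega>' p' q' = (\<omega> - \<omega>') -
     (ip (R1 s \<omega> p q) (R2 s \<omega> p q) \<nu>1 \<nu>2 - ip (R1 s \<omega>' p' q') (R2 s \<omega>' p' q') \<nu>1 \<nu>2) / \<tau>"
    by (simp add: T0_def diff_divide_distrib)
  also have "\<dots> = - (((bb \<omega> * G \<omega> - bb \<omega>' * G \<omega>') - \<tau> * (\<omega> - \<omega>')) + X' + ip Y1 Y2 \<nu>1 \<nu>2 + ip V1 V2 \<nu>1 \<nu>2) / \<tau>"
    unfolding R X using tpos by (simp add: field_simps)
  also have "\<bar>\<dots>\<bar> \<le> (Cq x0 + 2 * CB + 4 * CH) * ?S / \<tau>"
  proof -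
    have tri: "\<bar>a + b + c + e\<bar> \<le> A + B + C + E" if "\<bar>a\<bar> \<le> A" "\<bar>b\<bar> \<le> B" "\<bar>c\<bar> \<le> C" "\<bar>e\<bar> \<le> E" for a b c e A B C E :: real
      using that by linarith
    show ?thesis using order_trans[OF tri[OF q X' Y V] sum] tpos
      by (simp only: abs_divide abs_minus_cancel abs_of_pos) (simp add: divide_right_mono)
  qed
  also have "\<dots> \<le> (Cq x0 + 2 * CB + 4 * CH) * ?S / \<tau>0"
    using tau tpos constants_nonneg pos by (intro divide_left_mono) auto
  also have "\<dots> = (Cq x0 + 2 * CB + 4 * CH) / \<tau>0 * ?S" by simp
  also have "\<dots> \<le> Q * ?S" using Q_parts(5) pos by (intro mult_right_mono) auto
  finally show ?thesis unfolding w_def by (simp add: mult.assoc)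
qed

end

lemma T_sdiff:
  assumes s: "\<bar>s\<bar> \<le> 1" "\<bar>s'\<bar> \<le> 1" and D: "adm \<omega> p q"
  shows "\<bar>T0 s \<omega> p q - T0 s' \<omega> p q\<bar> \<le> Q * \<bar>s - s'\<bar>"
    "bdd (Q * \<bar>s - s'\<bar>) (\<lambda>x. T1 s \<omega> p q x - T1 s' \<omega> p q x)"
    "bdd (Q * \<bar>s - s'\<bar>) (\<lambda>x. T2 s \<omega> p q x - T2 s' \<omega> p q x)"
proof -
  note P = adm_P[OF D]
  note c = cper_R[OF D, of s] cper_R[OF D, of s']
  define e where "e = 16 * M * \<bar>s - s'\<bar>"
  have b: "bdd e (\<lambda>x. R1 s \<omega> p q x - R1 s' \<omega> p q x)" "bdd e (\<lambda>x. R2 s \<omega> p q x - R2 s' \<omega> p q x)"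
    using sN_diff[OF P(3,4) s P(7)] by (simp_all add: R1_def R2_def e_def)
  have i: "\<bar>ip (\<lambda>x. R1 s \<omega> p q x - R1 s' \<omega> p q x) (\<lambda>x. R2 s \<omega> p q x - R2 s' \<omega> p q x) \<nu>1 \<nu>2\<bar> \<le> 4 * e"
    using ip_bdd[OF cper_diff[OF c(1,3)] cper_diff[OF c(2,4)] cper_nu b bdd_nu] by simp
  have e0: "e \<ge> 0" using M by (simp add: e_def)
  have tpos: "\<tau> > 0" using tau by linarith
  have "\<bar>T0 s \<omega> p q - T0 s' \<omega> p q\<bar> = \<bar>ip (\<lambda>x. R1 s \<omega> p q x - R1 s' \<omega> p q x) (\<lambda>x. R2 s \<omega> p q x - R2 s' \<omega> p q x) \<nu>1 \<nu>2\<bar> / \<tau>"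
    unfolding ip_diff[OF c cper_nu] T0_def using tpos by (simp add: abs_minus_commute diff_divide_distrib[symmetric])
  also have "\<dots> \<le> 4 * e / \<tau>0" using i tau tpos e0 by (intro frac_le) auto
  also have "\<dots> = 64 * M / \<tau>0 * \<bar>s - s'\<bar>" by (simp add: e_def)
  also have "\<dots> \<le> Q * \<bar>s - s'\<bar>" using Q_parts(6) by (intro mult_right_mono) auto
  finally show "\<bar>T0 s \<omega> p q - T0 s' \<omega> p q\<bar> \<le> Q * \<bar>s - s'\<bar>" .
  have "bdd (KC * e) (\<lambda>x. KR1 s \<omega> p q x - KR1 s' \<omega> p q x)" "bdd (KC * e) (\<lambda>x. KR2 s \<omega> p q x - KR2 s' \<omega> p q x)"
    using K_bdd[OF cper_diff[OF c(1,3)] cper_diff[OF c(2,4)] b] unfolding KR1_def KR2_def K_diff[OF c, abs_def] .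
  note T = T_diff_of_KR[OF D D this]
  have "9 * (KC * e) = 144 * KC * M * \<bar>s - s'\<bar>" by (simp add: e_def)
  also have "\<dots> \<le> Q * \<bar>s - s'\<bar>" using Q_parts(7) by (intro mult_right_mono) auto
  finally show "bdd (Q * \<bar>s - s'\<bar>) (\<lambda>x. T1 s \<omega> p q x - T1 s' \<omega> p q x)"
    "bdd (Q * \<bar>s - s'\<bar>) (\<lambda>x. T2 s \<omega> p q x - T2 s' \<omega> p q x)"
    using T bdd_mono by blast+
qed

lemma T_base: "T0 0 \<xi> (\<lambda>x. 0) (\<lambda>x. 0) = \<xi>" "T1 0 \<xi> (\<lambda>x. 0) (\<lambda>x. 0) x = 0" "T2 0 \<xi> (\<lambda>x. 0) (\<lambda>x. 0) x = 0"
proof -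
  have R: "R1 0 \<xi> (\<lambda>x. 0) (\<lambda>x. 0) = (\<lambda>x. 0)" "R2 0 \<xi> (\<lambda>x. 0) (\<lambda>x. 0) = (\<lambda>x. 0)"
    by (auto simp: R1_def R2_def)
  have K: "K1 (\<lambda>x. 0) (\<lambda>x. 0) = (\<lambda>x. 0)" "K2 (\<lambda>x. 0) (\<lambda>x. 0) = (\<lambda>x. 0)"
    by (auto simp: K1_def K2_def Z_def Zad_def)
  show "T0 0 \<xi> (\<lambda>x. 0) (\<lambda>x. 0) = \<xi>" "T1 0 \<xi> (\<lambda>x. 0) (\<lambda>x. 0) x = 0" "T2 0 \<xi> (\<lambda>x. 0) (\<lambda>x. 0) x = 0"
    by (simp_all add: T0_def T1_def T2_def KR1_def KR2_def R K ip_def)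
qed

sublocale newton: newton_family Q \<xi> T0 T1 T2 r a0 adm
proof unfold_locales
  have s1: "\<bar>s\<bar> \<le> a0 \<Longrightarrow> \<bar>s\<bar> \<le> 1" for s using r_bounds by linarith
  note T_diff' = T_diff[OF s1] and T0_diff' = T0_diff[OF s1] and T_sdiff' = T_sdiff[OF s1 s1]
  show "r = 1 / (32 * Q\<^sup>2)" "a0 = 1 / (256 * Q ^ 4)" "Q \<ge> 1"
    by (simp_all add: r_def a0_def Q_parts)
  show "adm \<omega> p q \<longleftrightarrow> \<bar>\<omega> - \<xi>\<bar> \<le> r \<and> cper p \<and> cper q \<and> bdd r p \<and> bdd r q \<and> lip 1 p \<and> lip 1 q" for \<omega> p q
    by (rule adm_def)
  fix s s' \<omega> \<omega>' d :: real and p q p' q' :: "real \<Rightarrow> real"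
  assume s: "\<bar>s\<bar> \<le> a0" and D: "adm \<omega> p q"
  show "cper (T1 s \<omega> p q) \<and> cper (T2 s \<omega> p q) \<and> lip 1 (T1 s \<omega> p q) \<and> lip 1 (T2 s \<omega> p q)"
    by (rule T_regular[OF s D])
  show "\<bar>T0 s \<omega> p q - T0 s' \<omega> p q\<bar> \<le> Q * \<bar>s - s'\<bar> \<and>
      bdd (Q * \<bar>s - s'\<bar>) (\<lambda>x. T1 s \<omega> p q x - T1 s' \<omega> p q x) \<and>
      bdd (Q * \<bar>s - s'\<bar>) (\<lambda>x. T2 s \<omega> p q x - T2 s' \<omega> p q x)" if "\<bar>s'\<bar> \<le> a0"
    using T_sdiff'[OF s that D] by blast
  assume D': "adm \<omega>' p' q'" and d: "bdd d (\<lambda>x. p x - p' x)" "bdd d (\<lambda>x. q x - q' x)"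
  show "\<bar>T0 s \<omega> p q - T0 s \<omega>' p' q'\<bar> \<le> Q * (r + \<bar>s\<bar>) * (\<bar>\<omega> - \<omega>'\<bar> + d)"
    by (rule T0_diff'[OF s D D' d])
  show "bdd (Q * \<bar>\<omega> - \<omega>'\<bar> + Q * (r + \<bar>s\<bar>) * (\<bar>\<omega> - \<omega>'\<bar> + d)) (\<lambda>x. T1 s \<omega> p q x - T1 s \<omega>' p' q' x) \<and>
      bdd (Q * \<bar>\<omega> - \<omega>'\<bar> + Q * (r + \<bar>s\<bar>) * (\<bar>\<omega> - \<omega>'\<bar> + d)) (\<lambda>x. T2 s \<omega> p q x - T2 s \<omega>' p' q' x)"
    using T_diff'[OF s D D' d] by blast
qed (rule T_base)+

section \<open>From fixed points to solutions\<close>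

lemma force_split:
  "bb \<omega> * force1 (\<lambda>y. y + s * h1 s y) (\<lambda>y. \<kappa> * y + s * h2 s y) \<omega> p q x = B1 \<omega> p q x + s * N1 s \<omega> p q x"
  "bb \<omega> * force2 (\<lambda>y. y + s * h1 s y) (\<lambda>y. \<kappa> * y + s * h2 s y) \<omega> p q x = B2 \<omega> p q x + s * N2 s \<omega> p q x"
  by (simp_all add: force1_def force2_def B1_def B2_def A1_def A2_def Zw_def Zwad_def N1_def N2_def algebra_simps)

text \<open>At a fixed point the equation holds up to a multiple of \<open>\<nu>'\<close> and a constant, since \<open>Pi1\<close>, \<open>Pi2\<close> project
  onto the whole kernel. Testing with the derivative of the solution and with constants, where the forces do no work,
  shows that both multiples vanish.\<close>

lemma fixed_point_solves:
  assumes s: "\<bar>s\<bar> \<le> 1" and D: "adm \<omega> p q"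
    and fp: "T0 s \<omega> p q = \<omega>" "T1 s \<omega> p q = p" "T2 s \<omega> p q = q"
  defines "g1 \<equiv> \<lambda>y. y + s * h1 s y" and "g2 \<equiv> \<lambda>y. \<kappa> * y + s * h2 s y"
  shows "ip p q \<nu>1 \<nu>2 = 0"
    "\<exists>d. deriv2 (P1 p) d (\<lambda>x. bb \<omega> * force1 g1 g2 \<omega> (P1 p) (P2 q) x)"
    "\<exists>d. deriv2 (P2 q) d (\<lambda>x. bb \<omega> * force2 g1 g2 \<omega> (P1 p) (P2 q) x / m)"
proof -
  let ?R1 = "R1 s \<omega> p q" and ?R2 = "R2 s \<omega> p q"
  note cR = cper_R[OF D, of s] and P = adm_P[OF D] and cK = cper_KR[OF D, of s]
  have pq: "cper p" "cper q" using D by (auto simp: adm_def)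
  have tpos: "\<tau> > 0" using tau by linarith
  have ipR: "ip ?R1 ?R2 \<nu>1 \<nu>2 = 0" using fp(1) tpos by (simp add: T0_def)
  define c where "c = ip (KR1 s \<omega> p q) (KR2 s \<omega> p q) \<nu>1 \<nu>2"
  have p: "p = (\<lambda>x. KR1 s \<omega> p q x - c * \<nu>1 x)" and q: "q = (\<lambda>x. KR2 s \<omega> p q x - c * \<nu>2 x)"
    using fp(2,3) by (auto simp: T1_def T2_def c_def fun_eq_iff)
  have "ip p q \<nu>1 \<nu>2 = c - c * ip \<nu>1 \<nu>2 \<nu>1 \<nu>2"
    by (subst p, subst q) (simp add: ip_diff[OF cK] cper_mult ip_cmult c_def)
  then show ip0: "ip p q \<nu>1 \<nu>2 = 0" by (simp add: ip_nu)
  obtain d1 d2 where d: "deriv2 (KR1 s \<omega> p q) d1 (rhs1 ?R1 ?R2)" "deriv2 (KR2 s \<omega> p q) d2 (\<lambda>x. rhs2 ?R1 ?R2 x / m)"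
    using sol_cper[OF cR] by (auto simp: sol_def KR1_def KR2_def)
  define f1 f2 where "f1 = force1 g1 g2 \<omega> (P1 p) (P2 q)" and "f2 = force2 g1 g2 \<omega> (P1 p) (P2 q)"
  \<comment> \<open>\<beta> and \<gamma> are the components of the remainder along \<nu>' and along
    the constants, which the inversion leaves unsolved.\<close>
  define \<beta> where "\<beta> = ip ?R1 ?R2 (\<lambda>x. \<nu>1 (x + pi / 2)) (\<lambda>x. \<nu>2 (x + pi / 2))"
  define \<gamma> where "\<gamma> = (mean ?R1 + mean ?R2) / 2"
  define v1 v2 where "v1 x = bb \<omega> * f1 x - \<beta> * \<nu>1 (x + pi / 2) - \<gamma>" 
    and "v2 x = bb \<omega> * f2 x - \<beta> * \<nu>2 (x + pi / 2) - \<gamma>" for x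
  have K: "KR1 s \<omega> p q = (\<lambda>x. p x + c * \<nu>1 x)" "KR2 s \<omega> p q = (\<lambda>x. q x + c * \<nu>2 x)"
    by (subst (2) p, simp) (subst (2) q, simp)
  have lin: "(Z (\<lambda>x. q x + c * \<nu>2 x) x - (1 + \<kappa>) * (p x + c * \<nu>1 x)) / \<Lambda> = (Z q x - (1 + \<kappa>) * p x) / \<Lambda> - c * \<nu>1 x"
    "(Zad (\<lambda>x. p x + c * \<nu>1 x) x - (1 + \<kappa>) * (q x + c * \<nu>2 x)) / \<Lambda> = (Zad p x - (1 + \<kappa>) * q x) / \<Lambda> - m * c * \<nu>2 x" for x
  proof -
    have "Z (\<lambda>x. q x + c * \<nu>2 x) x - (1 + \<kappa>) * (p x + c * \<nu>1 x) = (Z q x - (1 + \<kappa>) * p x) + c * (Z \<nu>2 x - (1 + \<kappa>) * \<nu>1 x)"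
      "Zad (\<lambda>x. p x + c * \<nu>1 x) x - (1 + \<kappa>) * (q x + c * \<nu>2 x) = (Zad p x - (1 + \<kappa>) * q x) + c * (Zad \<nu>1 x - (1 + \<kappa>) * \<nu>2 x)"
      by (simp_all add: Z_def Zad_def algebra_simps)
    then show "(Z (\<lambda>x. q x + c * \<nu>2 x) x - (1 + \<kappa>) * (p x + c * \<nu>1 x)) / \<Lambda> = (Z q x - (1 + \<kappa>) * p x) / \<Lambda> - c * \<nu>1 x"
      "(Zad (\<lambda>x. p x + c * \<nu>1 x) x - (1 + \<kappa>) * (q x + c * \<nu>2 x)) / \<Lambda> = (Zad p x - (1 + \<kappa>) * q x) / \<Lambda> - m * c * \<nu>2 x"
      unfolding nu_eig using lam_pos by (simp_all add: add_divide_distrib diff_divide_distrib)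
  qed
  have BP: "B1 \<xi> (P1 p) (P2 q) x = (Z q x - (1 + \<kappa>) * p x) / \<Lambda> - \<nu>1 x" "B2 \<xi> (P1 p) (P2 q) x = (Zad p x - (1 + \<kappa>) * q x) / \<Lambda> - m * \<nu>2 x" for x
  proof -
    have "Z (P2 q) x - (1 + \<kappa>) * P1 p x = (Z q x - (1 + \<kappa>) * p x) + (Z \<nu>2 x - (1 + \<kappa>) * \<nu>1 x)"
      "Zad (P1 p) x - (1 + \<kappa>) * P2 q x = (Zad p x - (1 + \<kappa>) * q x) + (Zad \<nu>1 x - (1 + \<kappa>) * \<nu>2 x)"
      by (simp_all add: Z_def Zad_def P1_def P2_def algebra_simps)
    then show "B1 \<xi> (P1 p) (P2 q) x = (Z q x - (1 + \<kappa>) * p x) / \<Lambda> - \<nu>1 x" "B2 \<xi> (P1 p) (P2 q) x = (Zad p x - (1 + \<kappa>) * q x) / \<Lambda> - m * \<nu>2 x"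
      unfolding B1_def B2_def A_xi bb_xi nu_eig using lam_pos by (simp_all add: add_divide_distrib diff_divide_distrib)
  qed
  define e1 e2 where "e1 x = d1 x - c * \<nu>1 (x + pi / 2) + \<nu>1 (x + pi / 2)" and "e2 x = d2 x - c * \<nu>2 (x + pi / 2) + \<nu>2 (x + pi / 2)" for x
  have P1d: "deriv2 (P1 p) e1 v1"
  proof (unfold e1_def[abs_def], rule deriv2_cong[OF deriv2_add[OF deriv2_diff[OF d(1) deriv2_cmult[OF nu_deriv2(1)]] nu_deriv2(1)]])
    fix x
    show "KR1 s \<omega> p q x - c * \<nu>1 x + \<nu>1 x = P1 p x" by (simp add: P1_def K)
    have "rhs1 ?R1 ?R2 x = (Z q x - (1 + \<kappa>) * p x) / \<Lambda> - c * \<nu>1 x + ?R1 x - (\<beta> * \<nu>1 (x + pi / 2) + \<gamma>)"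
      unfolding rhs1_def Pi1_def ipR KR1_def[symmetric] KR2_def[symmetric] unfolding K lin by (simp add: \<beta>_def \<gamma>_def)
    moreover have "?R1 x = bb \<omega> * f1 x - B1 \<xi> (P1 p) (P2 q) x"
      unfolding f1_def g1_def g2_def force_split R1_def by simp
    ultimately show "rhs1 ?R1 ?R2 x - c * - \<nu>1 x + - \<nu>1 x = v1 x"
      unfolding BP v1_def by simp
  qed
  have P2d: "deriv2 (P2 q) e2 (\<lambda>x. v2 x / m)"
  proof (unfold e2_def[abs_def], rule deriv2_cong[OF deriv2_add[OF deriv2_diff[OF d(2) deriv2_cmult[OF nu_deriv2(2)]] nu_deriv2(2)]])
    fix x
    show "KR2 s \<omega> p q x - c * \<nu>2 x + \<nu>2 x = P2 q x" by (simp add: P2_def K)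
    have "rhs2 ?R1 ?R2 x = (Zad p x - (1 + \<kappa>) * q x) / \<Lambda> - m * c * \<nu>2 x + ?R2 x - (\<beta> * \<nu>2 (x + pi / 2) + \<gamma>)"
      unfolding rhs2_def Pi2_def ipR KR1_def[symmetric] KR2_def[symmetric] unfolding K lin by (simp add: \<beta>_def \<gamma>_def)
    moreover have "?R2 x = bb \<omega> * f2 x - B2 \<xi> (P1 p) (P2 q) x"
      unfolding f2_def g1_def g2_def force_split R2_def by simp
    ultimately have "rhs2 ?R1 ?R2 x = v2 x - m * c * \<nu>2 x + m * \<nu>2 x"
      unfolding BP v2_def by simp
    then show "rhs2 ?R1 ?R2 x / m - c * - \<nu>2 x + - \<nu>2 x = v2 x / m"
      using m_pos by (simp add: field_simps)
  qed
  have ce: "cper e1" "cper e2" using deriv2_cper[OF P1d P(1)] deriv2_cper[OF P2d P(2)] .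
  have de: "(P1 p has_real_derivative e1 x) (at x)" "(P2 q has_real_derivative e2 x) (at x)"
    "(e1 has_real_derivative v1 x) (at x)" "(e2 has_real_derivative v2 x / m) (at x)" for x
    using P1d P2d by (auto simp: deriv2_def)
  have g_cont: "continuous_on UNIV g1" "continuous_on UNIV g2"
    unfolding g1_def g2_def by (intro continuous_intros h_cont)+
  note inv = force_invariants[OF g_cont P(1,2) ce de(1,2), of \<omega>, folded f1_def f2_def]
  have cf: "cper f1" "cper f2"
    unfolding f1_def f2_def force1_def[abs_def] force2_def[abs_def]
    by (intro cper_diff cper_shift cper_shift' cper_compose[OF g_cont(1)] cper_compose[OF g_cont(2)] P)+
  have cnu: "cper (\<lambda>x. \<nu>1 (x + pi / 2))" "cper (\<lambda>x. \<nu>2 (x + pi / 2))" by (intro cper_shift cper_nu)+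
  have cv: "cper v1" "cper v2"
    unfolding v1_def[abs_def] v2_def[abs_def] by (intro cper_diff cper_mult cper_const cf cnu)+
  have mnu: "mean (\<lambda>x. \<nu>1 (x + pi / 2)) = 0" "mean (\<lambda>x. \<nu>2 (x + pi / 2)) = 0"
    by (rule mean_deriv[of \<nu>1], use nu_deriv2 cper_nu in \<open>auto simp: deriv2_def cper_def\<close>)
      (rule mean_deriv[of \<nu>2], use nu_deriv2 cper_nu in \<open>auto simp: deriv2_def cper_def\<close>)
  have v_mean: "mean v1 = 0" "mean v2 = 0"
  proof -
    show "mean v1 = 0" by (rule mean_deriv[of e1]) (use de cperD[OF ce(1)] in auto)
    have "mean (\<lambda>x. v2 x / m) = 0" by (rule mean_deriv[of e2]) (use de cperD[OF ce(2)] in auto)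
    then show "mean v2 = 0" using mean_cmult[of "1 / m" v2] m_pos by simp
  qed
  \<comment> \<open>Accelerations of a periodic motion have mean 0 and the forces have total mean 0,
    so only \<gamma> is left.\<close>
  have \<gamma>0: "\<gamma> = 0"
  proof -
    have "mean v1 = bb \<omega> * mean f1 - \<beta> * mean (\<lambda>x. \<nu>1 (x + pi / 2)) - \<gamma>"
      "mean v2 = bb \<omega> * mean f2 - \<beta> * mean (\<lambda>x. \<nu>2 (x + pi / 2)) - \<gamma>"
      unfolding v1_def[abs_def] v2_def[abs_def]
      by (simp_all only: mean_diff cper_diff cper_mult cper_const cf cnu mean_cmult mean_const)
    then have "2 * \<gamma> = bb \<omega> * (mean f1 + mean f2)" using v_mean mnu by (simp add: distrib_left)
    then show ?thesis using inv(1) by (simp add: mean_add cf)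
  qed
  have \<beta>0: "\<beta> = 0"
  proof -
    let ?n1 = "\<lambda>x. \<nu>1 (x + pi / 2)" and ?n2 = "\<lambda>x. \<nu>2 (x + pi / 2)"
    \<comment> \<open>The product of acceleration and velocity is the derivative of the kinetic
      energy, with weight m on the second component.\<close>
    have "ip v1 v2 e1 e2 = 0"
      unfolding ip_def
    proof (rule mean_deriv)
      show "((\<lambda>x. (e1 x * e1 x + m * (e2 x * e2 x)) / 2) has_real_derivative v1 x * e1 x + v2 x * e2 x) (at x)" for x
        using m_pos by (auto intro!: derivative_eq_intros de)
      show "(e1 (x + 2 * pi) * e1 (x + 2 * pi) + m * (e2 (x + 2 * pi) * e2 (x + 2 * pi))) / 2 = (e1 x * e1 x + m * (e2 x * e2 x)) / 2" for x
        using cperD[OF ce(1)] cperD[OF ce(2)] by simp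
    qed
    moreover have "ip v1 v2 e1 e2 = bb \<omega> * ip f1 f2 e1 e2 - \<beta> * ip ?n1 ?n2 e1 e2"
      unfolding v1_def[abs_def] v2_def[abs_def] \<gamma>0
      by (simp add: ip_diff cper_mult cf cnu ce ip_cmult)
    ultimately have b: "\<beta> * ip ?n1 ?n2 e1 e2 = 0" using inv(2) by simp
    \<comment> \<open>Integration by parts with \<nu>'' = -\<nu>. The profile is \<nu> plus an
      orthogonal part, so the factor multiplying \<beta> is 1.\<close>
    have "ip ?n1 ?n2 e1 e2 = ip (P1 p) (P2 q) \<nu>1 \<nu>2"
    proof -
      have "mean (\<lambda>x. (?n1 x * e1 x + ?n2 x * e2 x) - (P1 p x * \<nu>1 x + P2 q x * \<nu>2 x)) = 0"
      proof (rule mean_deriv)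
        have n: "(?n1 has_real_derivative - \<nu>1 x) (at x)" "(?n2 has_real_derivative - \<nu>2 x) (at x)" for x
          using nu_deriv2 by (auto simp: deriv2_def)
        show "((\<lambda>x. ?n1 x * P1 p x + ?n2 x * P2 q x) has_real_derivative
          (?n1 x * e1 x + ?n2 x * e2 x) - (P1 p x * \<nu>1 x + P2 q x * \<nu>2 x)) (at x)" for x
          using DERIV_add[OF DERIV_mult[OF n(1) de(1)] DERIV_mult[OF n(2) de(2)], of x] by (simp add: algebra_simps)
        show "?n1 (x + 2 * pi) * P1 p (x + 2 * pi) + ?n2 (x + 2 * pi) * P2 q (x + 2 * pi) = ?n1 x * P1 p x + ?n2 x * P2 q x" for x
          using cperD[OF cnu(1), of x] cperD[OF cnu(2), of x] cperD[OF P(1), of x] cperD[OF P(2), of x] by simp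
      qed
      then show ?thesis unfolding ip_def
        by (subst (asm) mean_diff) (auto intro!: cper_add cper_mult cnu ce P)
    qed
    also have "\<dots> = 1" unfolding P1_def[abs_def] P2_def[abs_def] using ip0 by (simp add: ip_add pq ip_nu)
    finally show ?thesis using b by simp
  qed
  show "\<exists>d. deriv2 (P1 p) d (\<lambda>x. bb \<omega> * force1 g1 g2 \<omega> (P1 p) (P2 q) x)"
    using P1d unfolding v1_def[abs_def] \<beta>0 \<gamma>0 f1_def by auto
  show "\<exists>d. deriv2 (P2 q) d (\<lambda>x. bb \<omega> * force2 g1 g2 \<omega> (P1 p) (P2 q) x / m)"
    using P2d unfolding v2_def[abs_def] \<beta>0 \<gamma>0 f2_def by auto
qed

text \<open>Restates the fixed points for the full profiles \<nu>1 + p and \<nu>2 + q, whose a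
  priori Lipschitz constant 3 will start the bootstrap.\<close>

theorem periodic_solution_family:
  obtains om p q where
    "\<And>s. \<bar>s\<bar> \<le> a0 \<Longrightarrow> \<bar>om s - \<xi>\<bar> \<le> x0 / 2"
    "\<And>s. \<bar>s\<bar> \<le> a0 \<Longrightarrow> cper (p s) \<and> cper (q s) \<and> bdd 3 (p s) \<and> bdd 3 (q s) \<and> lip 3 (p s) \<and> lip 3 (q s)"
    "\<And>s. \<bar>s\<bar> \<le> a0 \<Longrightarrow> ip (\<lambda>x. p s x - \<nu>1 x) (\<lambda>x. q s x - \<nu>2 x) \<nu>1 \<nu>2 = 0"
    "\<And>s. \<bar>s\<bar> \<le> a0 \<Longrightarrow> \<exists>d. deriv2 (p s) d
      (\<lambda>x. bb (om s) * force1 (\<lambda>y. y + s * h1 s y) (\<lambda>y. \<kappa> * y + s * h2 s y) (om s) (p s) (q s) x)"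
    "\<And>s. \<bar>s\<bar> \<le> a0 \<Longrightarrow> \<exists>d. deriv2 (q s) d
      (\<lambda>x. bb (om s) * force2 (\<lambda>y. y + s * h1 s y) (\<lambda>y. \<kappa> * y + s * h2 s y) (om s) (p s) (q s) x / m)"
    "\<And>s s'. \<bar>s\<bar> \<le> a0 \<Longrightarrow> \<bar>s'\<bar> \<le> a0 \<Longrightarrow> \<bar>om s - om s'\<bar> \<le> 8 * Q\<^sup>2 * \<bar>s - s'\<bar> \<and>
      bdd (8 * Q\<^sup>2 * \<bar>s - s'\<bar>) (\<lambda>x. p s x - p s' x) \<and> bdd (8 * Q\<^sup>2 * \<bar>s - s'\<bar>) (\<lambda>x. q s x - q s' x)"
    "om 0 = \<xi>" "p 0 = \<nu>1" "q 0 = \<nu>2"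
proof -
  obtain om p q where D: "\<And>s. \<bar>s\<bar> \<le> a0 \<Longrightarrow> newton.D (om s) (p s) (q s)"
    and fp: "\<And>s. \<bar>s\<bar> \<le> a0 \<Longrightarrow> T0 s (om s) (p s) (q s) = om s"
    "\<And>s. \<bar>s\<bar> \<le> a0 \<Longrightarrow> T1 s (om s) (p s) (q s) = p s"
    "\<And>s. \<bar>s\<bar> \<le> a0 \<Longrightarrow> T2 s (om s) (p s) (q s) = q s"
    and L: "\<And>s s'. \<bar>s\<bar> \<le> a0 \<Longrightarrow> \<bar>s'\<bar> \<le> a0 \<Longrightarrow> newton.near (8 * Q\<^sup>2 * \<bar>s - s'\<bar>) (om s) (p s) (q s) (om s') (p s') (q s')"
    and z: "om 0 = \<xi>" "p 0 = (\<lambda>x. 0)" "q 0 = (\<lambda>x. 0)"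
  proof (rule newton.fixed_point_family, goal_cases)
    case (1 om p q)
    show ?case by (rule 1(1)[of om p q]) (use 1(2-) in auto)
  qed
  have A: "adm (om s) (p s) (q s)" if "\<bar>s\<bar> \<le> a0" for s using newton.D_dom[OF D[OF that]] .
  have s1: "\<bar>s\<bar> \<le> a0 \<Longrightarrow> \<bar>s\<bar> \<le> 1" for s using r_bounds by linarith
  show ?thesis
  proof (rule that[of om "\<lambda>s. P1 (p s)" "\<lambda>s. P2 (q s)"])
    fix s s' assume s: "\<bar>s\<bar> \<le> a0"
    note P = adm_P[OF A[OF s]]
    note F = fixed_point_solves[OF s1[OF s] A[OF s] fp(1)[OF s] fp(2)[OF s] fp(3)[OF s]]
    show "\<bar>om s - \<xi>\<bar> \<le> x0 / 2" by (rule P)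
    show "cper (P1 (p s)) \<and> cper (P2 (q s)) \<and> bdd 3 (P1 (p s)) \<and> bdd 3 (P2 (q s))
      \<and> lip 3 (P1 (p s)) \<and> lip 3 (P2 (q s))" using P by blast
    show "ip (\<lambda>x. P1 (p s) x - \<nu>1 x) (\<lambda>x. P2 (q s) x - \<nu>2 x) \<nu>1 \<nu>2 = 0"
      using F(1) by (simp add: P1_def P2_def)
    show "\<exists>d. deriv2 (P1 (p s)) d
      (\<lambda>x. bb (om s) * force1 (\<lambda>y. y + s * h1 s y) (\<lambda>y. \<kappa> * y + s * h2 s y) (om s) (P1 (p s)) (P2 (q s)) x)"
      "\<exists>d. deriv2 (P2 (q s)) d
      (\<lambda>x. bb (om s) * force2 (\<lambda>y. y + s * h1 s y) (\<lambda>y. \<kappa> * y + s * h2 s y) (om s) (P1 (p s)) (P2 (q s)) x / m)"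
      using F(2,3) .
    assume s': "\<bar>s'\<bar> \<le> a0"
    have "\<bar>om s - om s'\<bar> \<le> 4 * Q * \<bar>om s - om s'\<bar>"
      using Q_parts(1) mult_right_mono[of 1 "4 * Q" "\<bar>om s - om s'\<bar>"] by simp
    moreover have "4 * Q * \<bar>om s - om s'\<bar> \<le> 8 * Q\<^sup>2 * \<bar>s - s'\<bar>"
      using L[OF s s'] unfolding newton.near_def by blast
    ultimately have "\<bar>om s - om s'\<bar> \<le> 8 * Q\<^sup>2 * \<bar>s - s'\<bar>" by linarith
    then show "\<bar>om s - om s'\<bar> \<le> 8 * Q\<^sup>2 * \<bar>s - s'\<bar> \<and>
      bdd (8 * Q\<^sup>2 * \<bar>s - s'\<bar>) (\<lambda>x. P1 (p s) x - P1 (p s') x) \<and> bdd (8 * Q\<^sup>2 * \<bar>s - s'\<bar>) (\<lambda>x. P2 (q s) x - P2 (q s') x)"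
      using L[OF s s'] by (auto simp: newton.near_def P1_def P2_def)
  qed (simp_all add: z P1_def[abs_def] P2_def[abs_def])
qed

end

section \<open>Smooth functions\<close>

text \<open>All derivatives come as one explicit sequence, the form that differentiation under an
  integral produces.\<close>

definition csmooth :: "(real \<Rightarrow> real) \<Rightarrow> bool" where
  "csmooth f \<longleftrightarrow> (\<exists>F. F 0 = f \<and> (\<forall>n x. (F n has_real_derivative F (Suc n) x) (at x)))"

lemma csmooth_deriv:
  assumes "csmooth f"
  obtains f' where "csmooth f'" "\<And>x. (f has_real_derivative f' x) (at x)"
proof -
  obtain F where F: "F 0 = f" "\<And>n x. (F n has_real_derivative F (Suc n) x) (at x)"
    using assms by (auto simp: csmooth_def)
  then have "csmooth (F (Suc 0))"
    unfolding csmooth_def by (intro exI[of _ "\<lambda>n. F (Suc n)"]) auto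
  then show ?thesis using that F by metis
qed

lemma csmooth_continuous: "csmooth f \<Longrightarrow> continuous_on UNIV f"
  by (metis csmooth_deriv DERIV_isCont continuous_at_imp_continuous_on)

lemma csmooth_local_bounds:
  assumes "csmooth f"
  obtains B where "0 \<le> B" "\<And>y. \<bar>y\<bar> \<le> C \<Longrightarrow> \<bar>f y\<bar> \<le> B"
    "\<And>y z. \<bar>y\<bar> \<le> C \<Longrightarrow> \<bar>z\<bar> \<le> C \<Longrightarrow> \<bar>f y - f z\<bar> \<le> B * \<bar>y - z\<bar>"
proof -
  obtain f' where f': "csmooth f'" "\<And>x. (f has_real_derivative f' x) (at x)" using csmooth_deriv[OF assms] by blast
  have "\<exists>B. \<forall>y\<in>{-C..C}. \<bar>g y\<bar> \<le> B" if "csmooth g" for g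
  proof -
    have "compact (g ` {-C..C})"
      by (intro compact_continuous_image continuous_on_subset[OF csmooth_continuous[OF that]]) auto
    then obtain B where "\<forall>x\<in>g ` {-C..C}. norm x \<le> B" using compact_imp_bounded bounded_iff by metis
    then show ?thesis by auto
  qed
  then obtain B1 B2 where B: "\<forall>y\<in>{-C..C}. \<bar>f y\<bar> \<le> B1" "\<forall>y\<in>{-C..C}. \<bar>f' y\<bar> \<le> B2" using assms f'(1) by metis
  define B where "B = max 0 (max B1 B2)"
  have "\<bar>f y - f z\<bar> \<le> B * \<bar>y - z\<bar>" if "\<bar>y\<bar> \<le> C" "\<bar>z\<bar> \<le> C" for y z
  proof -
    have "norm (f y - f z) \<le> B * norm (y - z)"
    proof (rule field_differentiable_bound[of "{-C..C}"])
      show "(f has_real_derivative f' x) (at x within {-C..C})" for x by (rule DERIV_subset[OF f'(2)]) simp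
      show "norm (f' x) \<le> B" if "x \<in> {-C..C}" for x
      proof -
        have "\<bar>f' x\<bar> \<le> B2" using B(2) that by blast
        then show ?thesis by (simp add: B_def)
      qed
    qed (use that in \<open>auto simp: abs_le_iff\<close>)
    then show ?thesis by simp
  qed
  moreover have "\<bar>f y\<bar> \<le> B" if "\<bar>y\<bar> \<le> C" for y proof -
    have "\<bar>f y\<bar> \<le> B1" using B(1) that by (simp add: abs_le_iff)
    then show ?thesis by (simp add: B_def)
  qed
  ultimately show ?thesis using that[of B] by (auto simp: B_def)
qed

text \<open>Hadamard's lemma: the quotient is \<open>\<integral>\<^sub>0\<^sup>1 f'(t x) dt\<close>.\<close>

lemma csmooth_divide:
  assumes "csmooth f" "f 0 = 0"
  obtains k where "csmooth k" "\<And>x. f x = x * k x"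
proof -
  obtain F where F: "F 0 = f" "\<And>n x. (F n has_real_derivative F (Suc n) x) (at x)"
    using assms by (auto simp: csmooth_def)
  have cF: "continuous_on A (F n)" for A n
    using F(2) DERIV_isCont by (blast intro: continuous_at_imp_continuous_on)
  \<comment> \<open>\<open>K n\<close> is the n-th derivative of the quotient \<open>K 0\<close>:
    each derivative in x of a function of t x brings down a factor t.\<close>
  define K where "K n x = integral {0..1} (\<lambda>t. t ^ n * F (Suc n) (t * x))" for n x
  have int: "(\<lambda>t. t ^ n * F (Suc n) (t * x)) integrable_on {0..1}" for n x
    by (intro integrable_continuous_interval continuous_intros continuous_on_compose2[OF cF[of UNIV]]) auto
  have dK: "(K n has_real_derivative K (Suc n) x) (at x)" for n x
  proof -
    have "((\<lambda>x. integral (cbox 0 1) (\<lambda>t. t ^ n * F (Suc n) (t * x))) has_field_derivative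
        integral (cbox 0 1) (\<lambda>t. t ^ Suc n * F (Suc (Suc n)) (t * x))) (at x within UNIV)"
    proof (rule leibniz_rule_field_derivative)
      show "((\<lambda>x. t ^ n * F (Suc n) (t * x)) has_field_derivative t ^ Suc n * F (Suc (Suc n)) (t * x)) (at x within UNIV)" for t x
        using DERIV_cmult[OF DERIV_chain2[OF F(2)[of "Suc n" "t * x"] DERIV_cmult_Id[of t]], of "t ^ n"] by (simp add: mult_ac)
      show "(\<lambda>t. t ^ n * F (Suc n) (t * x)) integrable_on cbox 0 1" for x using int by simp
      show "continuous_on (UNIV \<times> cbox 0 1) (\<lambda>(x, t). t ^ Suc n * F (Suc (Suc n)) (t * x))"
        unfolding case_prod_beta
        by (intro continuous_intros continuous_on_compose2[OF cF[of UNIV]]) auto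
    qed auto
    then show ?thesis by (simp add: K_def[abs_def])
  qed
  then have "csmooth (K 0)" unfolding csmooth_def by blast
  moreover have "f x = x * K 0 x" for x
  proof -
    have "((\<lambda>t. x * F (Suc 0) (t * x)) has_integral (f (1 * x) - f (0 * x))) {0..1}"
    proof (rule fundamental_theorem_of_calculus)
      fix t :: real
      have "((\<lambda>t. F 0 (t * x)) has_real_derivative F (Suc 0) (t * x) * x) (at t)"
        by (rule DERIV_chain2[OF F(2)]) (auto intro!: derivative_eq_intros)
      then show "((\<lambda>t. f (t * x)) has_vector_derivative x * F (Suc 0) (t * x)) (at t within {0..1})"
        by (auto simp: F(1) mult.commute has_real_derivative_iff_has_vector_derivative intro: has_vector_derivative_at_within)
    qed simp
    from integral_unique[OF this] show ?thesis using assms(2) by (simp add: K_def)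
  qed
  ultimately show ?thesis using that by blast
qed

section \<open>Iterated derivatives and the second order expansion of the forces\<close>

lemma nth_deriv_Suc: "nth_deriv (Suc n) f x = vector_derivative (nth_deriv n f) (at x)"
  by (simp add: nth_deriv_def)

lemma nth_deriv_Suc_right: "nth_deriv (Suc n) f = nth_deriv n (\<lambda>x. vector_derivative f (at x))"
  unfolding nth_deriv_def funpow_Suc_right by simp

lemma nth_deriv_eqI:
  assumes "F 0 = f" "\<And>n x. (F n has_vector_derivative F (Suc n) x) (at x)"
  shows "nth_deriv n f = F n"
proof (induction n)
  case (Suc n)
  then show ?case using vector_derivative_at[OF assms(2)] by (auto simp: nth_deriv_Suc)
qed (simp add: nth_deriv_def assms)

lemma smoothI:
  assumes "F 0 = f" "\<And>n x. (F n has_vector_derivative F (Suc n) x) (at x)"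
  shows "smooth f"
  unfolding smooth_def nth_deriv_eqI[OF assms] using assms(2) differentiableI_vector by blast

lemma nth_deriv_smooth:
  assumes "smooth f" shows "(nth_deriv n f has_vector_derivative nth_deriv (Suc n) f x) (at x)"
  using assms unfolding smooth_def nth_deriv_Suc by (simp add: vector_derivative_works[symmetric])

lemma smooth_deriv_csmooth:
  assumes "smooth V" shows "csmooth (deriv V)"
proof -
  have d: "(nth_deriv n V has_real_derivative nth_deriv (Suc n) V x) (at x)" for n x
    using nth_deriv_smooth[OF assms] by (simp add: has_real_derivative_iff_has_vector_derivative)
  have "deriv V x = nth_deriv 1 V x" for x using d[of 0 x] by (simp add: nth_deriv_def DERIV_imp_deriv)
  then have "deriv V = nth_deriv 1 V" by blast
  then show ?thesis unfolding csmooth_def by (intro exI[of _ "\<lambda>n. nth_deriv (Suc n) V"]) (use d in auto)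
qed

text \<open>Comparing limits at 0, the order condition forces first f 0 = 0 and then, for the
  quotient by r, the value k. Dividing by r twice leaves a smooth factor.\<close>

lemma csmooth_taylor2:
  assumes f: "csmooth f" and O: "(\<lambda>r. f r - (k * r + \<beta> * r\<^sup>2)) \<in> O[at 0](\<lambda>r. r ^ 3)"
  obtains h where "csmooth h" "\<And>r. f r = k * r + r\<^sup>2 * h r"
proof -
  obtain C where C: "C > 0" "\<forall>\<^sub>F r in at 0. norm (f r - (k * r + \<beta> * r\<^sup>2)) \<le> C * norm (r ^ 3)"
    using landau_o.bigE[OF O] by blast
  then have ev: "\<forall>\<^sub>F r in at 0. norm (f r - (k * r + \<beta> * r\<^sup>2)) \<le> norm (C * r ^ 3)"
    using C(1) by (simp add: abs_mult)
  have "((\<lambda>r. f r - (k * r + \<beta> * r\<^sup>2)) \<longlongrightarrow> 0) (at 0)"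
    by (rule Lim_null_comparison[OF ev]) (auto intro!: tendsto_eq_intros)
  then have "((\<lambda>r. f r - (k * r + \<beta> * r\<^sup>2) + (k * r + \<beta> * r\<^sup>2)) \<longlongrightarrow> 0 + 0) (at 0)"
    by (intro tendsto_add) (auto intro!: tendsto_eq_intros)
  moreover have "(f \<longlongrightarrow> f 0) (at 0)"
    using csmooth_continuous[OF f] by (simp add: continuous_on_eq_continuous_at isCont_def)
  ultimately have "f 0 = 0" using tendsto_unique[of "at (0::real)" f] by simp
  then obtain g where g: "csmooth g" "\<And>r. f r = r * g r" using csmooth_divide[OF f] by metis
  have ne: "\<forall>\<^sub>F r in at (0::real). r \<noteq> 0" by (simp add: eventually_at_filter)
  have "\<forall>\<^sub>F r in at 0. norm (g r - (k + \<beta> * r)) \<le> norm (C * r\<^sup>2)"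
    using ev ne
  proof eventually_elim
    case (elim r)
    have "f r - (k * r + \<beta> * r\<^sup>2) = r * (g r - (k + \<beta> * r))" by (simp add: g(2) algebra_simps power2_eq_square)
    moreover have "C * r ^ 3 = r * (C * r\<^sup>2)" by (simp add: power2_eq_square power3_eq_cube)
    ultimately have "\<bar>r\<bar> * \<bar>g r - (k + \<beta> * r)\<bar> \<le> \<bar>r\<bar> * \<bar>C * r\<^sup>2\<bar>" using elim(1) by (simp only: real_norm_def abs_mult)
    then show ?case using elim(2) mult_le_cancel_left_pos[of "\<bar>r\<bar>"] by simp
  qed
  then have "((\<lambda>r. g r - (k + \<beta> * r)) \<longlongrightarrow> 0) (at 0)"
    by (rule Lim_null_comparison) (auto intro!: tendsto_eq_intros)
  then have "((\<lambda>r. g r - (k + \<beta> * r) + (k + \<beta> * r)) \<longlongrightarrow> 0 + k) (at 0)"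
    by (intro tendsto_add) (auto intro!: tendsto_eq_intros)
  moreover have "(g \<longlongrightarrow> g 0) (at 0)"
    using csmooth_continuous[OF g(1)] by (simp add: continuous_on_eq_continuous_at isCont_def)
  ultimately have g0: "g 0 = k" using tendsto_unique[of "at (0::real)" g] by simp
  obtain G where G: "G 0 = g" "\<And>n x. (G n has_real_derivative G (Suc n) x) (at x)"
    using g(1) by (auto simp: csmooth_def)
  have sm: "csmooth (\<lambda>r. g r - k)"
    unfolding csmooth_def
  proof (intro exI[of _ "\<lambda>n. if n = 0 then (\<lambda>r. g r - k) else G n"] conjI allI)
    fix n x
    show "((if n = 0 then (\<lambda>r. g r - k) else G n) has_real_derivative (if Suc n = 0 then (\<lambda>r. g r - k) else G (Suc n)) x) (at x)"
      using G(2)[of n x] DERIV_diff[OF G(2)[of 0 x] DERIV_const[of k]] by (auto simp: G(1))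
  qed simp
  have "g 0 - k = 0" using g0 by simp
  from csmooth_divide[OF sm this] obtain h where "csmooth h" "\<And>r. g r - k = r * h r" by blast
  moreover have "f r = k * r + r\<^sup>2 * h r" for r
    using g(2)[of r] calculation(2)[of r] by (simp add: power2_eq_square algebra_simps)
  ultimately show ?thesis using that by blast
qed

section \<open>Families depending Lipschitz continuously on the amplitude\<close>

text \<open>The constant is chosen before \<open>i\<close>, \<open>s\<close> and \<open>x\<close>;
  with \<open>i\<close> the wave speed and \<open>s\<close> the amplitude this is the uniformity
  that (b) asks for.\<close>

definition tame0 :: "'i set \<Rightarrow> real set \<Rightarrow> ('i \<Rightarrow> real \<Rightarrow> real \<Rightarrow> real) \<Rightarrow> bool" where
  "tame0 I S u \<longleftrightarrow> (\<exists>C. \<forall>i\<in>I. \<forall>s\<in>S. \<forall>x. \<bar>u i s x\<bar> \<le> C \<and> (\<forall>s'\<in>S. \<bar>u i s x - u i s' x\<bar> \<le> C * \<bar>s - s'\<bar>))"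

text \<open>Derivatives enter as witnesses, which makes closure under sums, products and composition
  a plain induction; \<open>tame_nth_deriv\<close> translates back to iterated derivatives.\<close>

primrec tame :: "'i set \<Rightarrow> real set \<Rightarrow> nat \<Rightarrow> ('i \<Rightarrow> real \<Rightarrow> real \<Rightarrow> real) \<Rightarrow> bool" where
  "tame I S 0 u \<longleftrightarrow> tame0 I S u"
| "tame I S (Suc r) u \<longleftrightarrow> tame0 I S u \<and>
    (\<exists>v. (\<forall>i\<in>I. \<forall>s\<in>S. \<forall>x. (u i s has_real_derivative v i s x) (at x)) \<and> tame I S r v)"

lemma tame0I:
  assumes "\<And>i s x. i \<in> I \<Longrightarrow> s \<in> S \<Longrightarrow> \<bar>u i s x\<bar> \<le> C"
    "\<And>i s s' x. i \<in> I \<Longrightarrow> s \<in> S \<Longrightarrow> s' \<in> S \<Longrightarrow> \<bar>u i s x - u i s' x\<bar> \<le> L * \<bar>s - s'\<bar>"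
  shows "tame0 I S u"
  unfolding tame0_def
proof (intro exI[of _ "max C L"] ballI allI conjI)
  fix i s x s' assume a: "i \<in> I" "s \<in> S"
  show "\<bar>u i s x\<bar> \<le> max C L" using assms(1)[OF a, of x] by simp
  assume "s' \<in> S"
  then show "\<bar>u i s x - u i s' x\<bar> \<le> max C L * \<bar>s - s'\<bar>"
    using assms(2)[OF a, of s' x] mult_right_mono[of L "max C L" "\<bar>s - s'\<bar>"] by linarith
qed

lemma tame0E:
  assumes "tame0 I S u"
  obtains C where "0 \<le> C" "\<And>i s x. i \<in> I \<Longrightarrow> s \<in> S \<Longrightarrow> \<bar>u i s x\<bar> \<le> C"
    "\<And>i s s' x. i \<in> I \<Longrightarrow> s \<in> S \<Longrightarrow> s' \<in> S \<Longrightarrow> \<bar>u i s x - u i s' x\<bar> \<le> C * \<bar>s - s'\<bar>"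
proof -
  obtain C where C: "\<forall>i\<in>I. \<forall>s\<in>S. \<forall>x. \<bar>u i s x\<bar> \<le> C \<and> (\<forall>s'\<in>S. \<bar>u i s x - u i s' x\<bar> \<le> C * \<bar>s - s'\<bar>)"
    using assms by (auto simp: tame0_def)
  show ?thesis
  proof (rule that[of "max 0 C"])
    show "\<bar>u i s x\<bar> \<le> max 0 C" if "i \<in> I" "s \<in> S" for i s x
    proof -
      have "\<bar>u i s x\<bar> \<le> C" using C that by blast
      then show ?thesis by simp
    qed
    show "\<bar>u i s x - u i s' x\<bar> \<le> max 0 C * \<bar>s - s'\<bar>" if "i \<in> I" "s \<in> S" "s' \<in> S" for i s s' x
    proof -
      have "\<bar>u i s x - u i s' x\<bar> \<le> C * \<bar>s - s'\<bar>" using C that by blast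
      also have "\<dots> \<le> max 0 C * \<bar>s - s'\<bar>" by (intro mult_right_mono) auto
      finally show ?thesis .
    qed
  qed simp
qed

lemma tame_SucI:
  assumes "tame0 I S u" "\<And>i s x. i \<in> I \<Longrightarrow> s \<in> S \<Longrightarrow> (u i s has_real_derivative v i s x) (at x)" "tame I S r v"
  shows "tame I S (Suc r) u"
  unfolding tame.simps using assms by blast

lemma tame_SucE:
  assumes "tame I S (Suc r) u"
  obtains v where "\<And>i s x. i \<in> I \<Longrightarrow> s \<in> S \<Longrightarrow> (u i s has_real_derivative v i s x) (at x)" "tame I S r v"
  using assms unfolding tame.simps by blast

lemma tame_imp_tame0: "tame I S r u \<Longrightarrow> tame0 I S u"
  by (cases r) auto

lemma tame_SucD: "tame I S (Suc r) u \<Longrightarrow> tame I S r u"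
proof (induction r arbitrary: u)
  case (Suc r)
  obtain v where v: "\<And>i s x. i \<in> I \<Longrightarrow> s \<in> S \<Longrightarrow> (u i s has_real_derivative v i s x) (at x)" "tame I S (Suc r) v"
    using tame_SucE[OF Suc.prems] by blast
  show ?case by (rule tame_SucI[OF tame_imp_tame0[OF Suc.prems] v(1) Suc.IH[OF v(2)]])
qed auto

lemma tame0_add: "tame0 I S u \<Longrightarrow> tame0 I S v \<Longrightarrow> tame0 I S (\<lambda>i s x. u i s x + v i s x)"
proof -
  assume "tame0 I S u" "tame0 I S v"
  obtain C where C: "\<And>i s x. i \<in> I \<Longrightarrow> s \<in> S \<Longrightarrow> \<bar>u i s x\<bar> \<le> C"
    "\<And>i s s' x. i \<in> I \<Longrightarrow> s \<in> S \<Longrightarrow> s' \<in> S \<Longrightarrow> \<bar>u i s x - u i s' x\<bar> \<le> C * \<bar>s - s'\<bar>"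
    using tame0E[OF \<open>tame0 I S u\<close>] by metis
  obtain D where D: "\<And>i s x. i \<in> I \<Longrightarrow> s \<in> S \<Longrightarrow> \<bar>v i s x\<bar> \<le> D"
    "\<And>i s s' x. i \<in> I \<Longrightarrow> s \<in> S \<Longrightarrow> s' \<in> S \<Longrightarrow> \<bar>v i s x - v i s' x\<bar> \<le> D * \<bar>s - s'\<bar>"
    using tame0E[OF \<open>tame0 I S v\<close>] by metis
  show ?thesis
  proof (rule tame0I[where C="C + D" and L="C + D"])
    show "\<bar>u i s x + v i s x\<bar> \<le> C + D" if "i \<in> I" "s \<in> S" for i s x
      using C(1)[OF that, of x] D(1)[OF that, of x] by linarith
    show "\<bar>u i s x + v i s x - (u i s' x + v i s' x)\<bar> \<le> (C + D) * \<bar>s - s'\<bar>" if "i \<in> I" "s \<in> S" "s' \<in> S" for i s s' x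
      using C(2)[OF that, of x] D(2)[OF that, of x] unfolding distrib_right by linarith
  qed
qed

lemma tame0_mult: "tame0 I S u \<Longrightarrow> tame0 I S v \<Longrightarrow> tame0 I S (\<lambda>i s x. u i s x * v i s x)"
proof -
  assume "tame0 I S u" "tame0 I S v"
  obtain C where C: "0 \<le> C" "\<And>i s x. i \<in> I \<Longrightarrow> s \<in> S \<Longrightarrow> \<bar>u i s x\<bar> \<le> C"
    "\<And>i s s' x. i \<in> I \<Longrightarrow> s \<in> S \<Longrightarrow> s' \<in> S \<Longrightarrow> \<bar>u i s x - u i s' x\<bar> \<le> C * \<bar>s - s'\<bar>"
    using tame0E[OF \<open>tame0 I S u\<close>] by metis
  obtain D where D: "\<And>i s x. i \<in> I \<Longrightarrow> s \<in> S \<Longrightarrow> \<bar>v i s x\<bar> \<le> D"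
    "\<And>i s s' x. i \<in> I \<Longrightarrow> s \<in> S \<Longrightarrow> s' \<in> S \<Longrightarrow> \<bar>v i s x - v i s' x\<bar> \<le> D * \<bar>s - s'\<bar>"
    using tame0E[OF \<open>tame0 I S v\<close>] by metis
  show ?thesis
  proof (rule tame0I[where C="C * D" and L="2 * C * D"])
    show "\<bar>u i s x * v i s x\<bar> \<le> C * D" if "i \<in> I" "s \<in> S" for i s x
      unfolding abs_mult using C(1) C(2)[OF that, of x] D(1)[OF that, of x] by (intro mult_mono) auto
    show "\<bar>u i s x * v i s x - (u i s' x * v i s' x)\<bar> \<le> 2 * C * D * \<bar>s - s'\<bar>" if "i \<in> I" "s \<in> S" "s' \<in> S" for i s s' x
      using abs_mult_diff_le[OF C(3)[OF that, of x] D(1)[OF that(1,2), of x] C(2)[OF that(1,3), of x] D(2)[OF that, of x]]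
      by (simp add: algebra_simps)
  qed
qed

lemma tame_add: "tame I S r u \<Longrightarrow> tame I S r v \<Longrightarrow> tame I S r (\<lambda>i s x. u i s x + v i s x)"
proof (induction r arbitrary: u v)
  case (Suc r)
  obtain u' where u': "\<And>i s x. i \<in> I \<Longrightarrow> s \<in> S \<Longrightarrow> (u i s has_real_derivative u' i s x) (at x)" "tame I S r u'"
    using tame_SucE[OF Suc.prems(1)] by blast
  obtain v' where v': "\<And>i s x. i \<in> I \<Longrightarrow> s \<in> S \<Longrightarrow> (v i s has_real_derivative v' i s x) (at x)" "tame I S r v'"
    using tame_SucE[OF Suc.prems(2)] by blast
  show ?case
    by (rule tame_SucI[OF tame0_add[OF Suc.prems[THEN tame_imp_tame0]] DERIV_add[OF u'(1) v'(1)] Suc.IH[OF u'(2) v'(2)]])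
qed (simp add: tame0_add)

lemma tame_mult: "tame I S r u \<Longrightarrow> tame I S r v \<Longrightarrow> tame I S r (\<lambda>i s x. u i s x * v i s x)"
proof (induction r arbitrary: u v)
  case (Suc r)
  obtain u' where u': "\<And>i s x. i \<in> I \<Longrightarrow> s \<in> S \<Longrightarrow> (u i s has_real_derivative u' i s x) (at x)" "tame I S r u'"
    using tame_SucE[OF Suc.prems(1)] by blast
  obtain v' where v': "\<And>i s x. i \<in> I \<Longrightarrow> s \<in> S \<Longrightarrow> (v i s has_real_derivative v' i s x) (at x)" "tame I S r v'"
    using tame_SucE[OF Suc.prems(2)] by blast
  have t: "tame I S r (\<lambda>i s x. u' i s x * v i s x + v' i s x * u i s x)"
    by (intro tame_add Suc.IH u' v' tame_SucD[OF Suc.prems(1)] tame_SucD[OF Suc.prems(2)])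
  show ?case
    by (rule tame_SucI[OF tame0_mult[OF Suc.prems[THEN tame_imp_tame0]] DERIV_mult[OF u'(1) v'(1)] t])
qed (simp add: tame0_mult)

lemma tame_parameter: "tame0 I S (\<lambda>i s x. f i s) \<Longrightarrow> tame I S r (\<lambda>i s x. f i s)"
proof (induction r arbitrary: f)
  case (Suc r)
  have "tame I S r (\<lambda>i s x. 0)" by (rule Suc.IH) (auto simp: tame0_def)
  then show ?case using Suc.prems by (simp, intro exI[of _ "\<lambda>i s x. 0"]) auto
qed simp

lemma tame_const: "tame I S r (\<lambda>i s x. c)"
  by (rule tame_parameter) (auto simp: tame0_def intro!: exI[of _ "\<bar>c\<bar>"])

lemma tame_diff: "tame I S r u \<Longrightarrow> tame I S r v \<Longrightarrow> tame I S r (\<lambda>i s x. u i s x - v i s x)"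
  using tame_add[of I S r u "\<lambda>i s x. (- 1) * v i s x"] tame_mult[OF tame_const[of I S r "- 1"]] by auto

lemma tame0_compose:
  assumes k: "csmooth k" and u: "tame0 I S u"
  shows "tame0 I S (\<lambda>i s x. k (u i s x))"
proof -
    obtain C where C: "0 \<le> C" "\<And>i s x. i \<in> I \<Longrightarrow> s \<in> S \<Longrightarrow> \<bar>u i s x\<bar> \<le> C"
      "\<And>i s s' x. i \<in> I \<Longrightarrow> s \<in> S \<Longrightarrow> s' \<in> S \<Longrightarrow> \<bar>u i s x - u i s' x\<bar> \<le> C * \<bar>s - s'\<bar>"
      using tame0E[OF u] by metis
    obtain B where B: "0 \<le> B" "\<And>y. \<bar>y\<bar> \<le> C \<Longrightarrow> \<bar>k y\<bar> \<le> B"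
      "\<And>y z. \<bar>y\<bar> \<le> C \<Longrightarrow> \<bar>z\<bar> \<le> C \<Longrightarrow> \<bar>k y - k z\<bar> \<le> B * \<bar>y - z\<bar>"
      using csmooth_local_bounds[OF k] by metis
    show ?thesis
    proof (rule tame0I[where C=B and L="B * C"])
      show "\<bar>k (u i s x)\<bar> \<le> B" if "i \<in> I" "s \<in> S" for i s x using B(2) C(2)[OF that] by blast
      show "\<bar>k (u i s x) - k (u i s' x)\<bar> \<le> B * C * \<bar>s - s'\<bar>" if "i \<in> I" "s \<in> S" "s' \<in> S" for i s s' x
        using B(3)[OF C(2)[OF that(1,2)] C(2)[OF that(1,3)], of x x] mult_left_mono[OF C(3)[OF that, of x] B(1)] by linarith
    qed
qed

lemma tame_compose: "csmooth k \<Longrightarrow> tame I S r u \<Longrightarrow> tame I S r (\<lambda>i s x. k (u i s x))"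
proof (induction r arbitrary: k)
  case (Suc r)
  obtain u' where d: "\<And>i s x. i \<in> I \<Longrightarrow> s \<in> S \<Longrightarrow> (u i s has_real_derivative u' i s x) (at x)" "tame I S r u'"
    using tame_SucE[OF Suc.prems(2)] by blast
  obtain k' where k': "csmooth k'" "\<And>x. (k has_real_derivative k' x) (at x)"
    using csmooth_deriv[OF Suc.prems(1)] by blast
  have t: "tame I S r (\<lambda>i s x. k' (u i s x) * u' i s x)"
    by (rule tame_mult[OF Suc.IH[OF k'(1) tame_SucD[OF Suc.prems(2)]] d(2)])
  show ?case
    by (rule tame_SucI[OF tame0_compose[OF Suc.prems(1) tame_imp_tame0[OF Suc.prems(2)]] DERIV_chain2[OF k'(2) d(1)] t])
qed (simp add: tame0_compose)

text \<open>Changing \<open>s\<close> also moves the argument, and this is paid for by the Lipschitz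
  constant in x.\<close>

lemma tame0_shift:
  assumes "tame0 I S u" "\<And>i s. i \<in> I \<Longrightarrow> s \<in> S \<Longrightarrow> lip l (u i s)" "tame0 I S (\<lambda>i s x. h i s)"
  shows "tame0 I S (\<lambda>i s x. u i s (x + h i s))"
proof -
  obtain C where C: "0 \<le> C" "\<And>i s x. i \<in> I \<Longrightarrow> s \<in> S \<Longrightarrow> \<bar>u i s x\<bar> \<le> C"
    "\<And>i s s' x. i \<in> I \<Longrightarrow> s \<in> S \<Longrightarrow> s' \<in> S \<Longrightarrow> \<bar>u i s x - u i s' x\<bar> \<le> C * \<bar>s - s'\<bar>"
    using tame0E[OF assms(1)] by metis
  obtain D where D: "\<And>i s s'. i \<in> I \<Longrightarrow> s \<in> S \<Longrightarrow> s' \<in> S \<Longrightarrow> \<bar>h i s - h i s'\<bar> \<le> D * \<bar>s - s'\<bar>"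
    using tame0E[OF assms(3)] by metis
  show ?thesis
  proof (rule tame0I[where C=C and L="C + \<bar>l\<bar> * D"])
    show "\<bar>u i s (x + h i s)\<bar> \<le> C" if "i \<in> I" "s \<in> S" for i s x using C(2)[OF that] .
    show "\<bar>u i s (x + h i s) - u i s' (x + h i s')\<bar> \<le> (C + \<bar>l\<bar> * D) * \<bar>s - s'\<bar>" if "i \<in> I" "s \<in> S" "s' \<in> S" for i s s' x
    proof -
      have "\<bar>u i s' (x + h i s) - u i s' (x + h i s')\<bar> \<le> l * \<bar>h i s - h i s'\<bar>"
        using assms(2)[OF that(1,3)] unfolding lip_def by (metis add_diff_cancel_left)
      also have "\<dots> \<le> \<bar>l\<bar> * (D * \<bar>s - s'\<bar>)" using D[OF that] by (intro mult_mono) auto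
      finally show ?thesis using C(3)[OF that, of "x + h i s"] by (simp add: algebra_simps)
    qed
  qed
qed

lemma tame_lip:
  assumes "tame I S (Suc r) u"
  obtains l where "\<And>i s. i \<in> I \<Longrightarrow> s \<in> S \<Longrightarrow> lip l (u i s)"
proof -
  obtain u' where d: "\<And>i s x. i \<in> I \<Longrightarrow> s \<in> S \<Longrightarrow> (u i s has_real_derivative u' i s x) (at x)" "tame I S r u'"
    using tame_SucE[OF assms] by blast
  obtain C where C: "\<And>i s x. i \<in> I \<Longrightarrow> s \<in> S \<Longrightarrow> \<bar>u' i s x\<bar> \<le> C"
    using tame0E[OF tame_imp_tame0[OF d(2)]] by metis
  have "lip C (u i s)" if "i \<in> I" "s \<in> S" for i s
    unfolding lip_def using lipschitz_of_deriv[OF d(1)[OF that]] C[OF that] by (auto simp: bdd_def)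
  then show ?thesis using that by blast
qed

text \<open>One order is lost: for the shifted derivative of order r to be Lipschitz in
  \<open>s\<close>, the derivative of order r + 1 must be bounded.\<close>

lemma tame_shift:
  assumes "tame0 I S (\<lambda>i s x. h i s)"
  shows "tame I S (Suc r) u \<Longrightarrow> tame I S r (\<lambda>i s x. u i s (x + h i s))"
proof (induction r arbitrary: u)
  case 0
  obtain l where l: "\<And>i s. i \<in> I \<Longrightarrow> s \<in> S \<Longrightarrow> lip l (u i s)" using tame_lip[OF 0] by blast
  show ?case using tame0_shift[OF tame_imp_tame0[OF 0] l assms] by simp
next
  case (Suc r)
  obtain l where l: "\<And>i s. i \<in> I \<Longrightarrow> s \<in> S \<Longrightarrow> lip l (u i s)" using tame_lip[OF Suc.prems] by blast
  obtain u' where d: "\<And>i s x. i \<in> I \<Longrightarrow> s \<in> S \<Longrightarrow> (u i s has_real_derivative u' i s x) (at x)" "tame I S (Suc r) u'"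
    using tame_SucE[OF Suc.prems] by blast
  have dh: "((\<lambda>x. u i s (x + h i s)) has_real_derivative u' i s (x + h i s)) (at x)" if "i \<in> I" "s \<in> S" for i s x
    using d(1)[OF that] DERIV_shift[of "u i s" "u' i s (x + h i s)" x "h i s"] by simp
  show ?case by (rule tame_SucI[OF tame0_shift[OF tame_imp_tame0[OF Suc.prems] l assms] dh Suc.IH[OF d(2)]])
qed

text \<open>The first derivative, on which nothing is assumed, is controlled by
  \<open>deriv_bdd\<close>, applied to the functions and to their differences in \<open>s\<close>,
  which are periodic as well.\<close>

lemma tame_deriv2:
  assumes d: "\<And>i s. i \<in> I \<Longrightarrow> s \<in> S \<Longrightarrow> deriv2 (p i s) (p' i s) (v i s)"
    and c: "\<And>i s. i \<in> I \<Longrightarrow> s \<in> S \<Longrightarrow> cper (p i s)"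
    and p: "tame0 I S p" and v: "tame I S r v"
  shows "tame I S (Suc (Suc r)) p"
proof -
  obtain C where C: "\<And>i s x. i \<in> I \<Longrightarrow> s \<in> S \<Longrightarrow> \<bar>v i s x\<bar> \<le> C"
    "\<And>i s s' x. i \<in> I \<Longrightarrow> s \<in> S \<Longrightarrow> s' \<in> S \<Longrightarrow> \<bar>v i s x - v i s' x\<bar> \<le> C * \<bar>s - s'\<bar>"
    using tame0E[OF tame_imp_tame0[OF v]] by metis
  have "tame0 I S p'"
  proof (rule tame0I[where C="2 * pi * C" and L="2 * pi * C"])
    show "\<bar>p' i s x\<bar> \<le> 2 * pi * C" if "i \<in> I" "s \<in> S" for i s x
      using deriv_bdd[OF d[OF that] c[OF that], of C] C(1)[OF that] by (auto simp: bdd_def)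
    show "\<bar>p' i s x - p' i s' x\<bar> \<le> 2 * pi * C * \<bar>s - s'\<bar>" if "i \<in> I" "s \<in> S" "s' \<in> S" for i s s' x
      using deriv_bdd[OF deriv2_diff[OF d[OF that(1,2)] d[OF that(1,3)]] cper_diff[OF c[OF that(1,2)] c[OF that(1,3)]], of "C * \<bar>s - s'\<bar>"]
        C(2)[OF that] by (auto simp: bdd_def mult.assoc)
  qed
  then have "tame I S (Suc r) p'"
    by (rule tame_SucI[OF _ _ v]) (use d in \<open>auto simp: deriv2_def\<close>)
  then show ?thesis by (rule tame_SucI[OF p, rotated]) (use d in \<open>auto simp: deriv2_def\<close>)
qed

lemma tame_nth_deriv:
  assumes "tame I S n u"
  shows "\<exists>C. \<forall>i\<in>I. \<forall>s\<in>S. \<forall>x. \<bar>nth_deriv n (u i s) x\<bar> \<le> C \<and>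
    (\<forall>s'\<in>S. \<bar>nth_deriv n (u i s) x - nth_deriv n (u i s') x\<bar> \<le> C * \<bar>s - s'\<bar>)"
  using assms
proof (induction n arbitrary: u)
  case 0
  then show ?case by (simp add: nth_deriv_def tame0_def)
next
  case (Suc n)
  obtain u' where d: "\<And>i s x. i \<in> I \<Longrightarrow> s \<in> S \<Longrightarrow> (u i s has_real_derivative u' i s x) (at x)" "tame I S n u'"
    using tame_SucE[OF Suc.prems] by blast
  have "nth_deriv (Suc n) (u i s) = nth_deriv n (u' i s)" if "i \<in> I" "s \<in> S" for i s
  proof -
    have "(\<lambda>x. vector_derivative (u i s) (at x)) = u' i s"
      using d(1) that by (auto simp: has_real_derivative_iff_has_vector_derivative vector_derivative_at)
    then show ?thesis by (simp add: nth_deriv_Suc_right)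
  qed
  then show ?case using Suc.IH[OF d(2)] by simp
qed

lemma tame_has_nth_deriv:
  assumes "tame I S (Suc n) u" "i \<in> I" "s \<in> S"
  shows "(nth_deriv n (u i s) has_real_derivative nth_deriv (Suc n) (u i s) x) (at x)"
  using assms(1)
proof (induction n arbitrary: u)
  case 0
  then obtain u' where "(u i s has_real_derivative u' i s x) (at x)" using assms(2,3) by auto
  then show ?case
    by (simp add: nth_deriv_def has_real_derivative_iff_has_vector_derivative vector_derivative_at)
next
  case (Suc n)
  obtain u' where d: "\<And>i s x. i \<in> I \<Longrightarrow> s \<in> S \<Longrightarrow> (u i s has_real_derivative u' i s x) (at x)" "tame I S (Suc n) u'"
    using tame_SucE[OF Suc.prems] by blast
  have "(\<lambda>x. vector_derivative (u i s) (at x)) = u' i s"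
    using d(1) assms by (auto simp: has_real_derivative_iff_has_vector_derivative vector_derivative_at)
  then have "nth_deriv (Suc k) (u i s) = nth_deriv k (u' i s)" for k
    by (simp add: nth_deriv_Suc_right)
  then show ?case using Suc.IH[OF d(2)] by simp
qed

text \<open>Bootstrapping: a shift by the frequency costs one derivative, the equation gains two.\<close>

lemma tame_bootstrap:
  fixes om \<beta> :: "'i \<Rightarrow> real \<Rightarrow> real" and \<kappa> m :: real and k1 k2 :: "real \<Rightarrow> real" and p q :: "'i \<Rightarrow> real \<Rightarrow> real \<Rightarrow> real"
  defines "g1 \<equiv> \<lambda>s y. y + s * (y\<^sup>2 * k1 (s * y))" and "g2 \<equiv> \<lambda>s y. \<kappa> * y + s * (y\<^sup>2 * k2 (s * y))"
  assumes k: "csmooth k1" "csmooth k2" and S: "\<And>s. s \<in> S \<Longrightarrow> \<bar>s\<bar> \<le> 1"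
    and om: "tame0 I S (\<lambda>i s x. om i s)" and \<beta>: "tame0 I S (\<lambda>i s x. \<beta> i s)"
    and c: "\<And>i s. i \<in> I \<Longrightarrow> s \<in> S \<Longrightarrow> cper (p i s) \<and> cper (q i s)"
    and l: "\<And>i s. i \<in> I \<Longrightarrow> s \<in> S \<Longrightarrow> lip 3 (p i s) \<and> lip 3 (q i s)"
    and p: "tame0 I S p" and q: "tame0 I S q"
    and dp: "\<And>i s. i \<in> I \<Longrightarrow> s \<in> S \<Longrightarrow> \<exists>d. deriv2 (p i s) d (\<lambda>x. \<beta> i s * force1 (g1 s) (g2 s) (om i s) (p i s) (q i s) x)"
    and dq: "\<And>i s. i \<in> I \<Longrightarrow> s \<in> S \<Longrightarrow> \<exists>d. deriv2 (q i s) d (\<lambda>x. \<beta> i s * force2 (g1 s) (g2 s) (om i s) (p i s) (q i s) x / m)"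
  shows "tame I S r p \<and> tame I S r q"
proof -
  obtain p' q' where d: "\<And>i s. i \<in> I \<Longrightarrow> s \<in> S \<Longrightarrow> deriv2 (p i s) (p' i s) (\<lambda>x. \<beta> i s * force1 (g1 s) (g2 s) (om i s) (p i s) (q i s) x)"
    "\<And>i s. i \<in> I \<Longrightarrow> s \<in> S \<Longrightarrow> deriv2 (q i s) (q' i s) (\<lambda>x. \<beta> i s * force2 (g1 s) (g2 s) (om i s) (p i s) (q i s) x / m)"
    using dp dq by metis
  have om': "tame0 I S (\<lambda>i s x. - om i s)"
    using tame_mult[OF tame_const[of I S 0 "- 1"], of "\<lambda>i s x. om i s"] om by simp
  have "tame0 I S (\<lambda>i s x. s)" by (rule tame0I[where C=1 and L=1]) (use S in auto)
  then have s: "tame I S r (\<lambda>i s x. s)" for r by (rule tame_parameter)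
  have g: "tame I S r (\<lambda>i s x. g1 s (y i s x))" "tame I S r (\<lambda>i s x. g2 s (y i s x))" if "tame I S r y" for r y
    unfolding g1_def g2_def power2_eq_square
    by (intro tame_add tame_mult tame_const tame_compose[OF k(1)] tame_compose[OF k(2)] s that)+
  have v: "tame I S r (\<lambda>i s x. \<beta> i s * force1 (g1 s) (g2 s) (om i s) (p i s) (q i s) x)"
    "tame I S r (\<lambda>i s x. \<beta> i s * force2 (g1 s) (g2 s) (om i s) (p i s) (q i s) x / m)"
    if "tame I S r p" "tame I S r q" "tame I S r (\<lambda>i s x. p i s (x + om i s))" "tame I S r (\<lambda>i s x. q i s (x + om i s))"
      "tame I S r (\<lambda>i s x. p i s (x - om i s))" "tame I S r (\<lambda>i s x. q i s (x - om i s))" for r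
  proof -
    show "tame I S r (\<lambda>i s x. \<beta> i s * force1 (g1 s) (g2 s) (om i s) (p i s) (q i s) x)"
      unfolding force1_def by (intro tame_mult tame_parameter[OF \<beta>] tame_diff g that)
    show "tame I S r (\<lambda>i s x. \<beta> i s * force2 (g1 s) (g2 s) (om i s) (p i s) (q i s) x / m)"
      unfolding force2_def divide_inverse by (intro tame_mult tame_const tame_parameter[OF \<beta>] tame_diff g that)
  qed
  have step: "tame I S (Suc (Suc r)) p \<and> tame I S (Suc (Suc r)) q"
    if "tame I S r p" "tame I S r q" "tame I S r (\<lambda>i s x. p i s (x + om i s))" "tame I S r (\<lambda>i s x. q i s (x + om i s))"
      "tame I S r (\<lambda>i s x. p i s (x - om i s))" "tame I S r (\<lambda>i s x. q i s (x - om i s))" for r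
    using tame_deriv2[OF d(1) _ p v(1)[OF that]] tame_deriv2[OF d(2) _ q v(2)[OF that]] c by blast
  have "tame I S (Suc r) p \<and> tame I S (Suc r) q"
  proof (induction r)
    case 0
    \<comment> \<open>Before any derivative is under control, the a priori Lipschitz constant 3 lets
      the shifts start the induction.\<close>
    have l': "lip 3 (p i s)" "lip 3 (q i s)" if "i \<in> I" "s \<in> S" for i s using l that by auto
    have sh: "tame0 I S (\<lambda>i s x. p i s (x + om i s))" "tame0 I S (\<lambda>i s x. q i s (x + om i s))"
      by (rule tame0_shift[OF p l'(1) om], assumption+) (rule tame0_shift[OF q l'(2) om])
    have "tame0 I S (\<lambda>i s x. p i s (x + - om i s))" "tame0 I S (\<lambda>i s x. q i s (x + - om i s))"
      by (rule tame0_shift[OF p l'(1) om'], assumption+) (rule tame0_shift[OF q l'(2) om'])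
    then have "tame I S (Suc (Suc 0)) p \<and> tame I S (Suc (Suc 0)) q"
      by (intro step; simp only: tame.simps(1) add_uminus_conv_diff p q sh)
    then show ?case using tame_SucD by blast
  next
    case (Suc r)
    then have a: "tame I S (Suc r) p" "tame I S (Suc r) q" by auto
    show ?case
      by (rule step[OF tame_SucD[OF a(1)] tame_SucD[OF a(2)] tame_shift[OF om a(1)] tame_shift[OF om a(2)]
        tame_shift[OF om' a(1), unfolded add_uminus_conv_diff] tame_shift[OF om' a(2), unfolded add_uminus_conv_diff]])
  qed
  then show ?thesis using tame_SucD by blast
qed

section \<open>The dispersion relation\<close>

locale dispersion =
  fixes m \<kappa> w :: real
  assumes m_pos: "m > 0" and kap_pos: "\<kappa> > 0" and w_def: "w = 1 / m" and contrast: "w > 1 \<or> \<kappa> > 1"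
begin

text \<open>The sum of the two branches of the dispersion relation; the upper branch lies between
  half of it and the whole.\<close>

definition "tr = (1 + \<kappa>) * (1 + w)"
text \<open>The minimum of \<open>rho\<close>, attained at cos K = 0.\<close>

definition "rho0 = sqrt ((1 + w)\<^sup>2 * (1 - \<kappa>)\<^sup>2 + 4 * \<kappa> * (1 - w)\<^sup>2)"
text \<open>The minimum of \<open>lambda_plus\<close> minus 1 + \<kappa>, again at cos K = 0. The
  radicand agrees with that of \<open>rho0\<close>; this form shows the positivity.\<close>

definition "n0 = ((1 + \<kappa>) * (w - 1) + sqrt (((1 + \<kappa>) * (w - 1))\<^sup>2 + 4 * w * (1 - \<kappa>)\<^sup>2)) / 2"
text \<open>The speed for \<epsilon> = 1; \<open>x0\<close> and \<open>x1\<close> enclose the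
  critical frequencies of all speeds up to it.\<close>

definition "c1 = sqrt ((c_star \<kappa> w)\<^sup>2 + 1)"
definition "x0 = sqrt (tr / 2) / c1"
definition "x1 = sqrt tr / c_star \<kappa> w"

lemma w_pos: "w > 0" using m_pos by (simp add: w_def)

lemma tr_pos: "tr > 0" using w_pos kap_pos by (simp add: tr_def)

lemma rho0_pos: "rho0 > 0"
proof -
  have "(1 + w)\<^sup>2 * (1 - \<kappa>)\<^sup>2 + 4 * \<kappa> * (1 - w)\<^sup>2 > 0"
    using contrast
  proof
    assume "w > 1"
    then have "4 * \<kappa> * (1 - w)\<^sup>2 > 0" using kap_pos by simp
    moreover have "(1 + w)\<^sup>2 * (1 - \<kappa>)\<^sup>2 \<ge> 0" by simp
    ultimately show ?thesis by linarith
  next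
    assume "\<kappa> > 1"
    then have "(1 + w)\<^sup>2 * (1 - \<kappa>)\<^sup>2 > 0" using w_pos by simp
    moreover have "4 * \<kappa> * (1 - w)\<^sup>2 \<ge> 0" using kap_pos by simp
    ultimately show ?thesis by linarith
  qed
  then show ?thesis by (simp add: rho0_def)
qed

lemma rho_ge: "rho \<kappa> w K \<ge> rho0"
  unfolding rho_def rho0_def using kap_pos w_pos by (intro real_sqrt_le_mono) (simp add: algebra_simps)

lemma rho_pos: "rho \<kappa> w K > 0" using rho_ge[of K] rho0_pos by linarith

lemma rho_squared: "(rho \<kappa> w K)\<^sup>2 = tr\<^sup>2 - 16 * \<kappa> * w * (sin K)\<^sup>2"
proof -
  have "(1 + w)\<^sup>2 * (1 - \<kappa>)\<^sup>2 + 4 * \<kappa> * ((1 - w)\<^sup>2 + 4 * w * (cos K)\<^sup>2) \<ge> 0"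
    using kap_pos w_pos by (intro add_nonneg_nonneg mult_nonneg_nonneg) auto
  then have "(rho \<kappa> w K)\<^sup>2 = (1 + w)\<^sup>2 * (1 - \<kappa>)\<^sup>2 + 4 * \<kappa> * ((1 - w)\<^sup>2 + 4 * w * (cos K)\<^sup>2)"
    by (simp add: rho_def)
  also have "\<dots> = tr\<^sup>2 - 16 * \<kappa> * w * (sin K)\<^sup>2"
    unfolding tr_def cos_squared_eq by (simp add: power2_eq_square algebra_simps)
  finally show ?thesis .
qed

lemma rho_le: "rho \<kappa> w K \<le> tr"
proof -
  have "16 * \<kappa> * w * (sin K)\<^sup>2 \<ge> 0" using kap_pos w_pos by simp
  then have "(rho \<kappa> w K)\<^sup>2 \<le> tr\<^sup>2" unfolding rho_squared by linarith
  then show ?thesis by (rule power2_le_imp_le) (use tr_pos in simp)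
qed

text \<open>After squaring this reduces to 16 \<kappa> w <= tr^2, the product of 4 \<kappa> <= (1 +
  \<kappa>)^2 and 4 w <= (1 + w)^2.\<close>

lemma rho_ge_cos: "rho \<kappa> w K \<ge> tr * \<bar>cos K\<bar>"
proof (rule power2_le_imp_le)
  have "16 * \<kappa> * w \<le> tr\<^sup>2"
  proof -
    have "4 * \<kappa> \<le> (1 + \<kappa>)\<^sup>2" "4 * w \<le> (1 + w)\<^sup>2"
      using zero_le_power2[of "1 - \<kappa>"] zero_le_power2[of "1 - w"] by (simp_all add: power2_eq_square algebra_simps)
    then have "(4 * \<kappa>) * (4 * w) \<le> (1 + \<kappa>)\<^sup>2 * (1 + w)\<^sup>2" using kap_pos w_pos by (intro mult_mono) auto
    then show ?thesis by (simp add: tr_def power_mult_distrib)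
  qed
  then have "16 * \<kappa> * w * (sin K)\<^sup>2 \<le> tr\<^sup>2 * (sin K)\<^sup>2" by (rule mult_right_mono) simp
  then show "(tr * \<bar>cos K\<bar>)\<^sup>2 \<le> (rho \<kappa> w K)\<^sup>2"
    unfolding rho_squared by (simp add: power_mult_distrib cos_squared_eq algebra_simps)
qed (use rho_pos in \<open>simp add: less_imp_le\<close>)

lemma lambda_plus_eq: "lambda_plus \<kappa> w K = (tr + rho \<kappa> w K) / 2"
  by (simp add: lambda_plus_def tr_def add_divide_distrib)

lemma lambda_plus_bounds: "tr / 2 \<le> lambda_plus \<kappa> w K" "lambda_plus \<kappa> w K \<le> tr"
  using rho_le[of K] rho_pos[of K] by (auto simp: lambda_plus_eq)

lemma c_star_pos: "c_star \<kappa> w > 0"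
  using kap_pos w_pos by (simp add: c_star_def)

lemma c_star_squared: "(c_star \<kappa> w)\<^sup>2 = 4 * \<kappa> * w / tr"
  using kap_pos w_pos by (simp add: c_star_def tr_def)

lemma abs_sin_less:
  fixes K :: real
  assumes "K > 0" shows "\<bar>sin K\<bar> < K"
proof (cases "K > 1")
  case True
  then show ?thesis using abs_sin_le_one[of K] by linarith
next
  case False
  then obtain z where z: "0 < z" "z < K" "sin K - sin 0 = (K - 0) * cos z"
    using MVT2[of 0 K sin cos] assms by auto
  have "\<bar>cos z\<bar> < 1"
    using z False pi_gt3 cos_monotone_0_pi[of 0 z] cos_monotone_0_pi[of z pi] by auto
  then show ?thesis using z(3) assms by (simp add: abs_mult)
qed

lemma neg_abs_mult_le: "0 \<le> k \<Longrightarrow> - (k * \<bar>y\<bar>) \<le> k * y" for k y :: real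
  using mult_left_mono[OF abs_ge_minus_self, of k y] by simp

text \<open>The spectral gap that makes \<open>c\<^sup>2 K\<^sup>2 - \<lambda>\<^sub>+(K)\<close> increasing and the bifurcation transversal.\<close>

lemma gap:
  assumes "K > 0" "c\<^sup>2 \<ge> (c_star \<kappa> w)\<^sup>2"
  shows "c\<^sup>2 * K * rho \<kappa> w K - 4 * \<kappa> * w * \<bar>sin K * cos K\<bar> \<ge> 4 * \<kappa> * w * (rho0 / tr) * (K - \<bar>sin K\<bar>)"
proof -
  let ?r = "rho \<kappa> w K"
  have kw: "4 * \<kappa> * w > 0" using kap_pos w_pos by simp
  have "\<bar>cos K\<bar> \<le> ?r / tr" using rho_ge_cos[of K] tr_pos by (simp add: pos_le_divide_eq mult.commute)
  then have "\<bar>sin K * cos K\<bar> \<le> \<bar>sin K\<bar> * (?r / tr)" unfolding abs_mult by (rule mult_left_mono) simp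
  then have 1: "4 * \<kappa> * w * \<bar>sin K * cos K\<bar> \<le> 4 * \<kappa> * w * (\<bar>sin K\<bar> * (?r / tr))" using kw by (intro mult_left_mono) auto
  \<comment> \<open>The square of the speed of sound is exactly 4 \<kappa> w / tr, so both terms
    receive the same prefactor and K - |sin K| is left.\<close>
  have "4 * \<kappa> * w / tr * (K * ?r) \<le> c\<^sup>2 * (K * ?r)"
    using assms rho_pos[of K] unfolding c_star_squared by (intro mult_right_mono) auto
  with 1 have "c\<^sup>2 * K * ?r - 4 * \<kappa> * w * \<bar>sin K * cos K\<bar> \<ge> 4 * \<kappa> * w * (?r / tr * (K - \<bar>sin K\<bar>))"
    by (simp add: algebra_simps diff_divide_distrib)
  moreover have "4 * \<kappa> * w * (?r / tr * (K - \<bar>sin K\<bar>)) \<ge> 4 * \<kappa> * w * (rho0 / tr * (K - \<bar>sin K\<bar>))"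
    using kw rho_ge[of K] tr_pos abs_sin_less[OF assms(1)] by (intro mult_left_mono mult_right_mono divide_right_mono) auto
  ultimately show ?thesis by (simp add: mult.assoc)
qed

lemma gap_pos:
  assumes "K > 0" "c\<^sup>2 \<ge> (c_star \<kappa> w)\<^sup>2"
  shows "c\<^sup>2 * K * rho \<kappa> w K > 4 * \<kappa> * w * \<bar>sin K * cos K\<bar>"
proof -
  have "4 * \<kappa> * w * (rho0 / tr) * (K - \<bar>sin K\<bar>) > 0"
    using kap_pos w_pos rho0_pos tr_pos abs_sin_less[OF assms(1)] by simp
  then show ?thesis using gap[OF assms] by linarith
qed

lemma rho_deriv: "(rho \<kappa> w has_real_derivative - 16 * \<kappa> * w * sin K * cos K / rho \<kappa> w K) (at K)"
proof -
  have eq: "rho \<kappa> w = (\<lambda>K. sqrt (tr\<^sup>2 - 16 * \<kappa> * w * (sin K)\<^sup>2))"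
    using rho_squared rho_pos by (metis real_sqrt_abs abs_of_pos)
  have "tr\<^sup>2 - 16 * \<kappa> * w * (sin K)\<^sup>2 > 0" using rho_pos[of K] unfolding rho_squared[symmetric] by simp
  then show ?thesis
    unfolding eq by (auto intro!: derivative_eq_intros simp: field_simps)
qed

lemma dispersion_deriv:
  "((\<lambda>K. c\<^sup>2 * K\<^sup>2 - lambda_plus \<kappa> w K) has_real_derivative 2 * (c\<^sup>2 * K * rho \<kappa> w K + 4 * \<kappa> * w * (sin K * cos K)) / rho \<kappa> w K) (at K)"
proof -
  have nz: "rho \<kappa> w K \<noteq> 0" using rho_pos[of K] by simp
  have "((\<lambda>K. c\<^sup>2 * K\<^sup>2 - (tr + rho \<kappa> w K) / 2) has_real_derivative
      c\<^sup>2 * (2 * K) - (0 + - 16 * \<kappa> * w * sin K * cos K / rho \<kappa> w K) / 2) (at K)"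
    by (intro DERIV_diff DERIV_cmult DERIV_cdivide DERIV_add DERIV_const rho_deriv) (auto intro!: derivative_eq_intros)
  then show ?thesis unfolding lambda_plus_eq using nz by (simp add: field_simps)
qed

lemma lambda_plus_even: "lambda_plus \<kappa> w (- K) = lambda_plus \<kappa> w K"
  by (simp add: lambda_plus_def rho_def)

text \<open>The difference of the two sides is even, negative at 0, nonnegative at sqrt(tr) / c and
  strictly increasing on the positive axis by \<open>gap_pos\<close>. So there is one positive zero,
  which justifies the definite description.\<close>

lemma crit_freq_props:
  assumes c: "c > 0" "c\<^sup>2 \<ge> (c_star \<kappa> w)\<^sup>2"
  shows "crit_freq \<kappa> w c > 0" "c\<^sup>2 * (crit_freq \<kappa> w c)\<^sup>2 = lambda_plus \<kappa> w (crit_freq \<kappa> w c)"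
proof -
  define f where "f K = c\<^sup>2 * K\<^sup>2 - lambda_plus \<kappa> w K" for K
  have d: "(f has_real_derivative 2 * (c\<^sup>2 * K * rho \<kappa> w K + 4 * \<kappa> * w * (sin K * cos K)) / rho \<kappa> w K) (at K)" for K
    unfolding f_def[abs_def] by (rule dispersion_deriv)
  have dpos: "2 * (c\<^sup>2 * K * rho \<kappa> w K + 4 * \<kappa> * w * (sin K * cos K)) / rho \<kappa> w K > 0" if "K > 0" for K
  proof -
    have "4 * \<kappa> * w * (sin K * cos K) \<ge> - (4 * \<kappa> * w * \<bar>sin K * cos K\<bar>)"
      by (rule neg_abs_mult_le) (use kap_pos w_pos in simp)
    then show ?thesis using gap_pos[OF that c(2)] rho_pos[of K] by (intro divide_pos_pos mult_pos_pos) linarith+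
  qed
  have cont: "isCont f K" for K using d DERIV_isCont by blast
  have f0: "f 0 < 0" using lambda_plus_bounds(1)[of 0] tr_pos by (simp add: f_def)
  define K1 where "K1 = sqrt tr / c"
  have K1: "K1 > 0" using tr_pos c by (simp add: K1_def)
  have "c\<^sup>2 * K1\<^sup>2 = tr" using tr_pos c by (simp add: K1_def power_divide)
  then have fK1: "f K1 \<ge> 0" using lambda_plus_bounds(2)[of K1] by (simp add: f_def)
  obtain \<omega> where w: "0 \<le> \<omega>" "\<omega> \<le> K1" "f \<omega> = 0"
    using IVT[of f 0 0 K1] f0 fK1 K1 cont by auto
  have wpos: "\<omega> > 0" using w f0 by (cases "\<omega> = 0") auto
  have mono: "f x < f y" if "0 < x" "x < y" for x y
  proof (rule DERIV_pos_imp_increasing[OF that(2)])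
    show "\<exists>l. (f has_real_derivative l) (at z) \<and> 0 < l" if "x \<le> z" "z \<le> y" for z
      using d[of z] dpos[of z] that \<open>0 < x\<close> by force
  qed
  have iff: "c\<^sup>2 * K\<^sup>2 = lambda_plus \<kappa> w K \<longleftrightarrow> K = \<omega> \<or> K = - \<omega>" for K
  proof -
    have even: "f (- K) = f K" by (simp add: f_def lambda_plus_even)
    have "f \<bar>K\<bar> = 0 \<longleftrightarrow> \<bar>K\<bar> = \<omega>"
    proof
      assume a: "f \<bar>K\<bar> = 0"
      then have "\<bar>K\<bar> \<noteq> 0" using f0 by auto
      then show "\<bar>K\<bar> = \<omega>" using mono[of "\<bar>K\<bar>" \<omega>] mono[of \<omega> "\<bar>K\<bar>"] a w wpos by (cases "\<bar>K\<bar>" \<omega> rule: linorder_cases) auto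
    qed (use w in simp)
    moreover have "f \<bar>K\<bar> = f K" using even by (cases "K \<ge> 0") auto
    ultimately show ?thesis using wpos by (auto simp: f_def abs_if split: if_splits)
  qed
  have "crit_freq \<kappa> w c = \<omega>"
    unfolding crit_freq_def
  proof (rule the_equality)
    show "\<omega> > 0 \<and> (\<forall>K. c\<^sup>2 * K\<^sup>2 = lambda_plus \<kappa> w K \<longleftrightarrow> K = \<omega> \<or> K = - \<omega>)" using wpos iff by blast
    show "\<omega>' = \<omega>" if "\<omega>' > 0 \<and> (\<forall>K. c\<^sup>2 * K\<^sup>2 = lambda_plus \<kappa> w K \<longleftrightarrow> K = \<omega>' \<or> K = - \<omega>')" for \<omega>'
      using that iff[of \<omega>'] wpos by auto
  qed
  then show "crit_freq \<kappa> w c > 0" "c\<^sup>2 * (crit_freq \<kappa> w c)\<^sup>2 = lambda_plus \<kappa> w (crit_freq \<kappa> w c)"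
    using wpos iff by auto
qed

section \<open>Uniformity over the supersonic speeds\<close>

definition "speeds = {c. c_star \<kappa> w < c \<and> c \<le> c1}"

lemma c1_pos: "c1 > 0" by (simp add: c1_def add_nonneg_pos)

lemma x0_pos: "x0 > 0" and x1_pos: "x1 > 0"
  using tr_pos c1_pos c_star_pos by (auto simp: x0_def x1_def)

text \<open>If w > 1 the first summand is positive; if \<kappa> > 1 the root strictly exceeds the
  modulus of that summand.\<close>

lemma n0_pos: "n0 > 0"
proof -
  let ?A = "(1 + \<kappa>) * (w - 1)" and ?B = "4 * w * (1 - \<kappa>)\<^sup>2"
  have B: "?B \<ge> 0" using w_pos by simp
  have "?A + sqrt (?A\<^sup>2 + ?B) > 0"
    using contrast
  proof
    assume "w > 1"
    then have "?A > 0" using kap_pos by simp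
    moreover have "sqrt (?A\<^sup>2 + ?B) \<ge> 0" using B by simp
    ultimately show ?thesis by linarith
  next
    assume "\<kappa> > 1"
    then have "?B > 0" using w_pos by simp
    then have "sqrt (?A\<^sup>2) < sqrt (?A\<^sup>2 + ?B)" by (intro real_sqrt_less_mono) linarith
    then show ?thesis by simp
  qed
  then show ?thesis by (simp add: n0_def)
qed

text \<open>The square of speed times critical frequency is a value of the upper branch, hence
  between \<open>tr / 2\<close> and \<open>tr\<close>.\<close>

lemma speeds_props:
  assumes "c \<in> speeds"
  shows "c > 0" "c\<^sup>2 \<ge> (c_star \<kappa> w)\<^sup>2" "x0 \<le> crit_freq \<kappa> w c" "crit_freq \<kappa> w c \<le> x1"
proof -
  have c: "c > c_star \<kappa> w" "c \<le> c1" using assms by (auto simp: speeds_def)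
  show cpos: "c > 0" using c c_star_pos by linarith
  show c2: "c\<^sup>2 \<ge> (c_star \<kappa> w)\<^sup>2" using c c_star_pos by (intro power_mono) auto
  note f = crit_freq_props[OF cpos c2]
  let ?k = "crit_freq \<kappa> w c"
  have "(c * ?k)\<^sup>2 \<ge> tr / 2" using f lambda_plus_bounds(1)[of ?k] by (simp add: power_mult_distrib)
  then have "sqrt (tr / 2) \<le> c * ?k" using cpos f by (simp add: real_le_lsqrt)
  also have "\<dots> \<le> c1 * ?k" using c f by (intro mult_right_mono) auto
  finally show "x0 \<le> ?k" using c1_pos by (simp add: x0_def pos_divide_le_eq mult.commute)
  have "(c * ?k)\<^sup>2 \<le> tr" using f lambda_plus_bounds(2)[of ?k] by (simp add: power_mult_distrib)
  then have "c * ?k \<le> sqrt tr" using real_le_rsqrt by blast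
  moreover have "c_star \<kappa> w * ?k \<le> c * ?k" using c f by (intro mult_right_mono) auto
  ultimately show "?k \<le> x1" using c_star_pos by (simp add: x1_def pos_le_divide_eq mult.commute)
qed

lemma dimer_at_speed:
  assumes "c \<in> speeds"
  shows "dimer m \<kappa> (crit_freq \<kappa> w c) (c\<^sup>2 * (crit_freq \<kappa> w c)\<^sup>2) n0"
proof -
  note s = speeds_props[OF assms] 
  let ?k = "crit_freq \<kappa> w c"
  note f = crit_freq_props[OF s(1,2)]
  have mw: "m * w = 1" using m_pos by (simp add: w_def)
  have "m * tr = (1 + \<kappa>) * (m + m * w)" unfolding tr_def by (simp add: algebra_simps)
  then have mt: "m * tr = (1 + \<kappa>) * (1 + m)" by (simp add: mw)
  define L where "L = lambda_plus \<kappa> w ?k"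
  \<comment> \<open>The upper branch solves the characteristic equation; multiplied by m this
    becomes the assumption \<open>eig\<close> of the locale.\<close>
  have quad: "L\<^sup>2 = tr * L - 4 * \<kappa> * w * (sin ?k)\<^sup>2"
  proof -
    have "2 * L - tr = rho \<kappa> w ?k" using lambda_plus_eq[of ?k] by (simp add: L_def field_simps del: eq_divide_eq_numeral1)
    then have "(2 * L - tr)\<^sup>2 = tr\<^sup>2 - 16 * \<kappa> * w * (sin ?k)\<^sup>2" by (simp add: rho_squared)
    then show ?thesis by (simp add: power2_eq_square algebra_simps)
  qed
  show ?thesis
  proof
    show "m > 0" "\<kappa> > 0" "?k > 0" "n0 > 0" using m_pos kap_pos f n0_pos by auto
    show "(1 + \<kappa>) * (1 + m) \<le> 2 * m * (c\<^sup>2 * ?k\<^sup>2)" "m * (c\<^sup>2 * ?k\<^sup>2) \<le> (1 + \<kappa>) * (1 + m)"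
      unfolding f mt[symmetric] using mult_left_mono[OF lambda_plus_bounds(1)[of ?k], of m] mult_left_mono[OF lambda_plus_bounds(2)[of ?k], of m] m_pos
      by auto
    have "m * L\<^sup>2 = m * tr * L - 4 * \<kappa> * (m * w) * (sin ?k)\<^sup>2" unfolding quad by (simp add: algebra_simps)
    then have "m * L\<^sup>2 = (1 + \<kappa>) * (1 + m) * L - 4 * \<kappa> * (sin ?k)\<^sup>2" unfolding mw mt by simp
    then show "(c\<^sup>2 * ?k\<^sup>2 - (1 + \<kappa>)) * (m * (c\<^sup>2 * ?k\<^sup>2) - (1 + \<kappa>)) = 1 + \<kappa>\<^sup>2 + 2 * \<kappa> * cos (2 * ?k)"
      unfolding f L_def[symmetric] cos_double_sin by (simp add: power2_eq_square algebra_simps)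
    have "((1 + \<kappa>) * (w - 1))\<^sup>2 + 4 * w * (1 - \<kappa>)\<^sup>2 \<le> (rho \<kappa> w ?k)\<^sup>2"
    proof -
      have "16 * \<kappa> * w * (sin ?k)\<^sup>2 \<le> 16 * \<kappa> * w * 1"
        using kap_pos w_pos by (intro mult_left_mono) (auto simp: abs_square_le_1)
      then show ?thesis unfolding rho_squared tr_def by (simp add: power2_eq_square algebra_simps)
    qed
    then have "sqrt (((1 + \<kappa>) * (w - 1))\<^sup>2 + 4 * w * (1 - \<kappa>)\<^sup>2) \<le> rho \<kappa> w ?k"
      using rho_pos[of ?k] by (simp add: real_le_lsqrt)
    then show "n0 \<le> c\<^sup>2 * ?k\<^sup>2 - (1 + \<kappa>)"
      unfolding f n0_def lambda_plus_eq tr_def by (simp add: field_simps)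
  qed
qed

text \<open>\<tau> is a factor bounded below times the expression estimated in \<open>gap\<close>.
  All critical frequencies lie in the compact interval [x0, x1], on which K - |sin K| has a positive
  minimum, so the bound does not degenerate as the speeds approach \<open>c_star\<close>.\<close>

lemma tau_bound:
  obtains \<tau>0 where "\<tau>0 > 0" "\<And>c. c \<in> speeds \<Longrightarrow> \<tau>0 \<le> dimer.\<tau> m \<kappa> (crit_freq \<kappa> w c) (c\<^sup>2 * (crit_freq \<kappa> w c)\<^sup>2)"
proof -
  have "\<exists>\<delta>>0. \<forall>x\<in>{x0..x1}. \<delta> \<le> x - \<bar>sin x\<bar>"
  proof (cases "x0 \<le> x1")
    case True
    have "\<exists>x\<in>{x0..x1}. \<forall>y\<in>{x0..x1}. x - \<bar>sin x\<bar> \<le> y - \<bar>sin y\<bar>"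
      using True by (intro continuous_attains_inf) (auto intro!: continuous_intros)
    then show ?thesis using abs_sin_less x0_pos by (metis atLeastAtMost_iff diff_gt_0_iff_gt order_less_le_trans)
  qed (auto intro!: exI[of _ 1])
  then obtain \<delta> where \<delta>: "\<delta> > 0" "\<And>x. x0 \<le> x \<Longrightarrow> x \<le> x1 \<Longrightarrow> \<delta> \<le> x - \<bar>sin x\<bar>" by auto
  define \<tau>0 where "\<tau>0 = 2 * n0 / ((1 + \<kappa>)\<^sup>2 + tr\<^sup>2) * (m / tr * (4 * \<kappa> * w * (rho0 / tr) * \<delta>))"
  have pos: "4 * \<kappa> * w * (rho0 / tr) > 0" using kap_pos w_pos rho0_pos tr_pos by simp
  have "\<tau>0 > 0"
    unfolding \<tau>0_def using n0_pos kap_pos tr_pos m_pos w_pos rho0_pos \<delta> by (intro mult_pos_pos divide_pos_pos add_pos_pos) auto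
  moreover have "\<tau>0 \<le> dimer.\<tau> m \<kappa> (crit_freq \<kappa> w c) (c\<^sup>2 * (crit_freq \<kappa> w c)\<^sup>2)" if c: "c \<in> speeds" for c
  proof -
    define \<xi> where "\<xi> = crit_freq \<kappa> w c"
    define L where "L = c\<^sup>2 * \<xi>\<^sup>2"
    interpret D: dimer m \<kappa> \<xi> L n0 using dimer_at_speed[OF c] by (simp add: \<xi>_def L_def)
    note s = speeds_props[OF c, folded \<xi>_def] and f = crit_freq_props[OF speeds_props(1,2)[OF c], folded \<xi>_def]
    have L: "L = lambda_plus \<kappa> w \<xi>" "L > 0" "L \<le> tr" using f lambda_plus_bounds[of \<xi>] tr_pos by (auto simp: L_def)
    have mw: "m * w = 1" using m_pos by (simp add: w_def)
    have rho: "D.zz + m * D.n\<^sup>2 = D.n * m * rho \<kappa> w \<xi>"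
    proof -
      have "m * rho \<kappa> w \<xi> = 2 * m * L - (1 + \<kappa>) * (m + m * w)"
        unfolding L(1) lambda_plus_eq tr_def by (simp add: field_simps)
      then have e: "m * L - (1 + \<kappa>) + m * D.n = m * rho \<kappa> w \<xi>" unfolding mw D.n_def by (simp add: algebra_simps)
      have "D.zz + m * D.n\<^sup>2 = D.n * (m * L - (1 + \<kappa>) + m * D.n)"
        unfolding D.zz_n by (simp add: power2_eq_square algebra_simps)
      then show ?thesis unfolding e by (simp only: mult.assoc)
    qed
    have T: "D.\<tau> = D.g\<^sup>2 * D.n * (m / L * (c\<^sup>2 * \<xi> * rho \<kappa> w \<xi> + 4 * \<kappa> * w * (sin \<xi> * cos \<xi>)))"
    proof -
      have "rho \<kappa> w \<xi> / \<xi> = c\<^sup>2 * \<xi> * rho \<kappa> w \<xi> / L"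
        using f(1) s(1) by (simp add: L_def power2_eq_square)
      then have 1: "(D.zz + m * D.n\<^sup>2) / \<xi> = D.n * m * (c\<^sup>2 * \<xi> * rho \<kappa> w \<xi>) / L"
        unfolding rho by (metis times_divide_eq_right)
      have 2: "2 * \<kappa> * D.n * sin (2 * \<xi>) / L = D.n * m * (4 * \<kappa> * w * (sin \<xi> * cos \<xi>)) / L"
        using mw by (simp add: sin_double)
      show ?thesis unfolding D.\<tau>_def 1 2 by (simp add: distrib_left add_divide_distrib mult_ac)
    qed
    have N: "2 * n0 / ((1 + \<kappa>)\<^sup>2 + tr\<^sup>2) \<le> D.g\<^sup>2 * D.n"
    proof -
      have "D.zz \<le> (1 + \<kappa>)\<^sup>2" unfolding D.zz_def using kap_pos mult_left_mono[OF cos_le_one[of "2 * \<xi>"], of "2 * \<kappa>"] by (simp add: power2_sum)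
      moreover have "D.n\<^sup>2 \<le> tr\<^sup>2" using L(3) D.n_pos kap_pos by (intro power_mono) (simp_all add: D.n_def)
      ultimately have "2 * n0 / ((1 + \<kappa>)\<^sup>2 + tr\<^sup>2) \<le> 2 * D.n / (D.zz + D.n\<^sup>2)"
        using D.n_ge n0_pos D.n_pos D.zzn_pos by (intro frac_le) (auto simp: D.n_def)
      then show ?thesis by (simp add: D.g2)
    qed
    have B: "m / tr * (4 * \<kappa> * w * (rho0 / tr) * \<delta>) \<le> m / L * (c\<^sup>2 * \<xi> * rho \<kappa> w \<xi> + 4 * \<kappa> * w * (sin \<xi> * cos \<xi>))"
    proof (intro mult_mono divide_left_mono)
      have "4 * \<kappa> * w * (sin \<xi> * cos \<xi>) \<ge> - (4 * \<kappa> * w * \<bar>sin \<xi> * cos \<xi>\<bar>)"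
        by (rule neg_abs_mult_le) (use kap_pos w_pos in simp)
      moreover have "4 * \<kappa> * w * (rho0 / tr) * \<delta> \<le> 4 * \<kappa> * w * (rho0 / tr) * (\<xi> - \<bar>sin \<xi>\<bar>)"
        using \<delta>(2)[OF s(3,4)] pos by (intro mult_left_mono) auto
      ultimately show "4 * \<kappa> * w * (rho0 / tr) * \<delta> \<le> c\<^sup>2 * \<xi> * rho \<kappa> w \<xi> + 4 * \<kappa> * w * (sin \<xi> * cos \<xi>)"
        using gap[OF f(1) s(2)] by linarith
    qed (use L m_pos tr_pos kap_pos w_pos rho0_pos \<delta>(1) in \<open>auto intro!: mult_nonneg_nonneg divide_nonneg_pos\<close>)
    have "0 \<le> D.g\<^sup>2 * D.n" using D.n_pos by simp
    moreover have "0 \<le> m / tr * (4 * \<kappa> * w * (rho0 / tr) * \<delta>)"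
      using m_pos tr_pos kap_pos w_pos rho0_pos \<delta>(1) by (intro mult_nonneg_nonneg divide_nonneg_pos) auto
    ultimately have "\<tau>0 \<le> D.\<tau>"
      unfolding \<tau>0_def T by (rule mult_mono[OF N B])
    then show ?thesis by (simp add: \<xi>_def L_def)
  qed
  ultimately show ?thesis using that by blast
qed

lemma nu1_components:
  assumes "c \<in> speeds"
  defines "\<xi> \<equiv> crit_freq \<kappa> w c" and "L \<equiv> c\<^sup>2 * (crit_freq \<kappa> w c)\<^sup>2"
  shows "nu1 \<kappa> w c x $ 1 = dimer.\<nu>1 \<kappa> \<xi> L x" "nu1 \<kappa> w c x $ 2 = dimer.\<nu>2 \<kappa> \<xi> L x"
proof -
  interpret D: dimer m \<kappa> \<xi> L n0 using dimer_at_speed[OF assms(1)] by (simp add: \<xi>_def L_def)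
  define \<mu>1 where "\<mu>1 = Complex ((1 + \<kappa>) * cos \<xi>) ((1 - \<kappa>) * sin \<xi>)"
  have m1: "mu \<kappa> w c $ 1 = \<mu>1"
    by (simp add: mu_def Let_def \<xi>_def[symmetric] \<mu>1_def complex_eq_iff Re_exp Im_exp algebra_simps)
  have m2: "mu \<kappa> w c $ 2 = of_real (- D.n)"
    unfolding D.n_def by (simp add: mu_def Let_def L_def)
  have "(cmod \<mu>1)\<^sup>2 = (1 + \<kappa>)\<^sup>2 * (cos \<xi>)\<^sup>2 + (1 - \<kappa>)\<^sup>2 * (sin \<xi>)\<^sup>2"
    by (simp add: \<mu>1_def cmod_power2 power_mult_distrib)
  also have "\<dots> = D.zz" unfolding D.zz_def cos_double_sin cos_squared_eq by (simp add: power2_eq_square algebra_simps)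
  finally have z: "(cmod \<mu>1)\<^sup>2 = D.zz" .
  have "norm (mu \<kappa> w c) = sqrt (D.zz + D.n\<^sup>2)"
    by (simp add: norm_vec_def L2_set_def sum_2 m1 m2 z)
  then have N: "2 / N_norm \<kappa> w c = D.g"
    by (simp add: N_norm_def D.g_def flip: real_sqrt_mult)
  have e: "2 * y / N_norm \<kappa> w c = D.g * y" for y by (simp add: N[symmetric])
  have "nu1 \<kappa> w c x $ 1 = 2 * (cos x * Re \<mu>1 - sin x * Im \<mu>1) / N_norm \<kappa> w c"
    by (simp add: nu1_def nu1_complex_def m1 Re_exp Im_exp)
  also have "\<dots> = D.\<nu>1 x" unfolding e by (simp add: \<mu>1_def D.\<nu>1_def cos_add cos_diff algebra_simps)
  finally show "nu1 \<kappa> w c x $ 1 = D.\<nu>1 x" .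
  have "nu1 \<kappa> w c x $ 2 = 2 * (- cos x * D.n) / N_norm \<kappa> w c"
    by (simp add: nu1_def nu1_complex_def m2 Re_exp Im_exp)
  also have "\<dots> = D.\<nu>2 x" unfolding e by (simp add: D.\<nu>2_def)
  finally show "nu1 \<kappa> w c x $ 2 = D.\<nu>2 x" .
qed

end

section \<open>Travelling waves\<close>

lemma quadratic_remainder_bounds:
  assumes "csmooth k"
  obtains B where "0 \<le> B"
    "\<And>s y. \<bar>s\<bar> \<le> 1 \<Longrightarrow> \<bar>y\<bar> \<le> 6 \<Longrightarrow> \<bar>y\<^sup>2 * k (s * y)\<bar> \<le> B"
    "\<And>s y y'. \<bar>s\<bar> \<le> 1 \<Longrightarrow> \<bar>y\<bar> \<le> 6 \<Longrightarrow> \<bar>y'\<bar> \<le> 6 \<Longrightarrow> \<bar>y\<^sup>2 * k (s * y) - y'\<^sup>2 * k (s * y')\<bar> \<le> B * \<bar>y - y'\<bar>"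
    "\<And>s s' y. \<bar>s\<bar> \<le> 1 \<Longrightarrow> \<bar>s'\<bar> \<le> 1 \<Longrightarrow> \<bar>y\<bar> \<le> 6 \<Longrightarrow> \<bar>y\<^sup>2 * k (s * y) - y\<^sup>2 * k (s' * y)\<bar> \<le> B * \<bar>s - s'\<bar>"
proof -
  obtain B where B: "0 \<le> B" "\<And>y. \<bar>y\<bar> \<le> 6 \<Longrightarrow> \<bar>k y\<bar> \<le> B"
    "\<And>y z. \<bar>y\<bar> \<le> 6 \<Longrightarrow> \<bar>z\<bar> \<le> 6 \<Longrightarrow> \<bar>k y - k z\<bar> \<le> B * \<bar>y - z\<bar>"
    using csmooth_local_bounds[OF assms, of 6] by metis
  have y2: "\<bar>y\<^sup>2\<bar> \<le> 36" if "\<bar>y\<bar> \<le> 6" for y :: real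
    using power_mono[OF that, of 2] by simp
  have sy: "\<bar>s * y\<bar> \<le> 6" if "\<bar>s\<bar> \<le> 1" "\<bar>y\<bar> \<le> 6" for s y :: real
    using mult_mono[OF that] by (simp add: abs_mult)
  show ?thesis
  \<comment> \<open>216 = 36 * 6: y^2 is at most 36, and changing \<open>s\<close> moves s y by at
    most 6 |s - s'|. The Lipschitz bound in y takes only 12 + 36.\<close>
  proof (rule that[of "216 * B"])
    show "0 \<le> 216 * B" using B(1) by simp
    fix s s' y y' :: real
    assume s: "\<bar>s\<bar> \<le> 1" and y: "\<bar>y\<bar> \<le> 6"
    have "\<bar>y\<^sup>2 * k (s * y)\<bar> \<le> 36 * B"
      unfolding abs_mult using y2[OF y] B(2)[OF sy[OF s y]] by (intro mult_mono) auto
    then show "\<bar>y\<^sup>2 * k (s * y)\<bar> \<le> 216 * B" using B(1) by linarith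
    show "\<bar>y\<^sup>2 * k (s * y) - y'\<^sup>2 * k (s * y')\<bar> \<le> 216 * B * \<bar>y - y'\<bar>" if y': "\<bar>y'\<bar> \<le> 6"
    proof -
      have "\<bar>y + y'\<bar> \<le> 12" using y y' by linarith
      then have 1: "\<bar>y\<^sup>2 - y'\<^sup>2\<bar> \<le> 12 * \<bar>y - y'\<bar>"
        using mult_right_mono[of "\<bar>y + y'\<bar>" 12 "\<bar>y - y'\<bar>"] by (simp add: abs_mult[symmetric] power2_eq_square algebra_simps)
      have "\<bar>s * y - s * y'\<bar> \<le> \<bar>y - y'\<bar>"
        using mult_right_mono[OF s, of "\<bar>y - y'\<bar>"] by (simp add: abs_mult[symmetric] right_diff_distrib)
      then have 2: "\<bar>k (s * y) - k (s * y')\<bar> \<le> B * \<bar>y - y'\<bar>"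
        using B(3)[OF sy[OF s y] sy[OF s y']] mult_left_mono[OF _ B(1)] by fastforce
      have "\<bar>y\<^sup>2 * k (s * y) - y'\<^sup>2 * k (s * y')\<bar> \<le> 12 * \<bar>y - y'\<bar> * B + 36 * (B * \<bar>y - y'\<bar>)"
        by (rule abs_mult_diff_le[OF 1 B(2)[OF sy[OF s y]] y2[OF y'] 2])
      moreover have "0 \<le> B * \<bar>y - y'\<bar>" using B(1) by simp
      ultimately show ?thesis by (simp add: algebra_simps)
    qed
    show "\<bar>y\<^sup>2 * k (s * y) - y\<^sup>2 * k (s' * y)\<bar> \<le> 216 * B * \<bar>s - s'\<bar>" if s': "\<bar>s'\<bar> \<le> 1"
    proof -
      have "\<bar>k (s * y) - k (s' * y)\<bar> \<le> B * \<bar>s * y - s' * y\<bar>" by (rule B(3)[OF sy[OF s y] sy[OF s' y]])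
      also have "\<dots> \<le> B * (\<bar>s - s'\<bar> * 6)"
        using y B(1) by (intro mult_left_mono) (auto simp: abs_mult left_diff_distrib[symmetric] intro!: mult_left_mono)
      finally have "\<bar>y\<^sup>2\<bar> * \<bar>k (s * y) - k (s' * y)\<bar> \<le> 36 * (B * (\<bar>s - s'\<bar> * 6))"
        using y2[OF y] by (intro mult_mono) auto
      then show ?thesis by (simp add: abs_mult right_diff_distrib[symmetric])
    qed
  qed
qed

text \<open>Undoes the scaling: two derivatives of p(\<omega> x) give \<omega>^2, which cancels
  against 1 / (c^2 \<omega>^2), and a unit shift in x is a shift by \<omega> of the profile.\<close>

lemma travelling_waveI:
  assumes c: "c \<noteq> 0" "\<omega> \<noteq> 0" "m \<noteq> 0"
    and V: "\<And>r. deriv V1 r = r + r\<^sup>2 * k1 r" "\<And>r. deriv V2 r = \<kappa> * r + r\<^sup>2 * k2 r"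
    and p: "deriv2 p p' (\<lambda>x. 1 / (c\<^sup>2 * \<omega>\<^sup>2) * force1 (\<lambda>y. y + s * (y\<^sup>2 * k1 (s * y))) (\<lambda>y. \<kappa> * y + s * (y\<^sup>2 * k2 (s * y))) \<omega> p q x)"
    and q: "deriv2 q q' (\<lambda>x. 1 / (c\<^sup>2 * \<omega>\<^sup>2) * force2 (\<lambda>y. y + s * (y\<^sup>2 * k1 (s * y))) (\<lambda>y. \<kappa> * y + s * (y\<^sup>2 * k2 (s * y))) \<omega> p q x / m)"
  shows "travelling_wave m V1 V2 c (\<lambda>x. s * p (\<omega> * x)) (\<lambda>x. s * q (\<omega> * x))"
proof -
  have dd: "deriv (deriv (\<lambda>x. s * f (\<omega> * x))) x = s * \<omega>\<^sup>2 * v (\<omega> * x)" if "deriv2 f d v" for f d v x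
  proof -
    have f: "(f has_real_derivative d y) (at y)" "(d has_real_derivative v y) (at y)" for y
      using that by (auto simp: deriv2_def)
    have "((\<lambda>x. s * f (\<omega> * x)) has_real_derivative s * (d (\<omega> * y) * \<omega>)) (at y)" for y
      by (intro DERIV_cmult DERIV_chain2[OF f(1) DERIV_cmult_Id])
    then have "((\<lambda>x. s * f (\<omega> * x)) has_real_derivative s * (\<omega> * d (\<omega> * y))) (at y)" for y
      by (simp only: mult.commute[of \<omega>])
    then have "deriv (\<lambda>x. s * f (\<omega> * x)) = (\<lambda>x. s * (\<omega> * d (\<omega> * x)))" using DERIV_imp_deriv by blast
    moreover have "((\<lambda>x. s * (\<omega> * d (\<omega> * x))) has_real_derivative s * (\<omega> * (v (\<omega> * x) * \<omega>))) (at x)"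
      by (intro DERIV_cmult DERIV_chain2[OF f(2) DERIV_cmult_Id])
    then have "((\<lambda>x. s * (\<omega> * d (\<omega> * x))) has_real_derivative s * \<omega>\<^sup>2 * v (\<omega> * x)) (at x)"
      by (simp only: power2_eq_square mult.assoc mult.commute[of "v (\<omega> * x)"])
    ultimately show ?thesis using DERIV_imp_deriv by metis
  qed
  have V': "deriv V1 (s * y) = s * (y + s * (y\<^sup>2 * k1 (s * y)))" "deriv V2 (s * y) = s * (\<kappa> * y + s * (y\<^sup>2 * k2 (s * y)))" for y
    unfolding V by (simp_all add: power2_eq_square algebra_simps)
  have e: "c\<^sup>2 * (s * \<omega>\<^sup>2 * (1 / (c\<^sup>2 * \<omega>\<^sup>2) * F)) = s * F" "c\<^sup>2 * m * (s * \<omega>\<^sup>2 * (1 / (c\<^sup>2 * \<omega>\<^sup>2) * F / m)) = s * F" for F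
    using c by (simp_all add: field_simps)
  have sh: "s * f (\<omega> * (x + 1)) - s * g (\<omega> * x) = s * (f (\<omega> * x + \<omega>) - g (\<omega> * x))"
    "s * f (\<omega> * x) - s * g (\<omega> * (x + - 1)) = s * (f (\<omega> * x) - g (\<omega> * x - \<omega>))" for f g x
    by (simp_all add: algebra_simps)
  show ?thesis
    unfolding travelling_wave_def dd[OF p] dd[OF q] e shift_def sh V' force1_def force2_def
    by (simp add: right_diff_distrib)
qed

section \<open>Functions with values in the plane\<close>

lemma vector_2_eq: "(vector [a, b] :: real^2) = a *\<^sub>R axis 1 1 + b *\<^sub>R axis 2 1"
  by (simp add: vec_eq_iff forall_2 axis_def)

lemma norm_vector_2_le: "norm (vector [a, b] :: real^2) \<le> \<bar>a\<bar> + \<bar>b\<bar>"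
  using norm_le_l1_cart[of "vector [a, b] :: real^2"] by (simp add: sum_2)

lemma has_vector_derivative_vector_2:
  assumes "(f has_real_derivative f') (at x)" "(g has_real_derivative g') (at x)"
  shows "((\<lambda>x. vector [f x, g x] :: real^2) has_vector_derivative vector [f', g']) (at x)"
proof -
  have "((\<lambda>x. f x *\<^sub>R (axis 1 1 :: real^2) + g x *\<^sub>R axis 2 1) has_vector_derivative
      ((f x *\<^sub>R 0 + f' *\<^sub>R axis 1 1) + (g x *\<^sub>R 0 + g' *\<^sub>R axis 2 1))) (at x)"
    by (intro has_vector_derivative_add has_vector_derivative_scaleR has_vector_derivative_const assms)
  then show ?thesis by (simp add: vector_2_eq)
qed

lemma nth_deriv_vector_2:
  assumes "\<And>n x. (nth_deriv n f has_real_derivative nth_deriv (Suc n) f x) (at x)"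
    "\<And>n x. (nth_deriv n g has_real_derivative nth_deriv (Suc n) g x) (at x)"
  shows "smooth (\<lambda>x. vector [f x, g x] :: real^2)"
    "nth_deriv n (\<lambda>x. vector [f x, g x] :: real^2) = (\<lambda>x. vector [nth_deriv n f x, nth_deriv n g x])"
proof -
  let ?F = "\<lambda>n x. vector [nth_deriv n f x, nth_deriv n g x] :: real^2"
  have "?F 0 = (\<lambda>x. vector [f x, g x])" by (simp add: nth_deriv_def)
  moreover have "(?F n has_vector_derivative ?F (Suc n) x) (at x)" for n x
    by (rule has_vector_derivative_vector_2[OF assms])
  ultimately show "smooth (\<lambda>x. vector [f x, g x] :: real^2)"
    "nth_deriv n (\<lambda>x. vector [f x, g x] :: real^2) = ?F n"
    by (rule smoothI, rule nth_deriv_eqI)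
qed

lemma nth_deriv_diff:
  assumes "smooth u" "smooth v"
  shows "smooth (\<lambda>x. u x - v x)" "nth_deriv n (\<lambda>x. u x - v x) = (\<lambda>x. nth_deriv n u x - nth_deriv n v x)"
proof -
  let ?F = "\<lambda>n x. nth_deriv n u x - nth_deriv n v x"
  have "?F 0 = (\<lambda>x. u x - v x)" by (simp add: nth_deriv_def)
  moreover have "(?F n has_vector_derivative ?F (Suc n) x) (at x)" for n x
    by (intro has_vector_derivative_diff nth_deriv_smooth assms)
  ultimately show "smooth (\<lambda>x. u x - v x)" "nth_deriv n (\<lambda>x. u x - v x) = ?F n"
    by (rule smoothI, rule nth_deriv_eqI)
qed

text \<open>Pointwise bounds pass to the essential supremum; continuity of the derivatives supplies
  the measurability.\<close>

lemma Cper_norm_le: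
  assumes u: "smooth u" and b: "\<And>x. norm (u x) \<le> A" "\<And>x. norm (nth_deriv r u x) \<le> B"
  shows "Cper_norm r u \<le> ereal (A + B)"
proof -
  have le: "Linf_norm f \<le> ereal C" if c: "continuous_on UNIV f" and f: "\<And>x. norm (f x) \<le> C" for f C
    unfolding Linf_norm_def
  proof (rule esssup_I)
    show "(\<lambda>x. ereal (norm (f x))) \<in> borel_measurable lborel"
      using borel_measurable_continuous_onI[OF continuous_on_norm[OF c]] by simp
  qed (use f in simp)
  have cont: "continuous_on UNIV (nth_deriv n u)" for n
    using nth_deriv_smooth[OF u] by (meson continuous_at_imp_continuous_on has_vector_derivative_continuous)
  have "continuous_on UNIV u" using cont[of 0] by (simp add: nth_deriv_def)
  then show ?thesis
    unfolding Cper_norm_def plus_ereal.simps(1)[symmetric] using b by (intro add_mono le cont)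
qed

lemma inner_per_eq_ip:
  "inner_per \<phi> \<eta> = ip (\<lambda>x. \<phi> x $ 1) (\<lambda>x. \<phi> x $ 2) (\<lambda>x. \<eta> x $ 1) (\<lambda>x. \<eta> x $ 2)"
  by (simp add: inner_per_def ip_def mean_def inner_vec_def sum_2)

section \<open>Families of waves over the supersonic speeds\<close>

context dispersion
begin

text \<open>All conclusions at one speed in a single predicate, so that the branches for all speeds
  can be chosen at once with common constants \<open>a\<close> and \<open>L\<close>.\<close>

definition branch where
  "branch k1 k2 a L c om p q \<longleftrightarrow> (\<forall>s. \<bar>s\<bar> \<le> a \<longrightarrow>
      \<bar>om s - crit_freq \<kappa> w c\<bar> \<le> x0 / 2 \<and>
      cper (p s) \<and> cper (q s) \<and> bdd 3 (p s) \<and> bdd 3 (q s) \<and> lip 3 (p s) \<and> lip 3 (q s) \<and>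
      ip (\<lambda>x. p s x - nu1 \<kappa> w c x $ 1) (\<lambda>x. q s x - nu1 \<kappa> w c x $ 2) (\<lambda>x. nu1 \<kappa> w c x $ 1) (\<lambda>x. nu1 \<kappa> w c x $ 2) = 0 \<and>
      (\<exists>d. deriv2 (p s) d (\<lambda>x. 1 / (c\<^sup>2 * (om s)\<^sup>2) *
        force1 (\<lambda>y. y + s * (y\<^sup>2 * k1 (s * y))) (\<lambda>y. \<kappa> * y + s * (y\<^sup>2 * k2 (s * y))) (om s) (p s) (q s) x)) \<and>
      (\<exists>d. deriv2 (q s) d (\<lambda>x. 1 / (c\<^sup>2 * (om s)\<^sup>2) *
        force2 (\<lambda>y. y + s * (y\<^sup>2 * k1 (s * y))) (\<lambda>y. \<kappa> * y + s * (y\<^sup>2 * k2 (s * y))) (om s) (p s) (q s) x / m)) \<and>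
      \<bar>1 / (c\<^sup>2 * (om s)\<^sup>2)\<bar> \<le> 4 \<and>
      (\<forall>s'. \<bar>s'\<bar> \<le> a \<longrightarrow> \<bar>om s - om s'\<bar> \<le> L * \<bar>s - s'\<bar> \<and>
        \<bar>1 / (c\<^sup>2 * (om s)\<^sup>2) - 1 / (c\<^sup>2 * (om s')\<^sup>2)\<bar> \<le> 16 / x0 * L * \<bar>s - s'\<bar> \<and>
        bdd (L * \<bar>s - s'\<bar>) (\<lambda>x. p s x - p s' x) \<and> bdd (L * \<bar>s - s'\<bar>) (\<lambda>x. q s x - q s' x))) \<and>
    om 0 = crit_freq \<kappa> w c \<and> p 0 = (\<lambda>x. nu1 \<kappa> w c x $ 1) \<and> q 0 = (\<lambda>x. nu1 \<kappa> w c x $ 2)"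

lemma branches_exist:
  assumes k: "csmooth k1" "csmooth k2"
  obtains a L om p q where "0 < a" "a \<le> 1" "0 \<le> L"
    "\<And>c. c \<in> speeds \<Longrightarrow> branch k1 k2 a L c (om c) (p c) (q c)"
proof -
  define h1 h2 where "h1 s y = y\<^sup>2 * k1 (s * y)" and "h2 s y = y\<^sup>2 * k2 (s * y)" for s y
  obtain B1 where B1: "0 \<le> B1"
    "\<And>s y. \<bar>s\<bar> \<le> 1 \<Longrightarrow> \<bar>y\<bar> \<le> 6 \<Longrightarrow> \<bar>h1 s y\<bar> \<le> B1"
    "\<And>s y y'. \<bar>s\<bar> \<le> 1 \<Longrightarrow> \<bar>y\<bar> \<le> 6 \<Longrightarrow> \<bar>y'\<bar> \<le> 6 \<Longrightarrow> \<bar>h1 s y - h1 s y'\<bar> \<le> B1 * \<bar>y - y'\<bar>"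
    "\<And>s s' y. \<bar>s\<bar> \<le> 1 \<Longrightarrow> \<bar>s'\<bar> \<le> 1 \<Longrightarrow> \<bar>y\<bar> \<le> 6 \<Longrightarrow> \<bar>h1 s y - h1 s' y\<bar> \<le> B1 * \<bar>s - s'\<bar>"
    unfolding h1_def using quadratic_remainder_bounds[OF k(1)] by metis
  obtain B2 where B2: "0 \<le> B2"
    "\<And>s y. \<bar>s\<bar> \<le> 1 \<Longrightarrow> \<bar>y\<bar> \<le> 6 \<Longrightarrow> \<bar>h2 s y\<bar> \<le> B2"
    "\<And>s y y'. \<bar>s\<bar> \<le> 1 \<Longrightarrow> \<bar>y\<bar> \<le> 6 \<Longrightarrow> \<bar>y'\<bar> \<le> 6 \<Longrightarrow> \<bar>h2 s y - h2 s y'\<bar> \<le> B2 * \<bar>y - y'\<bar>"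
    "\<And>s s' y. \<bar>s\<bar> \<le> 1 \<Longrightarrow> \<bar>s'\<bar> \<le> 1 \<Longrightarrow> \<bar>y\<bar> \<le> 6 \<Longrightarrow> \<bar>h2 s y - h2 s' y\<bar> \<le> B2 * \<bar>s - s'\<bar>"
    unfolding h2_def using quadratic_remainder_bounds[OF k(2)] by metis
  define M where "M = B1 + B2"
  have le: "x \<le> M * \<bar>y\<bar>" if "x \<le> B1 * \<bar>y\<bar> \<or> x \<le> B2 * \<bar>y\<bar>" for x y
  proof -
    have "B1 * \<bar>y\<bar> \<le> M * \<bar>y\<bar>" "B2 * \<bar>y\<bar> \<le> M * \<bar>y\<bar>" using B1(1) B2(1) by (intro mult_right_mono; simp add: M_def)+
    then show ?thesis using that by linarith
  qed
  obtain \<tau>0 where \<tau>0: "\<tau>0 > 0" "\<And>c. c \<in> speeds \<Longrightarrow> \<tau>0 \<le> dimer.\<tau> m \<kappa> (crit_freq \<kappa> w c) (c\<^sup>2 * (crit_freq \<kappa> w c)\<^sup>2)"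
    using tau_bound by blast
  have loc: "dimer_nonlinear m \<kappa> (crit_freq \<kappa> w c) (c\<^sup>2 * (crit_freq \<kappa> w c)\<^sup>2) n0 h1 h2 M \<tau>0 x0" if c: "c \<in> speeds" for c
  proof -
    interpret D: dimer m \<kappa> "crit_freq \<kappa> w c" "c\<^sup>2 * (crit_freq \<kappa> w c)\<^sup>2" n0 by (rule dimer_at_speed[OF c])
    show ?thesis
    proof
      show "0 < x0" "x0 \<le> crit_freq \<kappa> w c" using x0_pos speeds_props[OF c] by auto
      show "0 \<le> M" using B1 B2 by (simp add: M_def)
      show "0 < \<tau>0" "\<tau>0 \<le> D.\<tau>" using \<tau>0 c by auto
      fix s s' y y' :: real
      show "continuous_on UNIV (h1 s)" "continuous_on UNIV (h2 s)"
        unfolding h1_def[abs_def] h2_def[abs_def]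
        by (intro continuous_intros continuous_on_compose2[OF csmooth_continuous[OF k(1)]]
          continuous_on_compose2[OF csmooth_continuous[OF k(2)]]; simp)+
      assume s: "\<bar>s\<bar> \<le> 1" and y: "\<bar>y\<bar> \<le> 6"
      show "\<bar>h1 s y\<bar> \<le> M \<and> \<bar>h2 s y\<bar> \<le> M"
        using B1(1) B2(1) B1(2)[OF s y] B2(2)[OF s y] by (simp add: M_def)
      show "\<bar>h1 s y - h1 s y'\<bar> \<le> M * \<bar>y - y'\<bar> \<and> \<bar>h2 s y - h2 s y'\<bar> \<le> M * \<bar>y - y'\<bar>" if "\<bar>y'\<bar> \<le> 6"
        using le B1(3)[OF s y that] B2(3)[OF s y that] by blast
      show "\<bar>h1 s y - h1 s' y\<bar> \<le> M * \<bar>s - s'\<bar> \<and> \<bar>h2 s y - h2 s' y\<bar> \<le> M * \<bar>s - s'\<bar>" if "\<bar>s'\<bar> \<le> 1"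
        using le B1(4)[OF s that y] B2(4)[OF s that y] by blast
    qed
  qed
  \<comment> \<open>The locale constants \<open>a0\<close> and \<open>Q\<close> depend only on
    \<open>m\<close>, \<kappa>, \<open>n0\<close>, \<open>M\<close>, \<open>\<tau>0\<close> and
    \<open>x0\<close>; they can therefore be named before a speed is fixed.\<close>
  define a where "a = dimer_nonlinear.a0 m \<kappa> n0 M \<tau>0 x0"
  define L where "L = 8 * (dimer_nonlinear.Q m \<kappa> n0 M \<tau>0 x0)\<^sup>2"
  have br: "\<exists>om p q. branch k1 k2 a L c om p q" "0 < a" "a \<le> 1" if c: "c \<in> speeds" for c
  proof -
    define \<xi> where "\<xi> = crit_freq \<kappa> w c"
    interpret D: dimer_nonlinear m \<kappa> \<xi> "c\<^sup>2 * \<xi>\<^sup>2" n0 h1 h2 M \<tau>0 x0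
      using loc[OF c] by (simp add: \<xi>_def)
    show "0 < a" "a \<le> 1" using D.r_bounds by (auto simp: a_def)
    have bb: "D.bb o' = 1 / (c\<^sup>2 * o'\<^sup>2)" for o'
      using D.xi_pos by (simp add: D.bb_def)
    have nu: "nu1 \<kappa> w c x $ 1 = D.\<nu>1 x" "nu1 \<kappa> w c x $ 2 = D.\<nu>2 x" for x
      using nu1_components[OF c, of x] by (simp_all add: \<xi>_def)
    have L0: "0 \<le> 16 / x0" using x0_pos by simp
    show "\<exists>om p q. branch k1 k2 a L c om p q"
    proof (rule D.periodic_solution_family, goal_cases)
      case (1 om p q)
      note P = 1[unfolded bb a_def[symmetric] L_def[symmetric] h1_def h2_def]
      have "\<bar>1 / (c\<^sup>2 * (om s)\<^sup>2)\<bar> \<le> 4" if "\<bar>s\<bar> \<le> a" for s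
        using D.bb_bounds(1,2)[OF P(1)[OF that] P(1)[OF that] D.x0] by (simp add: bb)
      moreover have "\<bar>1 / (c\<^sup>2 * (om s)\<^sup>2) - 1 / (c\<^sup>2 * (om s')\<^sup>2)\<bar> \<le> 16 / x0 * L * \<bar>s - s'\<bar>"
        if "\<bar>s\<bar> \<le> a" "\<bar>s'\<bar> \<le> a" for s s'
        using D.bb_bounds(3)[OF P(1)[OF that(1)] P(1)[OF that(2)] D.x0, unfolded bb]
          mult_left_mono[OF conjunct1[OF P(6)[OF that]] L0] unfolding mult.assoc by (rule order_trans)
      ultimately have "branch k1 k2 a L c om p q"
        unfolding branch_def nu \<xi>_def[symmetric] using P by blast
      then show ?case by blast
    qed
  qed
  have "0 \<le> L" by (simp add: L_def)
  \<comment> \<open>A speed must be exhibited, since the bounds on \<open>a\<close> are available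
    only inside an interpretation at some speed.\<close>
  moreover have "c1 \<in> speeds"
    using c_star_pos by (simp add: speeds_def c1_def real_less_rsqrt)
  moreover obtain om p q where "\<And>c. c \<in> speeds \<Longrightarrow> branch k1 k2 a L c (om c) (p c) (q c)"
    using br(1) by metis
  ultimately show ?thesis using that[of a L om p q] br(2,3) by blast
qed

lemma branch_tame:
  assumes k: "csmooth k1" "csmooth k2" and a: "a \<le> 1"
    and br: "\<And>c. c \<in> speeds \<Longrightarrow> branch k1 k2 a L c (om c) (p c) (q c)"
  shows "tame speeds {-a..a} r p \<and> tame speeds {-a..a} r q"
proof -
  have S: "\<bar>s\<bar> \<le> a" if "s \<in> {-a..a}" for s using that by auto
  have B: "\<bar>om c s - crit_freq \<kappa> w c\<bar> \<le> x0 / 2"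
    "cper (p c s) \<and> cper (q c s)" "bdd 3 (p c s)" "bdd 3 (q c s)" "lip 3 (p c s) \<and> lip 3 (q c s)"
    "\<exists>d. deriv2 (p c s) d (\<lambda>x. 1 / (c\<^sup>2 * (om c s)\<^sup>2) *
        force1 (\<lambda>y. y + s * (y\<^sup>2 * k1 (s * y))) (\<lambda>y. \<kappa> * y + s * (y\<^sup>2 * k2 (s * y))) (om c s) (p c s) (q c s) x)"
    "\<exists>d. deriv2 (q c s) d (\<lambda>x. 1 / (c\<^sup>2 * (om c s)\<^sup>2) *
        force2 (\<lambda>y. y + s * (y\<^sup>2 * k1 (s * y))) (\<lambda>y. \<kappa> * y + s * (y\<^sup>2 * k2 (s * y))) (om c s) (p c s) (q c s) x / m)"
    "\<bar>1 / (c\<^sup>2 * (om c s)\<^sup>2)\<bar> \<le> 4" if "c \<in> speeds" "s \<in> {-a..a}" for c s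
    using br[OF that(1)] S[OF that(2)] unfolding branch_def by blast+
  have Lip: "\<bar>om c s - om c s'\<bar> \<le> L * \<bar>s - s'\<bar>"
    "\<bar>1 / (c\<^sup>2 * (om c s)\<^sup>2) - 1 / (c\<^sup>2 * (om c s')\<^sup>2)\<bar> \<le> 16 / x0 * L * \<bar>s - s'\<bar>"
    "bdd (L * \<bar>s - s'\<bar>) (\<lambda>x. p c s x - p c s' x)" "bdd (L * \<bar>s - s'\<bar>) (\<lambda>x. q c s x - q c s' x)"
    if "c \<in> speeds" "s \<in> {-a..a}" "s' \<in> {-a..a}" for c s s'
    using br[OF that(1)] S[OF that(2)] S[OF that(3)] unfolding branch_def by blast+
  have om: "\<bar>om c s\<bar> \<le> x1 + x0" if "c \<in> speeds" "s \<in> {-a..a}" for c s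
    using B(1)[OF that] speeds_props(3,4)[OF that(1)] x0_pos by linarith
  show ?thesis
  proof (rule tame_bootstrap[OF k, where om=om and \<beta>="\<lambda>c s. 1 / (c\<^sup>2 * (om c s)\<^sup>2)" and \<kappa>=\<kappa> and m=m])
    show "\<bar>s\<bar> \<le> 1" if "s \<in> {-a..a}" for s using S[OF that] a by linarith
    show "tame0 speeds {-a..a} (\<lambda>i s x. om i s)" by (rule tame0I[OF om Lip(1)])
    show "tame0 speeds {-a..a} (\<lambda>i s x. 1 / (i\<^sup>2 * (om i s)\<^sup>2))" by (rule tame0I[OF B(8) Lip(2)])
    show "tame0 speeds {-a..a} p" by (rule tame0I[where C=3 and L=L]) (use B(3) Lip(3) in \<open>auto simp: bdd_def\<close>)
    show "tame0 speeds {-a..a} q" by (rule tame0I[where C=3 and L=L]) (use B(4) Lip(4) in \<open>auto simp: bdd_def\<close>)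
  qed (fact B)+
qed

lemma c_eps_speeds: "\<epsilon> \<in> {0<..<1} \<Longrightarrow> c_eps \<kappa> w \<epsilon> \<in> speeds"
  using c_star_pos by (auto simp: speeds_def c_eps_def c1_def power_le_one intro!: real_less_rsqrt)

end

lemma SUP_finite:
  assumes "\<And>i j. i \<in> I \<Longrightarrow> j \<in> J \<Longrightarrow> f i j \<le> ereal C"
  shows "(SUP i\<in>I. SUP j\<in>J. f i j) < \<infinity>"
proof -
  have "(SUP i\<in>I. SUP j\<in>J. f i j) \<le> ereal C" using assms by (intro SUP_least)
  then show ?thesis using le_less_trans by fastforce
qed

section \<open>Assembly along the speeds determined by \<epsilon>\<close>

theorem mainTheorem2:
  fixes m \<kappa> \<beta> w :: real and V1 V2 :: "real \<Rightarrow> real"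
  assumes "m > 0" and "\<kappa> > 0" and "w = 1 / m" and "w > 1 \<or> \<kappa> > 1"
    and "smooth V1" and "smooth V2"
    and "(\<lambda>r. deriv V1 r - (r + r^2)) \<in> O[at 0](\<lambda>r. r^3)"
    and "(\<lambda>r. deriv V2 r - (\<kappa> * r + \<beta> * r^2)) \<in> O[at 0](\<lambda>r. r^3)"
  shows "\<exists>a>0. \<exists>(\<phi> :: real \<Rightarrow> real \<Rightarrow> real \<Rightarrow> real^2) (\<psi> :: real \<Rightarrow> real \<Rightarrow> real \<Rightarrow> real^2)
      (\<Omega> :: real \<Rightarrow> real \<Rightarrow> real).
    (\<forall>\<epsilon>\<in>{0<..<1}. \<forall>\<alpha>\<in>{-a<..<a}.
        smooth (\<phi> \<epsilon> \<alpha>) \<and> (\<forall>x. \<phi> \<epsilon> \<alpha> (x + 2 * pi) = \<phi> \<epsilon> \<alpha> x) \<and>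
        travelling_wave m V1 V2 (c_eps \<kappa> w \<epsilon>)
          (\<lambda>x. (\<alpha> * \<epsilon>^2) * \<phi> \<epsilon> \<alpha> (\<epsilon> * \<Omega> \<epsilon> \<alpha> * x) $ 1)
          (\<lambda>x. (\<alpha> * \<epsilon>^2) * \<phi> \<epsilon> \<alpha> (\<epsilon> * \<Omega> \<epsilon> \<alpha> * x) $ 2) \<and>
        (\<forall>x. \<phi> \<epsilon> \<alpha> x = nu1 \<kappa> w (c_eps \<kappa> w \<epsilon>) x + \<psi> \<epsilon> \<alpha> x) \<and>
        inner_per (\<psi> \<epsilon> \<alpha>) (nu1 \<kappa> w (c_eps \<kappa> w \<epsilon>)) = 0) \<and>
    (\<forall>\<epsilon>\<in>{0<..<1}. (\<forall>x. \<psi> \<epsilon> 0 x = 0) \<and> \<epsilon> * \<Omega> \<epsilon> 0 = crit_freq \<kappa> w (c_eps \<kappa> w \<epsilon>)) \<and>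
    (SUP \<epsilon>\<in>{0<..<1}. SUP \<alpha>\<in>{-a<..<a}. ereal \<bar>\<epsilon> * \<Omega> \<epsilon> \<alpha>\<bar>) < \<infinity> \<and>
    (\<exists>C>0. \<forall>\<epsilon>\<in>{0<..<1}. \<forall>\<alpha>\<in>{-a<..<a}. \<forall>\<alpha>'\<in>{-a<..<a}.
        \<bar>\<Omega> \<epsilon> \<alpha> - \<Omega> \<epsilon> \<alpha>'\<bar> \<le> C * \<epsilon> * \<bar>\<alpha> - \<alpha>'\<bar>) \<and>
    (\<forall>r::nat.
        (SUP \<epsilon>\<in>{0<..<1}. SUP \<alpha>\<in>{-a<..<a}. Cper_norm r (\<phi> \<epsilon> \<alpha>)) < \<infinity> \<and>
        (\<exists>C>0. \<forall>\<alpha>\<in>{-a<..<a}. \<forall>\<alpha>'\<in>{-a<..<a}.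
          (SUP \<epsilon>\<in>{0<..<1}. Cper_norm r (\<lambda>x. \<phi> \<epsilon> \<alpha> x - \<phi> \<epsilon> \<alpha>' x)) \<le> ereal (C * \<bar>\<alpha> - \<alpha>'\<bar>)))"
proof -
  interpret dispersion m \<kappa> w by unfold_locales (use assms in auto)
  have "(\<lambda>r. deriv V1 r - (1 * r + 1 * r\<^sup>2)) \<in> O[at 0](\<lambda>r. r ^ 3)" using assms(7) by simp
  from csmooth_taylor2[OF smooth_deriv_csmooth[OF assms(5)] this]
  obtain k1 where k1: "csmooth k1" "\<And>r. deriv V1 r = r + r\<^sup>2 * k1 r" by auto
  obtain k2 where k2: "csmooth k2" "\<And>r. deriv V2 r = \<kappa> * r + r\<^sup>2 * k2 r"
    using csmooth_taylor2[OF smooth_deriv_csmooth[OF assms(6)] assms(8)] by metis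
  obtain a L om p q where a: "0 < a" "a \<le> 1" and L: "0 \<le> L"
    and br: "\<And>c. c \<in> speeds \<Longrightarrow> branch k1 k2 a L c (om c) (p c) (q c)"
    using branches_exist[OF k1(1) k2(1)] by metis
  have tm: "tame speeds {-a..a} r p" "tame speeds {-a..a} r q" for r
    using branch_tame[OF k1(1) k2(1) a(2) br] by auto
  define c where "c \<epsilon> = c_eps \<kappa> w \<epsilon>" for \<epsilon>
  define \<phi> where "\<phi> \<epsilon> \<alpha> x = (vector [p (c \<epsilon>) (\<alpha> * \<epsilon>\<^sup>2) x, q (c \<epsilon>) (\<alpha> * \<epsilon>\<^sup>2) x] :: real^2)" for \<epsilon> \<alpha> x
  define \<psi> where "\<psi> \<epsilon> \<alpha> x = \<phi> \<epsilon> \<alpha> x - nu1 \<kappa> w (c \<epsilon>) x" for \<epsilon> \<alpha> x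
  \<comment> \<open>The branches are described by the frequency of the profile itself, which is
    \<epsilon> \<Omega>.\<close>
  define \<Omega> where "\<Omega> \<epsilon> \<alpha> = om (c \<epsilon>) (\<alpha> * \<epsilon>\<^sup>2) / \<epsilon>" for \<epsilon> \<alpha>
  have c: "c \<epsilon> \<in> speeds" if "\<epsilon> \<in> {0<..<1}" for \<epsilon> unfolding c_def by (rule c_eps_speeds[OF that])
  \<comment> \<open>As \<epsilon> < 1, the radius for the amplitude s also serves as a radius for
    \<alpha> that does not depend on \<epsilon>.\<close>
  have s: "\<bar>\<alpha> * \<epsilon>\<^sup>2\<bar> \<le> a" "\<alpha> * \<epsilon>\<^sup>2 \<in> {-a..a}" if "\<epsilon> \<in> {0<..<1}" "\<alpha> \<in> {-a<..<a}" for \<epsilon> \<alpha>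
  proof -
    have "\<bar>\<alpha>\<bar> * \<epsilon>\<^sup>2 \<le> a * 1" using that by (intro mult_mono) (auto simp: power_le_one)
    then show "\<bar>\<alpha> * \<epsilon>\<^sup>2\<bar> \<le> a" by (simp add: abs_mult)
    then show "\<alpha> * \<epsilon>\<^sup>2 \<in> {-a..a}" by auto
  qed
  have ds: "\<bar>\<alpha> * \<epsilon>\<^sup>2 - \<alpha>' * \<epsilon>\<^sup>2\<bar> = \<bar>\<alpha> - \<alpha>'\<bar> * \<epsilon>\<^sup>2" "\<bar>\<alpha> - \<alpha>'\<bar> * \<epsilon>\<^sup>2 \<le> \<bar>\<alpha> - \<alpha>'\<bar>"
    if "\<epsilon> \<in> {0<..<1}" for \<epsilon> \<alpha> \<alpha>' :: real
    using that mult_left_mono[of "\<epsilon>\<^sup>2" 1 "\<bar>\<alpha> - \<alpha>'\<bar>"] by (auto simp: abs_mult left_diff_distrib[symmetric] power_le_one)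
  have eO: "\<epsilon> * \<Omega> \<epsilon> \<alpha> = om (c \<epsilon>) (\<alpha> * \<epsilon>\<^sup>2)" if "\<epsilon> \<in> {0<..<1}" for \<epsilon> \<alpha> using that by (simp add: \<Omega>_def)
  have om: "\<bar>om (c \<epsilon>) (\<alpha> * \<epsilon>\<^sup>2) - crit_freq \<kappa> w (c \<epsilon>)\<bar> \<le> x0 / 2" if "\<epsilon> \<in> {0<..<1}" "\<alpha> \<in> {-a<..<a}" for \<epsilon> \<alpha>
    using br[OF c[OF that(1)]] s(1)[OF that] unfolding branch_def by blast
  have der: "(nth_deriv n (p (c \<epsilon>) (\<alpha> * \<epsilon>\<^sup>2)) has_real_derivative nth_deriv (Suc n) (p (c \<epsilon>) (\<alpha> * \<epsilon>\<^sup>2)) x) (at x)"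
    "(nth_deriv n (q (c \<epsilon>) (\<alpha> * \<epsilon>\<^sup>2)) has_real_derivative nth_deriv (Suc n) (q (c \<epsilon>) (\<alpha> * \<epsilon>\<^sup>2)) x) (at x)"
    if "\<epsilon> \<in> {0<..<1}" "\<alpha> \<in> {-a<..<a}" for \<epsilon> \<alpha> n x
    using tame_has_nth_deriv[OF tm(1) c[OF that(1)] s(2)[OF that]] tame_has_nth_deriv[OF tm(2) c[OF that(1)] s(2)[OF that]] by blast+
  have sm: "smooth (\<phi> \<epsilon> \<alpha>)" and nd: "nth_deriv n (\<phi> \<epsilon> \<alpha>) x = vector [nth_deriv n (p (c \<epsilon>) (\<alpha> * \<epsilon>\<^sup>2)) x, nth_deriv n (q (c \<epsilon>) (\<alpha> * \<epsilon>\<^sup>2)) x]"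
    if "\<epsilon> \<in> {0<..<1}" "\<alpha> \<in> {-a<..<a}" for \<epsilon> \<alpha> n x
    using nth_deriv_vector_2[OF der[OF that]] by (simp_all add: \<phi>_def[abs_def])
  have bounds: "\<exists>C\<ge>0. \<forall>\<epsilon>\<in>{0<..<1}. \<forall>\<alpha>\<in>{-a<..<a}. \<forall>x. norm (nth_deriv n (\<phi> \<epsilon> \<alpha>) x) \<le> C \<and>
      (\<forall>\<alpha>'\<in>{-a<..<a}. norm (nth_deriv n (\<phi> \<epsilon> \<alpha>) x - nth_deriv n (\<phi> \<epsilon> \<alpha>') x) \<le> C * \<bar>\<alpha> - \<alpha>'\<bar>)" for n
  proof -
    obtain C1 C2 where C: "\<forall>i\<in>speeds. \<forall>s\<in>{-a..a}. \<forall>x. \<bar>nth_deriv n (p i s) x\<bar> \<le> C1 \<and>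
        (\<forall>s'\<in>{-a..a}. \<bar>nth_deriv n (p i s) x - nth_deriv n (p i s') x\<bar> \<le> C1 * \<bar>s - s'\<bar>)"
      "\<forall>i\<in>speeds. \<forall>s\<in>{-a..a}. \<forall>x. \<bar>nth_deriv n (q i s) x\<bar> \<le> C2 \<and>
        (\<forall>s'\<in>{-a..a}. \<bar>nth_deriv n (q i s) x - nth_deriv n (q i s') x\<bar> \<le> C2 * \<bar>s - s'\<bar>)"
      using tame_nth_deriv[OF tm(1)] tame_nth_deriv[OF tm(2)] by metis
    have "0 \<le> \<bar>C1\<bar> + \<bar>C2\<bar>" by simp
    moreover have "norm (nth_deriv n (\<phi> \<epsilon> \<alpha>) x) \<le> \<bar>C1\<bar> + \<bar>C2\<bar>"
      if "\<epsilon> \<in> {0<..<1}" "\<alpha> \<in> {-a<..<a}" for \<epsilon> \<alpha> x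
    proof -
      let ?u = "nth_deriv n (p (c \<epsilon>) (\<alpha> * \<epsilon>\<^sup>2)) x" and ?v = "nth_deriv n (q (c \<epsilon>) (\<alpha> * \<epsilon>\<^sup>2)) x"
      have "\<bar>?u\<bar> \<le> C1" "\<bar>?v\<bar> \<le> C2" using C c[OF that(1)] s(2)[OF that] by blast+
      then show ?thesis unfolding nd[OF that] using norm_vector_2_le[of ?u ?v] by linarith
    qed
    moreover have "norm (nth_deriv n (\<phi> \<epsilon> \<alpha>) x - nth_deriv n (\<phi> \<epsilon> \<alpha>') x) \<le> (\<bar>C1\<bar> + \<bar>C2\<bar>) * \<bar>\<alpha> - \<alpha>'\<bar>"
      if "\<epsilon> \<in> {0<..<1}" "\<alpha> \<in> {-a<..<a}" "\<alpha>' \<in> {-a<..<a}" for \<epsilon> \<alpha> \<alpha>' x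
    proof -
      let ?s = "\<alpha> * \<epsilon>\<^sup>2" and ?s' = "\<alpha>' * \<epsilon>\<^sup>2"
      let ?u = "nth_deriv n (p (c \<epsilon>) ?s) x - nth_deriv n (p (c \<epsilon>) ?s') x"
        and ?v = "nth_deriv n (q (c \<epsilon>) ?s) x - nth_deriv n (q (c \<epsilon>) ?s') x"
      have "\<bar>?u\<bar> \<le> C1 * \<bar>?s - ?s'\<bar>" "\<bar>?v\<bar> \<le> C2 * \<bar>?s - ?s'\<bar>"
        using C c[OF that(1)] s(2)[OF that(1,2)] s(2)[OF that(1,3)] by blast+
      moreover have "C1 * \<bar>?s - ?s'\<bar> \<le> \<bar>C1\<bar> * \<bar>\<alpha> - \<alpha>'\<bar>" "C2 * \<bar>?s - ?s'\<bar> \<le> \<bar>C2\<bar> * \<bar>\<alpha> - \<alpha>'\<bar>"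
        using ds[OF that(1), of \<alpha> \<alpha>'] by (intro mult_mono; simp)+
      moreover have v: "nth_deriv n (\<phi> \<epsilon> \<alpha>) x - nth_deriv n (\<phi> \<epsilon> \<alpha>') x = vector [?u, ?v]"
        unfolding nd[OF that(1,2)] nd[OF that(1,3)] by (simp add: vec_eq_iff forall_2)
      ultimately show ?thesis using norm_vector_2_le[of ?u ?v] unfolding v distrib_right by linarith
    qed
    ultimately show ?thesis by blast
  qed
  have 1: "smooth (\<phi> \<epsilon> \<alpha>) \<and> (\<forall>x. \<phi> \<epsilon> \<alpha> (x + 2 * pi) = \<phi> \<epsilon> \<alpha> x) \<and>
        travelling_wave m V1 V2 (c_eps \<kappa> w \<epsilon>)
          (\<lambda>x. (\<alpha> * \<epsilon>\<^sup>2) * \<phi> \<epsilon> \<alpha> (\<epsilon> * \<Omega> \<epsilon> \<alpha> * x) $ 1)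
          (\<lambda>x. (\<alpha> * \<epsilon>\<^sup>2) * \<phi> \<epsilon> \<alpha> (\<epsilon> * \<Omega> \<epsilon> \<alpha> * x) $ 2) \<and>
        (\<forall>x. \<phi> \<epsilon> \<alpha> x = nu1 \<kappa> w (c_eps \<kappa> w \<epsilon>) x + \<psi> \<epsilon> \<alpha> x) \<and>
        inner_per (\<psi> \<epsilon> \<alpha>) (nu1 \<kappa> w (c_eps \<kappa> w \<epsilon>)) = 0"
    if e: "\<epsilon> \<in> {0<..<1}" "\<alpha> \<in> {-a<..<a}" for \<epsilon> \<alpha>
  proof (intro conjI allI)
    let ?s = "\<alpha> * \<epsilon>\<^sup>2"
    note b = br[OF c[OF e(1)], unfolded branch_def] 
    show "smooth (\<phi> \<epsilon> \<alpha>)" by (rule sm[OF e])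
    have "cper (p (c \<epsilon>) ?s)" "cper (q (c \<epsilon>) ?s)" using b s(1)[OF e] by blast+
    then show "\<phi> \<epsilon> \<alpha> (x + 2 * pi) = \<phi> \<epsilon> \<alpha> x" for x by (simp add: \<phi>_def cperD)
    obtain p' q' where d: "deriv2 (p (c \<epsilon>) ?s) p' (\<lambda>x. 1 / ((c \<epsilon>)\<^sup>2 * (om (c \<epsilon>) ?s)\<^sup>2) *
        force1 (\<lambda>y. y + ?s * (y\<^sup>2 * k1 (?s * y))) (\<lambda>y. \<kappa> * y + ?s * (y\<^sup>2 * k2 (?s * y))) (om (c \<epsilon>) ?s) (p (c \<epsilon>) ?s) (q (c \<epsilon>) ?s) x)"
      "deriv2 (q (c \<epsilon>) ?s) q' (\<lambda>x. 1 / ((c \<epsilon>)\<^sup>2 * (om (c \<epsilon>) ?s)\<^sup>2) *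
        force2 (\<lambda>y. y + ?s * (y\<^sup>2 * k1 (?s * y))) (\<lambda>y. \<kappa> * y + ?s * (y\<^sup>2 * k2 (?s * y))) (om (c \<epsilon>) ?s) (p (c \<epsilon>) ?s) (q (c \<epsilon>) ?s) x / m)"
      using b s(1)[OF e] by blast
    have "c \<epsilon> \<noteq> 0" using speeds_props(1)[OF c[OF e(1)]] by simp
    moreover have "om (c \<epsilon>) ?s \<noteq> 0" using om[OF e] speeds_props(3)[OF c[OF e(1)]] x0_pos by linarith
    moreover have "m \<noteq> 0" using m_pos by simp
    ultimately show "travelling_wave m V1 V2 (c_eps \<kappa> w \<epsilon>)
          (\<lambda>x. (\<alpha> * \<epsilon>\<^sup>2) * \<phi> \<epsilon> \<alpha> (\<epsilon> * \<Omega> \<epsilon> \<alpha> * x) $ 1)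
          (\<lambda>x. (\<alpha> * \<epsilon>\<^sup>2) * \<phi> \<epsilon> \<alpha> (\<epsilon> * \<Omega> \<epsilon> \<alpha> * x) $ 2)"
      using travelling_waveI[OF _ _ _ k1(2) k2(2) d] unfolding eO[OF e(1)] by (simp add: \<phi>_def c_def)
    show "\<phi> \<epsilon> \<alpha> x = nu1 \<kappa> w (c_eps \<kappa> w \<epsilon>) x + \<psi> \<epsilon> \<alpha> x" for x by (simp add: \<psi>_def c_def)
    have "ip (\<lambda>x. p (c \<epsilon>) ?s x - nu1 \<kappa> w (c \<epsilon>) x $ 1) (\<lambda>x. q (c \<epsilon>) ?s x - nu1 \<kappa> w (c \<epsilon>) x $ 2)
      (\<lambda>x. nu1 \<kappa> w (c \<epsilon>) x $ 1) (\<lambda>x. nu1 \<kappa> w (c \<epsilon>) x $ 2) = 0" using b s(1)[OF e] by blast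
    then show "inner_per (\<psi> \<epsilon> \<alpha>) (nu1 \<kappa> w (c_eps \<kappa> w \<epsilon>)) = 0"
      by (simp add: inner_per_eq_ip \<psi>_def \<phi>_def c_def)
  qed
  have 2: "(\<forall>x. \<psi> \<epsilon> 0 x = 0) \<and> \<epsilon> * \<Omega> \<epsilon> 0 = crit_freq \<kappa> w (c_eps \<kappa> w \<epsilon>)" if e: "\<epsilon> \<in> {0<..<1}" for \<epsilon>
    using br[OF c[OF e]] eO[OF e, of 0] unfolding branch_def
    by (auto simp: \<psi>_def \<phi>_def c_def vec_eq_iff forall_2)
  have 3: "(SUP \<epsilon>\<in>{0<..<1}. SUP \<alpha>\<in>{-a<..<a}. ereal \<bar>\<epsilon> * \<Omega> \<epsilon> \<alpha>\<bar>) < \<infinity>"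
  proof (rule SUP_finite)
    show "ereal \<bar>\<epsilon> * \<Omega> \<epsilon> \<alpha>\<bar> \<le> ereal (x1 + x0)" if "\<epsilon> \<in> {0<..<1}" "\<alpha> \<in> {-a<..<a}" for \<epsilon> \<alpha>
    proof -
      have "\<bar>om (c \<epsilon>) (\<alpha> * \<epsilon>\<^sup>2)\<bar> \<le> x1 + x0"
        using om[OF that] speeds_props(3,4)[OF c[OF that(1)]] x0_pos by linarith
      then show ?thesis by (simp add: eO[OF that(1)])
    qed
  qed
  have 4: "\<bar>\<Omega> \<epsilon> \<alpha> - \<Omega> \<epsilon> \<alpha>'\<bar> \<le> (L + 1) * \<epsilon> * \<bar>\<alpha> - \<alpha>'\<bar>"
    if e: "\<epsilon> \<in> {0<..<1}" "\<alpha> \<in> {-a<..<a}" "\<alpha>' \<in> {-a<..<a}" for \<epsilon> \<alpha> \<alpha>'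
  proof -
    have "\<bar>om (c \<epsilon>) (\<alpha> * \<epsilon>\<^sup>2) - om (c \<epsilon>) (\<alpha>' * \<epsilon>\<^sup>2)\<bar> \<le> L * \<bar>\<alpha> * \<epsilon>\<^sup>2 - \<alpha>' * \<epsilon>\<^sup>2\<bar>"
      using br[OF c[OF e(1)]] s(1)[OF e(1,2)] s(1)[OF e(1,3)] unfolding branch_def by blast
    \<comment> \<open>Of the factor \<epsilon>^2 one \<epsilon> is spent on the division in
      \<Omega>; the other stays in the bound.\<close>
    then have "\<bar>om (c \<epsilon>) (\<alpha> * \<epsilon>\<^sup>2) - om (c \<epsilon>) (\<alpha>' * \<epsilon>\<^sup>2)\<bar> \<le> (L * \<epsilon> * \<bar>\<alpha> - \<alpha>'\<bar>) * \<epsilon>"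
      unfolding ds(1)[OF e(1)] by (simp add: power2_eq_square mult_ac)
    moreover have "\<Omega> \<epsilon> \<alpha> - \<Omega> \<epsilon> \<alpha>' = (om (c \<epsilon>) (\<alpha> * \<epsilon>\<^sup>2) - om (c \<epsilon>) (\<alpha>' * \<epsilon>\<^sup>2)) / \<epsilon>"
      by (simp add: \<Omega>_def diff_divide_distrib)
    ultimately have "\<bar>\<Omega> \<epsilon> \<alpha> - \<Omega> \<epsilon> \<alpha>'\<bar> \<le> L * \<epsilon> * \<bar>\<alpha> - \<alpha>'\<bar>"
      using e(1) by (simp add: pos_divide_le_eq)
    also have "\<dots> \<le> (L + 1) * \<epsilon> * \<bar>\<alpha> - \<alpha>'\<bar>" using e(1) by (intro mult_right_mono) auto
    finally show ?thesis .
  qed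
  have 5: "(SUP \<epsilon>\<in>{0<..<1}. SUP \<alpha>\<in>{-a<..<a}. Cper_norm r (\<phi> \<epsilon> \<alpha>)) < \<infinity> \<and>
        (\<exists>C>0. \<forall>\<alpha>\<in>{-a<..<a}. \<forall>\<alpha>'\<in>{-a<..<a}.
          (SUP \<epsilon>\<in>{0<..<1}. Cper_norm r (\<lambda>x. \<phi> \<epsilon> \<alpha> x - \<phi> \<epsilon> \<alpha>' x)) \<le> ereal (C * \<bar>\<alpha> - \<alpha>'\<bar>))" for r
  proof -
    obtain A B where A: "A \<ge> 0" "\<And>\<epsilon> \<alpha> x. \<epsilon> \<in> {0<..<1} \<Longrightarrow> \<alpha> \<in> {-a<..<a} \<Longrightarrow> norm (\<phi> \<epsilon> \<alpha> x) \<le> A"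
        "\<And>\<epsilon> \<alpha> \<alpha>' x. \<epsilon> \<in> {0<..<1} \<Longrightarrow> \<alpha> \<in> {-a<..<a} \<Longrightarrow> \<alpha>' \<in> {-a<..<a} \<Longrightarrow> norm (\<phi> \<epsilon> \<alpha> x - \<phi> \<epsilon> \<alpha>' x) \<le> A * \<bar>\<alpha> - \<alpha>'\<bar>"
      and B: "B \<ge> 0" "\<And>\<epsilon> \<alpha> x. \<epsilon> \<in> {0<..<1} \<Longrightarrow> \<alpha> \<in> {-a<..<a} \<Longrightarrow> norm (nth_deriv r (\<phi> \<epsilon> \<alpha>) x) \<le> B"
        "\<And>\<epsilon> \<alpha> \<alpha>' x. \<epsilon> \<in> {0<..<1} \<Longrightarrow> \<alpha> \<in> {-a<..<a} \<Longrightarrow> \<alpha>' \<in> {-a<..<a} \<Longrightarrow>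
          norm (nth_deriv r (\<phi> \<epsilon> \<alpha>) x - nth_deriv r (\<phi> \<epsilon> \<alpha>') x) \<le> B * \<bar>\<alpha> - \<alpha>'\<bar>"
    proof -
      obtain A B where "A \<ge> 0 \<and> (\<forall>\<epsilon>\<in>{0<..<1}. \<forall>\<alpha>\<in>{-a<..<a}. \<forall>x. norm (nth_deriv 0 (\<phi> \<epsilon> \<alpha>) x) \<le> A \<and>
          (\<forall>\<alpha>'\<in>{-a<..<a}. norm (nth_deriv 0 (\<phi> \<epsilon> \<alpha>) x - nth_deriv 0 (\<phi> \<epsilon> \<alpha>') x) \<le> A * \<bar>\<alpha> - \<alpha>'\<bar>))"
        "B \<ge> 0 \<and> (\<forall>\<epsilon>\<in>{0<..<1}. \<forall>\<alpha>\<in>{-a<..<a}. \<forall>x. norm (nth_deriv r (\<phi> \<epsilon> \<alpha>) x) \<le> B \<and>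
          (\<forall>\<alpha>'\<in>{-a<..<a}. norm (nth_deriv r (\<phi> \<epsilon> \<alpha>) x - nth_deriv r (\<phi> \<epsilon> \<alpha>') x) \<le> B * \<bar>\<alpha> - \<alpha>'\<bar>))"
        using bounds[of 0] bounds[of r] by blast
      moreover have "nth_deriv 0 f = f" for f :: "real \<Rightarrow> real^2" by (simp add: nth_deriv_def)
      ultimately show ?thesis by (intro that[of A B]) auto
    qed
    have "(SUP \<epsilon>\<in>{0<..<1}. SUP \<alpha>\<in>{-a<..<a}. Cper_norm r (\<phi> \<epsilon> \<alpha>)) < \<infinity>"
      by (rule SUP_finite, rule Cper_norm_le[OF sm A(2) B(2)])
    moreover have "(SUP \<epsilon>\<in>{0<..<1}. Cper_norm r (\<lambda>x. \<phi> \<epsilon> \<alpha> x - \<phi> \<epsilon> \<alpha>' x)) \<le> ereal ((A + B + 1) * \<bar>\<alpha> - \<alpha>'\<bar>)"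
      if \<alpha>: "\<alpha> \<in> {-a<..<a}" "\<alpha>' \<in> {-a<..<a}" for \<alpha> \<alpha>'
    proof (rule SUP_least)
      fix \<epsilon> :: real assume e: "\<epsilon> \<in> {0<..<1}"
      note d = nth_deriv_diff[OF sm[OF e \<alpha>(1)] sm[OF e \<alpha>(2)]]
      have "Cper_norm r (\<lambda>x. \<phi> \<epsilon> \<alpha> x - \<phi> \<epsilon> \<alpha>' x) \<le> ereal (A * \<bar>\<alpha> - \<alpha>'\<bar> + B * \<bar>\<alpha> - \<alpha>'\<bar>)"
        by (rule Cper_norm_le[OF d(1)]) (use A(3)[OF e \<alpha>] B(3)[OF e \<alpha>] in \<open>simp_all add: d(2)\<close>)
      also have "\<dots> \<le> ereal ((A + B + 1) * \<bar>\<alpha> - \<alpha>'\<bar>)" by (simp add: distrib_right)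
      finally show "Cper_norm r (\<lambda>x. \<phi> \<epsilon> \<alpha> x - \<phi> \<epsilon> \<alpha>' x) \<le> ereal ((A + B + 1) * \<bar>\<alpha> - \<alpha>'\<bar>)" .
    qed
    \<comment> \<open>The summand 1 makes the constant strictly positive.\<close>
    ultimately show ?thesis using A(1) B(1) by (intro conjI exI[of _ "A + B + 1"]) auto
  qed
  have 4: "\<exists>C>0. \<forall>\<epsilon>\<in>{0<..<1}. \<forall>\<alpha>\<in>{-a<..<a}. \<forall>\<alpha>'\<in>{-a<..<a}. \<bar>\<Omega> \<epsilon> \<alpha> - \<Omega> \<epsilon> \<alpha>'\<bar> \<le> C * \<epsilon> * \<bar>\<alpha> - \<alpha>'\<bar>"
    by (rule exI[of _ "L + 1"]) (use 4 L in simp)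
  show ?thesis
    by (rule exI[of _ a], rule conjI[OF a(1)], rule exI[of _ \<phi>], rule exI[of _ \<psi>], rule exI[of _ \<Omega>],
      intro conjI[OF _ conjI[OF _ conjI[OF 3 conjI[OF 4]]]] ballI allI) (rule 1 2 5; assumption)+
qed

end
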